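(* Let $R$ be a ring and let $\Theta=(\theta(I,J))_{I,J\in\mathcal P_{\mathrm f}(\mathbf N)}$ be a combinatorial family of module representations over $R$, with associated sets $\mathsf B(I,J)$; write $\mathsf B_\infty=\bigcup_{I,J\in\mathcal P_{\mathrm f}(\mathbf N)}\mathsf B(I,J)$ and assume $\mathsf B_\infty\subset\mathbf U$. Let $I,J\in\mathcal P_{\mathrm f}(\mathbf N)$ and $\ell\ge0$, and suppose that $\Theta$ is $(I,J)$-constant of rank $\ell$. Let $\beta\colon\mathsf B_\infty\to\mathcal C\cup\{\square\}$ be a partial colouring which is $\Theta(I,J)$-admissible of level $\ell$. Let $\tilde I,\tilde J\in\mathcal P_{\mathrm f}(\mathbf N)$ with $I\subset\tilde I$ and $J\subset\tilde J$. Let $N$ be a finitely generated $R$-module and let $\eta\colon N\to\mathrm{Hom}(R\tilde I,R\tilde J)$ be a module representation. Define module representations over $\acute R$ $$\sigma\colon \mathrm{Rel}(\mathsf B(I,J)/\!/\beta)\oplus\acute N\to\mathrm{Hom}(\acute R\tilde I,\acute R\tilde J),\quad (x,n)\mapsto x\,\inf{}^{\tilde I,\tilde J}_{I,J}\bigl(\theta(I,J)/\!/\beta\bigr)+n\,\acute\eta,$$ $$\tilde\sigma\colon \acute R\,\mathsf B(I,J)\oplus\acute N\to\mathrm{Hom}(\acute R\tilde I,\acute R\tilde J),\quad (x,n)\mapsto x\,\inf{}^{\tilde I,\tilde J}_{I,J}\bigl(\acute\theta(I,J)\bigr)+n\,\acute\eta.$$ Let $\mathfrak O$ be an $\acute R$-algebra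 which is a compact discrete valuation ring. Then $\mathsf Z^{\mathsf{ask}}_{\sigma^{\mathfrak O}}(T)=\mathsf Z^{\mathsf{ask}}_{\tilde\sigma^{\mathfrak O}}(T)$.
   Context: General conventions. All rings are commutative and unital. $\mathcal P_{\mathrm f}(\mathbf N)$ is the set of finite subsets of $\mathbf N$. For a set $A$, $RA$ is the free $R$-module with basis $(\mathsf e_a)_{a\in A}$; write $x=\sum_a x_a\mathsf e_a$. Maps act on the right. For $A\subset B$, $\mathrm{inc}\colon RA\to RB$ is the inclusion and $\mathrm{ret}\colon RB\to RA$ is the linear map fixing $\mathsf e_a$ ($a\in A$) and killing $\mathsf e_b$ ($b\in B\setminus A$). Module representations. A module representation over $R$ is an $R$-linear map $\theta\colon M\to\mathrm{Hom}_R(N,O)$. For an $R$-algebra $S$, $\theta^S\colon M\otimes S\to\mathrm{Hom}_S(N\otimes S,O\otimes S)$ is the extension of scalars. If $M,N$ are finite, $\mathrm{ask}(\theta)=\frac1{|M|}\sum_{m\in M}|\mathrm{Ker}(m\theta)|$. For $\theta$ over a compact discrete valuation ring $\mathfrak O$ with maximal ideal $\mathfrak P$ and $M,N$ finitely generated, $\mathsf Z^{\mathsf{ask}}_\theta(T)=\sum_{n\ge0}\mathrm{ask}(\theta^{\mathfrak O/\mathfrak P^n})T^n$. For $I\subset\tilde I$, $J\subset\tilde J$ finite and $\theta\colon M\to\mathrm{Hom}(RI,RJ)$, the inflation $\inf^{\tilde I,\tilde J}_{I,J}(\theta)\colon M\to\mathrm{Hom}(R\tilde I,R\tilde J)$ sends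 $m$ to the composite $R\tilde I\xrightarrow{\mathrm{ret}}RI\xrightarrow{m\theta}RJ\xrightarrow{\mathrm{inc}}R\tilde J$. For $\tilde\theta\colon\tilde M\to\mathrm{Hom}(R\tilde I,R\tilde J)$, the restriction $\mathrm{res}^{\tilde I,\tilde J}_{I,J}(\tilde\theta)\colon\tilde M\to\mathrm{Hom}(RI,RJ)$ sends $\tilde m$ to $RI\xrightarrow{\mathrm{inc}}R\tilde I\xrightarrow{\tilde m\tilde\theta}R\tilde J\xrightarrow{\mathrm{ret}}RJ$. Orbit modules. For $\theta\colon M\to\mathrm{Hom}(RI,RJ)$ with $I,J$ finite, let $X_I=(X_i)_{i\in I}$ be independent variables, $\mathbf X(m,\theta)=\sum_{i\in I}X_i\,\mathsf e_i(m\theta)\in R[X_I]J$ for $m\in M$, and $\mathrm{Orbit}(\theta)=R[X_I]J/\langle\mathbf X(m,\theta):m\in M\rangle_{R[X_I]}$. $\mathrm{Fit}_i$ denotes the $i$th Fitting ideal (generated by the $(n-i)\times(n-i)$ minors of an $m\times n$ matrix whose row span is the relation module of a presentation with $n$ generators; the unit ideal for $i\ge n$). Families. A combinatorial family of module representations $\Theta$ over $R$ consists of finite sets $\mathsf B(I,J)$ and module representations $\theta(I,J)\colon R\,\mathsf B(I,J)\to\mathrm{Hom}(RI,RJ)$ for all $I,J\in\mathcal P_{\mathrm f}(\mathbf N)$ such that: (i) for $I\subset\tilde I$ and $J\subset\tilde J$, $\mathsf B(I,J)\subset\mathsf B(\tilde I,\tilde J)$ and the composite of $\mathrm{ret}\colon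 R\,\mathsf B(\tilde I,\tilde J)\to R\,\mathsf B(I,J)$ with $\theta(I,J)$ equals $\mathrm{res}^{\tilde I,\tilde J}_{I,J}(\theta(\tilde I,\tilde J))$; (ii) writing $[b^{IJ}_{ij}]_{i\in I,j\in J}$ for the matrix of $\mathsf e_b\theta(I,J)$ and $G_b(I,J)=\{(i,j)\in I\times J:b^{IJ}_{ij}\ne0\}$, the sets $G_b(I,J)$ ($b\in\mathsf B(I,J)$) are pairwise disjoint and non-empty; (iii) every non-zero $b^{IJ}_{ij}$ is a unit of $R$. The grid is $\mathcal G(I,J)=\bigcup_{b\in\mathsf B(I,J)}G_b(I,J)$; its elements are cells and the sets $G_b(I,J)$ are its cell classes. A cell is $(I,J)$-isolated if it is the only member of its cell class in $\mathcal G(I,J)$. Constancy. Write $\Omega(I,J)=\mathrm{Orbit}(\theta(I,J))$ and $\Omega^\times(I,J)=\Omega(I,J)\otimes_{R[X_I]}R[X_I^{\pm1}]$. $\Theta$ is $(I,J)$-constant of rank $\ell$ if $\mathrm{Fit}_i(\Omega(I,J))=\langle0\rangle$ for $i=0,\dots,\ell-1$ and $\mathrm{Fit}_\ell(\Omega^\times(H,J))=\langle1\rangle$ for all non-empty $H\subset I$. Relation modules. $\mathbf U$ is a fixed infinite set, $\mathcal C$ an infinite set of colours, $\square\notin\mathcal C$ the blank symbol. $\acute R=R[\acute u_x^{\pm1}:x\in\mathbf U]$ with algebraically independent $\acute u_x$; an acute accent on a module or module representation over $R$ denotes extension of scalars $R\to\acute R$. A partial colouring of $U\subset\mathbf U$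 is a function $\beta\colon U\to\mathcal C\cup\{\square\}$ such that $\beta^{-1}(c)$ is finite for each $c\in\mathcal C$; it is extended to $\mathbf U$ by the value $\square$. For $B\subset\mathbf U$ let $\beta[B]=\{c\in\mathcal C:\beta^{-1}(c)\subset B\}$ and $\mathrm{Rel}(B/\!/\beta)=\{x\in\acute RB:\sum_{b\in\beta^{-1}(c)}\acute u_bx_b=0\text{ for all }c\in\beta[B]\}$. $\theta(I,J)/\!/\beta$ is the restriction of $\acute\theta(I,J)$ to $\mathrm{Rel}(\mathsf B(I,J)/\!/\beta)\subset\acute R\,\mathsf B(I,J)$. Moves and admissibility. For $I,J\in\mathcal P_{\mathrm f}(\mathbf N)$ let $\beta_{I,J}\colon\mathsf B(I,J)\to\mathcal C\cup\{\square\}$ send $b$ to $\beta(b)$ if $\beta(b)\in\beta[\mathsf B(I,J)]$ and to $\square$ otherwise; a cell in $G_b(I,J)$ is given the value $\beta_{I,J}(b)$ and is blank if this is $\square$. Write $(I,J)\to(I,J')$ if there is an $(I,J)$-isolated blank cell $(i,j)\in\mathcal G(I,J)$ with $J'=J\setminus\{j\}$, and let $\to^*$ be the reflexive transitive closure. $\beta$ is $\Theta(I,J)$-admissible of level $\ell$ if for every $\emptyset\ne H\subset I$ there is $D(H)\subset J$ with $|D(H)|\le\ell$ and $(H,J\setminus D(H))\to^*(H,\emptyset)$. *)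

theory Defs
  imports
    "HOL-Analysis.Abstract_Topology"
    "HOL-Computational_Algebra.Formal_Power_Series"
    "HOL-Combinatorics.Permutations"
    "HOL-Library.Poly_Mapping"
    "HOL-Algebra.Algebra"
    "HOL-Algebra.Algebraic_Closure_Type"
begin

section \<open>Modules: free modules, submodules, quotients, extension of scalars\<close>

text \<open>
  Elements of the free module \<open>S A\<close> are finitely supported functions that vanish outside \<open>A\<close>.
  Consequently, for \<open>A \<subseteq> B\<close>, the inclusion \<open>S A \<rightarrow> S B\<close> is the identity on functions.
\<close>

definition free_module :: "('s, 'x) ring_scheme \<Rightarrow> 'a set \<Rightarrow> ('s, 'a \<Rightarrow> 's) module" where
  "free_module S A =
    \<lparr> carrier = {x. finite {a. x a \<noteq> \<zero>\<^bsub>S\<^esub>} \<and> (\<forall>a\<in>A. x a \<in> carrier S) \<and> (\<forall>a. a \<notin> A \<longrightarrow> x a = \<zero>\<^bsub>S\<^esub>)},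
      monoid.mult = undefined, monoid.one = undefined,
      ring.zero = (\<lambda>_. \<zero>\<^bsub>S\<^esub>),
      ring.add = (\<lambda>x y a. x a \<oplus>\<^bsub>S\<^esub> y a),
      module.smult = (\<lambda>s x a. s \<otimes>\<^bsub>S\<^esub> x a) \<rparr>"

definition evec :: "('s, 'x) ring_scheme \<Rightarrow> 'a \<Rightarrow> 'a \<Rightarrow> 's" where
  "evec S a = (\<lambda>b. if b = a then \<one>\<^bsub>S\<^esub> else \<zero>\<^bsub>S\<^esub>)"

definition ret :: "('s, 'x) ring_scheme \<Rightarrow> 'a set \<Rightarrow> ('a \<Rightarrow> 's) \<Rightarrow> 'a \<Rightarrow> 's" where
  "ret S A x = (\<lambda>a. if a \<in> A then x a else \<zero>\<^bsub>S\<^esub>)"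

definition gen_submodule ::
    "('s, 'x) ring_scheme \<Rightarrow> ('s, 'm, 'y) module_scheme \<Rightarrow> 'm set \<Rightarrow> 'm set" where
  "gen_submodule S M G = \<Inter>{H. submodule H S M \<and> G \<subseteq> H}"

definition fin_gen :: "('s, 'x) ring_scheme \<Rightarrow> ('s, 'm, 'y) module_scheme \<Rightarrow> bool" where
  "fin_gen S M \<longleftrightarrow> (\<exists>G \<subseteq> carrier M. finite G \<and> gen_submodule S M G = carrier M)"

definition quot_module :: "('s, 'm, 'y) module_scheme \<Rightarrow> 'm set \<Rightarrow> ('s, 'm set) module" where
  "quot_module M K =
    \<lparr> carrier = a_rcosets\<^bsub>M\<^esub> K,
      monoid.mult = undefined, monoid.one = undefined,
      ring.zero = K,
      ring.add = set_add M,
      module.smult = (\<lambda>s C. \<Union>x\<in>C. K +>\<^bsub>M\<^esub> (s \<odot>\<^bsub>M\<^esub> x)) \<rparr>"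

definition dsum_module ::
    "('s, 'm, 'y) module_scheme \<Rightarrow> ('s, 'n, 'z) module_scheme \<Rightarrow> ('s, 'm \<times> 'n) module" where
  "dsum_module M N =
    \<lparr> carrier = carrier M \<times> carrier N,
      monoid.mult = undefined, monoid.one = undefined,
      ring.zero = (\<zero>\<^bsub>M\<^esub>, \<zero>\<^bsub>N\<^esub>),
      ring.add = (\<lambda>(m, n) (m', n'). (m \<oplus>\<^bsub>M\<^esub> m', n \<oplus>\<^bsub>N\<^esub> n')),
      module.smult = (\<lambda>s (m, n). (s \<odot>\<^bsub>M\<^esub> m, s \<odot>\<^bsub>N\<^esub> n)) \<rparr>"

text \<open>
  For a ring homomorphism \<open>\<phi> : R \<rightarrow> S\<close> (that is, an \<open>R\<close>-algebra \<open>S\<close>) and an \<open>R\<close>-module \<open>M\<close>, the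
  \<open>S\<close>-module \<open>M \<otimes> S\<close> is the free \<open>S\<close>-module on the underlying set of \<open>M\<close> modulo the relations
  \<open>[m + m'] = [m] + [m']\<close> and \<open>[r m] = \<phi>(r) [m]\<close>. The class of \<open>s [m]\<close> is \<open>m \<otimes> s\<close>.
\<close>

definition tensor_rels ::
    "('r, 'x) ring_scheme \<Rightarrow> ('s, 'y) ring_scheme \<Rightarrow> ('r \<Rightarrow> 's) \<Rightarrow> ('r, 'm, 'z) module_scheme
      \<Rightarrow> ('m \<Rightarrow> 's) set" where
  "tensor_rels R S \<phi> M = (let F = free_module S (carrier M) in
    gen_submodule S F
      ({evec S (m \<oplus>\<^bsub>M\<^esub> m') \<ominus>\<^bsub>F\<^esub> (evec S m \<oplus>\<^bsub>F\<^esub> evec S m') | m m'. m \<in> carrier M \<and> m' \<in> carrier M}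
       \<union> {evec S (r \<odot>\<^bsub>M\<^esub> m) \<ominus>\<^bsub>F\<^esub> (\<phi> r \<odot>\<^bsub>F\<^esub> evec S m) | r m. r \<in> carrier R \<and> m \<in> carrier M}))"

definition ext_module ::
    "('r, 'x) ring_scheme \<Rightarrow> ('s, 'y) ring_scheme \<Rightarrow> ('r \<Rightarrow> 's) \<Rightarrow> ('r, 'm, 'z) module_scheme
      \<Rightarrow> ('s, ('m \<Rightarrow> 's) set) module" where
  "ext_module R S \<phi> M = quot_module (free_module S (carrier M)) (tensor_rels R S \<phi> M)"

text \<open>The canonical isomorphism \<open>S A \<rightarrow> (R A) \<otimes> S\<close> sending \<open>e\<^sub>a\<close> to \<open>e\<^sub>a \<otimes> 1\<close>.\<close>

definition free_iso ::
    "('r, 'x) ring_scheme \<Rightarrow> ('s, 'y) ring_scheme \<Rightarrow> ('r \<Rightarrow> 's) \<Rightarrow> 'a set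
      \<Rightarrow> ('a \<Rightarrow> 's) \<Rightarrow> (('a \<Rightarrow> 'r) \<Rightarrow> 's) set" where
  "free_iso R S \<phi> A x = (let F = free_module S (carrier (free_module R A)) in
    tensor_rels R S \<phi> (free_module R A) +>\<^bsub>F\<^esub>
      (\<Oplus>\<^bsub>F\<^esub>a\<in>{a \<in> A. x a \<noteq> \<zero>\<^bsub>S\<^esub>}. x a \<odot>\<^bsub>F\<^esub> evec S (evec R a)))"


section \<open>Module representations\<close>

text \<open>
  A module representation \<open>\<theta> : M \<rightarrow> Hom(N, O)\<close>, with \<open>rep_act \<theta> m\<close> the map \<open>m \<theta>\<close>, written as a function.
\<close>

record ('s, 'm, 'n, 'o) mod_rep =
  rep_par :: "('s, 'm) module"
  rep_src :: "('s, 'n) module"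
  rep_tgt :: "('s, 'o) module"
  rep_act :: "'m \<Rightarrow> 'n \<Rightarrow> 'o"

definition lin_map ::
    "('s, 'x) ring_scheme \<Rightarrow> ('s, 'n, 'y) module_scheme \<Rightarrow> ('s, 'o, 'z) module_scheme
      \<Rightarrow> ('n \<Rightarrow> 'o) \<Rightarrow> bool" where
  "lin_map S N P f \<longleftrightarrow>
    f \<in> carrier N \<rightarrow> carrier P \<and>
    (\<forall>x\<in>carrier N. \<forall>y\<in>carrier N. f (x \<oplus>\<^bsub>N\<^esub> y) = f x \<oplus>\<^bsub>P\<^esub> f y) \<and>
    (\<forall>s\<in>carrier S. \<forall>x\<in>carrier N. f (s \<odot>\<^bsub>N\<^esub> x) = s \<odot>\<^bsub>P\<^esub> f x)"

definition is_mod_rep :: "('s, 'x) ring_scheme \<Rightarrow> ('s, 'm, 'n, 'o) mod_rep \<Rightarrow> bool" where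
  "is_mod_rep S \<theta> \<longleftrightarrow>
    Module.module S (rep_par \<theta>) \<and> Module.module S (rep_src \<theta>) \<and> Module.module S (rep_tgt \<theta>) \<and>
    (\<forall>m\<in>carrier (rep_par \<theta>). lin_map S (rep_src \<theta>) (rep_tgt \<theta>) (rep_act \<theta> m)) \<and>
    (\<forall>n\<in>carrier (rep_src \<theta>). lin_map S (rep_par \<theta>) (rep_tgt \<theta>) (\<lambda>m. rep_act \<theta> m n))"

definition ext_rep ::
    "('r, 'x) ring_scheme \<Rightarrow> ('s, 'y) ring_scheme \<Rightarrow> ('r \<Rightarrow> 's) \<Rightarrow> ('r, 'm, 'n, 'o) mod_rep
      \<Rightarrow> ('s, ('m \<Rightarrow> 's) set, ('n \<Rightarrow> 's) set, ('o \<Rightarrow> 's) set) mod_rep" where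
  "ext_rep R S \<phi> \<theta> =
    \<lparr> rep_par = ext_module R S \<phi> (rep_par \<theta>),
      rep_src = ext_module R S \<phi> (rep_src \<theta>),
      rep_tgt = ext_module R S \<phi> (rep_tgt \<theta>),
      rep_act = (\<lambda>C E. \<Union>f\<in>C. \<Union>g\<in>E.
        let F = free_module S (carrier (rep_tgt \<theta>)) in
        tensor_rels R S \<phi> (rep_tgt \<theta>) +>\<^bsub>F\<^esub>
          finsum F (\<lambda>(m, n). (f m \<otimes>\<^bsub>S\<^esub> g n) \<odot>\<^bsub>F\<^esub> evec S (rep_act \<theta> m n))
            ({m. f m \<noteq> \<zero>\<^bsub>S\<^esub>} \<times> {n. g n \<noteq> \<zero>\<^bsub>S\<^esub>})) \<rparr>"

text \<open>
  Extension of scalars of \<open>\<theta> : M \<rightarrow> Hom(R I, R J)\<close>, read as \<open>M \<otimes> S \<rightarrow> Hom(S I, S J)\<close> through the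
  canonical isomorphisms \<open>S I = R I \<otimes> S\<close> and \<open>S J = R J \<otimes> S\<close>; when \<open>M = R B\<close>, further
  as \<open>S B \<rightarrow> Hom(S I, S J)\<close>.
\<close>

definition ext_rep_free ::
    "('r, 'x) ring_scheme \<Rightarrow> ('s, 'y) ring_scheme \<Rightarrow> ('r \<Rightarrow> 's) \<Rightarrow> 'i set \<Rightarrow> 'j set
      \<Rightarrow> ('r, 'm, 'i \<Rightarrow> 'r, 'j \<Rightarrow> 'r) mod_rep
      \<Rightarrow> ('s, ('m \<Rightarrow> 's) set, 'i \<Rightarrow> 's, 'j \<Rightarrow> 's) mod_rep" where
  "ext_rep_free R S \<phi> I J \<theta> =
    \<lparr> rep_par = ext_module R S \<phi> (rep_par \<theta>),
      rep_src = free_module S I,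
      rep_tgt = free_module S J,
      rep_act = (\<lambda>C y. inv_into (carrier (free_module S J)) (free_iso R S \<phi> J)
        (rep_act (ext_rep R S \<phi> \<theta>) C (free_iso R S \<phi> I y))) \<rparr>"

definition ext_rep_free3 ::
    "('r, 'x) ring_scheme \<Rightarrow> ('s, 'y) ring_scheme \<Rightarrow> ('r \<Rightarrow> 's) \<Rightarrow> 'b set \<Rightarrow> 'i set \<Rightarrow> 'j set
      \<Rightarrow> ('r, 'b \<Rightarrow> 'r, 'i \<Rightarrow> 'r, 'j \<Rightarrow> 'r) mod_rep
      \<Rightarrow> ('s, 'b \<Rightarrow> 's, 'i \<Rightarrow> 's, 'j \<Rightarrow> 's) mod_rep" where
  "ext_rep_free3 R S \<phi> B I J \<theta> =
    \<lparr> rep_par = free_module S B,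
      rep_src = free_module S I,
      rep_tgt = free_module S J,
      rep_act = (\<lambda>x. rep_act (ext_rep_free R S \<phi> I J \<theta>) (free_iso R S \<phi> B x)) \<rparr>"

definition restrict_par :: "('s, 'm, 'n, 'o) mod_rep \<Rightarrow> 'm set \<Rightarrow> ('s, 'm, 'n, 'o) mod_rep" where
  "restrict_par \<theta> H = \<theta>\<lparr>rep_par := (rep_par \<theta>)\<lparr>carrier := H\<rparr>\<rparr>"

text \<open>
  The inflation of \<open>\<theta> : M \<rightarrow> Hom(S I, S J)\<close> to \<open>I' \<supseteq> I\<close> and \<open>J' \<supseteq> J\<close>. No trace of \<open>J\<close> is left since
  the inclusion \<open>S J \<rightarrow> S J'\<close> is the identity on functions.
\<close>

definition inflation ::
    "('s, 'x) ring_scheme \<Rightarrow> 'i set \<Rightarrow> 'j set \<Rightarrow> 'i set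
      \<Rightarrow> ('s, 'm, 'i \<Rightarrow> 's, 'j \<Rightarrow> 's) mod_rep \<Rightarrow> ('s, 'm, 'i \<Rightarrow> 's, 'j \<Rightarrow> 's) mod_rep" where
  "inflation S I' J' I \<theta> =
    \<lparr> rep_par = rep_par \<theta>,
      rep_src = free_module S I',
      rep_tgt = free_module S J',
      rep_act = (\<lambda>m y. rep_act \<theta> m (ret S I y)) \<rparr>"

text \<open>\<open>(m, n) \<mapsto> m \<rho> + n \<tau>\<close> for \<open>\<rho>\<close> and \<open>\<tau>\<close> with values in the same module of homomorphisms.\<close>

definition sum_rep ::
    "('s, 'm, 'k, 'o) mod_rep \<Rightarrow> ('s, 'n, 'k, 'o) mod_rep \<Rightarrow> ('s, 'm \<times> 'n, 'k, 'o) mod_rep" where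
  "sum_rep \<rho> \<tau> =
    \<lparr> rep_par = dsum_module (rep_par \<rho>) (rep_par \<tau>),
      rep_src = rep_src \<rho>,
      rep_tgt = rep_tgt \<rho>,
      rep_act = (\<lambda>(m, n) y. rep_act \<rho> m y \<oplus>\<^bsub>rep_tgt \<rho>\<^esub> rep_act \<tau> n y) \<rparr>"


section \<open>Compact discrete valuation rings and ask zeta functions\<close>

definition max_ideal :: "('o, 'x) ring_scheme \<Rightarrow> 'o set" where
  "max_ideal D = (THE P. maximalideal P D)"

definition dvr :: "('o, 'x) ring_scheme \<Rightarrow> bool" where
  "dvr D \<longleftrightarrow> principal_domain D \<and> (\<exists>!P. maximalideal P D) \<and> max_ideal D \<noteq> {\<zero>\<^bsub>D\<^esub>}"

definition ideal_power :: "('o, 'x) ring_scheme \<Rightarrow> 'o set \<Rightarrow> nat \<Rightarrow> 'o set" where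
  "ideal_power D P n = P [^]\<^bsub>ideals_set D\<^esub> n"

definition adic_topology :: "('o, 'x) ring_scheme \<Rightarrow> 'o set \<Rightarrow> 'o topology" where
  "adic_topology D P = topology
    (\<lambda>U. U \<subseteq> carrier D \<and> (\<forall>x\<in>U. \<exists>n. ideal_power D P n +>\<^bsub>D\<^esub> x \<subseteq> U))"

definition compact_dvr :: "('o, 'x) ring_scheme \<Rightarrow> bool" where
  "compact_dvr D \<longleftrightarrow> dvr D \<and> compact_space (adic_topology D (max_ideal D))"

definition rep_ker :: "('s, 'm, 'n, 'o) mod_rep \<Rightarrow> 'm \<Rightarrow> 'n set" where
  "rep_ker \<theta> m = {n \<in> carrier (rep_src \<theta>). rep_act \<theta> m n = \<zero>\<^bsub>rep_tgt \<theta>\<^esub>}"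

definition ask :: "('s, 'm, 'n, 'o) mod_rep \<Rightarrow> rat" where
  "ask \<theta> = 1 / of_nat (card (carrier (rep_par \<theta>))) *
     (\<Sum>m\<in>carrier (rep_par \<theta>). of_nat (card (rep_ker \<theta> m)))"

definition Zask :: "('o, 'x) ring_scheme \<Rightarrow> ('o, 'm, 'n, 'p) mod_rep \<Rightarrow> rat fps" where
  "Zask D \<theta> = Abs_fps (\<lambda>n. let Q = ideal_power D (max_ideal D) n in
     ask (ext_rep D (D Quot Q) (\<lambda>a. Q +>\<^bsub>D\<^esub> a) \<theta>))"


section \<open>Fitting ideals\<close>

definition ring_det :: "('s, 'x) ring_scheme \<Rightarrow> nat \<Rightarrow> (nat \<Rightarrow> nat \<Rightarrow> 's) \<Rightarrow> 's" where
  "ring_det S k A = (\<Oplus>\<^bsub>S\<^esub>p\<in>{p. p permutes {..<k}}.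
     (if evenperm p then \<one>\<^bsub>S\<^esub> else \<ominus>\<^bsub>S\<^esub> \<one>\<^bsub>S\<^esub>) \<otimes>\<^bsub>S\<^esub> (\<Otimes>\<^bsub>S\<^esub>i\<in>{..<k}. A i (p i)))"

text \<open>
  The \<open>k \<times> k\<close> minors of a matrix with \<open>n\<close> columns, given by its set \<open>G\<close> of rows. (Repeated rows would
  contribute only zero minors, and reordering rows or columns only changes signs.)
\<close>

definition minors :: "('s, 'x) ring_scheme \<Rightarrow> nat \<Rightarrow> (nat \<Rightarrow> 's) set \<Rightarrow> nat \<Rightarrow> 's set" where
  "minors S n G k = {ring_det S k (\<lambda>p q. r p (c q)) | r c.
     r \<in> {..<k} \<rightarrow> G \<and> inj_on r {..<k} \<and> c \<in> {..<k} \<rightarrow> {..<n} \<and> inj_on c {..<k}}"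

text \<open>
  \<open>M\<close> has \<open>n\<close> generators \<open>g 0, \<dots>, g (n - 1)\<close> whose module of relations is the row span of
  the matrix with rows \<open>G\<close>.
\<close>

definition presents ::
    "('s, 'x) ring_scheme \<Rightarrow> ('s, 'm, 'y) module_scheme \<Rightarrow> nat \<Rightarrow> (nat \<Rightarrow> 's) set \<Rightarrow> bool" where
  "presents S M n G \<longleftrightarrow> (\<exists>g \<in> {..<n} \<rightarrow> carrier M.
     let F = free_module S {..<n}; ev = (\<lambda>y. \<Oplus>\<^bsub>M\<^esub>k\<in>{..<n}. y k \<odot>\<^bsub>M\<^esub> g k) in
     ev ` carrier F = carrier M \<and>
     G \<subseteq> carrier F \<and> gen_submodule S F G = {y \<in> carrier F. ev y = \<zero>\<^bsub>M\<^esub>})"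

text \<open>
  By Fitting's lemma, the ideal does not depend on the presentation, so that any of them may be chosen.
  For \<open>i \<ge> n\<close>, truncated subtraction gives the \<open>0 \<times> 0\<close> minor, which is \<open>1\<close>. Infinite sets of rows
  are admitted so that the definition covers all finitely generated modules; for finitely
  presented ones, this makes no difference.
\<close>

definition fitting_ideal ::
    "('s, 'x) ring_scheme \<Rightarrow> ('s, 'm, 'y) module_scheme \<Rightarrow> nat \<Rightarrow> 's set" where
  "fitting_ideal S M i =
     (SOME F. \<exists>n G. presents S M n G \<and> F = Idl\<^bsub>S\<^esub> (minors S n G (n - i)))"


section \<open>Polynomial rings and orbit modules\<close>

text \<open>
  The base ring is a type of class \<open>comm_ring_1\<close>, viewed as a ring record with full carrier. The rings
  of polynomials and of Laurent polynomials in a given set \<open>V\<close> of variables are both realised inside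
  the monoid ring of the finitely supported integral exponent vectors.
\<close>

abbreviation base_ring :: "'r::comm_ring_1 ring" where
  "base_ring \<equiv> ring_of_type_algebra"

type_synonym ('v, 'r) laurent = "('v \<Rightarrow>\<^sub>0 int) \<Rightarrow>\<^sub>0 'r"

definition laurent_ring :: "'v set \<Rightarrow> ('v, 'r::comm_ring_1) laurent ring" where
  "laurent_ring V =
    ring_of_type_algebra\<lparr>carrier := {p. \<forall>e\<in>Poly_Mapping.keys p. Poly_Mapping.keys e \<subseteq> V}\<rparr>"

definition mpoly_ring :: "'v set \<Rightarrow> ('v, 'r::comm_ring_1) laurent ring" where
  "mpoly_ring V =
    ring_of_type_algebra\<lparr>carrier := {p. \<forall>e\<in>Poly_Mapping.keys p.
      Poly_Mapping.keys e \<subseteq> V \<and> (\<forall>v. 0 \<le> Poly_Mapping.lookup e v)}\<rparr>"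

definition lvar :: "'v \<Rightarrow> ('v, 'r::comm_ring_1) laurent" where
  "lvar v = Poly_Mapping.single (Poly_Mapping.single v 1) 1"

definition lconst :: "'r \<Rightarrow> ('v, 'r::comm_ring_1) laurent" where
  "lconst r = Poly_Mapping.single 0 r"

definition orbit_row ::
    "nat set \<Rightarrow> ('r::comm_ring_1, 'm, nat \<Rightarrow> 'r, nat \<Rightarrow> 'r) mod_rep \<Rightarrow> 'm
      \<Rightarrow> nat \<Rightarrow> (nat, 'r) laurent" where
  "orbit_row I \<theta> m = (\<lambda>j. \<Sum>i\<in>I. lvar i * lconst (rep_act \<theta> m (evec base_ring i) j))"

definition Orbit ::
    "nat set \<Rightarrow> nat set \<Rightarrow> ('r::comm_ring_1, 'm, nat \<Rightarrow> 'r, nat \<Rightarrow> 'r) mod_rep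
      \<Rightarrow> ((nat, 'r) laurent, (nat \<Rightarrow> (nat, 'r) laurent) set) module" where
  "Orbit I J \<theta> = quot_module (free_module (mpoly_ring I) J)
     (gen_submodule (mpoly_ring I) (free_module (mpoly_ring I) J)
       (orbit_row I \<theta> ` carrier (rep_par \<theta>)))"

definition Orbit_units ::
    "nat set \<Rightarrow> nat set \<Rightarrow> ('r::comm_ring_1, 'm, nat \<Rightarrow> 'r, nat \<Rightarrow> 'r) mod_rep
      \<Rightarrow> ((nat, 'r) laurent, ((nat \<Rightarrow> (nat, 'r) laurent) set \<Rightarrow> (nat, 'r) laurent) set) module" where
  "Orbit_units I J \<theta> = ext_module (mpoly_ring I) (laurent_ring I) (\<lambda>p. p) (Orbit I J \<theta>)"


section \<open>Combinatorial families\<close>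

text \<open>
  A family is given by the sets \<open>B I J\<close> and the maps \<open>\<theta> I J : R B(I,J) \<rightarrow> Hom(R I, R J)\<close>; both are
  only relevant for finite \<open>I\<close> and \<open>J\<close>.
\<close>

type_synonym 'u fam_sets = "nat set \<Rightarrow> nat set \<Rightarrow> 'u set"
type_synonym ('u, 'r) fam_maps =
  "nat set \<Rightarrow> nat set \<Rightarrow> ('u \<Rightarrow> 'r) \<Rightarrow> (nat \<Rightarrow> 'r) \<Rightarrow> (nat \<Rightarrow> 'r)"

definition fam_rep ::
    "'u fam_sets \<Rightarrow> ('u, 'r::comm_ring_1) fam_maps \<Rightarrow> nat set \<Rightarrow> nat set
      \<Rightarrow> ('r, 'u \<Rightarrow> 'r, nat \<Rightarrow> 'r, nat \<Rightarrow> 'r) mod_rep" where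
  "fam_rep B \<theta> I J =
    \<lparr> rep_par = free_module base_ring (B I J),
      rep_src = free_module base_ring I,
      rep_tgt = free_module base_ring J,
      rep_act = \<theta> I J \<rparr>"

definition entry ::
    "('u, 'r::comm_ring_1) fam_maps \<Rightarrow> nat set \<Rightarrow> nat set \<Rightarrow> 'u \<Rightarrow> nat \<Rightarrow> nat \<Rightarrow> 'r" where
  "entry \<theta> I J b i j = \<theta> I J (evec base_ring b) (evec base_ring i) j"

definition cell_class ::
    "('u, 'r::comm_ring_1) fam_maps \<Rightarrow> nat set \<Rightarrow> nat set \<Rightarrow> 'u \<Rightarrow> (nat \<times> nat) set" where
  "cell_class \<theta> I J b = {(i, j). i \<in> I \<and> j \<in> J \<and> entry \<theta> I J b i j \<noteq> 0}"

definition comb_family :: "'u fam_sets \<Rightarrow> ('u, 'r::comm_ring_1) fam_maps \<Rightarrow> bool" where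
  "comb_family B \<theta> \<longleftrightarrow>
    (\<forall>I J. finite I \<longrightarrow> finite J \<longrightarrow>
      finite (B I J) \<and> is_mod_rep base_ring (fam_rep B \<theta> I J) \<and>
      (\<forall>b\<in>B I J. cell_class \<theta> I J b \<noteq> {}) \<and>
      (\<forall>b\<in>B I J. \<forall>b'\<in>B I J. b \<noteq> b' \<longrightarrow> cell_class \<theta> I J b \<inter> cell_class \<theta> I J b' = {}) \<and>
      (\<forall>b\<in>B I J. \<forall>i\<in>I. \<forall>j\<in>J. entry \<theta> I J b i j \<noteq> 0 \<longrightarrow> entry \<theta> I J b i j dvd 1)) \<and>
    (\<forall>I I' J J'. finite I' \<longrightarrow> finite J' \<longrightarrow> I \<subseteq> I' \<longrightarrow> J \<subseteq> J' \<longrightarrow>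
      B I J \<subseteq> B I' J' \<and>
      (\<forall>x\<in>carrier (free_module base_ring (B I' J')). \<forall>y\<in>carrier (free_module base_ring I).
        \<theta> I J (ret base_ring (B I J) x) y = ret base_ring J (\<theta> I' J' x y)))"

definition B_infinity :: "'u fam_sets \<Rightarrow> 'u set" where
  "B_infinity B = \<Union>{B I J | I J. finite I \<and> finite J}"

definition constant_rank ::
    "'u fam_sets \<Rightarrow> ('u, 'r::comm_ring_1) fam_maps \<Rightarrow> nat set \<Rightarrow> nat set \<Rightarrow> nat \<Rightarrow> bool" where
  "constant_rank B \<theta> I J l \<longleftrightarrow>
    (\<forall>i<l. fitting_ideal (mpoly_ring I) (Orbit I J (fam_rep B \<theta> I J)) i = Idl\<^bsub>mpoly_ring I\<^esub> {0}) \<and>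
    (\<forall>H. H \<noteq> {} \<longrightarrow> H \<subseteq> I \<longrightarrow>
      fitting_ideal (laurent_ring H) (Orbit_units H J (fam_rep B \<theta> H J)) l = Idl\<^bsub>laurent_ring H\<^esub> {1})"


section \<open>Partial colourings, relation modules and admissibility\<close>

text \<open>
  The set of colours is the type \<open>'c\<close>, and the blank symbol is \<open>None\<close>. A partial colouring of \<open>V\<close> is
  represented by its extension by the blank symbol.
\<close>

definition partial_colouring :: "'u set \<Rightarrow> ('u \<Rightarrow> 'c option) \<Rightarrow> bool" where
  "partial_colouring V \<beta> \<longleftrightarrow> (\<forall>u. u \<notin> V \<longrightarrow> \<beta> u = None) \<and> (\<forall>c. finite (\<beta> -` {Some c}))"

definition colours_in :: "('u \<Rightarrow> 'c option) \<Rightarrow> 'u set \<Rightarrow> 'c set" where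
  "colours_in \<beta> A = {c. \<beta> -` {Some c} \<subseteq> A}"

definition Rel :: "'u set \<Rightarrow> 'u set \<Rightarrow> ('u \<Rightarrow> 'c option) \<Rightarrow> ('u \<Rightarrow> ('u, 'r::comm_ring_1) laurent) set" where
  "Rel U A \<beta> = {x \<in> carrier (free_module (laurent_ring U) A).
     \<forall>c\<in>colours_in \<beta> A. (\<Sum>b\<in>\<beta> -` {Some c}. lvar b * x b) = 0}"

definition acute_fam ::
    "'u set \<Rightarrow> 'u fam_sets \<Rightarrow> ('u, 'r::comm_ring_1) fam_maps \<Rightarrow> nat set \<Rightarrow> nat set
      \<Rightarrow> (('u, 'r) laurent, 'u \<Rightarrow> ('u, 'r) laurent, nat \<Rightarrow> ('u, 'r) laurent, nat \<Rightarrow> ('u, 'r) laurent) mod_rep" where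
  "acute_fam U B \<theta> I J =
     ext_rep_free3 base_ring (laurent_ring U) lconst (B I J) I J (fam_rep B \<theta> I J)"

definition rel_fam ::
    "'u set \<Rightarrow> 'u fam_sets \<Rightarrow> ('u, 'r::comm_ring_1) fam_maps \<Rightarrow> nat set \<Rightarrow> nat set \<Rightarrow> ('u \<Rightarrow> 'c option)
      \<Rightarrow> (('u, 'r) laurent, 'u \<Rightarrow> ('u, 'r) laurent, nat \<Rightarrow> ('u, 'r) laurent, nat \<Rightarrow> ('u, 'r) laurent) mod_rep" where
  "rel_fam U B \<theta> I J \<beta> = restrict_par (acute_fam U B \<theta> I J) (Rel U (B I J) \<beta>)"

definition local_colour :: "'u set \<Rightarrow> ('u \<Rightarrow> 'c option) \<Rightarrow> 'u \<Rightarrow> 'c option" where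
  "local_colour A \<beta> b = (if \<exists>c\<in>colours_in \<beta> A. \<beta> b = Some c then \<beta> b else None)"

text \<open>
  \<open>(I, J) \<rightarrow> (I, J')\<close>: a cell \<open>(i, j)\<close> of the class of \<open>b\<close> is isolated precisely when that class is \<open>{(i, j)}\<close>.
\<close>

definition move ::
    "'u fam_sets \<Rightarrow> ('u, 'r::comm_ring_1) fam_maps \<Rightarrow> ('u \<Rightarrow> 'c option) \<Rightarrow> nat set
      \<Rightarrow> nat set \<Rightarrow> nat set \<Rightarrow> bool" where
  "move B \<theta> \<beta> I J J' \<longleftrightarrow>
    (\<exists>b\<in>B I J. \<exists>i j. cell_class \<theta> I J b = {(i, j)} \<and> local_colour (B I J) \<beta> b = None \<and> J' = J - {j})"

definition admissible ::
    "'u fam_sets \<Rightarrow> ('u, 'r::comm_ring_1) fam_maps \<Rightarrow> ('u \<Rightarrow> 'c option) \<Rightarrow> nat set \<Rightarrow> nat set \<Rightarrow> nat \<Rightarrow> bool" where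
  "admissible B \<theta> \<beta> I J l \<longleftrightarrow>
    (\<forall>H. H \<noteq> {} \<longrightarrow> H \<subseteq> I \<longrightarrow>
      (\<exists>E \<subseteq> J. card E \<le> l \<and> (move B \<theta> \<beta> H)\<^sup>*\<^sup>* (J - E) {}))"

end

theory Submission
  imports Defs "Jordan_Normal_Form.Determinant"
begin

text \<open>
  Counting pairs \<open>(m, y)\<close> with \<open>y (m \<theta>) = 0\<close> by \<open>y\<close> shows that \<open>ask \<theta>\<close> is the sum over all \<open>y\<close> of the
  reciprocal of the number of vectors \<open>y (m \<theta>)\<close>. So it is enough to see that, over the finite local ring
  \<open>S = D / P ^ n\<close> and for every \<open>y\<close>, the relations produce the same vectors \<open>y (x \<theta>)\<close> as arbitrary parameters.

  Dividing by a power of the uniformiser, assume that \<open>y\<close> has a unit among its coordinates, and let \<open>H\<close> be the set of its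
  unit coordinates. A blank isolated cell in row \<open>i \<in> H\<close> and column \<open>j\<close> yields a relation that reaches \<open>e\<^sub>j\<close> modulo
  the uniformiser and the columns removed before. Hence admissibility and the nilpotency of the
  uniformiser show that the relations reach every vector of \<open>S J\<close> up to at most \<open>l\<close> coordinates \<open>E\<close>.
  If \<open>v = y (x \<theta>)\<close> for an arbitrary \<open>x\<close>, subtract such a vector to make \<open>v\<close> vanish outside \<open>E\<close>. For each
  \<open>d \<in> E\<close>, the vector \<open>v\<close> and the vectors congruent to \<open>e\<^sub>j\<close>, for \<open>j \<notin> E\<close>, form a triangular matrix with
  diagonal \<open>v\<^sub>d, 1, \<dots>, 1\<close> whose rows are specialised relations of the orbit module. The vanishing of the
  Fitting ideal of index \<open>card E - 1\<close> gives \<open>v\<^sub>d = 0\<close>.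
\<close>

section \<open>Determinants and vanishing minors\<close>

hide_const (open) Ring_Hom.ring_hom

text \<open>Two obstacles shape the linear algebra. First, \<open>fitting_ideal\<close> is defined
  by choice: its vanishing says that the minors of some unknown presentation vanish, whereas the
  relations at hand are vectors in the columns \<open>J\<close>. So the triangular matrix is carried
  over to the chosen presentation: it is bordered by the matrices that express each generating
  system through the other, which keeps its determinant and makes minors of the chosen presentation
  appear. Secondly, \<open>S\<close> is a ring record, while determinants are developed for types of
  class \<open>comm_ring_1\<close>. Hence \<open>S\<close> is covered by a polynomial ring with one
  variable for each of its elements; matrices are lifted there, and everything is read modulo the
  kernel.

  Extension of scalars is defined by cosets and unions over representatives, and the zeta function
  extends scalars twice. Pure tensors generate at both stages, so representations are compared only
  through their matrices, and images only through the submodules that contain them.\<close>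

lemma card_insert_index_preimage:
  assumes "i < Suc n" "G \<subseteq> {..<Suc n}"
  shows "card {p. p < n \<and> insert_index i p \<in> G} = card (G - {i})"
proof (rule bij_betw_same_card[of "insert_index i"])
  have im: "insert_index i ` {0..<n} = {0..<Suc n} - {i}"
    using insert_index_image[OF assms(1)] .
  have "inj_on (insert_index i) {p. p < n \<and> insert_index i p \<in> G}"
    by (auto simp: inj_on_def insert_index_def split: if_splits)
  moreover have "insert_index i ` {p. p < n \<and> insert_index i p \<in> G} = G - {i}"
  proof (intro equalityI subsetI)
    fix x assume "x \<in> G - {i}"
    then have "x \<in> insert_index i ` {0..<n}" using im assms by auto
    with \<open>x \<in> G - {i}\<close> show "x \<in> insert_index i ` {p. p < n \<and> insert_index i p \<in> G}" by auto
  qed (auto simp: insert_index_def split: if_splits)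
  ultimately show "bij_betw (insert_index i) {p. p < n \<and> insert_index i p \<in> G} (G - {i})"
    by (simp add: bij_betw_def)
qed

text \<open>\<open>Z\<close> will be the kernel of a surjection onto the ring of interest and
  \<open>K\<close> the set of vectors that this surjection sends into a module of relations. Row and
  column selections may repeat, so that expansions never have to track injectivity.\<close>

locale minors_in_ideal =
  fixes Z :: "'p::comm_ring_1 set" and K :: "(nat \<Rightarrow> 'p) set" and n k :: nat
  assumes Z_zero: "0 \<in> Z"
    and Z_add: "\<And>a b. a \<in> Z \<Longrightarrow> b \<in> Z \<Longrightarrow> a + b \<in> Z"
    and Z_mult: "\<And>a b. b \<in> Z \<Longrightarrow> a * b \<in> Z"
    and minors: "\<And>r c. (\<And>p. p < k \<Longrightarrow> r p \<in> K) \<Longrightarrow> (\<And>q. q < k \<Longrightarrow> c q < n)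
      \<Longrightarrow> det (mat k k (\<lambda>(p, q). r p (c q))) \<in> Z"
begin

lemma Z_sum: "(\<And>i. i \<in> S \<Longrightarrow> f i \<in> Z) \<Longrightarrow> sum f S \<in> Z"
  by (induction S rule: infinite_finite_induct) (auto intro: Z_zero Z_add)

text \<open>Expanding along a column of \<open>A\<close> removes one uncontrolled column and at most
  one row of \<open>Gd\<close>, so the inequality survives. Once no such column is left, rows
  outside \<open>Gd\<close> are removed, or any row while the matrix is larger than
  \<open>k\<close>. What remains are the \<open>k\<close>-minors of the locale.\<close>

lemma det_mixed:
  assumes "M \<in> carrier_mat N N" "A \<subseteq> {..<N}" "Gd \<subseteq> {..<N}"
    and "\<And>p. p \<in> Gd \<Longrightarrow> \<exists>v\<in>K. \<forall>q<N. q \<notin> A \<longrightarrow> M $$ (p, q) = v (c q)"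
    and "\<And>q. q < N \<Longrightarrow> q \<notin> A \<Longrightarrow> c q < n"
    and "k + card A \<le> card Gd"
  shows "det M \<in> Z"
  using assms
proof (induction N arbitrary: M A Gd c)
  case 0
  \<comment> \<open>The counting hypothesis forces \<open>k = 0\<close>; the assumption on minors,
    with nothing left to select, then puts the empty determinant into \<open>Z\<close>.\<close>
  then have "k = 0" "M \<in> carrier_mat 0 0" by auto
  then have "mat k k (\<lambda>(p, q). undefined p (undefined q)) = M" by auto
  moreover have "det (mat k k (\<lambda>(p, q). undefined p (undefined q))) \<in> Z"
    by (rule minors) (use \<open>k = 0\<close> in auto)
  ultimately show ?case by metis
next
  case (Suc N)
  \<comment> \<open>All deletions are treated at once: the inequality \<open>c'\<close> is what each
    kind of expansion has to verify, and \<open>insert_index\<close> renumbers the marked rows and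
    columns.\<close>
  have minor: "det (mat_delete M i a) \<in> Z"
    if i: "i < Suc N" and a: "a < Suc N" and c': "k + card (A - {a}) \<le> card (Gd - {i})" for i a
  proof (rule Suc.IH[where A = "{q. q < N \<and> insert_index a q \<in> A}"
        and Gd = "{p. p < N \<and> insert_index i p \<in> Gd}" and c = "\<lambda>q. c (insert_index a q)"])
    show "mat_delete M i a \<in> carrier_mat N N"
      using mat_delete_carrier[OF Suc.prems(1)] by simp
    show "k + card {q. q < N \<and> insert_index a q \<in> A} \<le> card {p. p < N \<and> insert_index i p \<in> Gd}"
      using c' Suc.prems by (simp add: card_insert_index_preimage i a)
    fix p assume p: "p \<in> {p. p < N \<and> insert_index i p \<in> Gd}"
    then obtain v where v: "v \<in> K" "\<forall>q<Suc N. q \<notin> A \<longrightarrow> M $$ (insert_index i p, q) = v (c q)"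
      using Suc.prems(4) by auto
    have "\<forall>q<N. q \<notin> {q. q < N \<and> insert_index a q \<in> A} \<longrightarrow>
        mat_delete M i a $$ (p, q) = v (c (insert_index a q))"
    proof (intro allI impI)
      fix q assume q: "q < N" "q \<notin> {q. q < N \<and> insert_index a q \<in> A}"
      have "mat_delete M i a $$ (p, q) = M $$ (insert_index i p, insert_index a q)"
        using p q by (subst mat_delete_index[OF Suc.prems(1) i a]) auto
      also have "insert_index a q < Suc N" using q by (auto simp: insert_index_def)
      then have "M $$ (insert_index i p, insert_index a q) = v (c (insert_index a q))"
        using v q by auto
      finally show "mat_delete M i a $$ (p, q) = v (c (insert_index a q))" .
    qed
    with v(1) show "\<exists>v\<in>K. \<forall>q<N. q \<notin> {q. q < N \<and> insert_index a q \<in> A} \<longrightarrow>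
        mat_delete M i a $$ (p, q) = v (c (insert_index a q))" by blast
  next
    fix q assume "q < N" "q \<notin> {q. q < N \<and> insert_index a q \<in> A}"
    then show "c (insert_index a q) < n"
      by (intro Suc.prems(5)) (auto simp: insert_index_def)
  qed auto
  have fin: "finite A" "finite Gd" using Suc.prems(2,3) by (auto intro: finite_subset)
  show ?case
  proof (cases "A = {}")
    case False
    then obtain a where a: "a \<in> A" by auto
    then have aN: "a < Suc N" using Suc.prems by auto
    have "k + card (A - {a}) \<le> card (Gd - {i})" for i
    proof -
      have "card (A - {a}) = card A - 1" "card A > 0" using a fin by (auto simp: card_gt_0_iff)
      moreover have "card (Gd - {i}) \<ge> card Gd - 1" using fin
        by (simp add: card_Diff_singleton_if)
      ultimately show ?thesis using Suc.prems(6) by linarith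
    qed
    then have "det (mat_delete M i a) \<in> Z" if "i < Suc N" for i using minor[OF that aN] by blast
    then show ?thesis
      unfolding laplace_expansion_column[OF Suc.prems(1) aN] cofactor_def
      by (intro Z_sum Z_mult) auto
  next
    case True
    have row: "det M \<in> Z" if p: "p < Suc N" and kp: "k \<le> card (Gd - {p})" for p
    proof -
      have "det (mat_delete M p a) \<in> Z" if "a < Suc N" for a
        using minor[OF p that] kp True by simp
      then show ?thesis
        unfolding laplace_expansion_row[OF Suc.prems(1) p] cofactor_def
        by (intro Z_sum Z_mult) auto
    qed
    show ?thesis
    proof (cases "k < Suc N")
      case k: True
      show ?thesis
      proof (cases "Gd = {..<Suc N}")
        case True
        then show ?thesis using k by (intro row[of 0]) auto
      next
        case False
        then obtain p where "p < Suc N" "p \<notin> Gd" using Suc.prems by auto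
        then show ?thesis using Suc.prems by (intro row[of p]) auto
      qed
    next
      case False
      have "card Gd \<le> Suc N" using card_mono[OF _ Suc.prems(3)] by simp
      with False Suc.prems have kN: "k = Suc N" "card Gd = Suc N" by auto
      then have "Gd = {..<Suc N}" using Suc.prems(3) by (simp add: card_subset_eq)
      then have "\<forall>p. p < k \<longrightarrow> (\<exists>v\<in>K. \<forall>q<k. M $$ (p, q) = v (c q))"
        using Suc.prems(4) True kN by simp
      then obtain r where r: "\<And>p. p < k \<Longrightarrow> r p \<in> K"
        "\<And>p q. p < k \<Longrightarrow> q < k \<Longrightarrow> M $$ (p, q) = r p (c q)" by metis
      have "M = mat k k (\<lambda>(p, q). r p (c q))"
        using Suc.prems(1) kN r(2) by (intro eq_matI) auto
      moreover have "\<And>q. q < k \<Longrightarrow> c q < n" using Suc.prems(5) True kN by auto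
      ultimately show ?thesis using minors[of r c] r(1) by auto
    qed
  qed
qed

text \<open>If \<open>E\<close> and \<open>C\<close> express two generating systems of a module in terms of each other, then a square
  matrix \<open>T\<close> with many relations of the second system among its rows is handled by the column operation
  \<open>(T, 0; -E, 1) (1, C; 0, 1) = (T, T C; -E, 1 - E C)\<close>, after which the last \<open>n\<close> columns contain
  relations of the first system.\<close>

lemma triangular_relations:
  assumes T: "T \<in> carrier_mat m m" and C: "C \<in> carrier_mat m n" and E: "E \<in> carrier_mat n m"
    and tri: "\<And>i j. i < j \<Longrightarrow> j < m \<Longrightarrow> T $$ (i, j) = 0"
    and Gd: "Gd \<subseteq> {..<m}" "m + k \<le> card Gd + n"
    and TC: "\<And>p. p \<in> Gd \<Longrightarrow> \<exists>v\<in>K. \<forall>q<n. (T * C) $$ (p, q) = v q"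
    and EC: "\<And>p. p < n \<Longrightarrow> \<exists>v\<in>K. \<forall>q<n. (1\<^sub>m n + (- E) * C) $$ (p, q) = v q"
  shows "prod_list (diag_mat T) \<in> Z"
proof -
  define M1 where "M1 = four_block_mat T (0\<^sub>m m n) (- E) (1\<^sub>m n)"
  define M2 where "M2 = four_block_mat (1\<^sub>m m) C (0\<^sub>m n m) (1\<^sub>m n)"
  have E': "- E \<in> carrier_mat n m" using E by simp
  have M1c: "M1 \<in> carrier_mat (m + n) (m + n)" and M2c: "M2 \<in> carrier_mat (m + n) (m + n)"
    unfolding M1_def M2_def using T C E' by auto
  have prod: "M1 * M2 = four_block_mat T (T * C) (- E) (1\<^sub>m n + (- E) * C)"
    unfolding M1_def M2_def
    by (subst mult_four_block_mat[OF T _ E' _ _ C]) (use T C E' in \<open>auto simp: comm_add_mat[of _ n n]\<close>)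
  have "det M1 = prod_list (diag_mat M1)"
  proof (rule det_lower_triangular[OF _ M1c])
    fix i j assume "i < j" "j < m + n"
    then show "M1 $$ (i, j) = 0" unfolding M1_def using T E' tri by auto
  qed
  also have "diag_mat M1 = diag_mat T @ diag_mat (1\<^sub>m n)"
    unfolding M1_def using T by (rule diag_four_block_mat) auto
  also have "prod_list \<dots> = prod_list (diag_mat T)"
    using det_upper_triangular[of "1\<^sub>m n" n] by (simp add: upper_triangular_def)
  finally have d1: "det M1 = prod_list (diag_mat T)" .
  have "det M2 = prod_list (diag_mat M2)"
    by (rule det_upper_triangular[OF _ M2c]) (use C in \<open>auto simp: M2_def upper_triangular_def\<close>)
  also have "diag_mat M2 = diag_mat (1\<^sub>m m) @ diag_mat (1\<^sub>m n)"
    unfolding M2_def by (rule diag_four_block_mat) auto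
  also have "prod_list \<dots> = (1 :: 'p)"
    using det_upper_triangular[of "1\<^sub>m n :: 'p mat" n] det_upper_triangular[of "1\<^sub>m m :: 'p mat" m]
    by (simp add: upper_triangular_def)
  finally have d2: "det M2 = 1" .
  \<comment> \<open>Only the first \<open>m\<close> columns of the product are uncontrolled. The
    rows in \<open>Gd\<close> restrict to relations by \<open>TC\<close> and all of the last
    \<open>n\<close> rows by \<open>EC\<close>, so the count required is
    \<open>k + m \<le> card Gd + n\<close>.\<close>
  have "det (M1 * M2) \<in> Z"
  proof (rule det_mixed[where A = "{..<m}" and Gd = "Gd \<union> (\<lambda>p. m + p) ` {..<n}" and c = "\<lambda>q. q - m"])
    show "M1 * M2 \<in> carrier_mat (m + n) (m + n)" using M1c M2c by simp
    have "card (Gd \<union> (\<lambda>p. m + p) ` {..<n}) = card Gd + n"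
      by (subst card_Un_disjoint) (use Gd finite_subset in \<open>auto simp: card_image\<close>)
    then show "k + card {..<m} \<le> card (Gd \<union> (\<lambda>p. m + p) ` {..<n})" using Gd by simp
    fix p assume "p \<in> Gd \<union> (\<lambda>p. m + p) ` {..<n}"
    then consider "p \<in> Gd" "p < m" | p' where "p = m + p'" "p' < n" using Gd by auto
    then show "\<exists>v\<in>K. \<forall>q<m + n. q \<notin> {..<m} \<longrightarrow> (M1 * M2) $$ (p, q) = v (q - m)"
    proof cases
      case 1
      then obtain v where "v \<in> K" "\<forall>q<n. (T * C) $$ (p, q) = v q" using TC by blast
      then show ?thesis unfolding prod using 1 T C E' by (intro bexI[of _ v]) auto
    next
      case 2
      then obtain v where "v \<in> K" "\<forall>q<n. (1\<^sub>m n + (- E) * C) $$ (p', q) = v q" using EC by blast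
      then show ?thesis unfolding prod using 2 T C E' by (intro bexI[of _ v]) auto
    qed
  qed (use Gd in auto)
  then show ?thesis using det_mult[OF M1c M2c] d1 d2 by simp
qed

end

section \<open>Modules and module representations\<close>

lemma (in module) submodule_diff:
  assumes "submodule H R M" "x \<in> H" "y \<in> H" shows "x \<ominus>\<^bsub>M\<^esub> y \<in> H"
  using submoduleE(3,5)[OF assms(1)] assms(2,3) by (simp add: M.minus_eq)

lemma (in module) submodule_zero:
  assumes "submodule H R M" shows "\<zero>\<^bsub>M\<^esub> \<in> H"
  using subgroup.one_closed[OF submodule.axioms(1)[OF assms]] by simp

lemma (in module) submodule_finsum:
  assumes H: "submodule H R M" and "\<And>i. i \<in> A \<Longrightarrow> f i \<in> H" shows "finsum M f A \<in> H"
  using assms(2)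
proof (induction A rule: infinite_finite_induct)
  case (insert x F)
  then have "f \<in> F \<rightarrow> carrier M" "f x \<in> carrier M" using submoduleE(1)[OF H] by auto
  then show ?case using insert submoduleE(5)[OF H] by simp
qed (use submodule_zero[OF H] in auto)

text \<open>Negation is multiplication by \<open>-1\<close>, so closure under scalars already
  provides additive inverses.\<close>

lemma (in module) submodule_smultI:
  assumes subset: "H \<subseteq> carrier M" and zero: "\<zero>\<^bsub>M\<^esub> \<in> H"
    and add: "\<And>a b. a \<in> H \<Longrightarrow> b \<in> H \<Longrightarrow> a \<oplus>\<^bsub>M\<^esub> b \<in> H"
    and smult: "\<And>a x. a \<in> carrier R \<Longrightarrow> x \<in> H \<Longrightarrow> a \<odot>\<^bsub>M\<^esub> x \<in> H"
  shows "submodule H R M"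
proof (rule submoduleI[OF subset zero _ add smult])
  fix a assume a: "a \<in> H"
  then have "\<ominus>\<^bsub>M\<^esub> a = (\<ominus> \<one>) \<odot>\<^bsub>M\<^esub> a"
    using subset smult_l_minus[of \<one> a] by auto
  then show "\<ominus>\<^bsub>M\<^esub> a \<in> H" using smult a by simp
qed

lemma (in module) gen_submodule_submodule:
  assumes "G \<subseteq> carrier M" shows "submodule (gen_submodule R M G) R M"
proof (rule submodule_smultI)
  show "gen_submodule R M G \<subseteq> carrier M"
    unfolding gen_submodule_def using carrier_is_submodule assms by auto
qed (auto simp: gen_submodule_def intro: submodule_zero dest: submoduleE(4,5))

lemma gen_submodule_incl: "G \<subseteq> gen_submodule R M G"
  by (auto simp: gen_submodule_def)

lemma gen_submodule_least: "submodule H R M \<Longrightarrow> G \<subseteq> H \<Longrightarrow> gen_submodule R M G \<subseteq> H"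
  by (auto simp: gen_submodule_def)

text \<open>Operations on a quotient are accessible through representatives only. The axioms are
  therefore checked upstairs and carried along \<open>p\<close>; an inverse comes from the inverse
  of a preimage.\<close>

lemma module_surj_image:
  assumes M: "module R M" and car: "carrier N = p ` carrier M"
    and add: "\<And>x y. x \<in> carrier M \<Longrightarrow> y \<in> carrier M \<Longrightarrow> p x \<oplus>\<^bsub>N\<^esub> p y = p (x \<oplus>\<^bsub>M\<^esub> y)"
    and zero: "\<zero>\<^bsub>N\<^esub> = p \<zero>\<^bsub>M\<^esub>"
    and smult: "\<And>a x. a \<in> carrier R \<Longrightarrow> x \<in> carrier M \<Longrightarrow> a \<odot>\<^bsub>N\<^esub> p x = p (a \<odot>\<^bsub>M\<^esub> x)"
  shows "module R N"
proof -
  interpret M: module R M by (rule M)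
  show ?thesis
  proof (rule moduleI)
    show "cring R" ..
    show "abelian_group N"
    proof (rule abelian_groupI)
      fix x assume "x \<in> carrier N"
      then obtain x' where "x' \<in> carrier M" "x = p x'" using car by auto
      then show "\<exists>y\<in>carrier N. y \<oplus>\<^bsub>N\<^esub> x = \<zero>\<^bsub>N\<^esub>"
        using add[of "\<ominus>\<^bsub>M\<^esub> x'" x'] by (intro bexI[of _ "p (\<ominus>\<^bsub>M\<^esub> x')"]) (auto simp: car zero M.l_neg)
    qed (auto simp: car add zero M.a_ac)
  qed (auto simp: car add zero smult M.smult_l_distr M.smult_r_distr M.smult_assoc1)
qed

subsection \<open>Free modules\<close>

lemma free_module_simps [simp]:
  "\<zero>\<^bsub>free_module S A\<^esub> = (\<lambda>_. \<zero>\<^bsub>S\<^esub>)"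
  "x \<oplus>\<^bsub>free_module S A\<^esub> y = (\<lambda>a. x a \<oplus>\<^bsub>S\<^esub> y a)"
  "s \<odot>\<^bsub>free_module S A\<^esub> x = (\<lambda>a. s \<otimes>\<^bsub>S\<^esub> x a)"
  by (simp_all add: free_module_def)

lemma carrier_free_module:
  "carrier (free_module S A) =
    {x. finite {a. x a \<noteq> \<zero>\<^bsub>S\<^esub>} \<and> (\<forall>a\<in>A. x a \<in> carrier S) \<and> (\<forall>a. a \<notin> A \<longrightarrow> x a = \<zero>\<^bsub>S\<^esub>)}"
  by (simp add: free_module_def)

lemma free_module_finite_support: "x \<in> carrier (free_module S A) \<Longrightarrow> finite {a. x a \<noteq> \<zero>\<^bsub>S\<^esub>}"
  by (simp add: carrier_free_module)

lemma free_module_support: "x \<in> carrier (free_module S A) \<Longrightarrow> {a. x a \<noteq> \<zero>\<^bsub>S\<^esub>} \<subseteq> A"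
  by (auto simp: carrier_free_module)

lemma free_module_zero_outside: "x \<in> carrier (free_module S A) \<Longrightarrow> a \<notin> A \<Longrightarrow> x a = \<zero>\<^bsub>S\<^esub>"
  by (simp add: carrier_free_module)

lemma carrier_free_module_finite:
  assumes "finite A"
  shows "x \<in> carrier (free_module S A) \<longleftrightarrow> (\<forall>a\<in>A. x a \<in> carrier S) \<and> (\<forall>a. a \<notin> A \<longrightarrow> x a = \<zero>\<^bsub>S\<^esub>)"
proof -
  have "finite {a. x a \<noteq> \<zero>\<^bsub>S\<^esub>}" if "\<forall>a. a \<notin> A \<longrightarrow> x a = \<zero>\<^bsub>S\<^esub>"
    using that by (intro finite_subset[OF _ assms]) auto
  then show ?thesis by (auto simp: carrier_free_module)
qed

lemma (in ring) free_module_closed: "x \<in> carrier (free_module R A) \<Longrightarrow> x a \<in> carrier R"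
  by (cases "a \<in> A") (auto simp: carrier_free_module)

lemma (in cring) free_module_module: "module R (free_module R A)"
proof -
  let ?F = "free_module R A"
  have closed: "x a \<in> carrier R" if "x \<in> carrier ?F" for x a
    using that by (rule free_module_closed)
  have add: "(\<lambda>a. x a \<oplus> y a) \<in> carrier ?F" if xy: "x \<in> carrier ?F" "y \<in> carrier ?F" for x y
  proof -
    have "{a. x a \<oplus> y a \<noteq> \<zero>} \<subseteq> {a. x a \<noteq> \<zero>} \<union> {a. y a \<noteq> \<zero>}" by auto
    moreover have "finite ({a. x a \<noteq> \<zero>} \<union> {a. y a \<noteq> \<zero>})"
      using xy by (simp add: free_module_finite_support)
    ultimately have "finite {a. x a \<oplus> y a \<noteq> \<zero>}" by (rule finite_subset)
    then show ?thesis using xy by (simp add: carrier_free_module)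
  qed
  have smult: "(\<lambda>b. a \<otimes> x b) \<in> carrier ?F" if a: "a \<in> carrier R" and x: "x \<in> carrier ?F" for a x
  proof -
    have "{b. a \<otimes> x b \<noteq> \<zero>} \<subseteq> {b. x b \<noteq> \<zero>}" using a by auto
    then have "finite {b. a \<otimes> x b \<noteq> \<zero>}"
      using free_module_finite_support[OF x] by (rule finite_subset)
    then show ?thesis using a x by (simp add: carrier_free_module)
  qed
  show ?thesis
  proof (rule moduleI)
    show "abelian_group ?F"
    proof (rule abelian_groupI)
      fix x assume x: "x \<in> carrier ?F"
      then have "(\<lambda>b. (\<ominus> \<one>) \<otimes> x b) \<in> carrier ?F" by (intro smult) auto
      moreover have "(\<ominus> \<one>) \<otimes> x b \<oplus> x b = \<zero>" for b
        using closed[OF x, of b] by (simp add: l_minus l_neg)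
      ultimately show "\<exists>y\<in>carrier ?F. y \<oplus>\<^bsub>?F\<^esub> x = \<zero>\<^bsub>?F\<^esub>"
        by (intro bexI[of _ "\<lambda>b. (\<ominus> \<one>) \<otimes> x b"]) simp_all
    next
      show "\<zero>\<^bsub>?F\<^esub> \<in> carrier ?F" by (simp add: carrier_free_module)
    qed (simp_all add: add closed a_ac)
  qed (simp_all add: is_cring smult closed l_distr r_distr m_assoc)
qed

lemma (in cring) evec_closed: "a \<in> A \<Longrightarrow> evec R a \<in> carrier (free_module R A)"
  by (auto simp: carrier_free_module evec_def)

lemma (in cring) finsum_free_module:
  assumes "g \<in> A \<rightarrow> carrier (free_module R B)"
  shows "finsum (free_module R B) g A b = (\<Oplus>a\<in>A. g a b)"
proof -
  interpret F: module R "free_module R B" by (rule free_module_module)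
  show ?thesis using assms
  proof (induction A rule: infinite_finite_induct)
    case (insert x A)
    then have "(\<lambda>a. g a b) \<in> A \<rightarrow> carrier R" "g x b \<in> carrier R"
      by (auto simp: Pi_iff free_module_closed)
    with insert show ?case by simp
  qed auto
qed

lemma (in cring) free_module_expand:
  assumes x: "x \<in> carrier (free_module R A)" and B: "finite B" "B \<subseteq> A" "{a. x a \<noteq> \<zero>} \<subseteq> B"
  shows "(\<Oplus>\<^bsub>free_module R A\<^esub>a\<in>B. x a \<odot>\<^bsub>free_module R A\<^esub> evec R a) = x"
proof
  fix b
  interpret F: module R "free_module R A" by (rule free_module_module)
  have cl: "(\<lambda>a. x a \<odot>\<^bsub>free_module R A\<^esub> evec R a) \<in> B \<rightarrow> carrier (free_module R A)"
    using B x free_module_closed[OF x] by (intro Pi_I F.smult_closed evec_closed) auto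
  have "(\<Oplus>\<^bsub>free_module R A\<^esub>a\<in>B. x a \<odot>\<^bsub>free_module R A\<^esub> evec R a) b = (\<Oplus>a\<in>B. x a \<otimes> evec R a b)"
    unfolding finsum_free_module[OF cl] by simp
  also have "\<dots> = (\<Oplus>a\<in>B. if b = a then x a else \<zero>)"
    by (rule add.finprod_cong') (auto simp: evec_def free_module_closed[OF x])
  also have "\<dots> = x b"
  proof (cases "b \<in> B")
    case True
    then show ?thesis using B free_module_closed[OF x] by (subst add.finprod_singleton) auto
  next
    case False
    then have "(\<Oplus>a\<in>B. if b = a then x a else \<zero>) = (\<Oplus>a\<in>B. \<zero>)"
      by (intro add.finprod_cong') auto
    moreover have "x b = \<zero>" using False B by auto
    ultimately show ?thesis by simp
  qed
  finally show "(\<Oplus>\<^bsub>free_module R A\<^esub>a\<in>B. x a \<odot>\<^bsub>free_module R A\<^esub> evec R a) b = x b" .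
qed

lemma (in cring) free_module_gen: "gen_submodule R (free_module R A) (evec R ` A) = carrier (free_module R A)"
proof
  interpret F: module R "free_module R A" by (rule free_module_module)
  have sub: "submodule (gen_submodule R (free_module R A) (evec R ` A)) R (free_module R A)"
    by (rule F.gen_submodule_submodule) (auto intro: evec_closed)
  then show "gen_submodule R (free_module R A) (evec R ` A) \<subseteq> carrier (free_module R A)"
    by (rule F.submoduleE(1))
  show "carrier (free_module R A) \<subseteq> gen_submodule R (free_module R A) (evec R ` A)"
  proof
    fix x assume x: "x \<in> carrier (free_module R A)"
    have "evec R a \<in> gen_submodule R (free_module R A) (evec R ` A)" if "x a \<noteq> \<zero>" for a
      using that free_module_support[OF x] by (intro gen_submodule_incl[THEN subsetD]) auto
    then have "(\<Oplus>\<^bsub>free_module R A\<^esub>a\<in>{a. x a \<noteq> \<zero>}. x a \<odot>\<^bsub>free_module R A\<^esub> evec R a)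
        \<in> gen_submodule R (free_module R A) (evec R ` A)"
      using free_module_closed[OF x]
      by (intro F.submodule_finsum[OF sub] F.submoduleE(4)[OF sub]) auto
    then show "x \<in> gen_submodule R (free_module R A) (evec R ` A)"
      by (subst (asm) free_module_expand[OF x])
        (auto simp: free_module_finite_support[OF x] free_module_support[OF x])
  qed
qed

subsection \<open>Linear maps\<close>

lemma lin_mapD:
  assumes "lin_map S N P f"
  shows "\<And>x. x \<in> carrier N \<Longrightarrow> f x \<in> carrier P"
    and "\<And>x y. x \<in> carrier N \<Longrightarrow> y \<in> carrier N \<Longrightarrow> f (x \<oplus>\<^bsub>N\<^esub> y) = f x \<oplus>\<^bsub>P\<^esub> f y"
    and "\<And>s x. s \<in> carrier S \<Longrightarrow> x \<in> carrier N \<Longrightarrow> f (s \<odot>\<^bsub>N\<^esub> x) = s \<odot>\<^bsub>P\<^esub> f x"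
  using assms unfolding lin_map_def by auto

lemma lin_mapI:
  assumes "\<And>x. x \<in> carrier N \<Longrightarrow> f x \<in> carrier P"
    and "\<And>x y. x \<in> carrier N \<Longrightarrow> y \<in> carrier N \<Longrightarrow> f (x \<oplus>\<^bsub>N\<^esub> y) = f x \<oplus>\<^bsub>P\<^esub> f y"
    and "\<And>s x. s \<in> carrier S \<Longrightarrow> x \<in> carrier N \<Longrightarrow> f (s \<odot>\<^bsub>N\<^esub> x) = s \<odot>\<^bsub>P\<^esub> f x"
  shows "lin_map S N P f"
  using assms unfolding lin_map_def by auto

lemma lin_map_cong:
  assumes "lin_map S N P f" "module S N" "\<And>x. x \<in> carrier N \<Longrightarrow> f x = g x"
  shows "lin_map S N P g"
proof (rule lin_mapI)
  interpret module S N by fact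
  note f = lin_mapD[OF assms(1)]
  fix x assume x: "x \<in> carrier N"
  show "g x \<in> carrier P" using f(1)[OF x] assms(3)[OF x] by simp
  show "g (x \<oplus>\<^bsub>N\<^esub> y) = g x \<oplus>\<^bsub>P\<^esub> g y" if "y \<in> carrier N" for y
    using f(2)[OF x that] assms(3)[OF x] assms(3)[OF that] assms(3)[of "x \<oplus>\<^bsub>N\<^esub> y"] x that by simp
  show "g (s \<odot>\<^bsub>N\<^esub> x) = s \<odot>\<^bsub>P\<^esub> g x" if "s \<in> carrier S" for s
    using f(3)[OF that x] assms(3)[OF x] assms(3)[of "s \<odot>\<^bsub>N\<^esub> x"] x that by simp
qed

lemma lin_map_comp:
  assumes "lin_map S N P f" "lin_map S P Q g" shows "lin_map S N Q (\<lambda>x. g (f x))"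
  using lin_mapD[OF assms(1)] lin_mapD[OF assms(2)] by (intro lin_mapI) simp_all

context
  fixes S N P f
  assumes mods: "module S N" "module S P" and lin: "lin_map S N P f"
begin

interpretation N: module S N by (rule mods)
interpretation P: module S P by (rule mods)

lemma lin_map_zero: "f \<zero>\<^bsub>N\<^esub> = \<zero>\<^bsub>P\<^esub>"
  using lin_mapD(1)[OF lin, of "\<zero>\<^bsub>N\<^esub>"] lin_mapD(3)[OF lin, of "\<zero>\<^bsub>S\<^esub>" "\<zero>\<^bsub>N\<^esub>"] by simp

lemma lin_map_neg: "x \<in> carrier N \<Longrightarrow> f (\<ominus>\<^bsub>N\<^esub> x) = \<ominus>\<^bsub>P\<^esub> f x"
  using lin_mapD(3)[OF lin, of "\<ominus>\<^bsub>S\<^esub> \<one>\<^bsub>S\<^esub>" x] lin_mapD(1)[OF lin, of x]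
  by (simp add: N.smult_l_minus P.smult_l_minus)

lemma lin_map_diff: "x \<in> carrier N \<Longrightarrow> y \<in> carrier N \<Longrightarrow> f (x \<ominus>\<^bsub>N\<^esub> y) = f x \<ominus>\<^bsub>P\<^esub> f y"
  by (simp add: N.minus_eq P.minus_eq lin_mapD[OF lin] lin_map_neg)

lemma lin_map_finsum: "g \<in> A \<rightarrow> carrier N \<Longrightarrow> f (finsum N g A) = (\<Oplus>\<^bsub>P\<^esub>a\<in>A. f (g a))"
proof (induction A rule: infinite_finite_induct)
  case (insert x A)
  then have "(\<lambda>a. f (g a)) \<in> A \<rightarrow> carrier P" using lin_mapD(1)[OF lin] by auto
  then show ?case using insert by (simp add: lin_mapD[OF lin] Pi_iff)
qed (auto simp: lin_map_zero)

lemma lin_map_preimage: "submodule H S P \<Longrightarrow> submodule {x \<in> carrier N. f x \<in> H} S N"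
  by (rule N.submodule_smultI)
    (auto simp: lin_mapD[OF lin] lin_map_zero P.submodule_zero P.submoduleE)

lemma lin_map_image: "submodule H S N \<Longrightarrow> submodule (f ` H) S P"
proof (rule P.submodule_smultI)
  assume H: "submodule H S N"
  note Hc = N.submoduleE(1)[OF H, THEN subsetD]
  show "f ` H \<subseteq> carrier P" using lin_mapD(1)[OF lin] Hc by auto
  show "\<zero>\<^bsub>P\<^esub> \<in> f ` H" using lin_map_zero N.submodule_zero[OF H] by force
  fix a b assume "a \<in> f ` H" "b \<in> f ` H"
  then obtain a' b' where "a' \<in> H" "b' \<in> H" "a = f a'" "b = f b'" by auto
  then show "a \<oplus>\<^bsub>P\<^esub> b \<in> f ` H"
    using lin_mapD(2)[OF lin, of a' b'] Hc N.submoduleE(5)[OF H, of a' b']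
    by (intro image_eqI[of _ _ "a' \<oplus>\<^bsub>N\<^esub> b'"]) auto
next
  assume H: "submodule H S N"
  note Hc = N.submoduleE(1)[OF H, THEN subsetD]
  fix a x assume "a \<in> carrier S" "x \<in> f ` H"
  then obtain x' where "x' \<in> H" "x = f x'" by auto
  then show "a \<odot>\<^bsub>P\<^esub> x \<in> f ` H"
    using lin_mapD(3)[OF lin, of a x'] Hc N.submoduleE(4)[OF H, of a x'] \<open>a \<in> carrier S\<close>
    by (intro image_eqI[of _ _ "a \<odot>\<^bsub>N\<^esub> x'"]) auto
qed

lemma lin_map_gen:
  assumes "G \<subseteq> carrier N" "submodule H S P" "\<And>g. g \<in> G \<Longrightarrow> f g \<in> H" "x \<in> gen_submodule S N G"
  shows "f x \<in> H"
  using gen_submodule_least[OF lin_map_preimage[OF assms(2)], of G] assms by auto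

end

lemma lin_map_add:
  assumes "module S P" "lin_map S N P f" "lin_map S N P g"
  shows "lin_map S N P (\<lambda>x. f x \<oplus>\<^bsub>P\<^esub> g x)"
proof -
  interpret P: module S P by fact
  note f = lin_mapD[OF assms(2)] and g = lin_mapD[OF assms(3)]
  show ?thesis
    by (rule lin_mapI) (auto simp: f g P.a_ac P.smult_r_distr)
qed

text \<open>The reindexing \<open>k\<close> separates the coordinates of \<open>x\<close> from the
  index set of the sum. It lets vectors over \<open>J\<close> be read through an enumeration of
  \<open>J\<close> by an initial segment of the natural numbers.\<close>

lemma (in module) lin_map_lincomb:
  assumes "finite A" "v \<in> A \<rightarrow> carrier M"
  shows "lin_map R (free_module R B) M (\<lambda>x. \<Oplus>\<^bsub>M\<^esub>a\<in>A. x (k a) \<odot>\<^bsub>M\<^esub> v a)"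
proof (rule lin_mapI)
  have cl: "x (k a) \<odot>\<^bsub>M\<^esub> v a \<in> carrier M" if "x \<in> carrier (free_module R B)" "a \<in> A" for x a
    using that assms free_module_closed by (intro smult_closed) auto
  then show "(\<Oplus>\<^bsub>M\<^esub>a\<in>A. x (k a) \<odot>\<^bsub>M\<^esub> v a) \<in> carrier M" if "x \<in> carrier (free_module R B)" for x
    using that by (intro finsum_closed) auto
  fix x assume x: "x \<in> carrier (free_module R B)"
  show "(\<Oplus>\<^bsub>M\<^esub>a\<in>A. (x \<oplus>\<^bsub>free_module R B\<^esub> y) (k a) \<odot>\<^bsub>M\<^esub> v a) =
      (\<Oplus>\<^bsub>M\<^esub>a\<in>A. x (k a) \<odot>\<^bsub>M\<^esub> v a) \<oplus>\<^bsub>M\<^esub> (\<Oplus>\<^bsub>M\<^esub>a\<in>A. y (k a) \<odot>\<^bsub>M\<^esub> v a)"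
    if y: "y \<in> carrier (free_module R B)" for y
  proof -
    have "(\<Oplus>\<^bsub>M\<^esub>a\<in>A. (x \<oplus>\<^bsub>free_module R B\<^esub> y) (k a) \<odot>\<^bsub>M\<^esub> v a) =
        (\<Oplus>\<^bsub>M\<^esub>a\<in>A. x (k a) \<odot>\<^bsub>M\<^esub> v a \<oplus>\<^bsub>M\<^esub> y (k a) \<odot>\<^bsub>M\<^esub> v a)"
      using x y cl assms(2)
      by (intro M.add.finprod_cong') (auto simp: smult_l_distr free_module_closed Pi_iff)
    also have "\<dots> = (\<Oplus>\<^bsub>M\<^esub>a\<in>A. x (k a) \<odot>\<^bsub>M\<^esub> v a) \<oplus>\<^bsub>M\<^esub> (\<Oplus>\<^bsub>M\<^esub>a\<in>A. y (k a) \<odot>\<^bsub>M\<^esub> v a)"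
      using x y cl by (intro M.add.finprod_multf) auto
    finally show ?thesis .
  qed
  show "(\<Oplus>\<^bsub>M\<^esub>a\<in>A. (s \<odot>\<^bsub>free_module R B\<^esub> x) (k a) \<odot>\<^bsub>M\<^esub> v a) = s \<odot>\<^bsub>M\<^esub> (\<Oplus>\<^bsub>M\<^esub>a\<in>A. x (k a) \<odot>\<^bsub>M\<^esub> v a)"
    if s: "s \<in> carrier R" for s
    using x s cl assms
    by (subst finsum_smult_ldistr)
      (auto intro!: M.add.finprod_cong' simp: smult_assoc1 free_module_closed Pi_iff)
qed

lemma (in module) lincomb_evec:
  assumes "finite A" "v \<in> A \<rightarrow> carrier M" "a \<in> A"
  shows "(\<Oplus>\<^bsub>M\<^esub>b\<in>A. evec R a b \<odot>\<^bsub>M\<^esub> v b) = v a"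
proof -
  have "(\<Oplus>\<^bsub>M\<^esub>b\<in>A. evec R a b \<odot>\<^bsub>M\<^esub> v b) = (\<Oplus>\<^bsub>M\<^esub>b\<in>A. if a = b then v b else \<zero>\<^bsub>M\<^esub>)"
    using assms by (intro M.add.finprod_cong') (auto simp: evec_def Pi_iff)
  then show ?thesis using assms by (simp add: M.add.finprod_singleton)
qed

subsection \<open>Quotient modules\<close>

lemma (in module) submodule_abelian_subgroup: "submodule H R M \<Longrightarrow> abelian_subgroup H M"
  by (intro abelian_subgroupI3 additive_subgroupI) (auto dest: submodule.axioms(1) intro: abelian_group_axioms)

context module
begin

context
  fixes H assumes H: "submodule H R M"
begin

interpretation H: abelian_subgroup H M by (rule submodule_abelian_subgroup[OF H])

lemma coset_eq_iff:
  assumes x: "x \<in> carrier M" and y: "y \<in> carrier M"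
  shows "H +>\<^bsub>M\<^esub> x = H +>\<^bsub>M\<^esub> y \<longleftrightarrow> x \<ominus>\<^bsub>M\<^esub> y \<in> H"
proof -
  have "H +>\<^bsub>M\<^esub> x = H +>\<^bsub>M\<^esub> y \<longleftrightarrow> x \<in> H +>\<^bsub>M\<^esub> y"
  proof
    assume "H +>\<^bsub>M\<^esub> x = H +>\<^bsub>M\<^esub> y"
    then show "x \<in> H +>\<^bsub>M\<^esub> y" using H.a_rcos_self[OF x] by simp
  next
    assume "x \<in> H +>\<^bsub>M\<^esub> y"
    then show "H +>\<^bsub>M\<^esub> x = H +>\<^bsub>M\<^esub> y" by (rule H.a_repr_independence'[OF _ y, symmetric])
  qed
  also have "\<dots> \<longleftrightarrow> x \<ominus>\<^bsub>M\<^esub> y \<in> H"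
    using H.a_rcos_module[OF y x] by (simp add: M.minus_eq)
  finally show ?thesis .
qed

lemma coset_repr:
  assumes "x \<in> carrier M" "y \<in> H +>\<^bsub>M\<^esub> x"
  shows "y \<in> carrier M" "H +>\<^bsub>M\<^esub> y = H +>\<^bsub>M\<^esub> x"
proof -
  show "y \<in> carrier M" by (rule H.a_elemrcos_carrier[OF assms])
  show "H +>\<^bsub>M\<^esub> y = H +>\<^bsub>M\<^esub> x" by (rule H.a_repr_independence'[OF assms(2,1), symmetric])
qed

lemma coset_self: "x \<in> carrier M \<Longrightarrow> x \<in> H +>\<^bsub>M\<^esub> x"
  by (rule H.a_rcos_self)

lemma quot_module_carrier: "carrier (quot_module M H) = (\<lambda>x. H +>\<^bsub>M\<^esub> x) ` carrier M"
  by (auto simp: quot_module_def A_RCOSETS_def')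

lemma quot_module_zero: "\<zero>\<^bsub>quot_module M H\<^esub> = H +>\<^bsub>M\<^esub> \<zero>\<^bsub>M\<^esub>"
  using H.a_rcos_const[of "\<zero>\<^bsub>M\<^esub>"] by (simp add: quot_module_def)

lemma quot_module_add:
  "x \<in> carrier M \<Longrightarrow> y \<in> carrier M \<Longrightarrow>
    (H +>\<^bsub>M\<^esub> x) \<oplus>\<^bsub>quot_module M H\<^esub> (H +>\<^bsub>M\<^esub> y) = H +>\<^bsub>M\<^esub> (x \<oplus>\<^bsub>M\<^esub> y)"
  using H.a_rcos_sum by (simp add: quot_module_def)

text \<open>The definition takes a union over all representatives. Two of them differ by an element
  of \<open>H\<close>, which \<open>s\<close> preserves, so all contribute the same coset; and there
  is a representative, namely \<open>x\<close>.\<close>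

lemma quot_module_smult:
  assumes s: "s \<in> carrier R" and x: "x \<in> carrier M"
  shows "s \<odot>\<^bsub>quot_module M H\<^esub> (H +>\<^bsub>M\<^esub> x) = H +>\<^bsub>M\<^esub> (s \<odot>\<^bsub>M\<^esub> x)"
proof -
  have "H +>\<^bsub>M\<^esub> (s \<odot>\<^bsub>M\<^esub> y) = H +>\<^bsub>M\<^esub> (s \<odot>\<^bsub>M\<^esub> x)" if y: "y \<in> H +>\<^bsub>M\<^esub> x" for y
  proof -
    note yM = coset_repr[OF x y]
    have "y \<ominus>\<^bsub>M\<^esub> x \<in> H" using coset_eq_iff[OF yM(1) x] yM(2) by simp
    then have "s \<odot>\<^bsub>M\<^esub> (y \<ominus>\<^bsub>M\<^esub> x) \<in> H" using submoduleE(4)[OF H s] by simp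
    moreover have "s \<odot>\<^bsub>M\<^esub> (y \<ominus>\<^bsub>M\<^esub> x) = s \<odot>\<^bsub>M\<^esub> y \<ominus>\<^bsub>M\<^esub> s \<odot>\<^bsub>M\<^esub> x"
      using s x yM(1) by (simp add: M.minus_eq smult_r_distr smult_r_minus)
    ultimately show ?thesis using s x yM(1) by (simp add: coset_eq_iff)
  qed
  then have "(\<Union>y\<in>H +>\<^bsub>M\<^esub> x. H +>\<^bsub>M\<^esub> (s \<odot>\<^bsub>M\<^esub> y)) = H +>\<^bsub>M\<^esub> (s \<odot>\<^bsub>M\<^esub> x)"
    using coset_self[OF x] by blast
  then show ?thesis by (simp add: quot_module_def)
qed

lemma quot_module_module: "module R (quot_module M H)"
  by (rule module_surj_image[where M = M and p = "\<lambda>x. H +>\<^bsub>M\<^esub> x"])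
    (simp_all add: module_axioms quot_module_carrier quot_module_zero quot_module_add quot_module_smult)

lemma quot_module_lin_map: "lin_map R M (quot_module M H) (\<lambda>x. H +>\<^bsub>M\<^esub> x)"
  by (rule lin_mapI) (simp_all add: quot_module_carrier quot_module_add quot_module_smult)

lemma quot_module_eq_zero:
  assumes "x \<in> carrier M" shows "H +>\<^bsub>M\<^esub> x = \<zero>\<^bsub>quot_module M H\<^esub> \<longleftrightarrow> x \<in> H"
  using assms coset_eq_iff[of x "\<zero>\<^bsub>M\<^esub>"] M.minus_equality[of "\<zero>\<^bsub>M\<^esub>" "\<zero>\<^bsub>M\<^esub>"]
  by (simp add: quot_module_zero M.minus_eq)

end
end

subsection \<open>Extension of scalars\<close>

text \<open>The extension of \<open>u\<close> from basis vectors to the free module. Summing over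
  the support keeps the sum finite even when the basis is the whole carrier of a module, as in the
  construction of tensor products.\<close>

definition lin_ext ::
    "('s, 'x) ring_scheme \<Rightarrow> ('s, 'p, 'y) module_scheme \<Rightarrow> ('a \<Rightarrow> 'p) \<Rightarrow> ('a \<Rightarrow> 's) \<Rightarrow> 'p" where
  "lin_ext S P u f = (\<Oplus>\<^bsub>P\<^esub>a\<in>{a. f a \<noteq> \<zero>\<^bsub>S\<^esub>}. f a \<odot>\<^bsub>P\<^esub> u a)"

lemma (in module) lin_ext_eq:
  assumes f: "f \<in> carrier (free_module R A)" and u: "u \<in> A \<rightarrow> carrier M"
    and B: "finite B" "{a. f a \<noteq> \<zero>} \<subseteq> B" "B \<subseteq> A"
  shows "lin_ext R M u f = (\<Oplus>\<^bsub>M\<^esub>a\<in>B. f a \<odot>\<^bsub>M\<^esub> u a)"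
  unfolding lin_ext_def
proof (rule M.add.finprod_mono_neutral_cong_left[OF B(1,2)])
  show "(\<lambda>a. f a \<odot>\<^bsub>M\<^esub> u a) \<in> B \<rightarrow> carrier M"
    using u B(3) free_module_closed[OF f] by auto
  fix a assume "a \<in> B - {a. f a \<noteq> \<zero>}"
  then have "f a = \<zero>" "u a \<in> carrier M" using u B(3) by auto
  then show "f a \<odot>\<^bsub>M\<^esub> u a = \<zero>\<^bsub>M\<^esub>" by simp
qed simp

lemma (in module) lin_ext_evec:
  assumes "a \<in> A" "u \<in> A \<rightarrow> carrier M" shows "lin_ext R M u (evec R a) = u a"
proof -
  have "lin_ext R M u (evec R a) = (\<Oplus>\<^bsub>M\<^esub>b\<in>{a}. evec R a b \<odot>\<^bsub>M\<^esub> u b)"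
    by (rule lin_ext_eq[OF evec_closed[OF assms(1)] assms(2)]) (use assms in \<open>auto simp: evec_def\<close>)
  also have "\<dots> = u a" using assms by (simp add: evec_def Pi_iff)
  finally show ?thesis .
qed

lemma (in module) lin_map_lin_ext:
  assumes u: "u \<in> A \<rightarrow> carrier M" shows "lin_map R (free_module R A) M (lin_ext R M u)"
proof (rule lin_mapI)
  interpret F: module R "free_module R A" by (rule free_module_module)
  have lc: "lin_map R (free_module R A) M (\<lambda>f. \<Oplus>\<^bsub>M\<^esub>a\<in>B. f a \<odot>\<^bsub>M\<^esub> u a)" if "finite B" "B \<subseteq> A" for B
    by (rule lin_map_lincomb) (use that u in auto)
  fix x assume x: "x \<in> carrier (free_module R A)"
  note fx = free_module_finite_support[OF x] free_module_support[OF x]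
  show "lin_ext R M u x \<in> carrier M"
    using lin_mapD(1)[OF lc x] fx by (subst lin_ext_eq[OF x u fx(1)]) auto
  show "lin_ext R M u (x \<oplus>\<^bsub>free_module R A\<^esub> y) = lin_ext R M u x \<oplus>\<^bsub>M\<^esub> lin_ext R M u y"
    if y: "y \<in> carrier (free_module R A)" for y
  proof -
    note fy = free_module_finite_support[OF y] free_module_support[OF y]
    have xy: "x \<oplus>\<^bsub>free_module R A\<^esub> y \<in> carrier (free_module R A)" using x y by (rule F.add.m_closed)
    \<comment> \<open>The supports of \<open>x\<close>, \<open>y\<close> and their sum differ, so
      all three sums are first extended to one finite index set.\<close>
    let ?B = "{a. x a \<noteq> \<zero>} \<union> {a. y a \<noteq> \<zero>}"
    have B: "finite ?B" "?B \<subseteq> A" using fx fy by auto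
    show ?thesis
      using lin_mapD(2)[OF lc[OF B] x y]
      by (subst (1 2 3) lin_ext_eq[OF _ u B(1) _ B(2)]) (use x y xy in auto)
  qed
  show "lin_ext R M u (s \<odot>\<^bsub>free_module R A\<^esub> x) = s \<odot>\<^bsub>M\<^esub> lin_ext R M u x" if s: "s \<in> carrier R" for s
  proof -
    have sx: "s \<odot>\<^bsub>free_module R A\<^esub> x \<in> carrier (free_module R A)" using s x by (rule F.smult_closed)
    show ?thesis
      using lin_mapD(3)[OF lc[OF fx] s x]
      by (subst (1 2) lin_ext_eq[OF _ u fx(1) _ fx(2)]) (use s x sx in auto)
  qed
qed

text \<open>The pure tensor of \<open>m\<close> with \<open>1\<close>. The map
  \<open>ext_proj\<close> below is the quotient map from formal combinations of elements of
  \<open>M\<close> onto the extension of scalars.\<close>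

definition tens ::
    "('r, 'x) ring_scheme \<Rightarrow> ('s, 'y) ring_scheme \<Rightarrow> ('r \<Rightarrow> 's) \<Rightarrow> ('r, 'm, 'z) module_scheme
      \<Rightarrow> 'm \<Rightarrow> ('m \<Rightarrow> 's) set" where
  "tens R S \<phi> M m = tensor_rels R S \<phi> M +>\<^bsub>free_module S (carrier M)\<^esub> evec S m"

definition ext_proj ::
    "('r, 'x) ring_scheme \<Rightarrow> ('s, 'y) ring_scheme \<Rightarrow> ('r \<Rightarrow> 's) \<Rightarrow> ('r, 'm, 'z) module_scheme
      \<Rightarrow> ('m \<Rightarrow> 's) \<Rightarrow> ('m \<Rightarrow> 's) set" where
  "ext_proj R S \<phi> M f = tensor_rels R S \<phi> M +>\<^bsub>free_module S (carrier M)\<^esub> f"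

definition semilin ::
    "('r, 'x) ring_scheme \<Rightarrow> ('r \<Rightarrow> 's) \<Rightarrow> ('r, 'm, 'z) module_scheme \<Rightarrow> ('s, 'p, 'w) module_scheme
      \<Rightarrow> ('m \<Rightarrow> 'p) \<Rightarrow> bool" where
  "semilin R \<phi> M P u \<longleftrightarrow> u \<in> carrier M \<rightarrow> carrier P \<and>
    (\<forall>m\<in>carrier M. \<forall>m'\<in>carrier M. u (m \<oplus>\<^bsub>M\<^esub> m') = u m \<oplus>\<^bsub>P\<^esub> u m') \<and>
    (\<forall>r\<in>carrier R. \<forall>m\<in>carrier M. u (r \<odot>\<^bsub>M\<^esub> m) = \<phi> r \<odot>\<^bsub>P\<^esub> u m)"

locale scalar_ext =
  fixes R :: "('r, 'x) ring_scheme" and S :: "('s, 'y) ring_scheme" and \<phi> :: "'r \<Rightarrow> 's"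
    and M :: "('r, 'm, 'z) module_scheme"
  assumes M_module: "module R M" and S_cring: "cring S" and \<phi>_hom: "\<phi> \<in> ring_hom R S"
begin

interpretation M: module R M by (rule M_module)
interpretation S: cring S by (rule S_cring)

lemma \<phi>_closed: "r \<in> carrier R \<Longrightarrow> \<phi> r \<in> carrier S"
  using \<phi>_hom by (rule ring_hom_closed)

abbreviation F where "F \<equiv> free_module S (carrier M)"
abbreviation T where "T \<equiv> tensor_rels R S \<phi> M"
abbreviation E where "E \<equiv> ext_module R S \<phi> M"
abbreviation t where "t \<equiv> tens R S \<phi> M"
abbreviation p where "p \<equiv> ext_proj R S \<phi> M"

lemma F_module: "module S F" by (rule S.free_module_module)

interpretation F: module S F by (rule F_module)

definition rels where
  "rels = {evec S (m \<oplus>\<^bsub>M\<^esub> m') \<ominus>\<^bsub>F\<^esub> (evec S m \<oplus>\<^bsub>F\<^esub> evec S m') | m m'. m \<in> carrier M \<and> m' \<in> carrier M}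
       \<union> {evec S (r \<odot>\<^bsub>M\<^esub> m) \<ominus>\<^bsub>F\<^esub> (\<phi> r \<odot>\<^bsub>F\<^esub> evec S m) | r m. r \<in> carrier R \<and> m \<in> carrier M}"

lemma T_eq: "T = gen_submodule S F rels"
  by (simp add: tensor_rels_def Let_def rels_def)

lemma evec_F: "m \<in> carrier M \<Longrightarrow> evec S m \<in> carrier F"
  by (rule S.evec_closed)

lemma rels_closed: "rels \<subseteq> carrier F"
proof
  fix f assume "f \<in> rels"
  then consider m m' where "f = evec S (m \<oplus>\<^bsub>M\<^esub> m') \<ominus>\<^bsub>F\<^esub> (evec S m \<oplus>\<^bsub>F\<^esub> evec S m')" "m \<in> carrier M" "m' \<in> carrier M"
    | r m where "f = evec S (r \<odot>\<^bsub>M\<^esub> m) \<ominus>\<^bsub>F\<^esub> (\<phi> r \<odot>\<^bsub>F\<^esub> evec S m)" "r \<in> carrier R" "m \<in> carrier M"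
    unfolding rels_def by blast
  then show "f \<in> carrier F"
  proof cases
    case 1
    show ?thesis unfolding 1(1)
      using 1(2,3) by (intro F.M.minus_closed F.M.a_closed evec_F M.M.a_closed)
  next
    case 2
    show ?thesis unfolding 2(1)
      using 2(2,3) by (intro F.M.minus_closed F.smult_closed evec_F M.smult_closed \<phi>_closed)
  qed
qed

lemma rels_T: "f \<in> rels \<Longrightarrow> f \<in> T"
  unfolding T_eq by (rule gen_submodule_incl[THEN subsetD])

lemma T_submodule: "submodule T S F"
  unfolding T_eq by (rule F.gen_submodule_submodule[OF rels_closed])

lemma E_eq: "E = quot_module F T"
  by (simp add: ext_module_def)

lemma E_module: "module S E"
  unfolding E_eq by (rule F.quot_module_module[OF T_submodule])

interpretation E: module S E by (rule E_module)

lemma p_lin: "lin_map S F E p"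
  unfolding E_eq ext_proj_def by (rule F.quot_module_lin_map[OF T_submodule])

lemma E_carrier: "carrier E = p ` carrier F"
  unfolding E_eq ext_proj_def by (rule F.quot_module_carrier[OF T_submodule])

lemma t_eq: "t m = p (evec S m)"
  by (simp add: tens_def ext_proj_def)

lemma p_eq_iff: "f \<in> carrier F \<Longrightarrow> g \<in> carrier F \<Longrightarrow> p f = p g \<longleftrightarrow> f \<ominus>\<^bsub>F\<^esub> g \<in> T"
  unfolding ext_proj_def by (rule F.coset_eq_iff[OF T_submodule])

lemma p_self: "f \<in> carrier F \<Longrightarrow> f \<in> p f"
  unfolding ext_proj_def by (rule F.coset_self[OF T_submodule])

lemma p_repr:
  assumes "f \<in> carrier F" "g \<in> p f" shows "g \<in> carrier F" "p g = p f"
  using F.coset_repr[OF T_submodule assms(1) assms(2)[unfolded ext_proj_def]] by (simp_all add: ext_proj_def)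

lemma t_closed: "m \<in> carrier M \<Longrightarrow> t m \<in> carrier E"
  unfolding t_eq by (rule lin_mapD(1)[OF p_lin evec_F])

lemma t_add:
  assumes "m \<in> carrier M" "m' \<in> carrier M" shows "t (m \<oplus>\<^bsub>M\<^esub> m') = t m \<oplus>\<^bsub>E\<^esub> t m'"
proof -
  have "evec S (m \<oplus>\<^bsub>M\<^esub> m') \<ominus>\<^bsub>F\<^esub> (evec S m \<oplus>\<^bsub>F\<^esub> evec S m') \<in> rels"
    unfolding rels_def using assms by (intro UnI1 CollectI exI[of _ m] exI[of _ m'] conjI refl)
  then have "p (evec S (m \<oplus>\<^bsub>M\<^esub> m')) = p (evec S m \<oplus>\<^bsub>F\<^esub> evec S m')"
    using assms by (intro p_eq_iff[THEN iffD2, OF _ _ rels_T] evec_F F.M.a_closed M.M.a_closed)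
  also have "\<dots> = p (evec S m) \<oplus>\<^bsub>E\<^esub> p (evec S m')"
    using assms by (intro lin_mapD(2)[OF p_lin] evec_F)
  finally show ?thesis unfolding t_eq .
qed

lemma t_smult:
  assumes "r \<in> carrier R" "m \<in> carrier M" shows "t (r \<odot>\<^bsub>M\<^esub> m) = \<phi> r \<odot>\<^bsub>E\<^esub> t m"
proof -
  have "evec S (r \<odot>\<^bsub>M\<^esub> m) \<ominus>\<^bsub>F\<^esub> (\<phi> r \<odot>\<^bsub>F\<^esub> evec S m) \<in> rels"
    unfolding rels_def using assms by (intro UnI2 CollectI exI[of _ r] exI[of _ m] conjI refl)
  then have "p (evec S (r \<odot>\<^bsub>M\<^esub> m)) = p (\<phi> r \<odot>\<^bsub>F\<^esub> evec S m)"
    using assms by (intro p_eq_iff[THEN iffD2, OF _ _ rels_T] evec_F F.smult_closed M.smult_closed \<phi>_closed)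
  also have "\<dots> = \<phi> r \<odot>\<^bsub>E\<^esub> p (evec S m)"
    using assms by (intro lin_mapD(3)[OF p_lin] evec_F \<phi>_closed)
  finally show ?thesis unfolding t_eq .
qed

lemma t_semilin: "semilin R \<phi> M E t"
  unfolding semilin_def by (intro conjI ballI Pi_I t_closed t_add t_smult)

text \<open>This serves as the induction principle for the extension of scalars: the formal
  combinations are spanned by basis vectors, whose classes are the pure tensors.\<close>

lemma E_gen:
  assumes "submodule H S E" "\<And>m. m \<in> carrier M \<Longrightarrow> t m \<in> H" "x \<in> carrier E" shows "x \<in> H"
proof -
  obtain f where f: "f \<in> carrier F" "x = p f" using assms(3) E_carrier by auto
  have "p f \<in> H"
    by (rule lin_map_gen[OF F_module E_module p_lin _ assms(1), of "evec S ` carrier M"])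
      (use f S.free_module_gen[of "carrier M"] assms(2) in \<open>auto simp: evec_F t_eq\<close>)
  then show ?thesis using f by simp
qed

text \<open>The universal property of the tensor product in the form used below. By linearity it
  suffices to look at the two families of generators of \<open>T\<close>, and these express exactly
  semilinearity on basis vectors.\<close>

lemma kills_T:
  assumes P: "module S P" and L: "lin_map S F P L"
    and "semilin R \<phi> M P (\<lambda>m. L (evec S m))" and "f \<in> T"
  shows "L f = \<zero>\<^bsub>P\<^esub>"
proof -
  interpret P: module S P by (rule P)
  note u = assms(3)[unfolded semilin_def]
  have cl: "L (evec S m) \<in> carrier P" if "m \<in> carrier M" for m using u that by auto
  have sub: "submodule {\<zero>\<^bsub>P\<^esub>} S P" by (rule P.submodule_smultI) auto
  have ker: "L g \<in> {\<zero>\<^bsub>P\<^esub>}" if "g \<in> rels" for g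
  proof -
    from that consider m m' where "g = evec S (m \<oplus>\<^bsub>M\<^esub> m') \<ominus>\<^bsub>F\<^esub> (evec S m \<oplus>\<^bsub>F\<^esub> evec S m')" "m \<in> carrier M" "m' \<in> carrier M"
      | r m where "g = evec S (r \<odot>\<^bsub>M\<^esub> m) \<ominus>\<^bsub>F\<^esub> (\<phi> r \<odot>\<^bsub>F\<^esub> evec S m)" "r \<in> carrier R" "m \<in> carrier M"
      unfolding rels_def by blast
    then show ?thesis
    proof cases
      case 1
      have "L g = L (evec S (m \<oplus>\<^bsub>M\<^esub> m')) \<ominus>\<^bsub>P\<^esub> (L (evec S m) \<oplus>\<^bsub>P\<^esub> L (evec S m'))"
        unfolding 1(1) using 1(2,3) lin_mapD(2)[OF L evec_F evec_F, of m m']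
        by (subst lin_map_diff[OF F_module P L]) (simp_all del: free_module_simps add: evec_F F.M.a_closed)
      also have "\<dots> = \<zero>\<^bsub>P\<^esub>" using 1 u cl by (simp add: P.M.minus_eq P.M.r_neg)
      finally show ?thesis by simp
    next
      case 2
      have "L g = L (evec S (r \<odot>\<^bsub>M\<^esub> m)) \<ominus>\<^bsub>P\<^esub> (\<phi> r \<odot>\<^bsub>P\<^esub> L (evec S m))"
        unfolding 2(1) using 2(2,3) lin_mapD(3)[OF L \<phi>_closed evec_F, of r m]
        by (subst lin_map_diff[OF F_module P L])
          (simp_all del: free_module_simps add: evec_F F.smult_closed \<phi>_closed)
      also have "\<dots> = \<zero>\<^bsub>P\<^esub>" using 2 u cl by (simp add: P.M.minus_eq P.M.r_neg \<phi>_closed)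
      finally show ?thesis by simp
    qed
  qed
  have "f \<in> gen_submodule S F rels" using \<open>f \<in> T\<close> unfolding T_eq .
  from lin_map_gen[OF F_module P L rels_closed sub ker this]
  have "L f \<in> {\<zero>\<^bsub>P\<^esub>}" .
  then show ?thesis by simp
qed

end

lemma (in abelian_group) eq_if_minus_zero:
  assumes "x \<in> carrier G" "y \<in> carrier G" "x \<ominus> y = \<zero>" shows "x = y"
  using assms minus_equality[of x "\<ominus> y"] by (simp add: minus_eq)

lemma (in abelian_monoid) finsum_Times:
  assumes "finite A" "finite B" "\<And>x y. x \<in> A \<Longrightarrow> y \<in> B \<Longrightarrow> h (x, y) \<in> carrier G"
  shows "finsum G h (A \<times> B) = (\<Oplus>x\<in>A. \<Oplus>y\<in>B. h (x, y))"
  using assms(1,3)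
proof (induction A)
  case (insert x A)
  have "insert x A \<times> B = Pair x ` B \<union> A \<times> B" by auto
  then have "finsum G h (insert x A \<times> B) = finsum G h (Pair x ` B \<union> A \<times> B)" by simp
  also have "\<dots> = finsum G h (Pair x ` B) \<oplus> finsum G h (A \<times> B)"
    using insert assms(2) by (intro add.finprod_Un_disjoint) auto
  also have "finsum G h (Pair x ` B) = (\<Oplus>y\<in>B. h (x, y))"
    using insert by (intro add.finprod_reindex) (auto simp: inj_on_def)
  also have "finsum G h (A \<times> B) = (\<Oplus>x\<in>A. \<Oplus>y\<in>B. h (x, y))"
    using insert by simp
  also have "(\<Oplus>y\<in>B. h (x, y)) \<oplus> (\<Oplus>x\<in>A. \<Oplus>y\<in>B. h (x, y)) = (\<Oplus>x\<in>insert x A. \<Oplus>y\<in>B. h (x, y))"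
    using insert by (intro add.finprod_insert[symmetric]) auto
  finally show ?case .
qed simp

lemma (in module) lin_ext_cong:
  assumes f: "f \<in> carrier (free_module R A)" and u: "u \<in> A \<rightarrow> carrier M" and "\<And>a. a \<in> A \<Longrightarrow> u a = v a"
  shows "lin_ext R M u f = lin_ext R M v f"
  unfolding lin_ext_def
proof (rule M.add.finprod_cong'[OF refl])
  have "f a \<odot>\<^bsub>M\<^esub> v a \<in> carrier M" "u a = v a" if "f a \<noteq> \<zero>" for a
  proof -
    have a: "a \<in> A" using that free_module_support[OF f] by auto
    then show "u a = v a" by (rule assms(3))
    then show "f a \<odot>\<^bsub>M\<^esub> v a \<in> carrier M"
      using a u free_module_closed[OF f, of a] by (auto simp: Pi_iff)
  qed
  then show "(\<lambda>a. f a \<odot>\<^bsub>M\<^esub> v a) \<in> {a. f a \<noteq> \<zero>} \<rightarrow> carrier M"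
    "\<And>a. a \<in> {a. f a \<noteq> \<zero>} \<Longrightarrow> f a \<odot>\<^bsub>M\<^esub> u a = f a \<odot>\<^bsub>M\<^esub> v a" by auto
qed

lemma (in module) lin_ext_add_fun:
  assumes f: "f \<in> carrier (free_module R A)" and u: "u \<in> A \<rightarrow> carrier M" and v: "v \<in> A \<rightarrow> carrier M"
  shows "lin_ext R M (\<lambda>a. u a \<oplus>\<^bsub>M\<^esub> v a) f = lin_ext R M u f \<oplus>\<^bsub>M\<^esub> lin_ext R M v f"
proof -
  have cl: "f a \<in> carrier R" "f a \<noteq> \<zero> \<Longrightarrow> u a \<in> carrier M" "f a \<noteq> \<zero> \<Longrightarrow> v a \<in> carrier M" for a
    using free_module_closed[OF f] free_module_support[OF f] u v by auto
  have "lin_ext R M (\<lambda>a. u a \<oplus>\<^bsub>M\<^esub> v a) f =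
      (\<Oplus>\<^bsub>M\<^esub>a\<in>{a. f a \<noteq> \<zero>}. f a \<odot>\<^bsub>M\<^esub> u a \<oplus>\<^bsub>M\<^esub> f a \<odot>\<^bsub>M\<^esub> v a)"
    unfolding lin_ext_def using cl by (intro M.add.finprod_cong') (auto simp: smult_r_distr)
  also have "\<dots> = lin_ext R M u f \<oplus>\<^bsub>M\<^esub> lin_ext R M v f"
    unfolding lin_ext_def using cl by (intro M.add.finprod_multf) auto
  finally show ?thesis .
qed

lemma (in module) lin_ext_smult_fun:
  assumes f: "f \<in> carrier (free_module R A)" and u: "u \<in> A \<rightarrow> carrier M" and s: "s \<in> carrier R"
  shows "lin_ext R M (\<lambda>a. s \<odot>\<^bsub>M\<^esub> u a) f = s \<odot>\<^bsub>M\<^esub> lin_ext R M u f"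
proof -
  have cl: "f a \<in> carrier R" "f a \<noteq> \<zero> \<Longrightarrow> u a \<in> carrier M" for a
    using free_module_closed[OF f] free_module_support[OF f] u by auto
  have "f a \<odot>\<^bsub>M\<^esub> (s \<odot>\<^bsub>M\<^esub> u a) = s \<odot>\<^bsub>M\<^esub> (f a \<odot>\<^bsub>M\<^esub> u a)" if "f a \<noteq> \<zero>" for a
    using cl(1)[of a] cl(2)[OF that] s
    by (simp add: smult_assoc1[symmetric] R.m_comm)
  then have "lin_ext R M (\<lambda>a. s \<odot>\<^bsub>M\<^esub> u a) f = (\<Oplus>\<^bsub>M\<^esub>a\<in>{a. f a \<noteq> \<zero>}. s \<odot>\<^bsub>M\<^esub> (f a \<odot>\<^bsub>M\<^esub> u a))"
    unfolding lin_ext_def using cl s by (intro M.add.finprod_cong') auto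
  also have "\<dots> = s \<odot>\<^bsub>M\<^esub> lin_ext R M u f"
    unfolding lin_ext_def using cl s free_module_finite_support[OF f]
    by (intro finsum_smult_ldistr[symmetric]) auto
  finally show ?thesis .
qed

lemma (in module) lin_map_smult:
  assumes L: "lin_map R N M L" and c: "c \<in> carrier R"
  shows "lin_map R N M (\<lambda>x. c \<odot>\<^bsub>M\<^esub> L x)"
proof (rule lin_mapI)
  fix x assume x: "x \<in> carrier N"
  show "c \<odot>\<^bsub>M\<^esub> L x \<in> carrier M" using lin_mapD(1)[OF L x] c by simp
  show "c \<odot>\<^bsub>M\<^esub> L (x \<oplus>\<^bsub>N\<^esub> y) = c \<odot>\<^bsub>M\<^esub> L x \<oplus>\<^bsub>M\<^esub> c \<odot>\<^bsub>M\<^esub> L y" if y: "y \<in> carrier N" for y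
    using lin_mapD(1)[OF L x] lin_mapD(1)[OF L y] lin_mapD(2)[OF L x y] c by (simp add: smult_r_distr)
  show "c \<odot>\<^bsub>M\<^esub> L (s \<odot>\<^bsub>N\<^esub> x) = s \<odot>\<^bsub>M\<^esub> (c \<odot>\<^bsub>M\<^esub> L x)" if s: "s \<in> carrier R" for s
    using lin_mapD(1)[OF L x] lin_mapD(3)[OF L s x] c s by (simp add: smult_assoc1[symmetric] R.m_comm)
qed

lemma (in module) lin_map_finsum_maps:
  assumes "\<And>a. a \<in> A \<Longrightarrow> lin_map R N M (L a)"
  shows "lin_map R N M (\<lambda>x. \<Oplus>\<^bsub>M\<^esub>a\<in>A. L a x)"
proof -
  have cl: "L a x \<in> carrier M" if "a \<in> A" "x \<in> carrier N" for a x
    using lin_mapD(1)[OF assms[OF that(1)] that(2)] .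
  show ?thesis
  proof (cases "finite A")
    case fin: True
    show ?thesis
    proof (rule lin_mapI)
      fix x assume x: "x \<in> carrier N"
      show "(\<Oplus>\<^bsub>M\<^esub>a\<in>A. L a x) \<in> carrier M" using cl x by (intro M.finsum_closed) auto
      show "(\<Oplus>\<^bsub>M\<^esub>a\<in>A. L a (x \<oplus>\<^bsub>N\<^esub> y)) = (\<Oplus>\<^bsub>M\<^esub>a\<in>A. L a x) \<oplus>\<^bsub>M\<^esub> (\<Oplus>\<^bsub>M\<^esub>a\<in>A. L a y)"
        if y: "y \<in> carrier N" for y
      proof -
        have "(\<Oplus>\<^bsub>M\<^esub>a\<in>A. L a (x \<oplus>\<^bsub>N\<^esub> y)) = (\<Oplus>\<^bsub>M\<^esub>a\<in>A. L a x \<oplus>\<^bsub>M\<^esub> L a y)"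
          using cl x y lin_mapD(2)[OF assms x y] by (intro M.add.finprod_cong') auto
        also have "\<dots> = (\<Oplus>\<^bsub>M\<^esub>a\<in>A. L a x) \<oplus>\<^bsub>M\<^esub> (\<Oplus>\<^bsub>M\<^esub>a\<in>A. L a y)"
          using cl x y by (intro M.add.finprod_multf) auto
        finally show ?thesis .
      qed
      show "(\<Oplus>\<^bsub>M\<^esub>a\<in>A. L a (s \<odot>\<^bsub>N\<^esub> x)) = s \<odot>\<^bsub>M\<^esub> (\<Oplus>\<^bsub>M\<^esub>a\<in>A. L a x)"
        if s: "s \<in> carrier R" for s
      proof -
        have "(\<Oplus>\<^bsub>M\<^esub>a\<in>A. L a (s \<odot>\<^bsub>N\<^esub> x)) = (\<Oplus>\<^bsub>M\<^esub>a\<in>A. s \<odot>\<^bsub>M\<^esub> L a x)"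
          using cl x s lin_mapD(3)[OF assms s x] by (intro M.add.finprod_cong') auto
        also have "\<dots> = s \<odot>\<^bsub>M\<^esub> (\<Oplus>\<^bsub>M\<^esub>a\<in>A. L a x)"
          using cl x s fin by (intro finsum_smult_ldistr[symmetric]) auto
        finally show ?thesis .
      qed
    qed
  next
    case False
    then show ?thesis by (intro lin_mapI) auto
  qed
qed

section \<open>Extension of scalars of a module representation\<close>

locale bilin_ext =
  fixes R :: "('r, 'x) ring_scheme" and S :: "('s, 'y) ring_scheme" and \<phi> :: "'r \<Rightarrow> 's"
    and \<theta> :: "('r, 'm, 'n, 'o) mod_rep"
  assumes rep: "is_mod_rep R \<theta>" and S_cring: "cring S" and \<phi>_hom: "\<phi> \<in> ring_hom R S"
begin

abbreviation "M \<equiv> rep_par \<theta>"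
abbreviation "N \<equiv> rep_src \<theta>"
abbreviation "Q \<equiv> rep_tgt \<theta>"
abbreviation "u \<equiv> rep_act \<theta>"
abbreviation "EQ \<equiv> ext_module R S \<phi> Q"
abbreviation "tq \<equiv> tens R S \<phi> Q"
abbreviation "FM \<equiv> free_module S (carrier M)"
abbreviation "FN \<equiv> free_module S (carrier N)"
abbreviation "FQ \<equiv> free_module S (carrier Q)"

lemma extM: "scalar_ext R S \<phi> M" and extN: "scalar_ext R S \<phi> N" and extQ: "scalar_ext R S \<phi> Q"
  using rep S_cring \<phi>_hom by (simp_all add: scalar_ext_def is_mod_rep_def)

interpretation S: cring S by (rule S_cring)
interpretation EQ: module S EQ by (rule scalar_ext.E_module[OF extQ])
interpretation M: module R M by (rule scalar_ext.M_module[OF extM])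
interpretation N: module R N by (rule scalar_ext.M_module[OF extN])
interpretation Q: module R Q by (rule scalar_ext.M_module[OF extQ])
interpretation FQ: module S FQ by (rule scalar_ext.F_module[OF extQ])

lemma u_lin_n: "m \<in> carrier M \<Longrightarrow> lin_map R N Q (u m)"
  and u_lin_m: "n \<in> carrier N \<Longrightarrow> lin_map R M Q (\<lambda>m. u m n)"
  using rep by (simp_all add: is_mod_rep_def)

lemma u_closed: "m \<in> carrier M \<Longrightarrow> n \<in> carrier N \<Longrightarrow> u m n \<in> carrier Q"
  using lin_mapD(1)[OF u_lin_n] .

lemma tu_closed: "m \<in> carrier M \<Longrightarrow> n \<in> carrier N \<Longrightarrow> tq (u m n) \<in> carrier EQ"
  by (rule scalar_ext.t_closed[OF extQ u_closed])

text \<open>The double sum of \<open>f m\<close>, \<open>g n\<close> and the pure tensor of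
  \<open>u m n\<close>, nested so that each stage is a linear extension in one variable and
  linearity in that variable comes for free.\<close>

definition inner where "inner m g = lin_ext S EQ (\<lambda>n. tq (u m n)) g"
definition bil where "bil f g = lin_ext S EQ (\<lambda>m. inner m g) f"

lemma inner_lin: "m \<in> carrier M \<Longrightarrow> lin_map S FN EQ (inner m)"
  unfolding inner_def by (rule EQ.lin_map_lin_ext) (simp add: tu_closed)

lemma inner_closed: "m \<in> carrier M \<Longrightarrow> g \<in> carrier FN \<Longrightarrow> inner m g \<in> carrier EQ"
  by (rule lin_mapD(1)[OF inner_lin])

lemma bil_lin1: "g \<in> carrier FN \<Longrightarrow> lin_map S FM EQ (\<lambda>f. bil f g)"
  unfolding bil_def by (rule EQ.lin_map_lin_ext) (simp add: inner_closed)

lemma bil_lin2: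
  assumes f: "f \<in> carrier FM" shows "lin_map S FN EQ (bil f)"
  unfolding bil_def lin_ext_def
proof (intro EQ.lin_map_finsum_maps EQ.lin_map_smult)
  fix m assume "m \<in> {a. f a \<noteq> \<zero>\<^bsub>S\<^esub>}"
  then show "lin_map S FN EQ (inner m)" using free_module_support[OF f] by (intro inner_lin) auto
qed (rule S.free_module_closed[OF f])

lemma bil_evec1: "m \<in> carrier M \<Longrightarrow> g \<in> carrier FN \<Longrightarrow> bil (evec S m) g = inner m g"
  unfolding bil_def by (rule EQ.lin_ext_evec) (auto simp: inner_closed)

lemma inner_evec: "m \<in> carrier M \<Longrightarrow> n \<in> carrier N \<Longrightarrow> inner m (evec S n) = tq (u m n)"
  unfolding inner_def by (rule EQ.lin_ext_evec) (auto simp: tu_closed)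

lemma bil_evec2:
  "f \<in> carrier FM \<Longrightarrow> n \<in> carrier N \<Longrightarrow> bil f (evec S n) = lin_ext S EQ (\<lambda>m. tq (u m n)) f"
  unfolding bil_def
proof (rule EQ.lin_ext_cong)
  assume n: "n \<in> carrier N"
  show "(\<lambda>m. inner m (evec S n)) \<in> carrier M \<rightarrow> carrier EQ"
    using S.evec_closed[OF n] by (intro Pi_I inner_closed)
  show "inner m (evec S n) = tq (u m n)" if "m \<in> carrier M" for m
    by (rule inner_evec[OF that n])
qed

lemma tu_add1:
  assumes "m \<in> carrier M" "m' \<in> carrier M" "n \<in> carrier N"
  shows "tq (u (m \<oplus>\<^bsub>M\<^esub> m') n) = tq (u m n) \<oplus>\<^bsub>EQ\<^esub> tq (u m' n)"
  using assms lin_mapD(2)[OF u_lin_m, of n m m'] by (simp add: scalar_ext.t_add[OF extQ] u_closed)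

lemma tu_add2:
  assumes "m \<in> carrier M" "n \<in> carrier N" "n' \<in> carrier N"
  shows "tq (u m (n \<oplus>\<^bsub>N\<^esub> n')) = tq (u m n) \<oplus>\<^bsub>EQ\<^esub> tq (u m n')"
  using assms lin_mapD(2)[OF u_lin_n, of m n n'] by (simp add: scalar_ext.t_add[OF extQ] u_closed)

lemma tu_smult1:
  assumes "r \<in> carrier R" "m \<in> carrier M" "n \<in> carrier N"
  shows "tq (u (r \<odot>\<^bsub>M\<^esub> m) n) = \<phi> r \<odot>\<^bsub>EQ\<^esub> tq (u m n)"
  using assms lin_mapD(3)[OF u_lin_m, of n r m] by (simp add: scalar_ext.t_smult[OF extQ] u_closed)

lemma tu_smult2:
  assumes "r \<in> carrier R" "m \<in> carrier M" "n \<in> carrier N"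
  shows "tq (u m (r \<odot>\<^bsub>N\<^esub> n)) = \<phi> r \<odot>\<^bsub>EQ\<^esub> tq (u m n)"
  using assms lin_mapD(3)[OF u_lin_n, of m r n] by (simp add: scalar_ext.t_smult[OF extQ] u_closed)

text \<open>For fixed \<open>g\<close> the values at basis vectors are semilinear in
  \<open>m\<close> because \<open>u\<close> is linear in \<open>m\<close>, so the universal property
  applies. The next lemma treats the other argument in the same way.\<close>

lemma bil_T1:
  assumes g: "g \<in> carrier FN" and f: "f \<in> tensor_rels R S \<phi> M" shows "bil f g = \<zero>\<^bsub>EQ\<^esub>"
proof (rule scalar_ext.kills_T[OF extM EQ.module_axioms bil_lin1[OF g] _ f])
  show "semilin R \<phi> M EQ (\<lambda>m. bil (evec S m) g)"
    unfolding semilin_def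
  proof (intro conjI ballI Pi_I)
    fix m assume m: "m \<in> carrier M"
    show "bil (evec S m) g \<in> carrier EQ" using m g by (simp add: bil_evec1 inner_closed)
    show "bil (evec S (m \<oplus>\<^bsub>M\<^esub> m')) g = bil (evec S m) g \<oplus>\<^bsub>EQ\<^esub> bil (evec S m') g" if m': "m' \<in> carrier M" for m'
    proof -
      have "inner (m \<oplus>\<^bsub>M\<^esub> m') g = lin_ext S EQ (\<lambda>n. tq (u m n) \<oplus>\<^bsub>EQ\<^esub> tq (u m' n)) g"
        unfolding inner_def by (rule EQ.lin_ext_cong[OF g]) (simp_all add: tu_closed tu_add1 m m')
      also have "\<dots> = inner m g \<oplus>\<^bsub>EQ\<^esub> inner m' g"
        unfolding inner_def by (rule EQ.lin_ext_add_fun[OF g]) (simp_all add: tu_closed m m')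
      finally show ?thesis using m m' g by (simp add: bil_evec1)
    qed
    show "bil (evec S (r \<odot>\<^bsub>M\<^esub> m)) g = \<phi> r \<odot>\<^bsub>EQ\<^esub> bil (evec S m) g" if r: "r \<in> carrier R" for r
    proof -
      have "inner (r \<odot>\<^bsub>M\<^esub> m) g = lin_ext S EQ (\<lambda>n. \<phi> r \<odot>\<^bsub>EQ\<^esub> tq (u m n)) g"
        unfolding inner_def by (rule EQ.lin_ext_cong[OF g]) (auto intro!: tu_closed simp: tu_smult1 m r)
      also have "\<dots> = \<phi> r \<odot>\<^bsub>EQ\<^esub> inner m g"
        unfolding inner_def
        by (rule EQ.lin_ext_smult_fun[OF g]) (simp_all add: tu_closed m scalar_ext.\<phi>_closed[OF extM r])
      finally show ?thesis using m r g by (simp add: bil_evec1)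
    qed
  qed
qed

lemma bil_T2:
  assumes f: "f \<in> carrier FM" and g: "g \<in> tensor_rels R S \<phi> N" shows "bil f g = \<zero>\<^bsub>EQ\<^esub>"
proof (rule scalar_ext.kills_T[OF extN EQ.module_axioms bil_lin2[OF f] _ g])
  show "semilin R \<phi> N EQ (\<lambda>n. bil f (evec S n))"
    unfolding semilin_def
  proof (intro conjI ballI Pi_I)
    fix n assume n: "n \<in> carrier N"
    show "bil f (evec S n) \<in> carrier EQ"
      by (rule lin_mapD(1)[OF bil_lin2[OF f] S.evec_closed[OF n]])
    show "bil f (evec S (n \<oplus>\<^bsub>N\<^esub> n')) = bil f (evec S n) \<oplus>\<^bsub>EQ\<^esub> bil f (evec S n')" if n': "n' \<in> carrier N" for n'
    proof -
      have "lin_ext S EQ (\<lambda>m. tq (u m (n \<oplus>\<^bsub>N\<^esub> n'))) f = lin_ext S EQ (\<lambda>m. tq (u m n) \<oplus>\<^bsub>EQ\<^esub> tq (u m n')) f"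
        by (rule EQ.lin_ext_cong[OF f]) (simp_all add: tu_closed tu_add2 n n')
      also have "\<dots> = lin_ext S EQ (\<lambda>m. tq (u m n)) f \<oplus>\<^bsub>EQ\<^esub> lin_ext S EQ (\<lambda>m. tq (u m n')) f"
        by (rule EQ.lin_ext_add_fun[OF f]) (simp_all add: tu_closed n n')
      finally show ?thesis using n n' f by (simp add: bil_evec2)
    qed
    show "bil f (evec S (r \<odot>\<^bsub>N\<^esub> n)) = \<phi> r \<odot>\<^bsub>EQ\<^esub> bil f (evec S n)" if r: "r \<in> carrier R" for r
    proof -
      have "lin_ext S EQ (\<lambda>m. tq (u m (r \<odot>\<^bsub>N\<^esub> n))) f = lin_ext S EQ (\<lambda>m. \<phi> r \<odot>\<^bsub>EQ\<^esub> tq (u m n)) f"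
        by (rule EQ.lin_ext_cong[OF f]) (auto intro!: tu_closed simp: tu_smult2 n r)
      also have "\<dots> = \<phi> r \<odot>\<^bsub>EQ\<^esub> lin_ext S EQ (\<lambda>m. tq (u m n)) f"
        by (rule EQ.lin_ext_smult_fun[OF f]) (simp_all add: tu_closed n scalar_ext.\<phi>_closed[OF extM r])
      finally show ?thesis using n r f by (simp add: bil_evec2)
    qed
  qed
qed

lemma bil_sum:
  assumes f: "f \<in> carrier FM" and g: "g \<in> carrier FN"
  shows "ext_proj R S \<phi> Q (finsum FQ (\<lambda>(m, n). (f m \<otimes>\<^bsub>S\<^esub> g n) \<odot>\<^bsub>FQ\<^esub> evec S (u m n))
      ({m. f m \<noteq> \<zero>\<^bsub>S\<^esub>} \<times> {n. g n \<noteq> \<zero>\<^bsub>S\<^esub>})) = bil f g"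
proof -
  let ?X = "{m. f m \<noteq> \<zero>\<^bsub>S\<^esub>}" and ?Y = "{n. g n \<noteq> \<zero>\<^bsub>S\<^esub>}"
  note X = free_module_finite_support[OF f] free_module_support[OF f]
  note Y = free_module_finite_support[OF g] free_module_support[OF g]
  note fg = S.free_module_closed[OF f] S.free_module_closed[OF g]
  have cl: "f m \<in> carrier S" "g n \<in> carrier S" "evec S (u m n) \<in> carrier FQ" "tq (u m n) \<in> carrier EQ"
    if "m \<in> ?X" "n \<in> ?Y" for m n
    using that X Y fg by (auto intro!: S.evec_closed u_closed tu_closed simp del: mem_Collect_eq)
  note pl = scalar_ext.p_lin[OF extQ]
  have "ext_proj R S \<phi> Q (finsum FQ (\<lambda>(m, n). (f m \<otimes>\<^bsub>S\<^esub> g n) \<odot>\<^bsub>FQ\<^esub> evec S (u m n)) (?X \<times> ?Y)) =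
      (\<Oplus>\<^bsub>EQ\<^esub>mn\<in>?X \<times> ?Y. ext_proj R S \<phi> Q ((\<lambda>(m, n). (f m \<otimes>\<^bsub>S\<^esub> g n) \<odot>\<^bsub>FQ\<^esub> evec S (u m n)) mn))"
  proof (rule lin_map_finsum[OF scalar_ext.F_module[OF extQ] EQ.module_axioms pl], rule Pi_I)
    fix mn assume "mn \<in> ?X \<times> ?Y"
    then obtain m n where mn: "mn = (m, n)" "m \<in> ?X" "n \<in> ?Y" by auto
    show "(\<lambda>(m, n). (f m \<otimes>\<^bsub>S\<^esub> g n) \<odot>\<^bsub>FQ\<^esub> evec S (u m n)) mn \<in> carrier FQ"
      unfolding mn(1) prod.case using cl[OF mn(2,3)] by (intro FQ.smult_closed S.m_closed)
  qed
  also have "\<dots> = (\<Oplus>\<^bsub>EQ\<^esub>mn\<in>?X \<times> ?Y. (\<lambda>(m, n). f m \<odot>\<^bsub>EQ\<^esub> (g n \<odot>\<^bsub>EQ\<^esub> tq (u m n))) mn)"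
  proof (rule EQ.M.add.finprod_cong'[OF refl])
    show "(\<lambda>mn. (\<lambda>(m, n). f m \<odot>\<^bsub>EQ\<^esub> (g n \<odot>\<^bsub>EQ\<^esub> tq (u m n))) mn) \<in> ?X \<times> ?Y \<rightarrow> carrier EQ"
      using cl by auto
    fix mn assume "mn \<in> ?X \<times> ?Y"
    then obtain m n where mn: "mn = (m, n)" "m \<in> ?X" "n \<in> ?Y" by auto
    note c = cl[OF mn(2,3)]
    have "ext_proj R S \<phi> Q ((f m \<otimes>\<^bsub>S\<^esub> g n) \<odot>\<^bsub>FQ\<^esub> evec S (u m n)) =
        (f m \<otimes>\<^bsub>S\<^esub> g n) \<odot>\<^bsub>EQ\<^esub> ext_proj R S \<phi> Q (evec S (u m n))"
      using c by (intro lin_mapD(3)[OF pl] S.m_closed)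
    also have "\<dots> = f m \<odot>\<^bsub>EQ\<^esub> (g n \<odot>\<^bsub>EQ\<^esub> tq (u m n))"
      using c by (simp add: scalar_ext.t_eq[OF extQ, symmetric] EQ.smult_assoc1)
    finally show "ext_proj R S \<phi> Q ((\<lambda>(m, n). (f m \<otimes>\<^bsub>S\<^esub> g n) \<odot>\<^bsub>FQ\<^esub> evec S (u m n)) mn) =
        (\<lambda>(m, n). f m \<odot>\<^bsub>EQ\<^esub> (g n \<odot>\<^bsub>EQ\<^esub> tq (u m n))) mn"
      unfolding mn(1) prod.case .
  qed
  also have "\<dots> = (\<Oplus>\<^bsub>EQ\<^esub>m\<in>?X. \<Oplus>\<^bsub>EQ\<^esub>n\<in>?Y. f m \<odot>\<^bsub>EQ\<^esub> (g n \<odot>\<^bsub>EQ\<^esub> tq (u m n)))"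
    using cl by (subst EQ.M.finsum_Times[OF X(1) Y(1)]) auto
  also have "\<dots> = (\<Oplus>\<^bsub>EQ\<^esub>m\<in>?X. f m \<odot>\<^bsub>EQ\<^esub> (\<Oplus>\<^bsub>EQ\<^esub>n\<in>?Y. g n \<odot>\<^bsub>EQ\<^esub> tq (u m n)))"
    using cl fg by (intro EQ.M.add.finprod_cong' refl EQ.finsum_smult_ldistr[OF Y(1), symmetric] Pi_I) auto
  also have "\<dots> = bil f g"
    by (simp add: bil_def inner_def lin_ext_def)
  finally show ?thesis .
qed

text \<open>\<open>ext_rep\<close> acts by a union over all pairs of representatives. Since
  \<open>bil\<close> vanishes on the tensor relations in each argument, every pair yields the same
  coset, and the union is that coset.\<close>

lemma ext_act:
  assumes f: "f \<in> carrier FM" and g: "g \<in> carrier FN"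
  shows "rep_act (ext_rep R S \<phi> \<theta>) (ext_proj R S \<phi> M f) (ext_proj R S \<phi> N g) = bil f g"
proof -
  let ?h = "\<lambda>f g. ext_proj R S \<phi> Q (finsum FQ (\<lambda>(m, n). (f m \<otimes>\<^bsub>S\<^esub> g n) \<odot>\<^bsub>FQ\<^esub> evec S (u m n))
      ({m. f m \<noteq> \<zero>\<^bsub>S\<^esub>} \<times> {n. g n \<noteq> \<zero>\<^bsub>S\<^esub>}))"
  have eq: "?h f' g' = bil f g" if f': "f' \<in> ext_proj R S \<phi> M f" and g': "g' \<in> ext_proj R S \<phi> N g" for f' g'
  proof -
    note fr = scalar_ext.p_repr[OF extM f f'] and gr = scalar_ext.p_repr[OF extN g g']
    have T1: "f' \<ominus>\<^bsub>FM\<^esub> f \<in> tensor_rels R S \<phi> M" using fr(2) scalar_ext.p_eq_iff[OF extM fr(1) f] by simp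
    have T2: "g' \<ominus>\<^bsub>FN\<^esub> g \<in> tensor_rels R S \<phi> N" using gr(2) scalar_ext.p_eq_iff[OF extN gr(1) g] by simp
    \<comment> \<open>The representatives are exchanged one at a time: first \<open>f'\<close> for
      \<open>f\<close>, then \<open>g'\<close> for \<open>g\<close>.\<close>
    have "bil f' g' \<ominus>\<^bsub>EQ\<^esub> bil f g' = \<zero>\<^bsub>EQ\<^esub>"
      using bil_T1[OF gr(1) T1]
        lin_map_diff[OF scalar_ext.F_module[OF extM] EQ.module_axioms bil_lin1[OF gr(1)] fr(1) f] by simp
    then have 1: "bil f' g' = bil f g'"
      by (rule EQ.M.eq_if_minus_zero[rotated 2]) (rule lin_mapD(1)[OF bil_lin1[OF gr(1)]], rule fr(1) f)+
    have "bil f g' \<ominus>\<^bsub>EQ\<^esub> bil f g = \<zero>\<^bsub>EQ\<^esub>"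
      using bil_T2[OF f T2]
        lin_map_diff[OF scalar_ext.F_module[OF extN] EQ.module_axioms bil_lin2[OF f] gr(1) g] by simp
    then have "bil f g' = bil f g"
      by (rule EQ.M.eq_if_minus_zero[rotated 2]) (rule lin_mapD(1)[OF bil_lin2[OF f]], rule gr(1) g)+
    then show ?thesis using 1 bil_sum[OF fr(1) gr(1)] by simp
  qed
  have "rep_act (ext_rep R S \<phi> \<theta>) (ext_proj R S \<phi> M f) (ext_proj R S \<phi> N g) =
      (\<Union>f'\<in>ext_proj R S \<phi> M f. \<Union>g'\<in>ext_proj R S \<phi> N g. ?h f' g')"
    by (simp add: ext_rep_def ext_proj_def Let_def)
  also have "\<dots> = (\<Union>f'\<in>ext_proj R S \<phi> M f. \<Union>g'\<in>ext_proj R S \<phi> N g. bil f g)"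
    using eq by (intro SUP_cong refl) auto
  also have "\<dots> = bil f g"
    using scalar_ext.p_self[OF extM f] scalar_ext.p_self[OF extN g] by auto
  finally show ?thesis .
qed

lemma ext_act_tens:
  assumes m: "m \<in> carrier M" and n: "n \<in> carrier N"
  shows "rep_act (ext_rep R S \<phi> \<theta>) (tens R S \<phi> M m) (tens R S \<phi> N n) = tq (u m n)"
  unfolding scalar_ext.t_eq[OF extM] scalar_ext.t_eq[OF extN]
  by (simp add: ext_act m n S.evec_closed bil_evec1 inner_evec)

lemma ext_rep_sel:
  "rep_par (ext_rep R S \<phi> \<theta>) = ext_module R S \<phi> M"
  "rep_src (ext_rep R S \<phi> \<theta>) = ext_module R S \<phi> N"
  "rep_tgt (ext_rep R S \<phi> \<theta>) = ext_module R S \<phi> Q"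
  by (simp_all add: ext_rep_def)

lemma ext_is_mod_rep: "is_mod_rep S (ext_rep R S \<phi> \<theta>)"
  unfolding is_mod_rep_def ext_rep_sel
proof (intro conjI ballI)
  show "module S (ext_module R S \<phi> M)" "module S (ext_module R S \<phi> N)" "module S EQ"
    using scalar_ext.E_module extM extN extQ by blast+
  fix C assume "C \<in> carrier (ext_module R S \<phi> M)"
  then obtain f where f: "f \<in> carrier FM" "C = ext_proj R S \<phi> M f"
    unfolding scalar_ext.E_carrier[OF extM] by auto
  note pl = lin_mapD[OF scalar_ext.p_lin[OF extN]]
  interpret FN: module S FN by (rule scalar_ext.F_module[OF extN])
  show "lin_map S (ext_module R S \<phi> N) EQ (rep_act (ext_rep R S \<phi> \<theta>) C)"
  proof (rule lin_mapI)
    fix D assume "D \<in> carrier (ext_module R S \<phi> N)"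
    then obtain g where g: "g \<in> carrier FN" "D = ext_proj R S \<phi> N g"
      unfolding scalar_ext.E_carrier[OF extN] by auto
    show "rep_act (ext_rep R S \<phi> \<theta>) C D \<in> carrier EQ"
      unfolding f g ext_act[OF f(1) g(1)] by (rule lin_mapD(1)[OF bil_lin2[OF f(1)] g(1)])
    show "rep_act (ext_rep R S \<phi> \<theta>) C (D \<oplus>\<^bsub>ext_module R S \<phi> N\<^esub> D') =
        rep_act (ext_rep R S \<phi> \<theta>) C D \<oplus>\<^bsub>EQ\<^esub> rep_act (ext_rep R S \<phi> \<theta>) C D'"
      if "D' \<in> carrier (ext_module R S \<phi> N)" for D'
    proof -
      from that obtain g' where g': "g' \<in> carrier FN" "D' = ext_proj R S \<phi> N g'"
        unfolding scalar_ext.E_carrier[OF extN] by auto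
      show ?thesis
        unfolding f(2) g(2) g'(2) pl(2)[OF g(1) g'(1), symmetric]
          ext_act[OF f(1) g(1)] ext_act[OF f(1) g'(1)] ext_act[OF f(1) FN.M.a_closed[OF g(1) g'(1)]]
        by (rule lin_mapD(2)[OF bil_lin2[OF f(1)] g(1) g'(1)])
    qed
    show "rep_act (ext_rep R S \<phi> \<theta>) C (s \<odot>\<^bsub>ext_module R S \<phi> N\<^esub> D) = s \<odot>\<^bsub>EQ\<^esub> rep_act (ext_rep R S \<phi> \<theta>) C D"
      if s: "s \<in> carrier S" for s
      unfolding f(2) g(2) pl(3)[OF s g(1), symmetric] ext_act[OF f(1) g(1)] ext_act[OF f(1) FN.smult_closed[OF s g(1)]]
      by (rule lin_mapD(3)[OF bil_lin2[OF f(1)] s g(1)])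
  qed
next
  fix D assume "D \<in> carrier (ext_module R S \<phi> N)"
  then obtain g where g: "g \<in> carrier FN" "D = ext_proj R S \<phi> N g"
    unfolding scalar_ext.E_carrier[OF extN] by auto
  note pl = lin_mapD[OF scalar_ext.p_lin[OF extM]]
  interpret FM: module S FM by (rule scalar_ext.F_module[OF extM])
  show "lin_map S (ext_module R S \<phi> M) EQ (\<lambda>C. rep_act (ext_rep R S \<phi> \<theta>) C D)"
  proof (rule lin_mapI)
    fix C assume "C \<in> carrier (ext_module R S \<phi> M)"
    then obtain f where f: "f \<in> carrier FM" "C = ext_proj R S \<phi> M f"
      unfolding scalar_ext.E_carrier[OF extM] by auto
    show "rep_act (ext_rep R S \<phi> \<theta>) C D \<in> carrier EQ"
      unfolding f g ext_act[OF f(1) g(1)] by (rule lin_mapD(1)[OF bil_lin2[OF f(1)] g(1)])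
    show "rep_act (ext_rep R S \<phi> \<theta>) (C \<oplus>\<^bsub>ext_module R S \<phi> M\<^esub> C') D =
        rep_act (ext_rep R S \<phi> \<theta>) C D \<oplus>\<^bsub>EQ\<^esub> rep_act (ext_rep R S \<phi> \<theta>) C' D"
      if "C' \<in> carrier (ext_module R S \<phi> M)" for C'
    proof -
      from that obtain f' where f': "f' \<in> carrier FM" "C' = ext_proj R S \<phi> M f'"
        unfolding scalar_ext.E_carrier[OF extM] by auto
      show ?thesis
        unfolding f(2) g(2) f'(2) pl(2)[OF f(1) f'(1), symmetric]
          ext_act[OF f(1) g(1)] ext_act[OF f'(1) g(1)] ext_act[OF FM.M.a_closed[OF f(1) f'(1)] g(1)]
        by (rule lin_mapD(2)[OF bil_lin1[OF g(1)] f(1) f'(1)])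
    qed
    show "rep_act (ext_rep R S \<phi> \<theta>) (s \<odot>\<^bsub>ext_module R S \<phi> M\<^esub> C) D = s \<odot>\<^bsub>EQ\<^esub> rep_act (ext_rep R S \<phi> \<theta>) C D"
      if s: "s \<in> carrier S" for s
      unfolding f(2) g(2) pl(3)[OF s f(1), symmetric] ext_act[OF f(1) g(1)] ext_act[OF FM.smult_closed[OF s f(1)] g(1)]
      by (rule lin_mapD(3)[OF bil_lin1[OF g(1)] s f(1)])
  qed
qed

end

subsection \<open>Extension of scalars of free modules\<close>

lemma bij_betw_lin_map_inv:
  assumes N: "module S N" and P: "module S P" and f: "lin_map S N P f"
    and bij: "bij_betw f (carrier N) (carrier P)"
  shows "lin_map S P N (inv_into (carrier N) f)"
proof (rule lin_mapI)
  interpret N: module S N by fact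
  let ?g = "inv_into (carrier N) f"
  have g: "?g x \<in> carrier N" "f (?g x) = x" if "x \<in> carrier P" for x
    using that bij by (auto simp: bij_betw_def inv_into_into f_inv_into_f)
  have gf: "?g x = y" if "y \<in> carrier N" "f y = x" for x y
    using that bij by (auto simp: bij_betw_def)
  fix x assume x: "x \<in> carrier P"
  show "?g x \<in> carrier N" using g(1)[OF x] .
  show "?g (x \<oplus>\<^bsub>P\<^esub> y) = ?g x \<oplus>\<^bsub>N\<^esub> ?g y" if y: "y \<in> carrier P" for y
    using g[OF x] g[OF y] lin_mapD(2)[OF f, of "?g x" "?g y"] by (intro gf) auto
  show "?g (s \<odot>\<^bsub>P\<^esub> x) = s \<odot>\<^bsub>N\<^esub> ?g x" if s: "s \<in> carrier S" for s
    using g[OF x] lin_mapD(3)[OF f s, of "?g x"] s by (intro gf) auto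
qed

locale free_ext =
  fixes R :: "('r, 'x) ring_scheme" and S :: "('s, 'y) ring_scheme" and \<phi> :: "'r \<Rightarrow> 's"
    and A :: "'a set"
  assumes R_cring: "cring R" and S_cring: "cring S" and \<phi>_hom: "\<phi> \<in> ring_hom R S"
begin

abbreviation "RA \<equiv> free_module R A"
abbreviation "SA \<equiv> free_module S A"
abbreviation "EA \<equiv> ext_module R S \<phi> RA"
abbreviation "FA \<equiv> free_module S (carrier RA)"
abbreviation "ta \<equiv> tens R S \<phi> RA"
abbreviation "pa \<equiv> ext_proj R S \<phi> RA"

interpretation R: cring R by (rule R_cring)
interpretation S: cring S by (rule S_cring)
interpretation RA: module R RA by (rule R.free_module_module)
interpretation SA: module S SA by (rule S.free_module_module)

lemma ext: "scalar_ext R S \<phi> RA"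
  by (simp add: scalar_ext_def RA.module_axioms S_cring \<phi>_hom)

interpretation FA: module S FA by (rule scalar_ext.F_module[OF ext])
interpretation EA: module S EA by (rule scalar_ext.E_module[OF ext])

lemma ring_hom_simps: "\<phi> \<zero>\<^bsub>R\<^esub> = \<zero>\<^bsub>S\<^esub>" "\<phi> \<one>\<^bsub>R\<^esub> = \<one>\<^bsub>S\<^esub>"
  "\<And>x. x \<in> carrier R \<Longrightarrow> \<phi> x \<in> carrier S"
  "\<And>x y. x \<in> carrier R \<Longrightarrow> y \<in> carrier R \<Longrightarrow> \<phi> (x \<oplus>\<^bsub>R\<^esub> y) = \<phi> x \<oplus>\<^bsub>S\<^esub> \<phi> y"
  "\<And>x y. x \<in> carrier R \<Longrightarrow> y \<in> carrier R \<Longrightarrow> \<phi> (x \<otimes>\<^bsub>R\<^esub> y) = \<phi> x \<otimes>\<^bsub>S\<^esub> \<phi> y"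
  using \<phi>_hom R.ring_axioms S.ring_axioms
  by (auto simp: ring_hom_zero ring_hom_one ring_hom_closed ring_hom_add ring_hom_mult)

lemma map_closed: "z \<in> carrier RA \<Longrightarrow> (\<lambda>a. \<phi> (z a)) \<in> carrier SA"
proof -
  assume z: "z \<in> carrier RA"
  have "{a. \<phi> (z a) \<noteq> \<zero>\<^bsub>S\<^esub>} \<subseteq> {a. z a \<noteq> \<zero>\<^bsub>R\<^esub>}" by (auto simp: ring_hom_simps)
  then have "finite {a. \<phi> (z a) \<noteq> \<zero>\<^bsub>S\<^esub>}"
    using free_module_finite_support[OF z] by (rule finite_subset)
  then show ?thesis
    using z by (auto simp: carrier_free_module ring_hom_simps)
qed

lemma map_evec: "(\<lambda>b. \<phi> (evec R a b)) = evec S a"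
  by (auto simp: evec_def ring_hom_simps)

lemma te_closed: "a \<in> A \<Longrightarrow> ta (evec R a) \<in> carrier EA"
  by (rule scalar_ext.t_closed[OF ext R.evec_closed])

lemma free_iso_proj:
  assumes x: "x \<in> carrier SA"
  shows "free_iso R S \<phi> A x = pa (lin_ext S FA (\<lambda>a. evec S (evec R a)) x)"
proof -
  have "{a \<in> A. x a \<noteq> \<zero>\<^bsub>S\<^esub>} = {a. x a \<noteq> \<zero>\<^bsub>S\<^esub>}" using free_module_support[OF x] by auto
  then show ?thesis by (simp add: free_iso_def Let_def ext_proj_def lin_ext_def)
qed

lemma evec2_closed: "(\<lambda>a. evec S (evec R a)) \<in> A \<rightarrow> carrier FA"
  by (intro Pi_I S.evec_closed R.evec_closed)

lemma free_iso_lin_ext: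
  assumes x: "x \<in> carrier SA"
  shows "free_iso R S \<phi> A x = lin_ext S EA (\<lambda>a. ta (evec R a)) x"
proof -
  have cl: "x a \<odot>\<^bsub>FA\<^esub> evec S (evec R a) \<in> carrier FA" "evec S (evec R a) \<in> carrier FA"
    if "a \<in> {a. x a \<noteq> \<zero>\<^bsub>S\<^esub>}" for a
  proof -
    have "a \<in> A" using that free_module_support[OF x] by auto
    then show "evec S (evec R a) \<in> carrier FA" by (intro S.evec_closed R.evec_closed)
    then show "x a \<odot>\<^bsub>FA\<^esub> evec S (evec R a) \<in> carrier FA"
      by (rule FA.smult_closed[OF S.free_module_closed[OF x]])
  qed
  have "free_iso R S \<phi> A x = (\<Oplus>\<^bsub>EA\<^esub>a\<in>{a. x a \<noteq> \<zero>\<^bsub>S\<^esub>}. pa (x a \<odot>\<^bsub>FA\<^esub> evec S (evec R a)))"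
    unfolding free_iso_proj[OF x] lin_ext_def
    by (rule lin_map_finsum[OF FA.module_axioms EA.module_axioms scalar_ext.p_lin[OF ext]]) (rule Pi_I, rule cl(1))
  also have "\<dots> = (\<Oplus>\<^bsub>EA\<^esub>a\<in>{a. x a \<noteq> \<zero>\<^bsub>S\<^esub>}. x a \<odot>\<^bsub>EA\<^esub> ta (evec R a))"
  proof (rule EA.M.add.finprod_cong'[OF refl])
    fix a assume a: "a \<in> {a. x a \<noteq> \<zero>\<^bsub>S\<^esub>}"
    show "pa (x a \<odot>\<^bsub>FA\<^esub> evec S (evec R a)) = x a \<odot>\<^bsub>EA\<^esub> ta (evec R a)"
      unfolding scalar_ext.t_eq[OF ext]
      by (rule lin_mapD(3)[OF scalar_ext.p_lin[OF ext] S.free_module_closed[OF x] cl(2)[OF a]])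
  next
    show "(\<lambda>a. x a \<odot>\<^bsub>EA\<^esub> ta (evec R a)) \<in> {a. x a \<noteq> \<zero>\<^bsub>S\<^esub>} \<rightarrow> carrier EA"
      using S.free_module_closed[OF x] free_module_support[OF x] te_closed
      by (intro Pi_I EA.smult_closed) auto
  qed
  finally show ?thesis by (simp add: lin_ext_def)
qed

lemma free_iso_lin: "lin_map S SA EA (free_iso R S \<phi> A)"
proof (rule lin_map_cong[OF _ SA.module_axioms])
  show "lin_map S SA EA (lin_ext S EA (\<lambda>a. ta (evec R a)))"
    by (rule EA.lin_map_lin_ext) (simp add: te_closed)
qed (simp add: free_iso_lin_ext)

lemma free_iso_evec: "a \<in> A \<Longrightarrow> free_iso R S \<phi> A (evec S a) = ta (evec R a)"
  by (subst free_iso_lin_ext) (simp_all add: S.evec_closed EA.lin_ext_evec[where A = A] te_closed)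

text \<open>Both sides are semilinear in \<open>z\<close>. Hence the \<open>z\<close> at which they
  agree form a submodule, and comparing basis vectors is enough.\<close>

lemma free_iso_map:
  assumes "z \<in> carrier RA" shows "free_iso R S \<phi> A (\<lambda>a. \<phi> (z a)) = ta z"
proof -
  let ?H = "{z \<in> carrier RA. free_iso R S \<phi> A (\<lambda>a. \<phi> (z a)) = ta z}"
  note iso = lin_mapD[OF free_iso_lin]
  have "submodule ?H R RA"
  proof (rule RA.submodule_smultI)
    have "evec S \<zero>\<^bsub>RA\<^esub> \<in> carrier FA" by (rule S.evec_closed[OF RA.M.zero_closed])
    have "ta \<zero>\<^bsub>RA\<^esub> = ta (\<zero>\<^bsub>R\<^esub> \<odot>\<^bsub>RA\<^esub> \<zero>\<^bsub>RA\<^esub>)" by simp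
    also have "\<dots> = \<phi> \<zero>\<^bsub>R\<^esub> \<odot>\<^bsub>EA\<^esub> ta \<zero>\<^bsub>RA\<^esub>"
      by (rule scalar_ext.t_smult[OF ext R.zero_closed RA.M.zero_closed])
    also have "\<dots> = \<zero>\<^bsub>EA\<^esub>"
      using scalar_ext.t_closed[OF ext RA.M.zero_closed] by (simp add: ring_hom_simps)
    finally have "ta \<zero>\<^bsub>RA\<^esub> = \<zero>\<^bsub>EA\<^esub>" .
    moreover have "free_iso R S \<phi> A (\<lambda>a. \<phi> (\<zero>\<^bsub>RA\<^esub> a)) = \<zero>\<^bsub>EA\<^esub>"
      using lin_map_zero[OF SA.module_axioms EA.module_axioms free_iso_lin] by (simp add: ring_hom_simps)
    ultimately show "\<zero>\<^bsub>RA\<^esub> \<in> ?H" using RA.M.zero_closed by simp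
  next
    fix z z' assume z: "z \<in> ?H" "z' \<in> ?H"
    then have zc: "z \<in> carrier RA" "z' \<in> carrier RA" by auto
    have "(\<lambda>a. \<phi> ((z \<oplus>\<^bsub>RA\<^esub> z') a)) = (\<lambda>a. \<phi> (z a)) \<oplus>\<^bsub>SA\<^esub> (\<lambda>a. \<phi> (z' a))"
      using R.free_module_closed[OF zc(1)] R.free_module_closed[OF zc(2)] by (simp add: ring_hom_simps)
    then have "free_iso R S \<phi> A (\<lambda>a. \<phi> ((z \<oplus>\<^bsub>RA\<^esub> z') a)) = ta z \<oplus>\<^bsub>EA\<^esub> ta z'"
      using iso(2)[OF map_closed[OF zc(1)] map_closed[OF zc(2)]] z by simp
    also have "\<dots> = ta (z \<oplus>\<^bsub>RA\<^esub> z')" by (rule scalar_ext.t_add[OF ext zc, symmetric])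
    finally show "z \<oplus>\<^bsub>RA\<^esub> z' \<in> ?H" using RA.M.a_closed[OF zc] by blast
  next
    fix r z assume r: "r \<in> carrier R" and z: "z \<in> ?H"
    then have zc: "z \<in> carrier RA" by auto
    have "(\<lambda>a. \<phi> ((r \<odot>\<^bsub>RA\<^esub> z) a)) = \<phi> r \<odot>\<^bsub>SA\<^esub> (\<lambda>a. \<phi> (z a))"
      using R.free_module_closed[OF zc] r by (simp add: ring_hom_simps)
    then have "free_iso R S \<phi> A (\<lambda>a. \<phi> ((r \<odot>\<^bsub>RA\<^esub> z) a)) = \<phi> r \<odot>\<^bsub>EA\<^esub> ta z"
      using iso(3)[OF ring_hom_simps(3)[OF r] map_closed[OF zc]] z by simp
    also have "\<dots> = ta (r \<odot>\<^bsub>RA\<^esub> z)" by (rule scalar_ext.t_smult[OF ext r zc, symmetric])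
    finally show "r \<odot>\<^bsub>RA\<^esub> z \<in> ?H" using RA.smult_closed[OF r zc] by blast
  qed auto
  moreover have "evec R ` A \<subseteq> ?H"
    using R.evec_closed[of _ A] by (auto simp: map_evec free_iso_evec)
  ultimately have "gen_submodule R RA (evec R ` A) \<subseteq> ?H" by (rule gen_submodule_least)
  then show ?thesis using assms R.free_module_gen[of A] by auto
qed

text \<open>Injectivity comes from a left inverse: \<open>L\<close> sends the formal symbol of
  \<open>z\<close> to the vector with entries \<open>\<phi> (z a)\<close>, kills the tensor
  relations, and recovers \<open>x\<close> from the formal combination that represents its image.
  Surjectivity holds because the image is a submodule containing all pure tensors.\<close>

lemma free_iso_bij: "bij_betw (free_iso R S \<phi> A) (carrier SA) (carrier EA)"
  unfolding bij_betw_def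
proof
  define L where "L = lin_ext S SA (\<lambda>z a. \<phi> (z a))"
  have L: "lin_map S FA SA L" unfolding L_def by (rule SA.lin_map_lin_ext) (simp add: map_closed)
  have Le: "L (evec S z) = (\<lambda>a. \<phi> (z a))" if "z \<in> carrier RA" for z
    unfolding L_def using that by (intro SA.lin_ext_evec) (auto simp: map_closed)
  have LT: "L f = \<zero>\<^bsub>SA\<^esub>" if f: "f \<in> tensor_rels R S \<phi> RA" for f
  proof (rule scalar_ext.kills_T[OF ext SA.module_axioms L _ f])
    have hom: "(\<lambda>a. \<phi> ((z \<oplus>\<^bsub>RA\<^esub> z') a)) = (\<lambda>a. \<phi> (z a)) \<oplus>\<^bsub>SA\<^esub> (\<lambda>a. \<phi> (z' a))"
      if "z \<in> carrier RA" "z' \<in> carrier RA" for z z'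
      using R.free_module_closed[OF that(1)] R.free_module_closed[OF that(2)] by (simp add: ring_hom_simps)
    have hom2: "(\<lambda>a. \<phi> ((r \<odot>\<^bsub>RA\<^esub> z) a)) = \<phi> r \<odot>\<^bsub>SA\<^esub> (\<lambda>a. \<phi> (z a))"
      if "r \<in> carrier R" "z \<in> carrier RA" for r z
      using R.free_module_closed[OF that(2)] that(1) by (simp add: ring_hom_simps)
    show "semilin R \<phi> RA SA (\<lambda>z. L (evec S z))"
      unfolding semilin_def
    proof (intro conjI ballI Pi_I)
      fix z assume z: "z \<in> carrier RA"
      show "L (evec S z) \<in> carrier SA" using z by (simp add: Le map_closed)
      show "L (evec S (z \<oplus>\<^bsub>RA\<^esub> z')) = L (evec S z) \<oplus>\<^bsub>SA\<^esub> L (evec S z')" if z': "z' \<in> carrier RA" for z'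
        unfolding Le[OF z] Le[OF z'] Le[OF RA.M.a_closed[OF z z']] by (rule hom[OF z z'])
      show "L (evec S (r \<odot>\<^bsub>RA\<^esub> z)) = \<phi> r \<odot>\<^bsub>SA\<^esub> L (evec S z)" if r: "r \<in> carrier R" for r
        unfolding Le[OF z] Le[OF RA.smult_closed[OF r z]] by (rule hom2[OF r z])
    qed
  qed
  have wc: "lin_ext S FA (\<lambda>a. evec S (evec R a)) x \<in> carrier FA" if "x \<in> carrier SA" for x
    by (rule lin_mapD(1)[OF FA.lin_map_lin_ext[OF evec2_closed] that])
  have Lw: "L (lin_ext S FA (\<lambda>a. evec S (evec R a)) x) = x" if x: "x \<in> carrier SA" for x
  proof -
    have a: "a \<in> A" if "a \<in> {a. x a \<noteq> \<zero>\<^bsub>S\<^esub>}" for a using that free_module_support[OF x] by auto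
    have "L (lin_ext S FA (\<lambda>a. evec S (evec R a)) x) =
        (\<Oplus>\<^bsub>SA\<^esub>a\<in>{a. x a \<noteq> \<zero>\<^bsub>S\<^esub>}. L (x a \<odot>\<^bsub>FA\<^esub> evec S (evec R a)))"
      unfolding lin_ext_def
      using a evec2_closed
      by (intro lin_map_finsum[OF FA.module_axioms SA.module_axioms L] Pi_I
          FA.smult_closed S.free_module_closed[OF x] S.evec_closed R.evec_closed)
    also have "\<dots> = (\<Oplus>\<^bsub>SA\<^esub>a\<in>{a. x a \<noteq> \<zero>\<^bsub>S\<^esub>}. x a \<odot>\<^bsub>SA\<^esub> evec S a)"
    proof (rule SA.M.add.finprod_cong'[OF refl])
      show "(\<lambda>a. x a \<odot>\<^bsub>SA\<^esub> evec S a) \<in> {a. x a \<noteq> \<zero>\<^bsub>S\<^esub>} \<rightarrow> carrier SA"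
        using a by (intro Pi_I SA.smult_closed S.free_module_closed[OF x] S.evec_closed)
      fix b assume b: "b \<in> {a. x a \<noteq> \<zero>\<^bsub>S\<^esub>}"
      have "L (x b \<odot>\<^bsub>FA\<^esub> evec S (evec R b)) = x b \<odot>\<^bsub>SA\<^esub> L (evec S (evec R b))"
        using a[OF b] by (intro lin_mapD(3)[OF L] S.free_module_closed[OF x] S.evec_closed R.evec_closed)
      then show "L (x b \<odot>\<^bsub>FA\<^esub> evec S (evec R b)) = x b \<odot>\<^bsub>SA\<^esub> evec S b"
        using Le[OF R.evec_closed[OF a[OF b]]] by (simp add: map_evec)
    qed
    also have "\<dots> = x"
      by (rule S.free_module_expand[OF x free_module_finite_support[OF x] free_module_support[OF x] subset_refl])
    finally show ?thesis .
  qed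
  show "inj_on (free_iso R S \<phi> A) (carrier SA)"
  proof (rule inj_onI)
    fix x y assume x: "x \<in> carrier SA" and y: "y \<in> carrier SA" and eq: "free_iso R S \<phi> A x = free_iso R S \<phi> A y"
    let ?w = "lin_ext S FA (\<lambda>a. evec S (evec R a))"
    have "?w x \<ominus>\<^bsub>FA\<^esub> ?w y \<in> tensor_rels R S \<phi> RA"
      using eq scalar_ext.p_eq_iff[OF ext wc[OF x] wc[OF y]] unfolding free_iso_proj[OF x] free_iso_proj[OF y] by simp
    from LT[OF this] have "x \<ominus>\<^bsub>SA\<^esub> y = \<zero>\<^bsub>SA\<^esub>"
      using lin_map_diff[OF FA.module_axioms SA.module_axioms L wc[OF x] wc[OF y]] by (simp only: Lw[OF x] Lw[OF y])
    then show "x = y" by (rule SA.M.eq_if_minus_zero[OF x y])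
  qed
  show "free_iso R S \<phi> A ` carrier SA = carrier EA"
  proof
    show "free_iso R S \<phi> A ` carrier SA \<subseteq> carrier EA" using lin_mapD(1)[OF free_iso_lin] by auto
    show "carrier EA \<subseteq> free_iso R S \<phi> A ` carrier SA"
    proof
      fix x assume x: "x \<in> carrier EA"
      show "x \<in> free_iso R S \<phi> A ` carrier SA"
      proof (rule scalar_ext.E_gen[OF ext _ _ x])
        show "submodule (free_iso R S \<phi> A ` carrier SA) S EA"
          by (rule lin_map_image[OF SA.module_axioms EA.module_axioms free_iso_lin SA.carrier_is_submodule])
        show "ta z \<in> free_iso R S \<phi> A ` carrier SA" if z: "z \<in> carrier RA" for z
          using free_iso_map[OF z] map_closed[OF z] by force
      qed
    qed
  qed
qed

abbreviation "iso_inv \<equiv> inv_into (carrier SA) (free_iso R S \<phi> A)"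

lemma iso_inv_lin: "lin_map S EA SA iso_inv"
  by (rule bij_betw_lin_map_inv[OF SA.module_axioms EA.module_axioms free_iso_lin free_iso_bij])

lemma iso_inv_tens: "z \<in> carrier RA \<Longrightarrow> iso_inv (ta z) = (\<lambda>a. \<phi> (z a))"
  using free_iso_map[of z] map_closed[of z] free_iso_bij by (metis bij_betw_def inv_into_f_f)

end

lemma lin_map_rep_act2:
  assumes "is_mod_rep S \<theta>" "m \<in> carrier (rep_par \<theta>)"
  shows "lin_map S (rep_src \<theta>) (rep_tgt \<theta>) (rep_act \<theta> m)"
  using assms by (simp add: is_mod_rep_def)

lemma lin_map_rep_act1:
  assumes "is_mod_rep S \<theta>" "n \<in> carrier (rep_src \<theta>)"
  shows "lin_map S (rep_par \<theta>) (rep_tgt \<theta>) (\<lambda>m. rep_act \<theta> m n)"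
  using assms by (simp add: is_mod_rep_def)

lemma is_mod_repI:
  assumes "module S (rep_par \<theta>)" "module S (rep_src \<theta>)" "module S (rep_tgt \<theta>)"
    and "\<And>m. m \<in> carrier (rep_par \<theta>) \<Longrightarrow> lin_map S (rep_src \<theta>) (rep_tgt \<theta>) (rep_act \<theta> m)"
    and "\<And>n. n \<in> carrier (rep_src \<theta>) \<Longrightarrow> lin_map S (rep_par \<theta>) (rep_tgt \<theta>) (\<lambda>m. rep_act \<theta> m n)"
  shows "is_mod_rep S \<theta>"
  using assms by (simp add: is_mod_rep_def)

lemma is_mod_rep_modules:
  assumes "is_mod_rep S \<theta>"
  shows "module S (rep_par \<theta>)" "module S (rep_src \<theta>)" "module S (rep_tgt \<theta>)"
  using assms by (simp_all add: is_mod_rep_def)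

context
  fixes R :: "('r, 'x) ring_scheme" and S :: "('s, 'y) ring_scheme" and \<phi> :: "'r \<Rightarrow> 's"
    and \<theta> :: "('r, 'm, 'i \<Rightarrow> 'r, 'j \<Rightarrow> 'r) mod_rep" and I J
  assumes R: "cring R" and S: "cring S" and \<phi>: "\<phi> \<in> ring_hom R S" and rep: "is_mod_rep R \<theta>"
    and src: "rep_src \<theta> = free_module R I" and tgt: "rep_tgt \<theta> = free_module R J"
begin

private lemma fI: "free_ext R S \<phi>" and be: "bilin_ext R S \<phi> \<theta>"
  using R S \<phi> rep by (simp_all add: free_ext_def bilin_ext_def)

lemma ext_rep_free_sel:
  "rep_par (ext_rep_free R S \<phi> I J \<theta>) = ext_module R S \<phi> (rep_par \<theta>)"
  "rep_src (ext_rep_free R S \<phi> I J \<theta>) = free_module S I"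
  "rep_tgt (ext_rep_free R S \<phi> I J \<theta>) = free_module S J"
  by (simp_all add: ext_rep_free_def)

lemma ext_rep_free_is_mod_rep: "is_mod_rep S (ext_rep_free R S \<phi> I J \<theta>)"
proof -
  have er: "is_mod_rep S (ext_rep R S \<phi> \<theta>)" by (rule bilin_ext.ext_is_mod_rep[OF be])
  note sel = bilin_ext.ext_rep_sel[OF be, unfolded src tgt]
  note a1 = lin_map_rep_act1[OF er, unfolded sel] and a2 = lin_map_rep_act2[OF er, unfolded sel]
  show ?thesis
  proof (rule is_mod_repI; unfold ext_rep_free_sel)
    show "module S (ext_module R S \<phi> (rep_par \<theta>))" using is_mod_rep_modules(1)[OF er] sel by simp
    show "module S (free_module S I)" "module S (free_module S J)" using S by (simp_all add: cring.free_module_module)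
    show "lin_map S (free_module S I) (free_module S J) (rep_act (ext_rep_free R S \<phi> I J \<theta>) C)"
      if "C \<in> carrier (ext_module R S \<phi> (rep_par \<theta>))" for C
      using lin_map_comp[OF lin_map_comp[OF free_ext.free_iso_lin[OF fI] a2[OF that]] free_ext.iso_inv_lin[OF fI]]
      by (simp add: ext_rep_free_def)
    show "lin_map S (ext_module R S \<phi> (rep_par \<theta>)) (free_module S J) (\<lambda>C. rep_act (ext_rep_free R S \<phi> I J \<theta>) C y)"
      if y: "y \<in> carrier (free_module S I)" for y
      using lin_map_comp[OF a1[OF lin_mapD(1)[OF free_ext.free_iso_lin[OF fI] y]] free_ext.iso_inv_lin[OF fI]]
      by (simp add: ext_rep_free_def)
  qed
qed

text \<open>With linearity this determines the extended representation, so the detour through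
  \<open>free_iso\<close> and its inverse need not be unfolded again: matrices merely have
  \<open>\<phi>\<close> applied to their entries.\<close>

lemma ext_rep_free_act:
  assumes m: "m \<in> carrier (rep_par \<theta>)" and i: "i \<in> I"
  shows "rep_act (ext_rep_free R S \<phi> I J \<theta>) (tens R S \<phi> (rep_par \<theta>) m) (evec S i) =
    (\<lambda>j. \<phi> (rep_act \<theta> m (evec R i) j))"
proof -
  have e: "evec R i \<in> carrier (free_module R I)" by (rule cring.evec_closed[OF R i])
  have "rep_act \<theta> m (evec R i) \<in> carrier (free_module R J)"
    using lin_mapD(1)[OF lin_map_rep_act2[OF rep m]] e src tgt by simp
  then show ?thesis
    using bilin_ext.ext_act_tens[OF be m, of "evec R i"] e
    by (simp add: ext_rep_free_def free_ext.free_iso_evec[OF fI i] src tgt free_ext.iso_inv_tens[OF fI])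
qed

end

lemma ext_rep_free3_sel:
  "rep_par (ext_rep_free3 R S \<phi> A I J \<theta>) = free_module S A"
  "rep_src (ext_rep_free3 R S \<phi> A I J \<theta>) = free_module S I"
  "rep_tgt (ext_rep_free3 R S \<phi> A I J \<theta>) = free_module S J"
  by (simp_all add: ext_rep_free3_def)

context
  fixes R :: "('r, 'x) ring_scheme" and S :: "('s, 'y) ring_scheme" and \<phi> :: "'r \<Rightarrow> 's"
    and \<theta> :: "('r, 'b \<Rightarrow> 'r, 'i \<Rightarrow> 'r, 'j \<Rightarrow> 'r) mod_rep" and A I J
  assumes R: "cring R" and S: "cring S" and \<phi>: "\<phi> \<in> ring_hom R S" and rep: "is_mod_rep R \<theta>"
    and par: "rep_par \<theta> = free_module R A" and src: "rep_src \<theta> = free_module R I" and tgt: "rep_tgt \<theta> = free_module R J"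
begin

private lemma fA: "free_ext R S \<phi>"
  using R S \<phi> by (simp_all add: free_ext_def)

lemma ext_rep_free3_is_mod_rep: "is_mod_rep S (ext_rep_free3 R S \<phi> A I J \<theta>)"
proof -
  have er: "is_mod_rep S (ext_rep_free R S \<phi> I J \<theta>)" by (rule ext_rep_free_is_mod_rep[OF R S \<phi> rep src tgt])
  note sel = ext_rep_free_sel[OF R S \<phi> rep src tgt, unfolded par]
  note a1 = lin_map_rep_act1[OF er, unfolded sel] and a2 = lin_map_rep_act2[OF er, unfolded sel]
  note iso = free_ext.free_iso_lin[OF fA, of A]
  show ?thesis
  proof (rule is_mod_repI; unfold ext_rep_free3_sel)
    show "module S (free_module S A)" "module S (free_module S I)" "module S (free_module S J)"
      using S by (simp_all add: cring.free_module_module)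
    show "lin_map S (free_module S I) (free_module S J) (rep_act (ext_rep_free3 R S \<phi> A I J \<theta>) x)"
      if "x \<in> carrier (free_module S A)" for x
      using a2[OF lin_mapD(1)[OF iso that]] by (simp add: ext_rep_free3_def)
    show "lin_map S (free_module S A) (free_module S J) (\<lambda>C. rep_act (ext_rep_free3 R S \<phi> A I J \<theta>) C y)"
      if y: "y \<in> carrier (free_module S I)" for y
      using lin_map_comp[OF iso a1[OF y]] by (simp add: ext_rep_free3_def)
  qed
qed

lemma ext_rep_free3_act:
  assumes "b \<in> A" "i \<in> I"
  shows "rep_act (ext_rep_free3 R S \<phi> A I J \<theta>) (evec S b) (evec S i) = (\<lambda>j. \<phi> (rep_act \<theta> (evec R b) (evec R i) j))"
  using ext_rep_free_act[OF R S \<phi> rep src tgt, of "evec R b" i] assms cring.evec_closed[OF R, of b A]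
  by (simp add: ext_rep_free3_def free_ext.free_iso_evec[OF fA] par)

end

subsection \<open>Constructions of module representations\<close>

lemma (in cring) ret_lin:
  assumes "I \<subseteq> I'" shows "lin_map R (free_module R I') (free_module R I) (ret R I)"
proof (rule lin_mapI)
  fix x assume x: "x \<in> carrier (free_module R I')"
  have "{a. ret R I x a \<noteq> \<zero>} \<subseteq> {a. x a \<noteq> \<zero>}" by (auto simp: ret_def)
  then have "finite {a. ret R I x a \<noteq> \<zero>}" using free_module_finite_support[OF x] by (rule finite_subset)
  then show "ret R I x \<in> carrier (free_module R I)"
    using free_module_closed[OF x] by (simp add: carrier_free_module) (simp add: ret_def)
qed (auto simp: ret_def)

lemma (in cring) inc_lin:
  assumes "J \<subseteq> J'" shows "lin_map R (free_module R J) (free_module R J') (\<lambda>x. x)"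
proof (rule lin_mapI)
  fix x assume x: "x \<in> carrier (free_module R J)"
  then show "x \<in> carrier (free_module R J')"
    using free_module_closed[OF x] assms by (auto simp: carrier_free_module)
qed auto

lemma inflation_is_mod_rep:
  assumes S: "cring S" and rep: "is_mod_rep S \<theta>"
    and src: "rep_src \<theta> = free_module S I" and tgt: "rep_tgt \<theta> = free_module S J"
    and sub: "I \<subseteq> I'" "J \<subseteq> J'"
  shows "is_mod_rep S (inflation S I' J' I \<theta>)"
proof -
  interpret cring S by fact
  note a1 = lin_map_rep_act1[OF rep, unfolded src tgt] and a2 = lin_map_rep_act2[OF rep, unfolded src tgt]
  note r = ret_lin[OF sub(1)] and i = inc_lin[OF sub(2)]
  show ?thesis
  proof (rule is_mod_repI)
    show "lin_map S (rep_src (inflation S I' J' I \<theta>)) (rep_tgt (inflation S I' J' I \<theta>)) (rep_act (inflation S I' J' I \<theta>) m)"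
      if "m \<in> carrier (rep_par (inflation S I' J' I \<theta>))" for m
      using lin_map_comp[OF lin_map_comp[OF r a2] i, of m] that by (simp add: inflation_def)
    show "lin_map S (rep_par (inflation S I' J' I \<theta>)) (rep_tgt (inflation S I' J' I \<theta>)) (\<lambda>m. rep_act (inflation S I' J' I \<theta>) m n)"
      if "n \<in> carrier (rep_src (inflation S I' J' I \<theta>))" for n
      using lin_map_comp[OF a1[OF lin_mapD(1)[OF r]] i, of n] that by (simp add: inflation_def)
  qed (use is_mod_rep_modules[OF rep] in \<open>simp_all add: inflation_def free_module_module\<close>)
qed

lemma restrict_par_is_mod_rep:
  assumes rep: "is_mod_rep S \<theta>" and H: "submodule H S (rep_par \<theta>)"
  shows "is_mod_rep S (restrict_par \<theta> H)"
proof -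
  interpret module S "rep_par \<theta>" by (rule is_mod_rep_modules(1)[OF rep])
  note HM = submoduleE(1)[OF H, THEN subsetD]
  show ?thesis
  proof (rule is_mod_repI)
    show "module S (rep_par (restrict_par \<theta> H))"
      using submodule.submodule_is_module[OF H module_axioms] by (simp add: restrict_par_def)
    show "lin_map S (rep_src (restrict_par \<theta> H)) (rep_tgt (restrict_par \<theta> H)) (rep_act (restrict_par \<theta> H) m)"
      if "m \<in> carrier (rep_par (restrict_par \<theta> H))" for m
      using lin_map_rep_act2[OF rep HM, of m] that by (simp add: restrict_par_def)
    show "lin_map S (rep_par (restrict_par \<theta> H)) (rep_tgt (restrict_par \<theta> H)) (\<lambda>m. rep_act (restrict_par \<theta> H) m n)"
      if "n \<in> carrier (rep_src (restrict_par \<theta> H))" for n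
    proof -
      have "lin_map S (rep_par \<theta>) (rep_tgt \<theta>) (\<lambda>m. rep_act \<theta> m n)"
        using lin_map_rep_act1[OF rep] that by (simp add: restrict_par_def)
      then show ?thesis using HM by (simp add: restrict_par_def lin_map_def Pi_iff)
    qed
  qed (use is_mod_rep_modules[OF rep] in \<open>simp_all add: restrict_par_def\<close>)
qed

lemma dsum_simps [simp]:
  "carrier (dsum_module M N) = carrier M \<times> carrier N"
  "\<zero>\<^bsub>dsum_module M N\<^esub> = (\<zero>\<^bsub>M\<^esub>, \<zero>\<^bsub>N\<^esub>)"
  "(m, n) \<oplus>\<^bsub>dsum_module M N\<^esub> (m', n') = (m \<oplus>\<^bsub>M\<^esub> m', n \<oplus>\<^bsub>N\<^esub> n')"
  "s \<odot>\<^bsub>dsum_module M N\<^esub> (m, n) = (s \<odot>\<^bsub>M\<^esub> m, s \<odot>\<^bsub>N\<^esub> n)"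
  by (simp_all add: dsum_module_def)

lemma dsum_module_module:
  assumes "module S M" "module S N" shows "module S (dsum_module M N)"
proof -
  interpret M: module S M by fact
  interpret N: module S N by fact
  show ?thesis
  proof (rule moduleI)
    show "cring S" ..
    show "abelian_group (dsum_module M N)"
    proof (rule abelian_groupI)
      fix x assume "x \<in> carrier (dsum_module M N)"
      then obtain m n where x: "x = (m, n)" "m \<in> carrier M" "n \<in> carrier N" by auto
      then show "\<exists>y\<in>carrier (dsum_module M N). y \<oplus>\<^bsub>dsum_module M N\<^esub> x = \<zero>\<^bsub>dsum_module M N\<^esub>"
        by (intro bexI[of _ "(\<ominus>\<^bsub>M\<^esub> m, \<ominus>\<^bsub>N\<^esub> n)"]) (simp_all add: M.M.l_neg N.M.l_neg)
    qed (auto simp: M.M.a_ac N.M.a_ac)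
  qed (auto simp: M.smult_l_distr N.smult_l_distr M.smult_r_distr N.smult_r_distr M.smult_assoc1 N.smult_assoc1)
qed

lemma sum_rep_is_mod_rep:
  assumes r: "is_mod_rep S \<rho>" and t: "is_mod_rep S \<tau>"
    and src: "rep_src \<tau> = rep_src \<rho>" and tgt: "rep_tgt \<tau> = rep_tgt \<rho>"
  shows "is_mod_rep S (sum_rep \<rho> \<tau>)"
proof -
  note rm = is_mod_rep_modules[OF r] and tm = is_mod_rep_modules[OF t]
  interpret P: module S "rep_tgt \<rho>" by (rule rm(3))
  show ?thesis
  proof (rule is_mod_repI)
    show "module S (rep_par (sum_rep \<rho> \<tau>))"
      using dsum_module_module[OF rm(1) tm(1)] by (simp add: sum_rep_def)
    show "lin_map S (rep_src (sum_rep \<rho> \<tau>)) (rep_tgt (sum_rep \<rho> \<tau>)) (rep_act (sum_rep \<rho> \<tau>) mn)"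
      if mn: "mn \<in> carrier (rep_par (sum_rep \<rho> \<tau>))" for mn
    proof -
      obtain m n where "mn = (m, n)" "m \<in> carrier (rep_par \<rho>)" "n \<in> carrier (rep_par \<tau>)"
        using mn by (auto simp: sum_rep_def)
      then show ?thesis
        using lin_map_add[OF P.module_axioms lin_map_rep_act2[OF r] lin_map_rep_act2[OF t, unfolded src tgt], of m n]
        by (simp add: sum_rep_def)
    qed
    show "lin_map S (rep_par (sum_rep \<rho> \<tau>)) (rep_tgt (sum_rep \<rho> \<tau>)) (\<lambda>mn. rep_act (sum_rep \<rho> \<tau>) mn y)"
      if y: "y \<in> carrier (rep_src (sum_rep \<rho> \<tau>))" for y
    proof -
      have y': "y \<in> carrier (rep_src \<rho>)" "y \<in> carrier (rep_src \<tau>)" using y src by (simp_all add: sum_rep_def)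
      have "lin_map S (dsum_module (rep_par \<rho>) (rep_par \<tau>)) (rep_tgt \<rho>) (\<lambda>mn. rep_act \<rho> (fst mn) y)"
        using lin_mapD[OF lin_map_rep_act1[OF r y'(1)]] by (intro lin_mapI) auto
      moreover have "lin_map S (dsum_module (rep_par \<rho>) (rep_par \<tau>)) (rep_tgt \<rho>) (\<lambda>mn. rep_act \<tau> (snd mn) y)"
        using lin_mapD[OF lin_map_rep_act1[OF t y'(2)]] tgt by (intro lin_mapI) auto
      ultimately show ?thesis
        using lin_map_add[OF P.module_axioms] by (simp add: sum_rep_def case_prod_beta')
    qed
  qed (use rm in \<open>simp_all add: sum_rep_def\<close>)
qed

subsection \<open>Average sizes of kernels\<close>

text \<open>All fibres over the image are translates of the kernel.\<close>

lemma card_kernel_image: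
  assumes N: "module S N" and P: "module S P" and f: "lin_map S N P f" and fin: "finite (carrier N)"
  shows "card (carrier N) = card {x \<in> carrier N. f x = \<zero>\<^bsub>P\<^esub>} * card (f ` carrier N)"
proof -
  interpret N: module S N by fact
  interpret P: module S P by fact
  let ?K = "{x \<in> carrier N. f x = \<zero>\<^bsub>P\<^esub>}"
  have "card {x \<in> carrier N. f x = z} = card ?K" if z: "z \<in> f ` carrier N" for z
  proof -
    obtain a where a: "a \<in> carrier N" "z = f a" using z by auto
    have "bij_betw (\<lambda>x. x \<oplus>\<^bsub>N\<^esub> a) ?K {x \<in> carrier N. f x = z}"
    proof (rule bij_betw_byWitness[where f' = "\<lambda>x. x \<ominus>\<^bsub>N\<^esub> a"])
      show "\<forall>x\<in>?K. x \<oplus>\<^bsub>N\<^esub> a \<ominus>\<^bsub>N\<^esub> a = x"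
        using a by (auto simp: N.M.minus_eq N.M.a_assoc N.M.r_neg)
      show "\<forall>x\<in>{x \<in> carrier N. f x = z}. x \<ominus>\<^bsub>N\<^esub> a \<oplus>\<^bsub>N\<^esub> a = x"
        using a by (auto simp: N.M.minus_eq N.M.a_assoc N.M.l_neg)
      show "(\<lambda>x. x \<oplus>\<^bsub>N\<^esub> a) ` ?K \<subseteq> {x \<in> carrier N. f x = z}"
        using a lin_mapD(1,2)[OF f] by auto
      show "(\<lambda>x. x \<ominus>\<^bsub>N\<^esub> a) ` {x \<in> carrier N. f x = z} \<subseteq> ?K"
        using a lin_mapD(1)[OF f] lin_map_diff[OF N P f] by (auto simp: P.M.minus_eq P.M.r_neg)
    qed
    then show ?thesis by (rule bij_betw_same_card[symmetric])
  qed
  then have "(\<Sum>z\<in>f ` carrier N. card {x \<in> carrier N. f x = z}) = card (f ` carrier N) * card ?K" by simp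
  moreover have "(\<Sum>z\<in>f ` carrier N. card {x \<in> carrier N. f x = z}) = card (carrier N)"
    using sum.group[of "carrier N" "f ` carrier N" f "\<lambda>_. 1 :: nat"] fin by simp
  ultimately show ?thesis by (simp add: mult.commute)
qed

lemma ask_images:
  assumes rep: "is_mod_rep S \<theta>" and fin: "finite (carrier (rep_par \<theta>))" "finite (carrier (rep_src \<theta>))"
  shows "ask \<theta> = (\<Sum>y\<in>carrier (rep_src \<theta>). 1 / of_nat (card ((\<lambda>m. rep_act \<theta> m y) ` carrier (rep_par \<theta>))))"
proof -
  let ?M = "carrier (rep_par \<theta>)" and ?N = "carrier (rep_src \<theta>)"
  let ?z = "\<zero>\<^bsub>rep_tgt \<theta>\<^esub>"
  note mods = is_mod_rep_modules[OF rep]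
  interpret M: module S "rep_par \<theta>" by (rule mods(1))
  have M0: "card ?M \<noteq> 0" using fin M.M.zero_closed by auto
  have "(\<Sum>m\<in>?M. of_nat (card (rep_ker \<theta> m)) :: rat) = (\<Sum>m\<in>?M. \<Sum>y\<in>?N. if rep_act \<theta> m y = ?z then 1 else 0)"
    using fin by (intro sum.cong refl) (simp add: rep_ker_def sum.If_cases Int_def)
  also have "\<dots> = (\<Sum>y\<in>?N. \<Sum>m\<in>?M. if rep_act \<theta> m y = ?z then 1 else 0)" by (rule sum.swap)
  also have "\<dots> = (\<Sum>y\<in>?N. of_nat (card {m \<in> ?M. rep_act \<theta> m y = ?z}))"
    using fin by (intro sum.cong refl) (simp add: sum.If_cases Int_def)
  finally have "ask \<theta> = (\<Sum>y\<in>?N. of_nat (card {m \<in> ?M. rep_act \<theta> m y = ?z}) / of_nat (card ?M))"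
    by (simp add: ask_def sum_divide_distrib)
  also have "\<dots> = (\<Sum>y\<in>?N. 1 / of_nat (card ((\<lambda>m. rep_act \<theta> m y) ` ?M)))"
  proof (rule sum.cong[OF refl])
    fix y assume y: "y \<in> ?N"
    \<comment> \<open>For fixed \<open>y\<close> the action is linear in the parameter, so the
      proportion of parameters that kill \<open>y\<close> is the reciprocal of the size of the
      image.\<close>
    have "card ?M = card {m \<in> ?M. rep_act \<theta> m y = ?z} * card ((\<lambda>m. rep_act \<theta> m y) ` ?M)"
      by (rule card_kernel_image[OF mods(1,3) lin_map_rep_act1[OF rep y] fin(1)])
    from arg_cong[OF this, of "of_nat :: nat \<Rightarrow> rat"] have "(of_nat (card ?M) :: rat) =
        of_nat (card {m \<in> ?M. rep_act \<theta> m y = ?z}) * of_nat (card ((\<lambda>m. rep_act \<theta> m y) ` ?M))"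
      by (simp only: of_nat_mult)
    moreover have "(of_nat (card ?M) :: rat) \<noteq> 0" using M0 by simp
    ultimately show "of_nat (card {m \<in> ?M. rep_act \<theta> m y = ?z}) / of_nat (card ?M) =
        (1 / of_nat (card ((\<lambda>m. rep_act \<theta> m y) ` ?M)) :: rat)" by auto
  qed
  finally show ?thesis .
qed

subsection \<open>Finitely generated modules\<close>

lemma fin_genI:
  assumes "module S M" "finite G" "G \<subseteq> carrier M"
    and "\<And>H. submodule H S M \<Longrightarrow> G \<subseteq> H \<Longrightarrow> carrier M \<subseteq> H"
  shows "fin_gen S M"
proof -
  interpret module S M by fact
  have "gen_submodule S M G = carrier M"
    using submoduleE(1)[OF gen_submodule_submodule[OF assms(3)]]
      assms(4)[OF gen_submodule_submodule[OF assms(3)] gen_submodule_incl] by (rule subset_antisym)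
  then show ?thesis using assms(2,3) by (auto simp: fin_gen_def)
qed

lemma fin_genD:
  assumes "fin_gen S M"
  shows "\<exists>G. finite G \<and> G \<subseteq> carrier M \<and> (\<forall>H. submodule H S M \<longrightarrow> G \<subseteq> H \<longrightarrow> carrier M \<subseteq> H)"
proof -
  obtain G where "G \<subseteq> carrier M" "finite G" "gen_submodule S M G = carrier M"
    using assms by (auto simp: fin_gen_def)
  then show ?thesis using gen_submodule_least[of _ S M G] by (intro exI[of _ G]) simp
qed

lemma (in cring) fin_gen_free: "finite A \<Longrightarrow> fin_gen R (free_module R A)"
  using free_module_gen[of A] evec_closed[of _ A] by (auto simp: fin_gen_def intro!: exI[of _ "evec R ` A"])

lemma fin_gen_image:
  assumes N: "module S N" and P: "module S P" and f: "lin_map S N P f" and surj: "carrier P \<subseteq> f ` carrier N"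
    and fg: "fin_gen S N"
  shows "fin_gen S P"
proof -
  obtain G where G: "finite G" "G \<subseteq> carrier N" "\<forall>H. submodule H S N \<longrightarrow> G \<subseteq> H \<longrightarrow> carrier N \<subseteq> H"
    using fin_genD[OF fg] by auto
  show ?thesis
  proof (rule fin_genI[OF P])
    show "finite (f ` G)" "f ` G \<subseteq> carrier P" using G lin_mapD(1)[OF f] by auto
    fix H assume H: "submodule H S P" "f ` G \<subseteq> H"
    have "carrier N \<subseteq> {x \<in> carrier N. f x \<in> H}"
      by (rule G(3)[rule_format, OF lin_map_preimage[OF N P f H(1)]]) (use G H in auto)
    then show "carrier P \<subseteq> H" using surj by auto
  qed
qed

lemma fin_gen_dsum:
  assumes M: "module S M" and N: "module S N" and "fin_gen S M" "fin_gen S N"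
  shows "fin_gen S (dsum_module M N)"
proof -
  interpret M: module S M by fact
  interpret N: module S N by fact
  obtain G where G: "finite G" "G \<subseteq> carrier M" "\<forall>H. submodule H S M \<longrightarrow> G \<subseteq> H \<longrightarrow> carrier M \<subseteq> H"
    using fin_genD[OF assms(3)] by auto
  obtain G' where G': "finite G'" "G' \<subseteq> carrier N" "\<forall>H. submodule H S N \<longrightarrow> G' \<subseteq> H \<longrightarrow> carrier N \<subseteq> H"
    using fin_genD[OF assms(4)] by auto
  have D: "module S (dsum_module M N)" by (rule dsum_module_module[OF M N])
  interpret D: module S "dsum_module M N" by (rule D)
  have i1: "lin_map S M (dsum_module M N) (\<lambda>m. (m, \<zero>\<^bsub>N\<^esub>))" and i2: "lin_map S N (dsum_module M N) (\<lambda>n. (\<zero>\<^bsub>M\<^esub>, n))"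
    by (auto intro!: lin_mapI)
  show ?thesis
  proof (rule fin_genI[OF D])
    show "finite (G \<times> {\<zero>\<^bsub>N\<^esub>} \<union> {\<zero>\<^bsub>M\<^esub>} \<times> G')" "G \<times> {\<zero>\<^bsub>N\<^esub>} \<union> {\<zero>\<^bsub>M\<^esub>} \<times> G' \<subseteq> carrier (dsum_module M N)"
      using G G' by auto
    fix H assume H: "submodule H S (dsum_module M N)" and sub: "G \<times> {\<zero>\<^bsub>N\<^esub>} \<union> {\<zero>\<^bsub>M\<^esub>} \<times> G' \<subseteq> H"
    have 1: "carrier M \<subseteq> {m \<in> carrier M. (m, \<zero>\<^bsub>N\<^esub>) \<in> H}"
      by (rule G(3)[rule_format, OF lin_map_preimage[OF M D i1 H]]) (use G sub in auto)
    have 2: "carrier N \<subseteq> {n \<in> carrier N. (\<zero>\<^bsub>M\<^esub>, n) \<in> H}"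
      by (rule G'(3)[rule_format, OF lin_map_preimage[OF N D i2 H]]) (use G' sub in auto)
    show "carrier (dsum_module M N) \<subseteq> H"
    proof
      fix x assume "x \<in> carrier (dsum_module M N)"
      then obtain m n where x: "x = (m, n)" "m \<in> carrier M" "n \<in> carrier N" by auto
      have "(m, \<zero>\<^bsub>N\<^esub>) \<oplus>\<^bsub>dsum_module M N\<^esub> (\<zero>\<^bsub>M\<^esub>, n) \<in> H"
        using 1 2 x by (intro D.submoduleE(5)[OF H]) auto
      then show "x \<in> H" using x by simp
    qed
  qed
qed

text \<open>Adjoining a generator \<open>x\<close> to a finite submodule \<open>H\<close> gives the
  image of \<open>carrier S \<times> H\<close>, which is again finite. This provides the finiteness
  that the counting formula for \<open>ask\<close> requires.\<close>

lemma finite_fin_gen: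
  assumes M: "module S M" and fin: "finite (carrier S)" and "fin_gen S M"
  shows "finite (carrier M)"
proof -
  interpret M: module S M by fact
  have ex: "\<exists>H. submodule H S M \<and> finite H \<and> G \<subseteq> H" if "finite G" "G \<subseteq> carrier M" for G
    using that
  proof (induction G)
    case empty
    have "submodule {\<zero>\<^bsub>M\<^esub>} S M" by (rule M.submodule_smultI) auto
    then show ?case by (intro exI[of _ "{\<zero>\<^bsub>M\<^esub>}"]) simp
  next
    case (insert x G)
    then obtain H where H: "submodule H S M" "finite H" "G \<subseteq> H" by auto
    note HM = M.submoduleE(1)[OF H(1), THEN subsetD]
    have x: "x \<in> carrier M" using insert by simp
    let ?f = "\<lambda>(s, h). s \<odot>\<^bsub>M\<^esub> x \<oplus>\<^bsub>M\<^esub> h"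
    let ?H = "?f ` (carrier S \<times> H)"
    have "submodule ?H S M"
    proof (rule M.submodule_smultI)
      show "?H \<subseteq> carrier M" using HM x by auto
      show "\<zero>\<^bsub>M\<^esub> \<in> ?H"
        using x M.submodule_zero[OF H(1)] by (intro image_eqI[of _ _ "(\<zero>\<^bsub>S\<^esub>, \<zero>\<^bsub>M\<^esub>)"]) auto
    next
      fix a b assume "a \<in> ?H" "b \<in> ?H"
      then obtain s h s' h' where ab: "a = s \<odot>\<^bsub>M\<^esub> x \<oplus>\<^bsub>M\<^esub> h" "b = s' \<odot>\<^bsub>M\<^esub> x \<oplus>\<^bsub>M\<^esub> h'"
        "s \<in> carrier S" "s' \<in> carrier S" "h \<in> H" "h' \<in> H" by auto
      have "a \<oplus>\<^bsub>M\<^esub> b = (s \<oplus>\<^bsub>S\<^esub> s') \<odot>\<^bsub>M\<^esub> x \<oplus>\<^bsub>M\<^esub> (h \<oplus>\<^bsub>M\<^esub> h')"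
        using ab x HM[of h] HM[of h'] by (simp add: M.smult_l_distr M.M.a_ac)
      then show "a \<oplus>\<^bsub>M\<^esub> b \<in> ?H"
        using ab M.submoduleE(5)[OF H(1)] by (intro image_eqI[of _ _ "(s \<oplus>\<^bsub>S\<^esub> s', h \<oplus>\<^bsub>M\<^esub> h')"]) auto
    next
      fix r a assume r: "r \<in> carrier S" and "a \<in> ?H"
      then obtain s h where a: "a = s \<odot>\<^bsub>M\<^esub> x \<oplus>\<^bsub>M\<^esub> h" "s \<in> carrier S" "h \<in> H" by auto
      have "r \<odot>\<^bsub>M\<^esub> a = (r \<otimes>\<^bsub>S\<^esub> s) \<odot>\<^bsub>M\<^esub> x \<oplus>\<^bsub>M\<^esub> r \<odot>\<^bsub>M\<^esub> h"
        using a x r HM[of h] by (simp add: M.smult_r_distr M.smult_assoc1)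
      then show "r \<odot>\<^bsub>M\<^esub> a \<in> ?H"
        using a r M.submoduleE(4)[OF H(1)] by (intro image_eqI[of _ _ "(r \<otimes>\<^bsub>S\<^esub> s, r \<odot>\<^bsub>M\<^esub> h)"]) auto
    qed
    moreover have "finite ?H" using fin H by auto
    moreover have "x \<in> ?H"
      using x M.submodule_zero[OF H(1)] by (intro image_eqI[of _ _ "(\<one>\<^bsub>S\<^esub>, \<zero>\<^bsub>M\<^esub>)"]) auto
    moreover have "h \<in> ?H" if "h \<in> G" for h
      using x H HM[of h] that by (intro image_eqI[of _ _ "(\<zero>\<^bsub>S\<^esub>, h)"]) auto
    ultimately show ?case by (intro exI[of _ ?H]) auto
  qed
  obtain G where G: "finite G" "G \<subseteq> carrier M" "\<forall>H. submodule H S M \<longrightarrow> G \<subseteq> H \<longrightarrow> carrier M \<subseteq> H"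
    using fin_genD[OF assms(3)] by auto
  from ex[OF G(1,2)] obtain H where H: "submodule H S M" "finite H" "G \<subseteq> H" by auto
  have "carrier M \<subseteq> H" by (rule G(3)[rule_format, OF H(1,3)])
  then show ?thesis using H(2) by (rule finite_subset)
qed

text \<open>The elements of \<open>M\<close> whose pure tensors lie in a given submodule form a
  submodule. If it contains the generators of \<open>M\<close>, it is all of \<open>M\<close>, and
  pure tensors generate.\<close>

lemma (in scalar_ext) fin_gen_ext:
  assumes "fin_gen R M" shows "fin_gen S E"
proof -
  interpret M: module R M by (rule M_module)
  interpret E: module S E by (rule E_module)
  obtain G where G: "finite G" "G \<subseteq> carrier M" "\<forall>H. submodule H R M \<longrightarrow> G \<subseteq> H \<longrightarrow> carrier M \<subseteq> H"
    using fin_genD[OF assms] by auto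
  show ?thesis
  proof (rule fin_genI[OF E_module])
    show "finite (t ` G)" "t ` G \<subseteq> carrier E" using G t_closed by auto
    fix H assume H: "submodule H S E" and sub: "t ` G \<subseteq> H"
    have "submodule {m \<in> carrier M. t m \<in> H} R M"
    proof (rule M.submodule_smultI)
      have "t \<zero>\<^bsub>M\<^esub> = t (\<zero>\<^bsub>R\<^esub> \<odot>\<^bsub>M\<^esub> \<zero>\<^bsub>M\<^esub>)" by simp
      also have "\<dots> = \<phi> \<zero>\<^bsub>R\<^esub> \<odot>\<^bsub>E\<^esub> t \<zero>\<^bsub>M\<^esub>" by (rule t_smult) auto
      also have "\<dots> = \<zero>\<^bsub>E\<^esub>"
        using t_closed[of "\<zero>\<^bsub>M\<^esub>"] ring_hom_zero[OF \<phi>_hom] M.R.ring_axioms cring.axioms(1)[OF S_cring] by simp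
      finally show "\<zero>\<^bsub>M\<^esub> \<in> {m \<in> carrier M. t m \<in> H}" using E.submodule_zero[OF H] by simp
    qed (auto simp: t_add t_smult E.submoduleE(4,5)[OF H] \<phi>_closed)
    from G(3)[rule_format, OF this] have "carrier M \<subseteq> {m \<in> carrier M. t m \<in> H}" using sub G by auto
    then show "carrier E \<subseteq> H" using E_gen[OF H] by auto
  qed
qed

section \<open>Polynomial rings and Fitting ideals\<close>

subsection \<open>Subrings of type class rings\<close>

lemma ring_of_type_algebra_simps [simp]:
  "x \<oplus>\<^bsub>ring_of_type_algebra\<lparr>carrier := C\<rparr>\<^esub> y = x + y"
  "x \<otimes>\<^bsub>ring_of_type_algebra\<lparr>carrier := C\<rparr>\<^esub> y = x * y"
  "\<zero>\<^bsub>ring_of_type_algebra\<lparr>carrier := C\<rparr>\<^esub> = 0"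
  "\<one>\<^bsub>ring_of_type_algebra\<lparr>carrier := C\<rparr>\<^esub> = 1"
  "carrier (ring_of_type_algebra\<lparr>carrier := C\<rparr>) = C"
  by (simp_all add: ring_of_type_algebra_def)

lemma base_ring_eq: "base_ring = (ring_of_type_algebra\<lparr>carrier := UNIV\<rparr> :: 'a::comm_ring_1 ring)"
  by (simp add: ring_of_type_algebra_def)

lemma base_ring_simps [simp]:
  fixes x y :: "'a::comm_ring_1"
  shows "x \<oplus>\<^bsub>base_ring\<^esub> y = x + y" "x \<otimes>\<^bsub>base_ring\<^esub> y = x * y"
    "\<zero>\<^bsub>base_ring\<^esub> = (0::'a)" "\<one>\<^bsub>base_ring\<^esub> = (1::'a)" "carrier base_ring = (UNIV :: 'a set)"
  by (simp_all add: ring_of_type_algebra_def)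

text \<open>The rings of polynomials have a carrier smaller than their type. On such a carrier the
  operations of the record are those of the type class, which gives access to ordinary sums,
  products and determinants.\<close>

locale type_subring =
  fixes C :: "'a::comm_ring_1 set"
  assumes add: "x \<in> C \<Longrightarrow> y \<in> C \<Longrightarrow> x + y \<in> C" and mult: "x \<in> C \<Longrightarrow> y \<in> C \<Longrightarrow> x * y \<in> C"
    and uminus: "x \<in> C \<Longrightarrow> - x \<in> C" and zero: "0 \<in> C" and one: "1 \<in> C"
begin

abbreviation "RC \<equiv> ring_of_type_algebra\<lparr>carrier := C\<rparr>"

lemma RC_cring: "cring RC"
proof (rule cringI)
  show "abelian_group RC"
    by (rule abelian_groupI) (auto simp: add zero algebra_simps intro!: bexI[of _ "- _"] uminus)
  show "comm_monoid RC"
    by (rule comm_monoidI) (auto simp: mult one algebra_simps)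
qed (auto simp: algebra_simps)

interpretation RC: cring RC by (rule RC_cring)

lemma RC_finsum: "(\<And>x. x \<in> A \<Longrightarrow> f x \<in> C) \<Longrightarrow> finsum RC f A = sum f A"
  by (induction A rule: infinite_finite_induct) (auto simp: RC.finsum_insert Pi_iff)

lemma RC_finprod: "(\<And>x. x \<in> A \<Longrightarrow> f x \<in> C) \<Longrightarrow> finprod RC f A = prod f A"
  by (induction A rule: infinite_finite_induct) (auto simp: RC.finprod_insert Pi_iff)

lemma RC_minus: "x \<in> C \<Longrightarrow> \<ominus>\<^bsub>RC\<^esub> x = - x"
  by (rule RC.minus_equality) (auto simp: uminus)

lemma prod_closed: "(\<And>x. x \<in> A \<Longrightarrow> f x \<in> C) \<Longrightarrow> prod f A \<in> C"
  by (induction A rule: infinite_finite_induct) (auto simp: one mult)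

lemma RC_ring_det:
  assumes "\<And>p q. p < k \<Longrightarrow> q < k \<Longrightarrow> A p q \<in> C"
  shows "ring_det RC k A = det (mat k k (\<lambda>(p, q). A p q))"
proof -
  have perm: "p i < k" if "p permutes {..<k}" "i < k" for p i
    using permutes_in_image[OF that(1), of i] that(2) by simp
  have sgn: "(if evenperm p then \<one>\<^bsub>RC\<^esub> else \<ominus>\<^bsub>RC\<^esub> \<one>\<^bsub>RC\<^esub>) = signof p" for p :: "nat \<Rightarrow> nat"
    by (simp add: RC_minus one sign_def)
  have pr: "(\<Otimes>\<^bsub>RC\<^esub>i\<in>{..<k}. A i (p i)) = (\<Prod>i<k. A i (p i))" "(\<Prod>i<k. A i (p i)) \<in> C"
    if "p permutes {..<k}" for p
    using assms perm[OF that] by (auto intro!: RC_finprod prod_closed)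
  have "ring_det RC k A = (\<Oplus>\<^bsub>RC\<^esub>p\<in>{p. p permutes {..<k}}. signof p * (\<Prod>i<k. A i (p i)))"
    unfolding ring_det_def sgn
    by (rule RC.add.finprod_cong'[OF refl])
      (auto simp: pr sign_def intro!: mult uminus one)
  also have "\<dots> = (\<Sum>p\<in>{p. p permutes {..<k}}. signof p * (\<Prod>i<k. A i (p i)))"
    by (rule RC_finsum) (auto simp: pr sign_def intro!: mult uminus one)
  also have "\<dots> = det (mat k k (\<lambda>(p, q). A p q))"
    unfolding det_def using perm by (auto simp: lessThan_atLeast0 intro!: sum.cong prod.cong)
  finally show ?thesis .
qed

end

lemma type_subring_UNIV: "type_subring UNIV"
  by unfold_locales auto

lemma cring_base_ring: "cring (base_ring :: 'a::comm_ring_1 ring)"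
  by (rule cring_from_type_algebra)

lemma (in cring) det_term_closed:
  assumes "\<And>i. i < k \<Longrightarrow> f i \<in> carrier R"
  shows "(if evenperm p then \<one> else \<ominus> \<one>) \<otimes> (\<Otimes>i\<in>{..<k}. f i) \<in> carrier R"
  using assms by (intro m_closed finprod_closed) auto

lemma (in cring) ring_det_cong:
  assumes A: "\<And>p q. p < k \<Longrightarrow> q < k \<Longrightarrow> A p q = A' p q" "\<And>p q. p < k \<Longrightarrow> q < k \<Longrightarrow> A' p q \<in> carrier R"
  shows "ring_det R k A = ring_det R k A'"
  unfolding ring_det_def
proof (rule add.finprod_cong'[OF refl])
  have perm: "p i < k" if "p \<in> {p. p permutes {..<k}}" "i < k" for p i
    using that permutes_in_image[of p "{..<k}" i] by simp
  show "(\<lambda>p. (if evenperm p then \<one> else \<ominus> \<one>) \<otimes> (\<Otimes>i\<in>{..<k}. A' i (p i))) \<in> {p. p permutes {..<k}} \<rightarrow> carrier R"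
    by (rule Pi_I, rule det_term_closed) (rule A(2), simp, rule perm)
  fix p assume p: "p \<in> {p. p permutes {..<k}}"
  have "(\<Otimes>i\<in>{..<k}. A i (p i)) = (\<Otimes>i\<in>{..<k}. A' i (p i))"
    using A perm[OF p] by (intro finprod_cong' refl) auto
  then show "(if evenperm p then \<one> else \<ominus> \<one>) \<otimes> (\<Otimes>i\<in>{..<k}. A i (p i)) =
      (if evenperm p then \<one> else \<ominus> \<one>) \<otimes> (\<Otimes>i\<in>{..<k}. A' i (p i))" by simp
qed

lemma ring_hom_det:
  assumes "cring R" "cring S" and h: "h \<in> ring_hom R S" and A: "\<And>p q. p < k \<Longrightarrow> q < k \<Longrightarrow> A p q \<in> carrier R"
  shows "ring_det S k (\<lambda>p q. h (A p q)) = h (ring_det R k A)"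
proof -
  interpret h: ring_hom_cring R S h by (simp add: ring_hom_cring_def ring_hom_cring_axioms_def assms)
  have perm: "p i < k" if "p permutes {..<k}" "i < k" for p i
    using permutes_in_image[OF that(1), of i] that(2) by simp
  have "h (ring_det R k A) = (\<Oplus>\<^bsub>S\<^esub>p\<in>{p. p permutes {..<k}}.
     h ((if evenperm p then \<one>\<^bsub>R\<^esub> else \<ominus>\<^bsub>R\<^esub> \<one>\<^bsub>R\<^esub>) \<otimes>\<^bsub>R\<^esub> (\<Otimes>\<^bsub>R\<^esub>i\<in>{..<k}. A i (p i))))"
    unfolding ring_det_def
  proof (rule h.hom_finsum[unfolded comp_def], rule Pi_I, rule h.R.det_term_closed)
    fix p i assume "p \<in> {p. p permutes {..<k}}" "i < k"
    then show "A i (p i) \<in> carrier R" using A[of i "p i"] perm[of p i] by simp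
  qed
  also have "\<dots> = ring_det S k (\<lambda>p q. h (A p q))"
    unfolding ring_det_def
  proof (rule h.S.add.finprod_cong'[OF refl])
    show "(\<lambda>p. (if evenperm p then \<one>\<^bsub>S\<^esub> else \<ominus>\<^bsub>S\<^esub> \<one>\<^bsub>S\<^esub>) \<otimes>\<^bsub>S\<^esub> (\<Otimes>\<^bsub>S\<^esub>i\<in>{..<k}. h (A i (p i))))
        \<in> {p. p permutes {..<k}} \<rightarrow> carrier S"
    proof (rule Pi_I, rule h.S.det_term_closed)
      fix p i assume "p \<in> {p. p permutes {..<k}}" "i < k"
      then show "h (A i (p i)) \<in> carrier S" using A[of i "p i"] perm[of p i] by simp
    qed
    fix p assume p: "p \<in> {p. p permutes {..<k}}"
    have cl: "(\<lambda>i. A i (p i)) \<in> {..<k} \<rightarrow> carrier R"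
    proof (rule Pi_I)
      fix i assume "i \<in> {..<k}"
      then show "A i (p i) \<in> carrier R" using p A[of i "p i"] perm[of p i] by simp
    qed
    have "(\<Otimes>\<^bsub>R\<^esub>i\<in>{..<k}. A i (p i)) \<in> carrier R" using cl by (rule h.R.finprod_closed)
    then have "h ((if evenperm p then \<one>\<^bsub>R\<^esub> else \<ominus>\<^bsub>R\<^esub> \<one>\<^bsub>R\<^esub>) \<otimes>\<^bsub>R\<^esub> (\<Otimes>\<^bsub>R\<^esub>i\<in>{..<k}. A i (p i))) =
        h (if evenperm p then \<one>\<^bsub>R\<^esub> else \<ominus>\<^bsub>R\<^esub> \<one>\<^bsub>R\<^esub>) \<otimes>\<^bsub>S\<^esub> h (\<Otimes>\<^bsub>R\<^esub>i\<in>{..<k}. A i (p i))"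
      by (intro h.hom_mult) auto
    also have "h (if evenperm p then \<one>\<^bsub>R\<^esub> else \<ominus>\<^bsub>R\<^esub> \<one>\<^bsub>R\<^esub>) = (if evenperm p then \<one>\<^bsub>S\<^esub> else \<ominus>\<^bsub>S\<^esub> \<one>\<^bsub>S\<^esub>)"
      by simp
    also have "h (\<Otimes>\<^bsub>R\<^esub>i\<in>{..<k}. A i (p i)) = (\<Otimes>\<^bsub>S\<^esub>i\<in>{..<k}. h (A i (p i)))"
      using h.hom_finprod[OF cl] by (simp add: comp_def)
    finally show "h ((if evenperm p then \<one>\<^bsub>R\<^esub> else \<ominus>\<^bsub>R\<^esub> \<one>\<^bsub>R\<^esub>) \<otimes>\<^bsub>R\<^esub> (\<Otimes>\<^bsub>R\<^esub>i\<in>{..<k}. A i (p i))) =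
        (if evenperm p then \<one>\<^bsub>S\<^esub> else \<ominus>\<^bsub>S\<^esub> \<one>\<^bsub>S\<^esub>) \<otimes>\<^bsub>S\<^esub> (\<Otimes>\<^bsub>S\<^esub>i\<in>{..<k}. h (A i (p i)))" .
  qed
  finally show ?thesis ..
qed

subsection \<open>Evaluation homomorphisms of monoid rings\<close>

definition mon_eval ::
    "('s, 'x) ring_scheme \<Rightarrow> ('r::comm_ring_1 \<Rightarrow> 's) \<Rightarrow> ('e \<Rightarrow> 's) \<Rightarrow> ('e \<Rightarrow>\<^sub>0 'r) \<Rightarrow> 's" where
  "mon_eval S f \<chi> p = (\<Oplus>\<^bsub>S\<^esub>e\<in>Poly_Mapping.keys p. f (Poly_Mapping.lookup p e) \<otimes>\<^bsub>S\<^esub> \<chi> e)"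

text \<open>Every element is the sum of its terms. All exponents stay inside \<open>E\<close>
  throughout, because evaluation is multiplicative only there.\<close>

lemma poly_mapping_span_induct:
  fixes p :: "'e \<Rightarrow>\<^sub>0 'r::comm_monoid_add"
  assumes zero: "P 0" and single: "\<And>e a. e \<in> E \<Longrightarrow> P (Poly_Mapping.single e a)"
    and add: "\<And>p q. Poly_Mapping.keys p \<subseteq> E \<Longrightarrow> Poly_Mapping.keys q \<subseteq> E \<Longrightarrow> P p \<Longrightarrow> P q \<Longrightarrow> P (p + q)"
    and p: "Poly_Mapping.keys p \<subseteq> E"
  shows "P p"
proof -
  have *: "P (\<Sum>e\<in>B. Poly_Mapping.single e (c e)) \<and> Poly_Mapping.keys (\<Sum>e\<in>B. Poly_Mapping.single e (c e)) \<subseteq> E"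
    if "finite B" "B \<subseteq> E" for B and c :: "'e \<Rightarrow> 'r"
    using that
  proof (induction B)
    case (insert e B)
    have k: "Poly_Mapping.keys (Poly_Mapping.single e (c e)) \<subseteq> E" using insert by simp
    have IH: "P (\<Sum>e\<in>B. Poly_Mapping.single e (c e))" "Poly_Mapping.keys (\<Sum>e\<in>B. Poly_Mapping.single e (c e)) \<subseteq> E"
      using insert by auto
    have "P (Poly_Mapping.single e (c e) + (\<Sum>e\<in>B. Poly_Mapping.single e (c e)))"
      using insert by (intro add k IH single) auto
    moreover have "Poly_Mapping.keys (Poly_Mapping.single e (c e) + (\<Sum>e\<in>B. Poly_Mapping.single e (c e))) \<subseteq> E"
      using keys_add[of "Poly_Mapping.single e (c e)" "\<Sum>e\<in>B. Poly_Mapping.single e (c e)"] k IH(2) by blast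
    ultimately show ?case using insert by simp
  qed (simp add: zero)
  have "p = (\<Sum>e\<in>Poly_Mapping.keys p. Poly_Mapping.single e (Poly_Mapping.lookup p e))"
  proof (rule poly_mapping_eqI)
    fix e
    show "Poly_Mapping.lookup p e =
        Poly_Mapping.lookup (\<Sum>e\<in>Poly_Mapping.keys p. Poly_Mapping.single e (Poly_Mapping.lookup p e)) e"
      by (simp add: lookup_sum lookup_single when_def in_keys_iff)
  qed
  then show ?thesis using *[OF finite_keys p, of "Poly_Mapping.lookup p"] by simp
qed

lemma type_subring_keys:
  fixes E :: "'e::comm_monoid_add set"
  assumes E0: "0 \<in> E" and Eadd: "\<And>e e'. e \<in> E \<Longrightarrow> e' \<in> E \<Longrightarrow> e + e' \<in> E"
  shows "type_subring {p :: 'e \<Rightarrow>\<^sub>0 'r::comm_ring_1. Poly_Mapping.keys p \<subseteq> E}"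
proof
  fix p q :: "'e \<Rightarrow>\<^sub>0 'r" assume pq: "p \<in> {p. Poly_Mapping.keys p \<subseteq> E}" "q \<in> {p. Poly_Mapping.keys p \<subseteq> E}"
  then show "p + q \<in> {p. Poly_Mapping.keys p \<subseteq> E}"
    using keys_add[of p q] by auto
  have "e \<in> E" if e: "e \<in> Poly_Mapping.keys (p * q)" for e
  proof -
    obtain a b where "e = a + b" "a \<in> Poly_Mapping.keys p" "b \<in> Poly_Mapping.keys q"
      using subsetD[OF keys_mult e] by auto
    then show ?thesis using Eadd pq by auto
  qed
  then show "p * q \<in> {p. Poly_Mapping.keys p \<subseteq> E}" by auto
qed (use E0 in auto)

text \<open>Additivity follows by summing over a common set of exponents; multiplicativity is then
  reduced to two monomials by an induction over each factor. The submonoid \<open>E\<close> is there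
  because integral exponents are evaluated through \<open>nat\<close>, which is additive only on
  non-negative integers.\<close>

lemma mon_eval_hom:
  fixes S :: "('s, 'x) ring_scheme" and f :: "'r::comm_ring_1 \<Rightarrow> 's" and \<chi> :: "'e::comm_monoid_add \<Rightarrow> 's"
  assumes S: "cring S" and f: "f \<in> ring_hom base_ring S"
    and E0: "0 \<in> E" and Eadd: "\<And>e e'. e \<in> E \<Longrightarrow> e' \<in> E \<Longrightarrow> e + e' \<in> E"
    and \<chi>: "\<And>e. e \<in> E \<Longrightarrow> \<chi> e \<in> carrier S" and \<chi>0: "\<chi> 0 = \<one>\<^bsub>S\<^esub>"
    and \<chi>add: "\<And>e e'. e \<in> E \<Longrightarrow> e' \<in> E \<Longrightarrow> \<chi> (e + e') = \<chi> e \<otimes>\<^bsub>S\<^esub> \<chi> e'"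
  shows "mon_eval S f \<chi> \<in> ring_hom (ring_of_type_algebra\<lparr>carrier := {p. Poly_Mapping.keys p \<subseteq> E}\<rparr>) S"
    and "\<And>e a. e \<in> E \<Longrightarrow> mon_eval S f \<chi> (Poly_Mapping.single e a) = f a \<otimes>\<^bsub>S\<^esub> \<chi> e"
proof -
  interpret S: cring S by (rule S)
  have fc: "f a \<in> carrier S" and fadd: "f (a + b) = f a \<oplus>\<^bsub>S\<^esub> f b" and fmult: "f (a * b) = f a \<otimes>\<^bsub>S\<^esub> f b"
    and f1: "f 1 = \<one>\<^bsub>S\<^esub>" for a b
    using ring_hom_closed[OF f, of a] ring_hom_add[OF f, of a b] ring_hom_mult[OF f, of a b] ring_hom_one[OF f] by simp_all
  have f0: "f 0 = \<zero>\<^bsub>S\<^esub>"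
    using ring_hom_zero[OF f cring.axioms(1)[OF cring_base_ring] S.ring_axioms] by simp
  have sup: "mon_eval S f \<chi> p = (\<Oplus>\<^bsub>S\<^esub>e\<in>B. f (Poly_Mapping.lookup p e) \<otimes>\<^bsub>S\<^esub> \<chi> e)"
    if "finite B" "Poly_Mapping.keys p \<subseteq> B" "B \<subseteq> E" for p :: "'e \<Rightarrow>\<^sub>0 'r" and B
    unfolding mon_eval_def
  proof (rule S.add.finprod_mono_neutral_cong_left[OF that(1,2)])
    show "(\<lambda>e. f (Poly_Mapping.lookup p e) \<otimes>\<^bsub>S\<^esub> \<chi> e) \<in> B \<rightarrow> carrier S" using \<chi> fc that(3) by auto
    fix e assume "e \<in> B - Poly_Mapping.keys p"
    then show "f (Poly_Mapping.lookup p e) \<otimes>\<^bsub>S\<^esub> \<chi> e = \<zero>\<^bsub>S\<^esub>" using \<chi> that(3) by (auto simp: in_keys_iff f0)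
  qed simp
  have evc: "mon_eval S f \<chi> p \<in> carrier S" if "Poly_Mapping.keys p \<subseteq> E" for p :: "'e \<Rightarrow>\<^sub>0 'r"
    unfolding mon_eval_def using that \<chi> fc by (intro S.finsum_closed) auto
  have evadd: "mon_eval S f \<chi> (p + q) = mon_eval S f \<chi> p \<oplus>\<^bsub>S\<^esub> mon_eval S f \<chi> q"
    if "Poly_Mapping.keys p \<subseteq> E" "Poly_Mapping.keys q \<subseteq> E" for p q :: "'e \<Rightarrow>\<^sub>0 'r"
  proof -
    let ?B = "Poly_Mapping.keys p \<union> Poly_Mapping.keys q"
    have B: "finite ?B" "?B \<subseteq> E" using that by auto
    have "mon_eval S f \<chi> (p + q) = (\<Oplus>\<^bsub>S\<^esub>e\<in>?B. f (Poly_Mapping.lookup (p + q) e) \<otimes>\<^bsub>S\<^esub> \<chi> e)"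
      by (rule sup[OF B(1) keys_add B(2)])
    also have "\<dots> = (\<Oplus>\<^bsub>S\<^esub>e\<in>?B. f (Poly_Mapping.lookup p e) \<otimes>\<^bsub>S\<^esub> \<chi> e \<oplus>\<^bsub>S\<^esub> f (Poly_Mapping.lookup q e) \<otimes>\<^bsub>S\<^esub> \<chi> e)"
      using B(2) \<chi> fc by (intro S.add.finprod_cong') (auto simp: lookup_add fadd S.l_distr)
    also have "\<dots> = (\<Oplus>\<^bsub>S\<^esub>e\<in>?B. f (Poly_Mapping.lookup p e) \<otimes>\<^bsub>S\<^esub> \<chi> e) \<oplus>\<^bsub>S\<^esub> (\<Oplus>\<^bsub>S\<^esub>e\<in>?B. f (Poly_Mapping.lookup q e) \<otimes>\<^bsub>S\<^esub> \<chi> e)"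
      using B(2) \<chi> fc by (intro S.add.finprod_multf) auto
    also have "\<dots> = mon_eval S f \<chi> p \<oplus>\<^bsub>S\<^esub> mon_eval S f \<chi> q"
      using B by (subst (1 2) sup[of ?B]) auto
    finally show ?thesis .
  qed
  have ev1: "mon_eval S f \<chi> (Poly_Mapping.single e a) = f a \<otimes>\<^bsub>S\<^esub> \<chi> e" if "e \<in> E" for e a
  proof -
    have "mon_eval S f \<chi> (Poly_Mapping.single e a) = (\<Oplus>\<^bsub>S\<^esub>e'\<in>{e}. f (Poly_Mapping.lookup (Poly_Mapping.single e a) e') \<otimes>\<^bsub>S\<^esub> \<chi> e')"
      using that by (intro sup) auto
    then show ?thesis using that \<chi> fc by simp
  qed
  show "mon_eval S f \<chi> (Poly_Mapping.single e a) = f a \<otimes>\<^bsub>S\<^esub> \<chi> e" if "e \<in> E" for e a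
    by (rule ev1[OF that])
  interpret C: type_subring "{p :: 'e \<Rightarrow>\<^sub>0 'r. Poly_Mapping.keys p \<subseteq> E}"
    by (rule type_subring_keys[OF E0 Eadd])
  have km: "Poly_Mapping.keys (p * q) \<subseteq> E" if "Poly_Mapping.keys p \<subseteq> E" "Poly_Mapping.keys q \<subseteq> E" for p q :: "'e \<Rightarrow>\<^sub>0 'r"
    using C.mult[of p q] that by simp
  have ev0: "mon_eval S f \<chi> 0 = \<zero>\<^bsub>S\<^esub>" by (simp add: mon_eval_def)
  have evmult1: "mon_eval S f \<chi> (Poly_Mapping.single e a * q) = (f a \<otimes>\<^bsub>S\<^esub> \<chi> e) \<otimes>\<^bsub>S\<^esub> mon_eval S f \<chi> q"
    if e: "e \<in> E" and q: "Poly_Mapping.keys q \<subseteq> E" for e a and q :: "'e \<Rightarrow>\<^sub>0 'r"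
    using q
  proof (rule poly_mapping_span_induct[rotated 3])
    show "mon_eval S f \<chi> (Poly_Mapping.single e a * 0) = (f a \<otimes>\<^bsub>S\<^esub> \<chi> e) \<otimes>\<^bsub>S\<^esub> mon_eval S f \<chi> 0"
      using e by (simp add: ev0 fc \<chi>)
    fix e' b assume e': "e' \<in> E"
    have "mon_eval S f \<chi> (Poly_Mapping.single e a * Poly_Mapping.single e' b) = f (a * b) \<otimes>\<^bsub>S\<^esub> \<chi> (e + e')"
      unfolding mult_single by (rule ev1) (rule Eadd[OF e e'])
    also have "\<dots> = (f a \<otimes>\<^bsub>S\<^esub> f b) \<otimes>\<^bsub>S\<^esub> (\<chi> e \<otimes>\<^bsub>S\<^esub> \<chi> e')"
      by (simp only: \<chi>add[OF e e'] fmult)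
    also have "\<dots> = (f a \<otimes>\<^bsub>S\<^esub> \<chi> e) \<otimes>\<^bsub>S\<^esub> (f b \<otimes>\<^bsub>S\<^esub> \<chi> e')"
      using fc[of a] fc[of b] \<chi>[OF e] \<chi>[OF e'] by (simp add: S.m_ac)
    finally show "mon_eval S f \<chi> (Poly_Mapping.single e a * Poly_Mapping.single e' b) =
        (f a \<otimes>\<^bsub>S\<^esub> \<chi> e) \<otimes>\<^bsub>S\<^esub> mon_eval S f \<chi> (Poly_Mapping.single e' b)"
      unfolding ev1[OF e'] .
  next
    fix p q :: "'e \<Rightarrow>\<^sub>0 'r" assume k: "Poly_Mapping.keys p \<subseteq> E" "Poly_Mapping.keys q \<subseteq> E"
      and IH: "mon_eval S f \<chi> (Poly_Mapping.single e a * p) = (f a \<otimes>\<^bsub>S\<^esub> \<chi> e) \<otimes>\<^bsub>S\<^esub> mon_eval S f \<chi> p"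
        "mon_eval S f \<chi> (Poly_Mapping.single e a * q) = (f a \<otimes>\<^bsub>S\<^esub> \<chi> e) \<otimes>\<^bsub>S\<^esub> mon_eval S f \<chi> q"
    have ks: "Poly_Mapping.keys (Poly_Mapping.single e a) \<subseteq> E" using e by simp
    have "mon_eval S f \<chi> (Poly_Mapping.single e a * (p + q)) =
        mon_eval S f \<chi> (Poly_Mapping.single e a * p) \<oplus>\<^bsub>S\<^esub> mon_eval S f \<chi> (Poly_Mapping.single e a * q)"
      unfolding distrib_left by (rule evadd[OF km[OF ks k(1)] km[OF ks k(2)]])
    also have "\<dots> = (f a \<otimes>\<^bsub>S\<^esub> \<chi> e) \<otimes>\<^bsub>S\<^esub> mon_eval S f \<chi> (p + q)"
      unfolding IH evadd[OF k] using evc[OF k(1)] evc[OF k(2)] fc[of a] \<chi>[OF e] by (simp add: S.r_distr)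
    finally show "mon_eval S f \<chi> (Poly_Mapping.single e a * (p + q)) = (f a \<otimes>\<^bsub>S\<^esub> \<chi> e) \<otimes>\<^bsub>S\<^esub> mon_eval S f \<chi> (p + q)" .
  qed
  have evmult: "mon_eval S f \<chi> (p * q) = mon_eval S f \<chi> p \<otimes>\<^bsub>S\<^esub> mon_eval S f \<chi> q"
    if p: "Poly_Mapping.keys p \<subseteq> E" and q: "Poly_Mapping.keys q \<subseteq> E" for p q :: "'e \<Rightarrow>\<^sub>0 'r"
    using p
  proof (rule poly_mapping_span_induct[rotated 3])
    show "mon_eval S f \<chi> (0 * q) = mon_eval S f \<chi> 0 \<otimes>\<^bsub>S\<^esub> mon_eval S f \<chi> q"
      using evc[OF q] by (simp add: ev0)
    show "mon_eval S f \<chi> (Poly_Mapping.single e a * q) = mon_eval S f \<chi> (Poly_Mapping.single e a) \<otimes>\<^bsub>S\<^esub> mon_eval S f \<chi> q"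
      if "e \<in> E" for e a unfolding ev1[OF that] by (rule evmult1[OF that q])
    fix p p' :: "'e \<Rightarrow>\<^sub>0 'r" assume k: "Poly_Mapping.keys p \<subseteq> E" "Poly_Mapping.keys p' \<subseteq> E"
      and IH: "mon_eval S f \<chi> (p * q) = mon_eval S f \<chi> p \<otimes>\<^bsub>S\<^esub> mon_eval S f \<chi> q"
        "mon_eval S f \<chi> (p' * q) = mon_eval S f \<chi> p' \<otimes>\<^bsub>S\<^esub> mon_eval S f \<chi> q"
    have "mon_eval S f \<chi> ((p + p') * q) = mon_eval S f \<chi> (p * q) \<oplus>\<^bsub>S\<^esub> mon_eval S f \<chi> (p' * q)"
      unfolding distrib_right by (rule evadd[OF km[OF k(1) q] km[OF k(2) q]])
    also have "\<dots> = mon_eval S f \<chi> (p + p') \<otimes>\<^bsub>S\<^esub> mon_eval S f \<chi> q"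
      unfolding IH evadd[OF k] using evc[OF k(1)] evc[OF k(2)] evc[OF q] by (simp add: S.l_distr)
    finally show "mon_eval S f \<chi> ((p + p') * q) = mon_eval S f \<chi> (p + p') \<otimes>\<^bsub>S\<^esub> mon_eval S f \<chi> q" .
  qed
  have "mon_eval S f \<chi> 1 = \<one>\<^bsub>S\<^esub>"
    using ev1[OF E0, of 1] by (simp add: f1 \<chi>0)
  then show "mon_eval S f \<chi> \<in> ring_hom (ring_of_type_algebra\<lparr>carrier := {p. Poly_Mapping.keys p \<subseteq> E}\<rparr>) S"
    by (intro ring_hom_memI) (simp_all add: evc evadd evmult)
qed

text \<open>\<open>\<nu>\<close> turns exponents into natural numbers: it is \<open>nat\<close> for
  the integral exponents of \<open>mpoly_ring\<close> and \<open>id\<close> for the natural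
  exponents of the covering ring.\<close>

definition monomial_eval ::
    "('s, 'x) ring_scheme \<Rightarrow> ('n \<Rightarrow> nat) \<Rightarrow> ('v \<Rightarrow> 's) \<Rightarrow> ('v \<Rightarrow>\<^sub>0 'n::comm_monoid_add) \<Rightarrow> 's" where
  "monomial_eval S \<nu> g e = (\<Otimes>\<^bsub>S\<^esub>v\<in>Poly_Mapping.keys e. g v [^]\<^bsub>S\<^esub> \<nu> (Poly_Mapping.lookup e v))"

lemma monomial_eval:
  fixes S :: "('s, 'x) ring_scheme" and g :: "'v \<Rightarrow> 's" and \<nu> :: "'n::comm_monoid_add \<Rightarrow> nat"
  assumes S: "cring S" and g: "\<And>v. v \<in> V \<Longrightarrow> g v \<in> carrier S" and \<nu>0: "\<nu> 0 = 0"
    and \<nu>add: "\<And>a b. a \<in> A \<Longrightarrow> b \<in> A \<Longrightarrow> \<nu> (a + b) = \<nu> a + \<nu> b"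
  defines "E \<equiv> {e. Poly_Mapping.keys e \<subseteq> V \<and> (\<forall>v. Poly_Mapping.lookup e v \<in> A)}"
  shows "\<And>e. e \<in> E \<Longrightarrow> monomial_eval S \<nu> g e \<in> carrier S"
    and "monomial_eval S \<nu> g 0 = \<one>\<^bsub>S\<^esub>"
    and "\<And>e e'. e \<in> E \<Longrightarrow> e' \<in> E \<Longrightarrow>
      monomial_eval S \<nu> g (e + e') = monomial_eval S \<nu> g e \<otimes>\<^bsub>S\<^esub> monomial_eval S \<nu> g e'"
    and "\<And>v. v \<in> V \<Longrightarrow> \<nu> a = 1 \<Longrightarrow> monomial_eval S \<nu> g (Poly_Mapping.single v a) = g v"
proof -
  interpret S: cring S by (rule S)
  have sup: "monomial_eval S \<nu> g e = (\<Otimes>\<^bsub>S\<^esub>v\<in>W. g v [^]\<^bsub>S\<^esub> \<nu> (Poly_Mapping.lookup e v))"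
    if "finite W" "Poly_Mapping.keys e \<subseteq> W" "W \<subseteq> V" for e W
    unfolding monomial_eval_def
    by (rule S.finprod_mono_neutral_cong_left[OF that(1,2)])
      (use g that(3) in \<open>auto simp: in_keys_iff \<nu>0\<close>)
  show "monomial_eval S \<nu> g e \<in> carrier S" if "e \<in> E" for e
    unfolding monomial_eval_def using that g by (intro S.finprod_closed) (auto simp: E_def)
  show "monomial_eval S \<nu> g 0 = \<one>\<^bsub>S\<^esub>" by (simp add: monomial_eval_def)
  show "monomial_eval S \<nu> g (e + e') = monomial_eval S \<nu> g e \<otimes>\<^bsub>S\<^esub> monomial_eval S \<nu> g e'"
    if e: "e \<in> E" "e' \<in> E" for e e'
  proof -
    let ?W = "Poly_Mapping.keys e \<union> Poly_Mapping.keys e'"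
    have W: "finite ?W" "?W \<subseteq> V" using e by (auto simp: E_def)
    have "monomial_eval S \<nu> g (e + e') = (\<Otimes>\<^bsub>S\<^esub>v\<in>?W. g v [^]\<^bsub>S\<^esub> \<nu> (Poly_Mapping.lookup (e + e') v))"
      by (rule sup[OF W(1) keys_add W(2)])
    also have "\<dots> = (\<Otimes>\<^bsub>S\<^esub>v\<in>?W. g v [^]\<^bsub>S\<^esub> \<nu> (Poly_Mapping.lookup e v) \<otimes>\<^bsub>S\<^esub> g v [^]\<^bsub>S\<^esub> \<nu> (Poly_Mapping.lookup e' v))"
    proof (rule S.finprod_cong'[OF refl])
      show "(\<lambda>v. g v [^]\<^bsub>S\<^esub> \<nu> (Poly_Mapping.lookup e v) \<otimes>\<^bsub>S\<^esub> g v [^]\<^bsub>S\<^esub> \<nu> (Poly_Mapping.lookup e' v)) \<in> ?W \<rightarrow> carrier S"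
        using g W(2) by auto
      fix v assume "v \<in> ?W"
      then have "g v \<in> carrier S" using g W(2) by auto
      moreover have "\<nu> (Poly_Mapping.lookup (e + e') v) = \<nu> (Poly_Mapping.lookup e v) + \<nu> (Poly_Mapping.lookup e' v)"
        using e by (simp add: lookup_add \<nu>add E_def)
      ultimately show "g v [^]\<^bsub>S\<^esub> \<nu> (Poly_Mapping.lookup (e + e') v) =
          g v [^]\<^bsub>S\<^esub> \<nu> (Poly_Mapping.lookup e v) \<otimes>\<^bsub>S\<^esub> g v [^]\<^bsub>S\<^esub> \<nu> (Poly_Mapping.lookup e' v)"
        by (simp add: S.nat_pow_mult)
    qed
    also have "\<dots> = (\<Otimes>\<^bsub>S\<^esub>v\<in>?W. g v [^]\<^bsub>S\<^esub> \<nu> (Poly_Mapping.lookup e v)) \<otimes>\<^bsub>S\<^esub> (\<Otimes>\<^bsub>S\<^esub>v\<in>?W. g v [^]\<^bsub>S\<^esub> \<nu> (Poly_Mapping.lookup e' v))"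
      using g W(2) by (intro S.finprod_multf) auto
    also have "\<dots> = monomial_eval S \<nu> g e \<otimes>\<^bsub>S\<^esub> monomial_eval S \<nu> g e'"
      using W by (subst (1 2) sup[of ?W]) auto
    finally show ?thesis .
  qed
  show "monomial_eval S \<nu> g (Poly_Mapping.single v a) = g v" if v: "v \<in> V" and a: "\<nu> a = 1" for v
  proof -
    have "monomial_eval S \<nu> g (Poly_Mapping.single v a) =
        (\<Otimes>\<^bsub>S\<^esub>w\<in>{v}. g w [^]\<^bsub>S\<^esub> \<nu> (Poly_Mapping.lookup (Poly_Mapping.single v a) w))"
      using v by (intro sup) auto
    then show ?thesis using v g a by simp
  qed
qed

lemma laurent_ring_eq: "laurent_ring V = ring_of_type_algebra\<lparr>carrier := {p. Poly_Mapping.keys p \<subseteq> {e. Poly_Mapping.keys e \<subseteq> V}}\<rparr>"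
  unfolding laurent_ring_def by (intro arg_cong[where f = "\<lambda>C. ring_of_type_algebra\<lparr>carrier := C\<rparr>"]) auto

lemma mpoly_ring_eq: "mpoly_ring V = ring_of_type_algebra\<lparr>carrier := {p. Poly_Mapping.keys p \<subseteq>
    {e. Poly_Mapping.keys e \<subseteq> V \<and> (\<forall>v. Poly_Mapping.lookup e v \<in> {0..})}}\<rparr>"
  unfolding mpoly_ring_def by (intro arg_cong[where f = "\<lambda>C. ring_of_type_algebra\<lparr>carrier := C\<rparr>"]) auto

lemma laurent_subring:
  "type_subring {p :: ('v, 'r::comm_ring_1) laurent. Poly_Mapping.keys p \<subseteq> {e. Poly_Mapping.keys e \<subseteq> V}}"
proof (rule type_subring_keys)
  fix e e' :: "'v \<Rightarrow>\<^sub>0 int" assume "e \<in> {e. Poly_Mapping.keys e \<subseteq> V}" "e' \<in> {e. Poly_Mapping.keys e \<subseteq> V}"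
  then show "e + e' \<in> {e. Poly_Mapping.keys e \<subseteq> V}" using keys_add[of e e'] by auto
qed simp

lemma mpoly_subring:
  "type_subring {p :: ('v, 'r::comm_ring_1) laurent. Poly_Mapping.keys p \<subseteq>
    {e. Poly_Mapping.keys e \<subseteq> V \<and> (\<forall>v. Poly_Mapping.lookup e v \<in> {0..})}}"
proof (rule type_subring_keys)
  fix e e' :: "'v \<Rightarrow>\<^sub>0 int"
  assume "e \<in> {e. Poly_Mapping.keys e \<subseteq> V \<and> (\<forall>v. Poly_Mapping.lookup e v \<in> {0..})}"
    "e' \<in> {e. Poly_Mapping.keys e \<subseteq> V \<and> (\<forall>v. Poly_Mapping.lookup e v \<in> {0..})}"
  then show "e + e' \<in> {e. Poly_Mapping.keys e \<subseteq> V \<and> (\<forall>v. Poly_Mapping.lookup e v \<in> {0..})}"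
    using keys_add[of e e'] by (auto simp: lookup_add)
qed simp

lemma cring_laurent_ring: "cring (laurent_ring V)"
  unfolding laurent_ring_eq by (rule type_subring.RC_cring[OF laurent_subring])

lemma cring_mpoly_ring: "cring (mpoly_ring V)"
  unfolding mpoly_ring_eq by (rule type_subring.RC_cring[OF mpoly_subring])

lemma laurent_ring_simps [simp]:
  "x \<oplus>\<^bsub>laurent_ring V\<^esub> y = x + y" "x \<otimes>\<^bsub>laurent_ring V\<^esub> y = x * y"
  "\<zero>\<^bsub>laurent_ring V\<^esub> = 0" "\<one>\<^bsub>laurent_ring V\<^esub> = 1"
  by (simp_all add: laurent_ring_def)

lemma mpoly_ring_simps [simp]:
  "x \<oplus>\<^bsub>mpoly_ring V\<^esub> y = x + y" "x \<otimes>\<^bsub>mpoly_ring V\<^esub> y = x * y"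
  "\<zero>\<^bsub>mpoly_ring V\<^esub> = 0" "\<one>\<^bsub>mpoly_ring V\<^esub> = 1"
  by (simp_all add: mpoly_ring_def)

lemma lconst_closed: "lconst r \<in> carrier (laurent_ring V)" "lconst r \<in> carrier (mpoly_ring V)"
  by (simp_all add: laurent_ring_def mpoly_ring_def lconst_def)

lemma lvar_closed: "v \<in> V \<Longrightarrow> lvar v \<in> carrier (laurent_ring V)" "v \<in> V \<Longrightarrow> lvar v \<in> carrier (mpoly_ring V)"
  by (auto simp: laurent_ring_def mpoly_ring_def lvar_def lookup_single when_def)

lemma lconst_hom: "lconst \<in> ring_hom base_ring (laurent_ring V)"
  by (rule ring_hom_memI) (simp_all add: lconst_closed, simp_all add: lconst_def single_add mult_single)

lemma mpoly_eval:
  fixes S :: "('s, 'x) ring_scheme" and f :: "'r::comm_ring_1 \<Rightarrow> 's"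
  assumes S: "cring S" and f: "f \<in> ring_hom base_ring S" and y: "\<And>v. v \<in> V \<Longrightarrow> y v \<in> carrier S"
  shows "\<exists>ev. ev \<in> ring_hom (mpoly_ring V) S \<and> (\<forall>v\<in>V. ev (lvar v) = y v) \<and> (\<forall>r. ev (lconst r) = f r)"
proof -
  let ?E = "{e. Poly_Mapping.keys e \<subseteq> V \<and> (\<forall>v. Poly_Mapping.lookup e v \<in> {0::int..})}"
  let ?\<chi> = "monomial_eval S nat y"
  have nadd: "a \<in> {0..} \<Longrightarrow> b \<in> {0..} \<Longrightarrow> nat (a + b) = nat a + nat b" for a b by auto
  have n0: "nat 0 = 0" by simp
  have \<chi>1: "?\<chi> e \<in> carrier S" if "e \<in> ?E" for e
    by (rule monomial_eval(1)[where V = V and A = "{0..}"]) (use S y n0 nadd that in auto)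
  have \<chi>2: "?\<chi> 0 = \<one>\<^bsub>S\<^esub>"
    by (rule monomial_eval(2)[where V = V and A = "{0..}"]) (use S y n0 nadd in auto)
  have \<chi>3: "?\<chi> (e + e') = ?\<chi> e \<otimes>\<^bsub>S\<^esub> ?\<chi> e'" if "e \<in> ?E" "e' \<in> ?E" for e e'
    by (rule monomial_eval(3)[where V = V and A = "{0..}"]) (use S y n0 nadd that in auto)
  have \<chi>4: "?\<chi> (Poly_Mapping.single v 1) = y v" if "v \<in> V" for v
    by (rule monomial_eval(4)[where V = V and A = "{0..}"]) (use S y n0 nadd that in auto)
  have E0: "0 \<in> ?E" by simp
  have Eadd: "e + e' \<in> ?E" if "e \<in> ?E" "e' \<in> ?E" for e e'
    using that keys_add[of e e'] by (auto simp: lookup_add)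
  have ev1: "mon_eval S f ?\<chi> \<in> ring_hom (ring_of_type_algebra\<lparr>carrier := {p. Poly_Mapping.keys p \<subseteq> ?E}\<rparr>) S"
    by (rule mon_eval_hom(1)[OF S f E0 Eadd \<chi>1 \<chi>2 \<chi>3])
  have ev2: "mon_eval S f ?\<chi> (Poly_Mapping.single e a) = f a \<otimes>\<^bsub>S\<^esub> ?\<chi> e" if "e \<in> ?E" for e a
    by (rule mon_eval_hom(2)[OF S f E0 Eadd \<chi>1 \<chi>2 \<chi>3 that])
  interpret S: cring S by (rule S)
  have f1: "f 1 = \<one>\<^bsub>S\<^esub>" "f r \<in> carrier S" for r using ring_hom_one[OF f] ring_hom_closed[OF f] by simp_all
  have "mon_eval S f (monomial_eval S nat y) (lvar v) = y v" if v: "v \<in> V" for v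
  proof -
    have "Poly_Mapping.single v 1 \<in> ?E" using v by (auto simp: lookup_single when_def)
    then have "mon_eval S f (monomial_eval S nat y) (lvar v) = f 1 \<otimes>\<^bsub>S\<^esub> monomial_eval S nat y (Poly_Mapping.single v 1)"
      unfolding lvar_def by (rule ev2)
    then show ?thesis using \<chi>4[OF v] y[OF v] by (simp add: f1)
  qed
  moreover have "mon_eval S f (monomial_eval S nat y) (lconst r) = f r" for r
    using ev2[OF E0, of r] f1(2)[of r] \<chi>2 by (simp add: lconst_def)
  ultimately show ?thesis using ev1 unfolding mpoly_ring_eq by (intro exI[of _ "mon_eval S f ?\<chi>"] conjI ballI allI)
qed

text \<open>A polynomial ring with a variable for every element of \<open>S\<close> maps onto
  \<open>S\<close>. Unlike the record \<open>S\<close> it is a type of class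
  \<open>comm_ring_1\<close>, to which the theory of determinants applies.\<close>

lemma universal_cover:
  fixes S :: "('s, 'x) ring_scheme" and f :: "'r::comm_ring_1 \<Rightarrow> 's"
  assumes S: "cring S" and f: "f \<in> ring_hom base_ring S"
  shows "\<exists>ev :: (('s \<Rightarrow>\<^sub>0 nat) \<Rightarrow>\<^sub>0 'r) \<Rightarrow> 's. ev \<in> ring_hom base_ring S \<and> (\<forall>s\<in>carrier S. \<exists>x. ev x = s)"
proof -
  interpret S: cring S by (rule S)
  \<comment> \<open>The variables are all elements of the type, including those outside the carrier;
    the latter are sent to \<open>1\<close>, an arbitrary value inside the carrier.\<close>
  define g where "g v = (if v \<in> carrier S then v else \<one>\<^bsub>S\<^esub>)" for v
  have g: "g v \<in> carrier S" for v by (simp add: g_def)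
  let ?\<chi> = "monomial_eval S id g :: ('s \<Rightarrow>\<^sub>0 nat) \<Rightarrow> 's"
  have \<chi>1: "?\<chi> e \<in> carrier S" for e
    by (rule monomial_eval(1)[where V = UNIV and A = UNIV]) (use S g in auto)
  have \<chi>2: "?\<chi> 0 = \<one>\<^bsub>S\<^esub>"
    by (rule monomial_eval(2)[where V = UNIV and A = UNIV]) (use S g in auto)
  have \<chi>3: "?\<chi> (e + e') = ?\<chi> e \<otimes>\<^bsub>S\<^esub> ?\<chi> e'" for e e'
    by (rule monomial_eval(3)[where V = UNIV and A = UNIV]) (use S g in auto)
  have \<chi>4: "?\<chi> (Poly_Mapping.single v 1) = g v" for v
    by (rule monomial_eval(4)[where V = UNIV and A = UNIV]) (use S g in auto)
  have ev: "mon_eval S f ?\<chi> \<in> ring_hom (ring_of_type_algebra\<lparr>carrier := {p. Poly_Mapping.keys p \<subseteq> UNIV}\<rparr>) S"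
    by (rule mon_eval_hom(1)[OF S f]) (simp_all add: \<chi>1 \<chi>2 \<chi>3)
  have ev2: "mon_eval S f ?\<chi> (Poly_Mapping.single e a) = f a \<otimes>\<^bsub>S\<^esub> ?\<chi> e" for e a
    by (rule mon_eval_hom(2)[OF S f, where E = UNIV]) (simp_all add: \<chi>1 \<chi>2 \<chi>3)
  have "mon_eval S f (monomial_eval S id g) (Poly_Mapping.single (Poly_Mapping.single s 1) 1) = s" if s: "s \<in> carrier S" for s
  proof -
    have "f 1 = \<one>\<^bsub>S\<^esub>" using ring_hom_one[OF f] by simp
    moreover have "monomial_eval S id g (Poly_Mapping.single s 1) = s" using \<chi>4[of s] s by (simp add: g_def)
    ultimately show ?thesis unfolding ev2 using s by simp
  qed
  moreover have "mon_eval S f ?\<chi> \<in> ring_hom base_ring S" using ev by (simp flip: base_ring_eq)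
  ultimately show ?thesis by (intro exI[of _ "mon_eval S f ?\<chi>"]) auto
qed

subsection \<open>Fitting ideals and generating systems\<close>

lemma (in cring) free_module_minus:
  assumes "x \<in> carrier (free_module R A)" "y \<in> carrier (free_module R A)"
  shows "(x \<ominus>\<^bsub>free_module R A\<^esub> y) a = x a \<ominus> y a"
proof -
  interpret F: module R "free_module R A" by (rule free_module_module)
  have "\<ominus>\<^bsub>free_module R A\<^esub> y = (\<ominus> \<one>) \<odot>\<^bsub>free_module R A\<^esub> y"
    using F.smult_l_minus[of \<one> y] assms(2) F.smult_one[OF assms(2)] by (simp del: free_module_simps)
  then have "(\<ominus>\<^bsub>free_module R A\<^esub> y) a = \<ominus> y a"
    using free_module_closed[OF assms(2), of a] by (simp add: l_minus)
  then show ?thesis by (simp add: F.M.minus_eq minus_eq)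
qed

section \<open>Determinants over a ring record by means of a covering ring\<close>

locale ring_cover =
  fixes S :: "('s, 'x) ring_scheme" and ev :: "'p::comm_ring_1 \<Rightarrow> 's"
  assumes S_cring: "cring S" and ev_hom: "ev \<in> ring_hom base_ring S"
    and ev_surj: "s \<in> carrier S \<Longrightarrow> \<exists>x. ev x = s"
begin

interpretation S: cring S by (rule S_cring)

lemma ev_closed: "ev x \<in> carrier S"
  and ev_add: "ev (x + y) = ev x \<oplus>\<^bsub>S\<^esub> ev y"
  and ev_mult: "ev (x * y) = ev x \<otimes>\<^bsub>S\<^esub> ev y"
  and ev_one: "ev 1 = \<one>\<^bsub>S\<^esub>"
  and ev_zero: "ev 0 = \<zero>\<^bsub>S\<^esub>"
  using ring_hom_closed[OF ev_hom] ring_hom_add[OF ev_hom] ring_hom_mult[OF ev_hom] ring_hom_one[OF ev_hom]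
    ring_hom_zero[OF ev_hom cring.axioms(1)[OF cring_base_ring] S.ring_axioms] by simp_all

lemma ev_uminus: "ev (- x) = \<ominus>\<^bsub>S\<^esub> ev x"
  using S.minus_equality[of "ev (- x)" "ev x"] ev_add[of "- x" x] ev_closed ev_zero by simp

lemma ev_sum: "ev (sum h A) = (\<Oplus>\<^bsub>S\<^esub>a\<in>A. ev (h a))"
  by (induction A rule: infinite_finite_induct) (simp_all add: ev_zero ev_add ev_closed Pi_iff)

lemma ev_det: "ring_det S k (\<lambda>p q. ev (A p q)) = ev (det (mat k k (\<lambda>(p, q). A p q)))"
proof -
  have "ring_det base_ring k A = det (mat k k (\<lambda>(p, q). A p q))"
    using type_subring.RC_ring_det[OF type_subring_UNIV, of k A] by (simp flip: base_ring_eq)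
  then show ?thesis using ring_hom_det[OF cring_base_ring S_cring ev_hom, of k A] by simp
qed

text \<open>A section of \<open>ev\<close> normalised at \<open>0\<close> and \<open>1\<close>, so
  that zeros above a diagonal and ones on it survive the lift. In the zero ring the first clause
  wins.\<close>

definition lift where
  "lift s = (if s = \<zero>\<^bsub>S\<^esub> then 0 else if s = \<one>\<^bsub>S\<^esub> then 1 else SOME x. ev x = s)"

lemma ev_lift: "s \<in> carrier S \<Longrightarrow> ev (lift s) = s"
  using someI_ex[OF ev_surj] by (auto simp: lift_def ev_zero ev_one)

lemma ring_det_lift:
  assumes "\<And>p q. p < k \<Longrightarrow> q < k \<Longrightarrow> A p q \<in> carrier S"
  shows "ring_det S k A = ev (det (mat k k (\<lambda>(p, q). lift (A p q))))"
  unfolding ev_det[symmetric] by (rule S.ring_det_cong) (simp_all add: ev_lift assms)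

lemma ring_det_row_expansion:
  assumes j: "j < k" and A: "\<And>p q. p < k \<Longrightarrow> q < k \<Longrightarrow> A p q \<in> carrier S"
  shows "\<exists>g. (\<forall>q<k. g q \<in> carrier S) \<and> (\<forall>v. (\<forall>q<k. v q \<in> carrier S) \<longrightarrow>
    ring_det S k (\<lambda>p q. if p = j then v q else A p q) = (\<Oplus>\<^bsub>S\<^esub>q\<in>{..<k}. v q \<otimes>\<^bsub>S\<^esub> g q))"
proof -
  define M where "M v = mat k k (\<lambda>(p, q). lift (if p = j then v q else A p q))" for v
  have M: "M v \<in> carrier_mat k k" for v by (simp add: M_def)
  \<comment> \<open>The cofactors along row \<open>j\<close> do not see row \<open>j\<close> and may
    be computed with zeros there. Hence the coefficients do not depend on \<open>v\<close>.\<close>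
  have cof: "cofactor (M v) j q = cofactor (M w) j q" if "q < k" for v w q
    unfolding cofactor_def
    by (intro arg_cong2[where f = times] arg_cong[where f = det] refl)
      (auto simp: mat_delete_def M_def intro!: eq_matI)
  let ?g = "\<lambda>q. ev (cofactor (M (\<lambda>_. \<zero>\<^bsub>S\<^esub>)) j q)"
  show ?thesis
  proof (intro exI[of _ ?g] conjI allI impI)
    fix v assume v: "\<forall>q<k. v q \<in> carrier S"
    have "ring_det S k (\<lambda>p q. if p = j then v q else A p q) = ev (det (M v))"
      unfolding M_def by (rule ring_det_lift) (use A v in auto)
    also have "det (M v) = (\<Sum>q<k. lift (v q) * cofactor (M (\<lambda>_. \<zero>\<^bsub>S\<^esub>)) j q)"
      unfolding laplace_expansion_row[OF M j]
      by (rule sum.cong) (use cof[of _ v "\<lambda>_. \<zero>\<^bsub>S\<^esub>"] j in \<open>simp_all add: M_def\<close>)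
    also have "ev \<dots> = (\<Oplus>\<^bsub>S\<^esub>q\<in>{..<k}. v q \<otimes>\<^bsub>S\<^esub> ?g q)"
      unfolding ev_sum by (rule S.add.finprod_cong') (use v in \<open>auto simp: ev_mult ev_lift ev_closed\<close>)
    finally show "ring_det S k (\<lambda>p q. if p = j then v q else A p q) = (\<Oplus>\<^bsub>S\<^esub>q\<in>{..<k}. v q \<otimes>\<^bsub>S\<^esub> ?g q)" .
  qed (rule ev_closed)
qed

text \<open>Rows are released from \<open>G\<close> into its span one at a time. With the other rows
  fixed, the determinant is a linear form in row \<open>j\<close>; the vectors at which it vanishes
  form a submodule containing \<open>G\<close>.\<close>

lemma ring_det_rows_span:
  assumes G: "G \<subseteq> carrier (free_module S {..<n})" and c: "\<And>q. q < k \<Longrightarrow> c q < n"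
    and minors: "\<And>r. r \<in> {..<k} \<rightarrow> G \<Longrightarrow> ring_det S k (\<lambda>p q. r p (c q)) = \<zero>\<^bsub>S\<^esub>"
    and r: "\<And>p. p < k \<Longrightarrow> r p \<in> gen_submodule S (free_module S {..<n}) G"
  shows "ring_det S k (\<lambda>p q. r p (c q)) = \<zero>\<^bsub>S\<^esub>"
proof -
  let ?F = "free_module S {..<n}" and ?K = "gen_submodule S (free_module S {..<n}) G"
  interpret F: module S ?F by (rule S.free_module_module)
  have K: "submodule ?K S ?F" by (rule F.gen_submodule_submodule[OF G])
  have KF: "v \<in> carrier ?F" if "v \<in> ?K" for v using F.submoduleE(1)[OF K] that by auto
  \<comment> \<open>The first \<open>j\<close> rows are already arbitrary in the span, the remaining
    ones still belong to \<open>G\<close>.\<close>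
  have *: "ring_det S k (\<lambda>p q. r p (c q)) = \<zero>\<^bsub>S\<^esub>"
    if "j \<le> k" "\<And>p. p < j \<Longrightarrow> r p \<in> ?K" "\<And>p. j \<le> p \<Longrightarrow> p < k \<Longrightarrow> r p \<in> G" for j r
    using that
  proof (induction j arbitrary: r)
    case 0
    then show ?case by (intro minors) auto
  next
    case (Suc j)
    have rF: "r p \<in> carrier ?F" if "p < k" for p
      using Suc.prems(2,3)[of p] KF[of "r p"] G that by (cases "p < Suc j") auto
    have j: "j < k" using Suc.prems(1) by simp
    obtain g where g: "\<forall>q<k. g q \<in> carrier S"
      "\<forall>v. (\<forall>q<k. v q \<in> carrier S) \<longrightarrow>
        ring_det S k (\<lambda>p q. if p = j then v q else r p (c q)) = (\<Oplus>\<^bsub>S\<^esub>q\<in>{..<k}. v q \<otimes>\<^bsub>S\<^esub> g q)"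
      using ring_det_row_expansion[OF j, of "\<lambda>p q. r p (c q)"] S.free_module_closed[OF rF] by auto
    define L where "L v = (\<Oplus>\<^bsub>S\<^esub>q\<in>{..<k}. v (c q) \<otimes>\<^bsub>S\<^esub> g q)" for v
    have L: "L v = ring_det S k (\<lambda>p q. if p = j then v (c q) else r p (c q))" if "v \<in> carrier ?F" for v
      unfolding L_def using g(2) S.free_module_closed[OF that] by simp
    have upd: "L v = ring_det S k (\<lambda>p q. (r(j := v)) p (c q))" if "v \<in> carrier ?F" for v
      unfolding L[OF that] by (intro arg_cong[where f = "ring_det S k"] ext) simp
    have "submodule {v \<in> carrier ?F. L v = \<zero>\<^bsub>S\<^esub>} S ?F"
    proof (rule F.submodule_smultI)
      have "L \<zero>\<^bsub>?F\<^esub> = (\<Oplus>\<^bsub>S\<^esub>q\<in>{..<k}. \<zero>\<^bsub>S\<^esub>)"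
        unfolding L_def using g(1) by (intro S.add.finprod_cong') auto
      then show "\<zero>\<^bsub>?F\<^esub> \<in> {v \<in> carrier ?F. L v = \<zero>\<^bsub>S\<^esub>}" using F.M.zero_closed by simp
    next
      fix v w assume "v \<in> {v \<in> carrier ?F. L v = \<zero>\<^bsub>S\<^esub>}" "w \<in> {v \<in> carrier ?F. L v = \<zero>\<^bsub>S\<^esub>}"
      then have v: "v \<in> carrier ?F" "L v = \<zero>\<^bsub>S\<^esub>" and w: "w \<in> carrier ?F" "L w = \<zero>\<^bsub>S\<^esub>" by auto
      note vc = S.free_module_closed[OF v(1)] and wc = S.free_module_closed[OF w(1)]
      have "L (v \<oplus>\<^bsub>?F\<^esub> w) = (\<Oplus>\<^bsub>S\<^esub>q\<in>{..<k}. v (c q) \<otimes>\<^bsub>S\<^esub> g q \<oplus>\<^bsub>S\<^esub> w (c q) \<otimes>\<^bsub>S\<^esub> g q)"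
        unfolding L_def using g(1) vc wc by (intro S.add.finprod_cong') (auto simp: S.l_distr)
      also have "\<dots> = L v \<oplus>\<^bsub>S\<^esub> L w"
        unfolding L_def using g(1) vc wc by (intro S.add.finprod_multf) auto
      finally show "v \<oplus>\<^bsub>?F\<^esub> w \<in> {v \<in> carrier ?F. L v = \<zero>\<^bsub>S\<^esub>}"
        using F.M.a_closed[OF v(1) w(1)] v(2) w(2) by simp
    next
      fix s v assume s: "s \<in> carrier S" and "v \<in> {v \<in> carrier ?F. L v = \<zero>\<^bsub>S\<^esub>}"
      then have v: "v \<in> carrier ?F" "L v = \<zero>\<^bsub>S\<^esub>" by auto
      note vc = S.free_module_closed[OF v(1)]
      have "L (s \<odot>\<^bsub>?F\<^esub> v) = (\<Oplus>\<^bsub>S\<^esub>q\<in>{..<k}. s \<otimes>\<^bsub>S\<^esub> (v (c q) \<otimes>\<^bsub>S\<^esub> g q))"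
        unfolding L_def using g(1) vc s by (intro S.add.finprod_cong') (auto simp: S.m_assoc)
      also have "\<dots> = s \<otimes>\<^bsub>S\<^esub> L v"
        unfolding L_def using g(1) vc s by (intro S.finsum_rdistr[symmetric]) auto
      finally show "s \<odot>\<^bsub>?F\<^esub> v \<in> {v \<in> carrier ?F. L v = \<zero>\<^bsub>S\<^esub>}"
        using F.smult_closed[OF s v(1)] v(2) s by simp
    qed auto
    moreover have "G \<subseteq> {v \<in> carrier ?F. L v = \<zero>\<^bsub>S\<^esub>}"
    proof
      fix v assume v: "v \<in> G"
      have "ring_det S k (\<lambda>p q. (r(j := v)) p (c q)) = \<zero>\<^bsub>S\<^esub>"
        by (rule Suc.IH) (use Suc.prems v in auto)
      then show "v \<in> {v \<in> carrier ?F. L v = \<zero>\<^bsub>S\<^esub>}" using v G upd[of v] by auto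
    qed
    ultimately have "?K \<subseteq> {v \<in> carrier ?F. L v = \<zero>\<^bsub>S\<^esub>}" by (rule gen_submodule_least)
    then have "L (r j) = \<zero>\<^bsub>S\<^esub>" using Suc.prems(2)[of j] by auto
    then show ?case using upd[OF rF[OF j]] by simp
  qed
  show ?thesis by (rule *[of k]) (use r in auto)
qed

text \<open>The comparison of two generating systems, moved from the covering ring to
  \<open>S\<close>. \<open>C\<close> expresses the \<open>m\<close> generators of the second system
  through the \<open>n\<close> of the first, \<open>E\<close> the first through the second, in both
  cases up to relations spanned by \<open>G\<close>. Since all diagonal entries but one are
  \<open>1\<close>, the product of the diagonal is the entry in question.\<close>

lemma triangular_relations_zero:
  fixes n m k :: nat
  defines "Fn \<equiv> free_module S {..<n}"
  assumes G: "G \<subseteq> carrier Fn"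
    and minors: "\<And>r c. r \<in> {..<k} \<rightarrow> G \<Longrightarrow> c \<in> {..<k} \<rightarrow> {..<n} \<Longrightarrow> ring_det S k (\<lambda>p q. r p (c q)) = \<zero>\<^bsub>S\<^esub>"
    and C: "\<And>p. p < m \<Longrightarrow> C p \<in> carrier Fn"
    and E: "\<And>q p. q < n \<Longrightarrow> p < m \<Longrightarrow> E q p \<in> carrier S"
    and EC: "\<And>q. q < n \<Longrightarrow> evec S q \<ominus>\<^bsub>Fn\<^esub> (\<Oplus>\<^bsub>Fn\<^esub>p\<in>{..<m}. E q p \<odot>\<^bsub>Fn\<^esub> C p) \<in> gen_submodule S Fn G"
    and T: "\<And>i p. i < m \<Longrightarrow> p < m \<Longrightarrow> T i p \<in> carrier S"
    and tri: "\<And>i j. i < j \<Longrightarrow> j < m \<Longrightarrow> T i j = \<zero>\<^bsub>S\<^esub>"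
    and Gd: "Gd \<subseteq> {..<m}" "m + k \<le> card Gd + n"
    and TC: "\<And>i. i \<in> Gd \<Longrightarrow> (\<Oplus>\<^bsub>Fn\<^esub>p\<in>{..<m}. T i p \<odot>\<^bsub>Fn\<^esub> C p) \<in> gen_submodule S Fn G"
    and d0: "d0 < m" and diag: "\<And>i. i < m \<Longrightarrow> i \<noteq> d0 \<Longrightarrow> T i i = \<one>\<^bsub>S\<^esub>"
  shows "T d0 d0 = \<zero>\<^bsub>S\<^esub>"
proof -
  interpret Fn: module S Fn unfolding Fn_def by (rule S.free_module_module)
  \<comment> \<open>Vectors of the covering ring that map to relations. They are functions on all
    natural numbers, of which only the first \<open>n\<close> values matter.\<close>
  define K where "K = {v. \<exists>w\<in>gen_submodule S Fn G. \<forall>q<n. ev (v q) = w q}"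
  have genF: "w \<in> carrier Fn" if "w \<in> gen_submodule S Fn G" for w
    using Fn.submoduleE(1)[OF Fn.gen_submodule_submodule[OF G]] that by auto
  have Fc: "v q \<in> carrier S" if "v \<in> carrier Fn" for v q
    using that unfolding Fn_def by (rule S.free_module_closed)
  interpret minors_in_ideal "{x. ev x = \<zero>\<^bsub>S\<^esub>}" K n k
  proof
    fix r c assume r: "\<And>p. p < k \<Longrightarrow> r p \<in> K" and c: "\<And>q. q < k \<Longrightarrow> c q < n"
    have "\<forall>p. \<exists>w. p < k \<longrightarrow> w \<in> gen_submodule S Fn G \<and> (\<forall>q<n. ev (r p q) = w q)"
      using r by (auto simp: K_def)
    then obtain w where w: "\<And>p. p < k \<Longrightarrow> w p \<in> gen_submodule S Fn G"
      "\<And>p q. p < k \<Longrightarrow> q < n \<Longrightarrow> ev (r p q) = w p q" by metis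
    have "ring_det S k (\<lambda>p q. ev (r p (c q))) = ring_det S k (\<lambda>p q. w p (c q))"
      by (rule S.ring_det_cong) (simp_all add: w(2) c Fc[OF genF[OF w(1)]])
    also have "\<dots> = \<zero>\<^bsub>S\<^esub>"
      by (rule ring_det_rows_span[where G = G and n = n])
        (use G w(1) c minors in \<open>auto simp: Fn_def\<close>)
    finally show "det (mat k k (\<lambda>(p, q). r p (c q))) \<in> {x. ev x = \<zero>\<^bsub>S\<^esub>}" by (simp add: ev_det)
  qed (simp_all add: ev_zero ev_add ev_mult ev_closed)
  define Tm where "Tm = mat m m (\<lambda>(i, p). lift (T i p))"
  define Cm where "Cm = mat m n (\<lambda>(p, q). lift (C p q))"
  define Em where "Em = mat n m (\<lambda>(q, p). lift (E q p))"
  have mult: "ev (\<Sum>p<m. lift (h p) * lift (C p q)) = (\<Oplus>\<^bsub>Fn\<^esub>p\<in>{..<m}. h p \<odot>\<^bsub>Fn\<^esub> C p) q"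
    if h: "\<And>p. p < m \<Longrightarrow> h p \<in> carrier S" for h q
  proof -
    have "ev (\<Sum>p<m. lift (h p) * lift (C p q)) = (\<Oplus>\<^bsub>S\<^esub>p\<in>{..<m}. h p \<otimes>\<^bsub>S\<^esub> C p q)"
      unfolding ev_sum
      by (rule S.add.finprod_cong') (use h C Fc in \<open>auto simp: ev_mult ev_lift\<close>)
    also have "\<dots> = (\<Oplus>\<^bsub>Fn\<^esub>p\<in>{..<m}. h p \<odot>\<^bsub>Fn\<^esub> C p) q"
      using h C Fn.smult_closed unfolding Fn_def by (subst S.finsum_free_module) auto
    finally show ?thesis .
  qed
  have "prod_list (diag_mat Tm) \<in> {x. ev x = \<zero>\<^bsub>S\<^esub>}"
  proof (rule triangular_relations[where C = Cm and E = Em and Gd = Gd])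
    show "Tm \<in> carrier_mat m m" "Cm \<in> carrier_mat m n" "Em \<in> carrier_mat n m"
      by (simp_all add: Tm_def Cm_def Em_def)
    show "Tm $$ (i, j) = 0" if "i < j" "j < m" for i j
      using that tri by (simp add: Tm_def lift_def)
    show "Gd \<subseteq> {..<m}" "m + k \<le> card Gd + n" by (rule Gd)+
    fix i assume i: "i \<in> Gd"
    have "ev ((Tm * Cm) $$ (i, q)) = (\<Oplus>\<^bsub>Fn\<^esub>p\<in>{..<m}. T i p \<odot>\<^bsub>Fn\<^esub> C p) q" if q: "q < n" for q
    proof -
      have "(Tm * Cm) $$ (i, q) = (\<Sum>p<m. lift (T i p) * lift (C p q))"
        using i Gd(1) q by (auto simp: Tm_def Cm_def scalar_prod_def lessThan_atLeast0 intro!: sum.cong)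
      then show ?thesis using mult[of "T i" q] T i Gd(1) by auto
    qed
    then show "\<exists>v\<in>K. \<forall>q<n. (Tm * Cm) $$ (i, q) = v q"
      using TC[OF i] by (intro bexI[of _ "\<lambda>q. (Tm * Cm) $$ (i, q)"]) (auto simp: K_def)
  next
    fix p assume p: "p < n"
    have "ev ((1\<^sub>m n + - Em * Cm) $$ (p, q)) = (evec S p \<ominus>\<^bsub>Fn\<^esub> (\<Oplus>\<^bsub>Fn\<^esub>p'\<in>{..<m}. E p p' \<odot>\<^bsub>Fn\<^esub> C p')) q"
      if q: "q < n" for q
    proof -
      have e: "evec S p \<in> carrier Fn" unfolding Fn_def using p by (intro S.evec_closed) simp
      have s: "(\<Oplus>\<^bsub>Fn\<^esub>p'\<in>{..<m}. E p p' \<odot>\<^bsub>Fn\<^esub> C p') \<in> carrier Fn"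
        using C E[OF p] by (intro Fn.M.finsum_closed) auto
      have \<delta>: "ev (if p = q then 1 else 0) = evec S p q" by (auto simp: evec_def ev_one ev_zero)
      have "(1\<^sub>m n + - Em * Cm) $$ (p, q) = (if p = q then 1 else 0) + - (\<Sum>p'<m. lift (E p p') * lift (C p' q))"
        using p q by (auto simp: Em_def Cm_def scalar_prod_def lessThan_atLeast0 sum_negf intro!: sum.cong)
      then have "ev ((1\<^sub>m n + - Em * Cm) $$ (p, q)) =
          evec S p q \<oplus>\<^bsub>S\<^esub> (\<ominus>\<^bsub>S\<^esub> (\<Oplus>\<^bsub>Fn\<^esub>p'\<in>{..<m}. E p p' \<odot>\<^bsub>Fn\<^esub> C p') q)"
        using mult[of "E p" q] E[OF p] \<delta> by (simp only: ev_add ev_uminus)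
      also have "\<dots> = (evec S p \<ominus>\<^bsub>Fn\<^esub> (\<Oplus>\<^bsub>Fn\<^esub>p'\<in>{..<m}. E p p' \<odot>\<^bsub>Fn\<^esub> C p')) q"
        using S.free_module_minus[OF e[unfolded Fn_def] s[unfolded Fn_def]] by (simp add: S.minus_eq Fn_def)
      finally show ?thesis .
    qed
    then show "\<exists>v\<in>K. \<forall>q<n. (1\<^sub>m n + - Em * Cm) $$ (p, q) = v q"
      using EC[OF p] by (intro bexI[of _ "\<lambda>q. (1\<^sub>m n + - Em * Cm) $$ (p, q)"]) (auto simp: K_def)
  qed
  \<comment> \<open>Away from \<open>d0\<close> the diagonal entries \<open>1\<close> lift to
    \<open>1\<close> only if \<open>1\<close> and \<open>0\<close> differ in \<open>S\<close>;
    otherwise \<open>lift\<close> returns \<open>0\<close>. In the zero ring the claim is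
    trivial.\<close>
  moreover have "prod_list (diag_mat Tm) = lift (T d0 d0)" if "\<one>\<^bsub>S\<^esub> \<noteq> \<zero>\<^bsub>S\<^esub>"
  proof -
    have "prod_list (diag_mat Tm) = (\<Prod>i<m. lift (T i i))"
      by (simp add: prod_list_diag_prod Tm_def lessThan_atLeast0)
    also have "\<dots> = (\<Prod>i<m. if i = d0 then lift (T d0 d0) else 1)"
      using diag that by (intro prod.cong) (auto simp: lift_def)
    also have "\<dots> = lift (T d0 d0)" using d0 by (simp add: prod.delta)
    finally show ?thesis .
  qed
  moreover have "T d0 d0 = \<zero>\<^bsub>S\<^esub>" if "\<one>\<^bsub>S\<^esub> = \<zero>\<^bsub>S\<^esub>"
    using S.l_one[OF T[OF d0 d0]] S.l_null[OF T[OF d0 d0]] that by simp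
  ultimately show ?thesis using ev_lift[OF T[OF d0 d0]]
    by (cases "\<one>\<^bsub>S\<^esub> = \<zero>\<^bsub>S\<^esub>") simp_all
qed

end

section \<open>The presentation behind a vanishing Fitting ideal\<close>

lemma (in cring) ring_det_closed:
  assumes "\<And>p q. p < k \<Longrightarrow> q < k \<Longrightarrow> A p q \<in> carrier R" shows "ring_det R k A \<in> carrier R"
  unfolding ring_det_def
proof (rule finsum_closed, rule Pi_I, rule det_term_closed)
  fix p i assume "p \<in> {p. p permutes {..<k}}" "i < k"
  then show "A i (p i) \<in> carrier R" using assms[of i "p i"] permutes_in_image[of p "{..<k}" i] by simp
qed

text \<open>\<open>fitting_ideal\<close> is a choice among the ideals coming from all presentations.
  So a presentation has to exist before anything follows, and the vanishing minors belong to one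
  over which there is no control.\<close>

lemma fitting_ideal_zero:
  assumes A: "cring A" and ex: "\<exists>n G. presents A M n G" and fit: "fitting_ideal A M i = Idl\<^bsub>A\<^esub> {\<zero>\<^bsub>A\<^esub>}"
  shows "\<exists>n G. presents A M n G \<and> minors A n G (n - i) \<subseteq> {\<zero>\<^bsub>A\<^esub>}"
proof -
  interpret A: cring A by (rule A)
  have "\<exists>F n G. presents A M n G \<and> F = Idl\<^bsub>A\<^esub> (minors A n G (n - i))" using ex by auto
  from someI_ex[OF this] obtain n G where nG: "presents A M n G" "fitting_ideal A M i = Idl\<^bsub>A\<^esub> (minors A n G (n - i))"
    unfolding fitting_ideal_def by auto
  have GF: "G \<subseteq> carrier (free_module A {..<n})" using nG(1) by (auto simp: presents_def Let_def)
  have "minors A n G (n - i) \<subseteq> carrier A"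
  proof
    fix x assume "x \<in> minors A n G (n - i)"
    then obtain r c where x: "x = ring_det A (n - i) (\<lambda>p q. r p (c q))" and r: "r \<in> {..<n - i} \<rightarrow> G"
      by (auto simp: minors_def)
    have "r p \<in> carrier (free_module A {..<n})" if "p < n - i" for p using r GF that by auto
    then show "x \<in> carrier A" unfolding x by (intro A.ring_det_closed A.free_module_closed)
  qed
  then have "minors A n G (n - i) \<subseteq> Idl\<^bsub>A\<^esub> {\<zero>\<^bsub>A\<^esub>}"
    using A.genideal_self[of "minors A n G (n - i)"] nG(2) fit by simp
  then show ?thesis using nG(1) by (auto simp: A.genideal_zero)
qed

text \<open>The whole kernel serves as the set of rows, which \<open>presents\<close> permits to be
  infinite.\<close>

lemma presents_kernel:
  assumes M: "module S M" and g: "g \<in> {..<n} \<rightarrow> carrier M"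
    and surj: "\<And>H. submodule H S M \<Longrightarrow> g ` {..<n} \<subseteq> H \<Longrightarrow> carrier M \<subseteq> H"
  shows "\<exists>G. presents S M n G"
proof -
  interpret M: module S M by (rule M)
  let ?F = "free_module S {..<n}"
  interpret F: module S ?F by (rule M.R.free_module_module)
  let ?ev = "\<lambda>y. \<Oplus>\<^bsub>M\<^esub>k\<in>{..<n}. y k \<odot>\<^bsub>M\<^esub> g k"
  have lin: "lin_map S ?F M ?ev" by (rule M.lin_map_lincomb) (use g in auto)
  have "g ` {..<n} \<subseteq> ?ev ` carrier ?F"
  proof
    fix x assume "x \<in> g ` {..<n}"
    then obtain k where k: "k < n" "x = g k" by auto
    have "?ev (evec S k) = g k" by (rule M.lincomb_evec) (use g k in auto)
    then show "x \<in> ?ev ` carrier ?F" using k M.R.evec_closed[of k "{..<n}"] by force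
  qed
  then have "carrier M \<subseteq> ?ev ` carrier ?F"
    by (rule surj[OF lin_map_image[OF F.module_axioms M lin F.carrier_is_submodule]])
  then have im: "?ev ` carrier ?F = carrier M" using lin_mapD(1)[OF lin] by auto
  define K where "K = {y \<in> carrier ?F. ?ev y = \<zero>\<^bsub>M\<^esub>}"
  have "submodule {\<zero>\<^bsub>M\<^esub>} S M" by (rule M.submodule_smultI) auto
  from lin_map_preimage[OF F.module_axioms M lin this] have "submodule K S ?F" by (simp add: K_def)
  then have "gen_submodule S ?F K = K" using gen_submodule_incl gen_submodule_least by (metis subset_antisym subset_refl)
  then have "presents S M n K"
    unfolding presents_def Let_def by (intro bexI[OF _ g] conjI im) (auto simp: K_def)
  then show ?thesis ..
qed

lemma (in cring) expand_enum:
  fixes h :: "nat \<Rightarrow> 'j"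
  assumes h: "bij_betw h {..<m} J" and z: "z \<in> carrier (free_module R J)"
  shows "(\<Oplus>\<^bsub>free_module R J\<^esub>p\<in>{..<m}. z (h p) \<odot>\<^bsub>free_module R J\<^esub> evec R (h p)) = z"
proof -
  interpret F: module R "free_module R J" by (rule free_module_module)
  have J: "h ` {..<m} = J" "inj_on h {..<m}" "finite J" using h by (auto simp: bij_betw_def)
  have "(\<Oplus>\<^bsub>free_module R J\<^esub>j\<in>h ` {..<m}. z j \<odot>\<^bsub>free_module R J\<^esub> evec R j) =
      (\<Oplus>\<^bsub>free_module R J\<^esub>p\<in>{..<m}. z (h p) \<odot>\<^bsub>free_module R J\<^esub> evec R (h p))"
  proof (rule F.M.add.finprod_reindex[OF _ J(2)])
    show "(\<lambda>j. z j \<odot>\<^bsub>free_module R J\<^esub> evec R j) \<in> h ` {..<m} \<rightarrow> carrier (free_module R J)"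
      unfolding J(1) using free_module_closed[OF z] by (intro Pi_I F.smult_closed evec_closed) auto
  qed
  then show ?thesis
    using free_module_expand[OF z J(3) subset_refl free_module_support[OF z]] unfolding J(1) by simp
qed

text \<open>This moves spans through a change of rings: to see that a span maps into
  \<open>H\<close>, its generators suffice.\<close>

lemma semilin_preimage:
  assumes R: "cring R" and S: "cring S" and h: "h \<in> ring_hom R S"
    and M: "module R M" and P: "module S P" and u: "semilin R h M P u" and H: "submodule H S P"
  shows "submodule {m \<in> carrier M. u m \<in> H} R M"
proof -
  interpret M: module R M by (rule M)
  interpret P: module S P by (rule P)
  note u = u[unfolded semilin_def]
  have uc: "u m \<in> carrier P" if "m \<in> carrier M" for m using u that by auto
  have "u \<zero>\<^bsub>M\<^esub> = u (\<zero>\<^bsub>R\<^esub> \<odot>\<^bsub>M\<^esub> \<zero>\<^bsub>M\<^esub>)" by simp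
  also have "\<dots> = h \<zero>\<^bsub>R\<^esub> \<odot>\<^bsub>P\<^esub> u \<zero>\<^bsub>M\<^esub>" using u M.R.zero_closed M.M.zero_closed by blast
  also have "\<dots> = \<zero>\<^bsub>P\<^esub>"
    using uc[of "\<zero>\<^bsub>M\<^esub>"] ring_hom_zero[OF h cring.axioms(1)[OF R] cring.axioms(1)[OF S]] by simp
  finally have u0: "u \<zero>\<^bsub>M\<^esub> = \<zero>\<^bsub>P\<^esub>" .
  show ?thesis
  proof (rule M.submodule_smultI)
    show "\<zero>\<^bsub>M\<^esub> \<in> {m \<in> carrier M. u m \<in> H}" using u0 P.submodule_zero[OF H] by simp
    show "a \<oplus>\<^bsub>M\<^esub> b \<in> {m \<in> carrier M. u m \<in> H}"
      if "a \<in> {m \<in> carrier M. u m \<in> H}" "b \<in> {m \<in> carrier M. u m \<in> H}" for a b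
      using that u P.submoduleE(5)[OF H, of "u a" "u b"] by simp
    show "r \<odot>\<^bsub>M\<^esub> a \<in> {m \<in> carrier M. u m \<in> H}" if "r \<in> carrier R" "a \<in> {m \<in> carrier M. u m \<in> H}" for r a
      using that u P.submoduleE(4)[OF H, of "h r" "u a"] ring_hom_closed[OF h, of r] by simp
  qed auto
qed

lemma semilin_map:
  assumes "cring R" "cring S" "h \<in> ring_hom R S"
  shows "semilin R h (free_module R A) (free_module S A) (\<lambda>z a. h (z a))"
proof -
  interpret R: cring R by fact
  interpret S: cring S by fact
  interpret free_ext R S h by (simp add: free_ext_def assms)
  show ?thesis
    unfolding semilin_def
  proof (intro conjI ballI Pi_I HOL.ext)
    fix z assume z: "z \<in> carrier (free_module R A)"
    show "(\<lambda>a. h (z a)) \<in> carrier (free_module S A)" by (rule map_closed[OF z])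
    show "h ((z \<oplus>\<^bsub>free_module R A\<^esub> z') a) = ((\<lambda>a. h (z a)) \<oplus>\<^bsub>free_module S A\<^esub> (\<lambda>a. h (z' a))) a"
      if "z' \<in> carrier (free_module R A)" for z' a
      using R.free_module_closed[OF z] R.free_module_closed[OF that] by (simp add: ring_hom_simps)
    show "h ((r \<odot>\<^bsub>free_module R A\<^esub> z) a) = (h r \<odot>\<^bsub>free_module S A\<^esub> (\<lambda>a. h (z a))) a"
      if "r \<in> carrier R" for r a
      using R.free_module_closed[OF z] that by (simp add: ring_hom_simps)
  qed
qed

lemma map_lincomb:
  assumes "cring R" "cring S" "h \<in> ring_hom R S"
    and C: "\<And>p. p < m \<Longrightarrow> C p \<in> carrier (free_module R A)" and z: "\<And>p. p < m \<Longrightarrow> z p \<in> carrier R"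
  shows "(\<lambda>a. h ((\<Oplus>\<^bsub>free_module R A\<^esub>p\<in>{..<m}. z p \<odot>\<^bsub>free_module R A\<^esub> C p) a)) =
    (\<Oplus>\<^bsub>free_module S A\<^esub>p\<in>{..<m}. h (z p) \<odot>\<^bsub>free_module S A\<^esub> (\<lambda>a. h (C p a)))"
proof
  interpret R: cring R by fact
  interpret S: cring S by fact
  interpret h: ring_hom_cring R S h by (simp add: ring_hom_cring_def ring_hom_cring_axioms_def assms)
  interpret FR: module R "free_module R A" by (rule R.free_module_module)
  interpret FS: module S "free_module S A" by (rule S.free_module_module)
  interpret fe: free_ext R S h by (simp add: free_ext_def assms)
  fix a
  have cl: "z p \<in> carrier R" "C p a \<in> carrier R" if "p < m" for p
    using z[OF that] R.free_module_closed[OF C[OF that], of a] by auto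
  have "(\<Oplus>\<^bsub>free_module R A\<^esub>p\<in>{..<m}. z p \<odot>\<^bsub>free_module R A\<^esub> C p) a = (\<Oplus>\<^bsub>R\<^esub>p\<in>{..<m}. z p \<otimes>\<^bsub>R\<^esub> C p a)"
    using z C by (subst R.finsum_free_module) (auto intro!: FR.smult_closed simp del: free_module_simps(3), simp)
  moreover have "(\<Oplus>\<^bsub>free_module S A\<^esub>p\<in>{..<m}. h (z p) \<odot>\<^bsub>free_module S A\<^esub> (\<lambda>a. h (C p a))) a =
      (\<Oplus>\<^bsub>S\<^esub>p\<in>{..<m}. h (z p) \<otimes>\<^bsub>S\<^esub> h (C p a))"
    using z C by (subst S.finsum_free_module) (auto intro!: FS.smult_closed fe.map_closed simp del: free_module_simps(3), simp)
  moreover have "h (\<Oplus>\<^bsub>R\<^esub>p\<in>{..<m}. z p \<otimes>\<^bsub>R\<^esub> C p a) = (\<Oplus>\<^bsub>S\<^esub>p\<in>{..<m}. h (z p \<otimes>\<^bsub>R\<^esub> C p a))"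
    by (rule h.hom_finsum[unfolded comp_def]) (use cl in auto)
  moreover have "(\<Oplus>\<^bsub>S\<^esub>p\<in>{..<m}. h (z p \<otimes>\<^bsub>R\<^esub> C p a)) = (\<Oplus>\<^bsub>S\<^esub>p\<in>{..<m}. h (z p) \<otimes>\<^bsub>S\<^esub> h (C p a))"
    by (rule S.add.finprod_cong') (use cl in auto)
  ultimately show "h ((\<Oplus>\<^bsub>free_module R A\<^esub>p\<in>{..<m}. z p \<odot>\<^bsub>free_module R A\<^esub> C p) a) =
      (\<Oplus>\<^bsub>free_module S A\<^esub>p\<in>{..<m}. h (z p) \<odot>\<^bsub>free_module S A\<^esub> (\<lambda>a. h (C p a))) a" by simp
qed

text \<open>\<open>minors\<close> ranges over injective selections only. Since repetitions give
  determinant zero, vanishing extends to the arbitrary selections demanded by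
  \<open>minors_in_ideal\<close>.\<close>

lemma mpoly_det_repeated:
  fixes A :: "nat \<Rightarrow> nat \<Rightarrow> ('v, 'r::comm_ring_1) laurent"
  assumes A: "\<And>p q. p < k \<Longrightarrow> q < k \<Longrightarrow> A p q \<in> carrier (mpoly_ring V)"
    and "(\<exists>i j. i < k \<and> j < k \<and> i \<noteq> j \<and> (\<forall>q<k. A i q = A j q)) \<or>
      (\<exists>i j. i < k \<and> j < k \<and> i \<noteq> j \<and> (\<forall>p<k. A p i = A p j))"
  shows "ring_det (mpoly_ring V) k A = 0"
proof -
  let ?M = "mat k k (\<lambda>(p, q). A p q)"
  have "ring_det (mpoly_ring V) k A = det ?M"
    unfolding mpoly_ring_eq by (rule type_subring.RC_ring_det[OF mpoly_subring]) (use A in \<open>simp add: mpoly_ring_eq\<close>)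
  also have "det ?M = 0"
    using assms(2)
  proof (elim disjE exE conjE)
    fix i j assume "i < k" "j < k" "i \<noteq> j" "\<forall>q<k. A i q = A j q"
    then show ?thesis by (intro det_identical_rows[of ?M k i j] eq_vecI) auto
  next
    fix i j assume "i < k" "j < k" "i \<noteq> j" "\<forall>p<k. A p i = A p j"
    then show ?thesis by (intro det_identical_columns[of ?M k i j] eq_vecI) auto
  qed
  finally show ?thesis .
qed

text \<open>The presentation of the orbit module by the columns \<open>J\<close> meets the unknown
  one behind its Fitting ideal. Each is expressed through the other over the polynomial ring, the
  resulting matrices and relations are specialised along \<open>ev\<close>, and the comparison takes
  place over \<open>S\<close> with minors of size \<open>n - i\<close>.\<close>

lemma orbit_triangular:
  fixes \<theta> :: "('r::comm_ring_1, 'm, nat \<Rightarrow> 'r, nat \<Rightarrow> 'r) mod_rep" and S :: "('s, 'x) ring_scheme"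
    and I J :: "nat set" and h :: "nat \<Rightarrow> nat"
  assumes S: "cring S" and f: "(f :: 'r \<Rightarrow> 's) \<in> ring_hom base_ring S"
    and h: "bij_betw h {..<m} J"
    and rows: "\<And>b. b \<in> carrier (rep_par \<theta>) \<Longrightarrow> orbit_row I \<theta> b \<in> carrier (free_module (mpoly_ring I) J)"
    and fit: "fitting_ideal (mpoly_ring I) (Orbit I J \<theta>) i = Idl\<^bsub>mpoly_ring I\<^esub> {0}"
    and ev: "ev \<in> ring_hom (mpoly_ring I) S"
    and T: "\<And>a. a < m \<Longrightarrow> T a \<in> carrier (free_module S J)"
    and tri: "\<And>a b. a < b \<Longrightarrow> b < m \<Longrightarrow> T a (h b) = \<zero>\<^bsub>S\<^esub>"
    and Gd: "Gd \<subseteq> {..<m}" "m \<le> card Gd + i"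
    and TG: "\<And>a. a \<in> Gd \<Longrightarrow> T a \<in> gen_submodule S (free_module S J)
      ((\<lambda>b j. ev (orbit_row I \<theta> b j)) ` carrier (rep_par \<theta>))"
    and d0: "d0 < m" and diag: "\<And>a. a < m \<Longrightarrow> a \<noteq> d0 \<Longrightarrow> T a (h a) = \<one>\<^bsub>S\<^esub>"
  shows "T d0 (h d0) = \<zero>\<^bsub>S\<^esub>"
proof -
  define A where "A = (mpoly_ring I :: (nat, 'r) laurent ring)"
  interpret A: cring A unfolding A_def by (rule cring_mpoly_ring)
  interpret S: cring S by (rule S)
  note ev = ev[folded A_def]
  note rows = rows[folded A_def]
  define FJ where "FJ = free_module A J"
  interpret FJ: module A FJ unfolding FJ_def by (rule A.free_module_module)
  define W where "W = gen_submodule A FJ (orbit_row I \<theta> ` carrier (rep_par \<theta>))"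
  have rowsF: "orbit_row I \<theta> ` carrier (rep_par \<theta>) \<subseteq> carrier FJ" using rows by (auto simp: FJ_def)
  have W: "submodule W A FJ" unfolding W_def by (rule FJ.gen_submodule_submodule[OF rowsF])
  define \<Omega> where "\<Omega> = quot_module FJ W"
  have \<Omega>: "Orbit I J \<theta> = \<Omega>" by (simp add: Orbit_def \<Omega>_def FJ_def W_def A_def)
  interpret \<Omega>: module A \<Omega> unfolding \<Omega>_def by (rule FJ.quot_module_module[OF W])
  define pr where "pr z = W +>\<^bsub>FJ\<^esub> z" for z
  have pr: "lin_map A FJ \<Omega> pr" unfolding \<Omega>_def pr_def by (rule FJ.quot_module_lin_map[OF W])
  have pr_surj: "carrier \<Omega> = pr ` carrier FJ" unfolding \<Omega>_def pr_def by (rule FJ.quot_module_carrier[OF W])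
  have pr_zero: "pr z = \<zero>\<^bsub>\<Omega>\<^esub>" if "z \<in> W" for z
    using that FJ.quot_module_eq_zero[OF W, of z] FJ.submoduleE(1)[OF W] unfolding \<Omega>_def pr_def by auto
  have hJ: "h p \<in> J" if "p < m" for p using h that by (auto simp: bij_betw_def)
  have eJ: "evec A (h p) \<in> carrier FJ" if "p < m" for p unfolding FJ_def by (rule A.evec_closed[OF hJ[OF that]])
  have expJ: "(\<Oplus>\<^bsub>FJ\<^esub>p\<in>{..<m}. z (h p) \<odot>\<^bsub>FJ\<^esub> evec A (h p)) = z" if "z \<in> carrier FJ" for z
    using A.expand_enum[OF h] that by (simp add: FJ_def)
  have zA: "z a \<in> carrier A" if "z \<in> carrier FJ" for z a using that unfolding FJ_def by (rule A.free_module_closed)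
  have pr_exp: "pr z = (\<Oplus>\<^bsub>\<Omega>\<^esub>p\<in>{..<m}. z (h p) \<odot>\<^bsub>\<Omega>\<^esub> pr (evec A (h p)))" if z: "z \<in> carrier FJ" for z
  proof -
    have "pr z = (\<Oplus>\<^bsub>\<Omega>\<^esub>p\<in>{..<m}. pr (z (h p) \<odot>\<^bsub>FJ\<^esub> evec A (h p)))"
      using lin_map_finsum[OF FJ.module_axioms \<Omega>.module_axioms pr,
          of "\<lambda>p. z (h p) \<odot>\<^bsub>FJ\<^esub> evec A (h p)" "{..<m}"] expJ[OF z] eJ zA[OF z] by auto
    also have "\<dots> = (\<Oplus>\<^bsub>\<Omega>\<^esub>p\<in>{..<m}. z (h p) \<odot>\<^bsub>\<Omega>\<^esub> pr (evec A (h p)))"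
      using lin_mapD(1)[OF pr] lin_mapD(3)[OF pr] eJ zA[OF z] by (intro \<Omega>.M.add.finprod_cong') auto
    finally show ?thesis .
  qed
  \<comment> \<open>The classes of the \<open>m\<close> basis vectors generate. This is the
    existence that the choice in \<open>fitting_ideal\<close> presupposes.\<close>
  have "\<exists>G. presents A \<Omega> m G"
  proof (rule presents_kernel[OF \<Omega>.module_axioms, where g = "\<lambda>p. pr (evec A (h p))"])
    show "(\<lambda>p. pr (evec A (h p))) \<in> {..<m} \<rightarrow> carrier \<Omega>" using lin_mapD(1)[OF pr eJ] by auto
    fix H assume H: "submodule H A \<Omega>" "(\<lambda>p. pr (evec A (h p))) ` {..<m} \<subseteq> H"
    show "carrier \<Omega> \<subseteq> H"
    proof
      fix x assume "x \<in> carrier \<Omega>"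
      then obtain z where z: "z \<in> carrier FJ" "x = pr z" using pr_surj by auto
      show "x \<in> H" unfolding z(2) pr_exp[OF z(1)]
        by (rule \<Omega>.submodule_finsum[OF H(1)], rule \<Omega>.submoduleE(4)[OF H(1)]) (use H(2) zA[OF z(1)] in auto)
    qed
  qed
  then obtain n G where nG: "presents A \<Omega> n G" "minors A n G (n - i) \<subseteq> {\<zero>\<^bsub>A\<^esub>}"
    using fitting_ideal_zero[OF A.is_cring, of \<Omega> i] fit unfolding \<Omega> by (auto simp: A_def)
  define Fn where "Fn = free_module A {..<n}"
  interpret Fn: module A Fn unfolding Fn_def by (rule A.free_module_module)
  obtain g where g: "g \<in> {..<n} \<rightarrow> carrier \<Omega>"
    "(\<lambda>y. \<Oplus>\<^bsub>\<Omega>\<^esub>k\<in>{..<n}. y k \<odot>\<^bsub>\<Omega>\<^esub> g k) ` carrier Fn = carrier \<Omega>" "G \<subseteq> carrier Fn"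
    "gen_submodule A Fn G = {y \<in> carrier Fn. (\<Oplus>\<^bsub>\<Omega>\<^esub>k\<in>{..<n}. y k \<odot>\<^bsub>\<Omega>\<^esub> g k) = \<zero>\<^bsub>\<Omega>\<^esub>}"
    using nG(1) by (auto simp: presents_def Let_def Fn_def)
  define e where "e y = (\<Oplus>\<^bsub>\<Omega>\<^esub>k\<in>{..<n}. y k \<odot>\<^bsub>\<Omega>\<^esub> g k)" for y
  have e: "lin_map A Fn \<Omega> e" unfolding e_def Fn_def by (rule \<Omega>.lin_map_lincomb) (use g(1) in auto)
  \<comment> \<open>\<open>C p\<close> writes the class of the basis vector at column
    \<open>h p\<close> in the chosen generators. Conversely, \<open>E q\<close> below represents the
    chosen generator \<open>g q\<close> by a vector over \<open>J\<close>.\<close>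
  have "\<forall>p. \<exists>c. p < m \<longrightarrow> c \<in> carrier Fn \<and> e c = pr (evec A (h p))"
  proof
    fix p
    show "\<exists>c. p < m \<longrightarrow> c \<in> carrier Fn \<and> e c = pr (evec A (h p))"
    proof (cases "p < m")
      case True
      then have "pr (evec A (h p)) \<in> e ` carrier Fn" using lin_mapD(1)[OF pr eJ[OF True]] g(2) by (simp add: e_def)
      then show ?thesis by auto
    qed simp
  qed
  then obtain C where C: "\<And>p. p < m \<Longrightarrow> C p \<in> carrier Fn" "\<And>p. p < m \<Longrightarrow> e (C p) = pr (evec A (h p))" by metis
  have "\<forall>q. \<exists>z. q < n \<longrightarrow> z \<in> carrier FJ \<and> pr z = g q"
  proof
    fix q
    show "\<exists>z. q < n \<longrightarrow> z \<in> carrier FJ \<and> pr z = g q"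
    proof (cases "q < n")
      case True
      then have "g q \<in> pr ` carrier FJ" using g(1) pr_surj by auto
      then show ?thesis by auto
    qed simp
  qed
  then obtain E where E: "\<And>q. q < n \<Longrightarrow> E q \<in> carrier FJ" "\<And>q. q < n \<Longrightarrow> pr (E q) = g q" by metis
  have eC: "e (\<Oplus>\<^bsub>Fn\<^esub>p\<in>{..<m}. z (h p) \<odot>\<^bsub>Fn\<^esub> C p) = pr z" if z: "z \<in> carrier FJ" for z
  proof -
    have "e (\<Oplus>\<^bsub>Fn\<^esub>p\<in>{..<m}. z (h p) \<odot>\<^bsub>Fn\<^esub> C p) = (\<Oplus>\<^bsub>\<Omega>\<^esub>p\<in>{..<m}. e (z (h p) \<odot>\<^bsub>Fn\<^esub> C p))"
      using C zA[OF z] by (intro lin_map_finsum[OF Fn.module_axioms \<Omega>.module_axioms e]) auto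
    also have "\<dots> = (\<Oplus>\<^bsub>\<Omega>\<^esub>p\<in>{..<m}. z (h p) \<odot>\<^bsub>\<Omega>\<^esub> pr (evec A (h p)))"
      using lin_mapD(1)[OF pr eJ] lin_mapD(3)[OF e] C zA[OF z] by (intro \<Omega>.M.add.finprod_cong') auto
    finally show ?thesis using pr_exp[OF z] by simp
  qed
  have sumC: "(\<Oplus>\<^bsub>Fn\<^esub>p\<in>{..<m}. z (h p) \<odot>\<^bsub>Fn\<^esub> C p) \<in> carrier Fn" if "z \<in> carrier FJ" for z
    using C zA[OF that] by (intro Fn.M.finsum_closed) auto
  define SF where "SF = free_module S {..<n}"
  interpret SF: module S SF unfolding SF_def by (rule S.free_module_module)
  define G' where "G' = (\<lambda>w q. ev (w q)) ` G"
  have sl: "semilin A ev Fn SF (\<lambda>w q. ev (w q))"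
    unfolding Fn_def SF_def by (rule semilin_map[OF A.is_cring S ev])
  have G'F: "G' \<subseteq> carrier SF" using g(3) sl by (auto simp: G'_def semilin_def)
  have K: "submodule (gen_submodule S SF G') S SF" by (rule SF.gen_submodule_submodule[OF G'F])
  \<comment> \<open>Only relations are specialised, not modules: the relations over the polynomial
    ring are spanned by \<open>G\<close>, and the vectors that specialise into the span of
    \<open>G'\<close> form a submodule containing \<open>G\<close>.\<close>
  have ker: "(\<lambda>q. ev (w q)) \<in> gen_submodule S SF G'" if "w \<in> carrier Fn" "e w = \<zero>\<^bsub>\<Omega>\<^esub>" for w
  proof -
    have "G \<subseteq> {w \<in> carrier Fn. (\<lambda>q. ev (w q)) \<in> gen_submodule S SF G'}"
      using g(3) gen_submodule_incl[of G' S SF] by (auto simp: G'_def)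
    then have "gen_submodule A Fn G \<subseteq> {w \<in> carrier Fn. (\<lambda>q. ev (w q)) \<in> gen_submodule S SF G'}"
      by (rule gen_submodule_least[OF semilin_preimage[OF A.is_cring S ev Fn.module_axioms SF.module_axioms sl K]])
    then show ?thesis using that g(4) by (auto simp: e_def)
  qed
  obtain cov :: "(('s \<Rightarrow>\<^sub>0 nat) \<Rightarrow>\<^sub>0 'r) \<Rightarrow> 's" where cov: "cov \<in> ring_hom base_ring S" "\<forall>s\<in>carrier S. \<exists>x. cov x = s"
    using universal_cover[OF S f] by auto
  interpret cov: ring_cover S cov by unfold_locales (use S cov in auto)
  interpret ev: ring_hom_cring A S ev by (simp add: ring_hom_cring_def ring_hom_cring_axioms_def A.is_cring S ev)
  have min0: "ring_det A (n - i) (\<lambda>p q. r p (c q)) = \<zero>\<^bsub>A\<^esub>"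
    if r: "r \<in> {..<n - i} \<rightarrow> G" and c: "c \<in> {..<n - i} \<rightarrow> {..<n}" for r c
  proof (cases "inj_on r {..<n - i} \<and> inj_on c {..<n - i}")
    case True
    then show ?thesis using nG(2) r c by (auto simp: minors_def)
  next
    case False
    have "r p q \<in> carrier A" if "p < n - i" for p q
      using r g(3) that A.free_module_closed[of "r p" "{..<n}" q] by (auto simp: Fn_def)
    then show ?thesis
      using False unfolding A_def mpoly_ring_simps
      by (intro mpoly_det_repeated) (auto simp: inj_on_def A_def, (metis lessThan_iff)+)
  qed
  have minS: "ring_det S (n - i) (\<lambda>p q. r p (c q)) = \<zero>\<^bsub>S\<^esub>"
    if r: "r \<in> {..<n - i} \<rightarrow> G'" and c: "c \<in> {..<n - i} \<rightarrow> {..<n}" for r c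
  proof -
    have "\<forall>p. \<exists>w. p < n - i \<longrightarrow> w \<in> G \<and> r p = (\<lambda>q. ev (w q))" using r by (auto simp: G'_def Pi_iff)
    then obtain w where w: "\<And>p. p < n - i \<Longrightarrow> w p \<in> G" "\<And>p. p < n - i \<Longrightarrow> r p = (\<lambda>q. ev (w p q))" by metis
    have wA: "w p q \<in> carrier A" if "p < n - i" for p q
      using w(1)[OF that] g(3) A.free_module_closed[of "w p" "{..<n}" q] by (auto simp: Fn_def)
    have "ring_det S (n - i) (\<lambda>p q. r p (c q)) = ring_det S (n - i) (\<lambda>p q. ev (w p (c q)))"
      by (rule S.ring_det_cong) (simp_all add: w(2) wA)
    also have "\<dots> = ev (ring_det A (n - i) (\<lambda>p q. w p (c q)))"
      by (rule ring_hom_det[OF A.is_cring S ev]) (simp add: wA)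
    also have "\<dots> = \<zero>\<^bsub>S\<^esub>" using min0[of w c] w(1) c by simp
    finally show ?thesis .
  qed
  show ?thesis
  proof (cases "i \<le> n")
    case False
    \<comment> \<open>If the index exceeds \<open>n\<close>, truncated subtraction gives the empty
      minor \<open>1\<close>; its vanishing makes \<open>S\<close> the zero ring.\<close>
    then have "\<one>\<^bsub>S\<^esub> = \<zero>\<^bsub>S\<^esub>" using minS[of undefined undefined] by (simp add: ring_det_def)
    then show ?thesis
      using S.l_one[of "T d0 (h d0)"] S.l_null[of "T d0 (h d0)"] S.free_module_closed[OF T[OF d0]] by simp
  next
    case True
    show ?thesis
    proof (rule cov.triangular_relations_zero[where T = "\<lambda>a b. T a (h b)" and k = "n - i" and n = n and m = m
          and G = G' and C = "\<lambda>p q. ev (C p q)" and E = "\<lambda>q p. ev (E q (h p))" and Gd = Gd, folded SF_def])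
      show "m + (n - i) \<le> card Gd + n" using Gd(2) True by linarith
      show "(\<lambda>q. ev (C p q)) \<in> carrier SF" if "p < m" for p
        using sl C(1)[OF that] by (auto simp: semilin_def)
      show "ev (E q (h p)) \<in> carrier S" if "q < n" for q p using zA[OF E(1)[OF that]] by simp
      show "T a (h p) \<in> carrier S" if "a < m" for a p by (rule S.free_module_closed[OF T[OF that]])
      show "evec S q \<ominus>\<^bsub>SF\<^esub> (\<Oplus>\<^bsub>SF\<^esub>p\<in>{..<m}. ev (E q (h p)) \<odot>\<^bsub>SF\<^esub> (\<lambda>q. ev (C p q))) \<in> gen_submodule S SF G'"
        if q: "q < n" for q
      proof -
        \<comment> \<open>The \<open>q\<close>-th basis vector and the combination \<open>?s\<close>
          both represent the generator \<open>g q\<close>, so their difference is a relation of the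
          chosen presentation.\<close>
        let ?s = "\<Oplus>\<^bsub>Fn\<^esub>p\<in>{..<m}. E q (h p) \<odot>\<^bsub>Fn\<^esub> C p"
        have ec: "evec A q \<in> carrier Fn" unfolding Fn_def using q by (intro A.evec_closed) simp
        note sc = sumC[OF E(1)[OF q]]
        have w: "evec A q \<ominus>\<^bsub>Fn\<^esub> ?s \<in> carrier Fn" using ec sc by (rule Fn.M.minus_closed)
        have "e (evec A q) = g q"
          unfolding e_def by (rule \<Omega>.lincomb_evec) (use g(1) q in auto)
        moreover have gq: "g q \<in> carrier \<Omega>" using g(1) q by auto
        ultimately have "e (evec A q \<ominus>\<^bsub>Fn\<^esub> ?s) = \<zero>\<^bsub>\<Omega>\<^esub>"
          using lin_map_diff[OF Fn.module_axioms \<Omega>.module_axioms e ec sc] eC[OF E(1)[OF q]] E(2)[OF q]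
            \<Omega>.M.r_neg[OF gq] by (simp add: \<Omega>.M.minus_eq)
        from ker[OF w this] have "(\<lambda>a. ev ((evec A q \<ominus>\<^bsub>Fn\<^esub> ?s) a)) \<in> gen_submodule S SF G'" .
        moreover have "(\<lambda>a. ev ((evec A q \<ominus>\<^bsub>Fn\<^esub> ?s) a)) =
            evec S q \<ominus>\<^bsub>SF\<^esub> (\<Oplus>\<^bsub>SF\<^esub>p\<in>{..<m}. ev (E q (h p)) \<odot>\<^bsub>SF\<^esub> (\<lambda>q. ev (C p q)))"
        proof
          fix a
          have sS: "(\<lambda>a. ev (?s a)) = (\<Oplus>\<^bsub>SF\<^esub>p\<in>{..<m}. ev (E q (h p)) \<odot>\<^bsub>SF\<^esub> (\<lambda>q. ev (C p q)))"
            unfolding Fn_def SF_def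
            by (rule map_lincomb[OF A.is_cring S ev]) (use C zA[OF E(1)[OF q]] in \<open>auto simp: Fn_def\<close>)
          have sSc: "(\<lambda>a. ev (?s a)) \<in> carrier SF" using sl sc by (auto simp: semilin_def)
          have eS: "evec S q \<in> carrier SF" unfolding SF_def using q by (intro S.evec_closed) simp
          have "ev ((evec A q \<ominus>\<^bsub>Fn\<^esub> ?s) a) = ev (evec A q a \<ominus>\<^bsub>A\<^esub> ?s a)"
            using A.free_module_minus[OF ec[unfolded Fn_def] sc[unfolded Fn_def]] by (simp add: Fn_def)
          also have "\<dots> = ev (evec A q a) \<ominus>\<^bsub>S\<^esub> ev (?s a)"
            using A.free_module_closed[OF ec[unfolded Fn_def], of a] A.free_module_closed[OF sc[unfolded Fn_def], of a]
            by (simp add: A.minus_eq S.minus_eq Fn_def)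
          also have "ev (evec A q a) = evec S q a" by (simp add: evec_def)
          also have "evec S q a \<ominus>\<^bsub>S\<^esub> ev (?s a) = (evec S q \<ominus>\<^bsub>SF\<^esub> (\<lambda>a. ev (?s a))) a"
            using S.free_module_minus[OF eS[unfolded SF_def] sSc[unfolded SF_def]] by (simp add: SF_def)
          finally show "ev ((evec A q \<ominus>\<^bsub>Fn\<^esub> ?s) a) =
              (evec S q \<ominus>\<^bsub>SF\<^esub> (\<Oplus>\<^bsub>SF\<^esub>p\<in>{..<m}. ev (E q (h p)) \<odot>\<^bsub>SF\<^esub> (\<lambda>q. ev (C p q)))) a"
            unfolding sS .
        qed
        ultimately show ?thesis by simp
      qed
      show "(\<Oplus>\<^bsub>SF\<^esub>p\<in>{..<m}. T a (h p) \<odot>\<^bsub>SF\<^esub> (\<lambda>q. ev (C p q))) \<in> gen_submodule S SF G'" if a: "a \<in> Gd" for a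
      proof -
        \<comment> \<open>Rewriting vectors over \<open>J\<close> in the chosen generators is
          linear, so it is enough to rewrite the specialised orbit rows. Before specialisation these
          represent zero in the orbit module.\<close>
        let ?L = "\<lambda>z. \<Oplus>\<^bsub>SF\<^esub>p\<in>{..<m}. z (h p) \<odot>\<^bsub>SF\<^esub> (\<lambda>q. ev (C p q))"
        have L: "lin_map S (free_module S J) SF ?L"
          by (rule SF.lin_map_lincomb) (use sl C(1) in \<open>auto simp: semilin_def\<close>)
        have slJ: "semilin A ev FJ (free_module S J) (\<lambda>z j. ev (z j))"
          unfolding FJ_def by (rule semilin_map[OF A.is_cring S ev])
        show ?thesis
        proof (rule lin_map_gen[OF S.free_module_module SF.module_axioms L _ K _ TG[OF a]])
          show "(\<lambda>b j. ev (orbit_row I \<theta> b j)) ` carrier (rep_par \<theta>) \<subseteq> carrier (free_module S J)"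
            using slJ rowsF by (auto simp: semilin_def)
          fix z assume "z \<in> (\<lambda>b j. ev (orbit_row I \<theta> b j)) ` carrier (rep_par \<theta>)"
          then obtain b where b: "b \<in> carrier (rep_par \<theta>)" "z = (\<lambda>j. ev (orbit_row I \<theta> b j))" by auto
          have rF: "orbit_row I \<theta> b \<in> carrier FJ" using rowsF b by auto
          have "orbit_row I \<theta> b \<in> W" unfolding W_def using b(1) by (intro gen_submodule_incl[THEN subsetD]) auto
          then have "e (\<Oplus>\<^bsub>Fn\<^esub>p\<in>{..<m}. orbit_row I \<theta> b (h p) \<odot>\<^bsub>Fn\<^esub> C p) = \<zero>\<^bsub>\<Omega>\<^esub>"
            using eC[OF rF] pr_zero by simp
          from ker[OF sumC[OF rF] this]
          have "(\<lambda>q. ev ((\<Oplus>\<^bsub>Fn\<^esub>p\<in>{..<m}. orbit_row I \<theta> b (h p) \<odot>\<^bsub>Fn\<^esub> C p) q)) \<in> gen_submodule S SF G'" .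
          moreover have "(\<lambda>q. ev ((\<Oplus>\<^bsub>Fn\<^esub>p\<in>{..<m}. orbit_row I \<theta> b (h p) \<odot>\<^bsub>Fn\<^esub> C p) q)) = ?L z"
            unfolding b(2) Fn_def SF_def
            by (rule map_lincomb[OF A.is_cring S ev]) (use C zA[OF rF] in \<open>auto simp: Fn_def\<close>)
          ultimately show "?L z \<in> gen_submodule S SF G'" by simp
        qed
      qed
    qed (use G'F minS tri Gd d0 diag in auto)
  qed
qed

section \<open>Vectors produced by relations at a point\<close>

lemma (in abelian_group) add_minus_cancel: "x \<in> carrier G \<Longrightarrow> y \<in> carrier G \<Longrightarrow> x \<oplus> y \<ominus> x = y"
  by (simp add: minus_eq a_comm[of x y] a_assoc r_neg)

lemma (in abelian_group) minus_minus_cancel: "x \<in> carrier G \<Longrightarrow> y \<in> carrier G \<Longrightarrow> x \<ominus> (x \<ominus> y) = y"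
  by (simp add: minus_eq minus_add r_neg2)

definition lvar_inv :: "'v \<Rightarrow> ('v, 'r::comm_ring_1) laurent" where
  "lvar_inv v = Poly_Mapping.single (Poly_Mapping.single v (- 1)) 1"

lemma lvar_inv: "lvar v * lvar_inv v = 1"
  by (simp add: lvar_def lvar_inv_def mult_single flip: single_add)

lemma lvar_inv_closed: "v \<in> V \<Longrightarrow> lvar_inv v \<in> carrier (laurent_ring V)"
  by (auto simp: laurent_ring_def lvar_inv_def)

lemma sum_single_support:
  assumes "finite A" "\<And>x. x \<in> A \<Longrightarrow> x \<noteq> a \<Longrightarrow> g x = 0"
  shows "sum g A = (if a \<in> A then g a else 0)"
proof -
  have "sum g A = (\<Sum>x\<in>A. if x = a then g a else 0)" using assms(2) by (intro sum.cong) auto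
  then show ?thesis using assms(1) by (simp add: sum.delta)
qed

text \<open>If no colour complete in \<open>A\<close> restricts \<open>b\<close>, the basis vector
  at \<open>b\<close> is itself a relation. Otherwise the colour of \<open>b\<close>, being
  incomplete in \<open>A'\<close>, also occurs at some \<open>d\<close> in \<open>A\<close> outside
  \<open>A'\<close>, and the contribution of \<open>b\<close> is cancelled there: the relation is
  \<open>e_b - (u_b / u_d) e_d\<close>, which uses that \<open>u_d\<close> is invertible.\<close>

lemma blank_relation:
  assumes col: "partial_colouring V \<beta>" and AU: "A \<subseteq> U" and A'A: "A' \<subseteq> A" and b: "b \<in> A'"
    and blank: "local_colour A' \<beta> b = None"
  shows "\<exists>x\<in>(Rel U A \<beta> :: ('u \<Rightarrow> ('u, 'r::comm_ring_1) laurent) set). x b = 1 \<and> (\<forall>b'\<in>A'. b' \<noteq> b \<longrightarrow> x b' = 0)"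
proof -
  interpret L: cring "laurent_ring U :: ('u, 'r) laurent ring" by (rule cring_laurent_ring)
  let ?F = "free_module (laurent_ring U :: ('u, 'r) laurent ring) A"
  interpret F: module "laurent_ring U :: ('u, 'r) laurent ring" ?F by (rule L.free_module_module)
  have fin: "finite (\<beta> -` {Some c})" for c using col by (simp add: partial_colouring_def)
  let ?e = "evec (laurent_ring U :: ('u, 'r) laurent ring)"
  have bA: "b \<in> A" using b A'A by auto
  have e: "?e b \<in> carrier ?F" by (rule L.evec_closed[OF bA])
  have ev: "?e b b = 1" "b' \<noteq> b \<Longrightarrow> ?e b b' = 0" for b b' :: 'u by (simp_all add: evec_def)
  show ?thesis
  proof (cases "\<exists>c. \<beta> b = Some c \<and> c \<in> colours_in \<beta> A")
    case False
    have "(\<Sum>b'\<in>\<beta> -` {Some c}. lvar b' * ?e b b') = 0" if "c \<in> colours_in \<beta> A" for c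
      by (subst sum_single_support[OF fin, of _ b]) (use False that in \<open>auto simp: ev\<close>)
    then have "?e b \<in> Rel U A \<beta>" using e by (simp add: Rel_def)
    then show ?thesis using ev by (intro bexI[of _ "?e b"]) auto
  next
    case True
    then obtain c where c: "\<beta> b = Some c" "c \<in> colours_in \<beta> A" by auto
    then have "c \<notin> colours_in \<beta> A'" using blank by (auto simp: local_colour_def split: if_splits)
    then obtain d where d: "\<beta> d = Some c" "d \<notin> A'" by (auto simp: colours_in_def)
    have dA: "d \<in> A" using c(2) d(1) by (auto simp: colours_in_def)
    have db: "d \<noteq> b" using d(2) b by auto
    define s where "s = - (lvar b * lvar_inv d :: ('u, 'r) laurent)"
    have s: "s \<in> carrier (laurent_ring U)"
    proof -
      have "lvar b * lvar_inv d \<in> carrier (laurent_ring U :: ('u, 'r) laurent ring)"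
        using L.m_closed[OF lvar_closed(1)[of b U] lvar_inv_closed[of d U]] bA dA AU by auto
      then show ?thesis
        using type_subring.uminus[OF laurent_subring] by (simp add: s_def laurent_ring_eq)
    qed
    define x where "x = ?e b \<oplus>\<^bsub>?F\<^esub> s \<odot>\<^bsub>?F\<^esub> ?e d"
    have x: "x \<in> carrier ?F"
      unfolding x_def by (intro F.M.a_closed F.smult_closed e s L.evec_closed dA)
    have xv: "x b' = ?e b b' + s * ?e d b'" for b' by (simp add: x_def)
    have "(\<Sum>b'\<in>\<beta> -` {Some c'}. lvar b' * x b') = 0" if c': "c' \<in> colours_in \<beta> A" for c'
    proof -
      have "(\<Sum>b'\<in>\<beta> -` {Some c'}. lvar b' * x b') =
          (\<Sum>b'\<in>\<beta> -` {Some c'}. lvar b' * ?e b b') + (\<Sum>b'\<in>\<beta> -` {Some c'}. lvar b' * (s * ?e d b'))"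
        by (simp add: xv distrib_left sum.distrib)
      also have "(\<Sum>b'\<in>\<beta> -` {Some c'}. lvar b' * ?e b b') = (if b \<in> \<beta> -` {Some c'} then lvar b else 0)"
        by (subst sum_single_support[OF fin, of _ b]) (simp_all add: ev)
      also have "(\<Sum>b'\<in>\<beta> -` {Some c'}. lvar b' * (s * ?e d b')) = (if d \<in> \<beta> -` {Some c'} then lvar d * s else 0)"
        by (subst sum_single_support[OF fin, of _ d]) (simp_all add: ev)
      also have "lvar d * s = - lvar b"
      proof -
        have "lvar d * s = - (lvar b * (lvar d * lvar_inv d))" by (simp add: s_def mult.left_commute)
        then show ?thesis by (simp add: lvar_inv)
      qed
      finally show ?thesis using c(1) d(1) by simp
    qed
    then have "x \<in> Rel U A \<beta>" using x by (simp add: Rel_def)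
    moreover have "x b = 1" using db ev by (simp add: xv)
    moreover have "\<forall>b'\<in>A'. b' \<noteq> b \<longrightarrow> x b' = 0" using d(2) by (auto simp: xv ev evec_def)
    ultimately show ?thesis by blast
  qed
qed

text \<open>The quotient of the valuation ring enters through a nilpotent \<open>\<pi>\<close> of
  which every non-unit is a multiple. In the application \<open>\<psi>\<close> is the structure map
  to the valuation ring followed by reduction.\<close>

locale family_point =
  fixes S :: "('s, 'x) ring_scheme" and \<pi> :: 's and n :: nat
    and U :: "'u set" and B :: "'u fam_sets" and \<theta> :: "('u, 'r::comm_ring_1) fam_maps"
    and \<beta> :: "'u \<Rightarrow> 'c option" and I J :: "nat set" and l :: nat and \<psi> :: "('u, 'r) laurent \<Rightarrow> 's"
  assumes S_cring: "cring S" and \<pi>: "\<pi> \<in> carrier S" and \<pi>_nil: "\<pi> [^]\<^bsub>S\<^esub> n = \<zero>\<^bsub>S\<^esub>"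
    and local_ring: "\<And>s. s \<in> carrier S \<Longrightarrow> s \<in> Units S \<or> (\<exists>t\<in>carrier S. s = \<pi> \<otimes>\<^bsub>S\<^esub> t)"
    and comb: "comb_family B \<theta>" and BU: "B_infinity B \<subseteq> U"
    and finI: "finite I" and finJ: "finite J" and const: "constant_rank B \<theta> I J l"
    and col: "partial_colouring (B_infinity B) \<beta>" and adm: "admissible B \<theta> \<beta> I J l"
    and \<psi>: "\<psi> \<in> ring_hom (laurent_ring U) S"
begin

interpretation S: cring S by (rule S_cring)

abbreviation "SJ \<equiv> free_module S J"
abbreviation "Bs \<equiv> B I J"

interpretation SJ: module S SJ by (rule S.free_module_module)

definition f where "f r = \<psi> (lconst r)"
text \<open>This is the image of the vector \<open>y\<close> under the matrix of \<open>b\<close>,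
  and also the orbit row of the basis element \<open>b\<close> evaluated at
  \<open>X_i = y i\<close>. The two readings link relations with the orbit module.\<close>

definition basis_vec where "basis_vec y b = (\<lambda>j. \<Oplus>\<^bsub>S\<^esub>i\<in>I. y i \<otimes>\<^bsub>S\<^esub> f (entry \<theta> I J b i j))"
definition point_vec where "point_vec y \<xi> = (\<Oplus>\<^bsub>SJ\<^esub>b\<in>Bs. \<xi> b \<odot>\<^bsub>SJ\<^esub> basis_vec y b)"
text \<open>\<open>\<psi>\<close> need not be surjective, so the specialised relations need not be
  closed under scalars from \<open>S\<close>. For this reason \<open>rel_span\<close> takes the span
  of the vectors that they produce.\<close>

definition Rel_image where "Rel_image = (\<lambda>x b. \<psi> (x b)) ` (Rel U Bs \<beta>)"
definition rel_span where "rel_span y = gen_submodule S SJ (point_vec y ` Rel_image)"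

lemma f_hom: "f \<in> ring_hom base_ring S"
  using ring_hom_trans[OF lconst_hom \<psi>] by (simp add: f_def[abs_def] comp_def)

lemma f_closed: "f r \<in> carrier S" using ring_hom_closed[OF f_hom] by simp
lemma f_zero: "f 0 = \<zero>\<^bsub>S\<^esub>"
  using ring_hom_zero[OF f_hom cring.axioms(1)[OF cring_base_ring] S.ring_axioms] by simp

lemma f_unit: assumes "r dvd 1" shows "f r \<in> Units S"
proof -
  obtain t where "1 = r * t" using assms by auto
  then have "f r \<otimes>\<^bsub>S\<^esub> f t = \<one>\<^bsub>S\<^esub>" using ring_hom_mult[OF f_hom, of r t] ring_hom_one[OF f_hom] by simp
  then show ?thesis using f_closed S.m_comm[of "f r" "f t"] by (auto simp: Units_def)
qed

lemma comb_familyD: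
  assumes "finite H" "finite K"
  shows "finite (B H K)" "is_mod_rep base_ring (fam_rep B \<theta> H K)"
    "\<And>b i j. b \<in> B H K \<Longrightarrow> i \<in> H \<Longrightarrow> j \<in> K \<Longrightarrow> entry \<theta> H K b i j \<noteq> 0 \<Longrightarrow> entry \<theta> H K b i j dvd 1"
proof -
  note * = comb[unfolded comb_family_def, THEN conjunct1, rule_format, OF assms]
  show "finite (B H K)" using * by (elim conjE)
  show "is_mod_rep base_ring (fam_rep B \<theta> H K)" using * by (elim conjE)
  have "\<forall>b\<in>B H K. \<forall>i\<in>H. \<forall>j\<in>K. entry \<theta> H K b i j \<noteq> 0 \<longrightarrow> entry \<theta> H K b i j dvd 1"
    using * by (elim conjE)
  then show "entry \<theta> H K b i j dvd 1" if "b \<in> B H K" "i \<in> H" "j \<in> K" "entry \<theta> H K b i j \<noteq> 0" for b i j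
    using that by simp
qed

lemma comb_family_restrictD:
  assumes "finite H'" "finite K'" "H \<subseteq> H'" "K \<subseteq> K'"
  shows "B H K \<subseteq> B H' K'"
    "\<And>x y. x \<in> carrier (free_module base_ring (B H' K')) \<Longrightarrow> y \<in> carrier (free_module base_ring H) \<Longrightarrow>
      \<theta> H K (ret base_ring (B H K) x) y = ret base_ring K (\<theta> H' K' x y)"
proof -
  note * = comb[unfolded comb_family_def, THEN conjunct2, rule_format, OF assms]
  show "B H K \<subseteq> B H' K'" using * by (rule conjunct1)
  show "\<theta> H K (ret base_ring (B H K) x) y = ret base_ring K (\<theta> H' K' x y)"
    if "x \<in> carrier (free_module base_ring (B H' K'))" "y \<in> carrier (free_module base_ring H)" for x y
    using conjunct2[OF *] that by (elim ballE) auto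
qed

lemma entry_outside:
  assumes "finite H" "finite K" "b \<in> B H K" "i \<in> H" "j \<notin> K" shows "entry \<theta> H K b i j = 0"
proof -
  interpret b: cring "base_ring :: 'r ring" by (rule cring_base_ring)
  have "\<theta> H K (evec base_ring b) (evec base_ring i) \<in> carrier (free_module base_ring K)"
    using lin_mapD(1)[OF lin_map_rep_act2[OF comb_familyD(2)[OF assms(1,2)]], of "evec base_ring b" "evec base_ring i"]
      b.evec_closed[OF assms(3)] b.evec_closed[OF assms(4)] by (simp add: fam_rep_def)
  from free_module_zero_outside[OF this assms(5)] show ?thesis by (simp add: entry_def)
qed

text \<open>Compatibility with restriction, tested on a basis vector: \<open>ret\<close> either
  fixes it or kills it. So cells of a smaller grid can be used in computations with the matrices
  over \<open>(I, J)\<close>.\<close>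

lemma entry_restrict:
  assumes "finite H'" "finite K'" "H \<subseteq> H'" "K \<subseteq> K'" "b \<in> B H' K'" "i \<in> H" "j \<in> K"
  shows "entry \<theta> H' K' b i j = (if b \<in> B H K then entry \<theta> H K b i j else 0)"
proof -
  interpret b: cring "base_ring :: 'r ring" by (rule cring_base_ring)
  have fin: "finite H" "finite K" using assms finite_subset by auto
  have eb: "evec base_ring b \<in> carrier (free_module (base_ring :: 'r ring) (B H' K'))" by (rule b.evec_closed[OF assms(5)])
  have ei: "evec base_ring i \<in> carrier (free_module (base_ring :: 'r ring) H)" by (rule b.evec_closed[OF assms(6)])
  have eq: "\<theta> H K (ret base_ring (B H K) (evec base_ring b)) (evec base_ring i) j = entry \<theta> H' K' b i j"
    using comb_family_restrictD(2)[OF assms(1-4) eb ei] assms(7) by (simp add: ret_def entry_def)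
  show ?thesis
  proof (cases "b \<in> B H K")
    case True
    then have "ret base_ring (B H K) (evec base_ring b) = (evec base_ring b :: 'u \<Rightarrow> 'r)" by (auto simp: ret_def evec_def)
    then show ?thesis using eq True by (simp add: entry_def)
  next
    case False
    then have r: "ret base_ring (B H K) (evec base_ring b) = (\<zero>\<^bsub>free_module base_ring (B H K)\<^esub> :: 'u \<Rightarrow> 'r)"
      by (auto simp: ret_def evec_def)
    note rep = comb_familyD(2)[OF fin]
    have "lin_map base_ring (free_module base_ring (B H K)) (free_module base_ring K) (\<lambda>x. \<theta> H K x (evec base_ring i))"
      using lin_map_rep_act1[OF rep, of "evec base_ring i"] ei by (simp add: fam_rep_def)
    from lin_map_zero[OF b.free_module_module b.free_module_module this]
    have "\<theta> H K \<zero>\<^bsub>free_module base_ring (B H K)\<^esub> (evec base_ring i) j = (0 :: 'r)" by simp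
    then show ?thesis using eq False unfolding r by simp
  qed
qed

lemma finB: "finite Bs" by (rule comb_familyD(1)[OF finI finJ])

lemma basis_vec_closed: assumes y: "y \<in> I \<rightarrow> carrier S" and b: "b \<in> Bs" shows "basis_vec y b \<in> carrier SJ"
  unfolding carrier_free_module_finite[OF finJ]
proof (intro conjI ballI allI impI)
  have yc: "y i \<in> carrier S" if "i \<in> I" for i using y that by auto
  show "basis_vec y b j \<in> carrier S" for j
    unfolding basis_vec_def using y f_closed by (intro S.finsum_closed) auto
  fix j assume "j \<notin> J"
  then have "basis_vec y b j = (\<Oplus>\<^bsub>S\<^esub>i\<in>I. \<zero>\<^bsub>S\<^esub>)"
    unfolding basis_vec_def using yc entry_outside[OF finI finJ b] by (intro S.add.finprod_cong') (auto simp: f_zero)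
  then show "basis_vec y b j = \<zero>\<^bsub>S\<^esub>" by simp
qed

lemma point_vec_lin: "y \<in> I \<rightarrow> carrier S \<Longrightarrow> lin_map S (free_module S Bs) SJ (point_vec y)"
  unfolding point_vec_def by (rule SJ.lin_map_lincomb[OF finB]) (simp add: basis_vec_closed)

lemma Rel_image_closed: "Rel_image \<subseteq> carrier (free_module S Bs)"
proof
  fix \<xi> assume "\<xi> \<in> Rel_image"
  then obtain x where x: "x \<in> Rel U Bs \<beta>" "\<xi> = (\<lambda>b. \<psi> (x b))" by (auto simp: Rel_image_def)
  then show "\<xi> \<in> carrier (free_module S Bs)"
    using semilin_map[OF cring_laurent_ring S_cring \<psi>, of Bs] by (auto simp: semilin_def Rel_def)
qed

lemma rel_span_submodule: assumes "y \<in> I \<rightarrow> carrier S" shows "submodule (rel_span y) S SJ"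
  unfolding rel_span_def using lin_mapD(1)[OF point_vec_lin[OF assms]] Rel_image_closed
  by (intro SJ.gen_submodule_submodule) auto

lemma point_vec_rel_span: "\<xi> \<in> Rel_image \<Longrightarrow> point_vec y \<xi> \<in> rel_span y"
  unfolding rel_span_def by (rule gen_submodule_incl[THEN subsetD]) simp

lemma point_vec_apply:
  assumes y: "y \<in> I \<rightarrow> carrier S" and \<xi>: "\<xi> \<in> carrier (free_module S Bs)"
  shows "point_vec y \<xi> j = (\<Oplus>\<^bsub>S\<^esub>i\<in>I. y i \<otimes>\<^bsub>S\<^esub> (\<Oplus>\<^bsub>S\<^esub>b\<in>Bs. \<xi> b \<otimes>\<^bsub>S\<^esub> f (entry \<theta> I J b i j)))"
proof -
  note \<xi>c = S.free_module_closed[OF \<xi>]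
  have yc: "y i \<in> carrier S" if "i \<in> I" for i using y that by auto
  have cl: "\<xi> b \<otimes>\<^bsub>S\<^esub> (y i \<otimes>\<^bsub>S\<^esub> f (entry \<theta> I J b i j)) \<in> carrier S" if "i \<in> I" for b i
    using \<xi>c yc f_closed that by auto
  have "point_vec y \<xi> j = (\<Oplus>\<^bsub>S\<^esub>b\<in>Bs. \<xi> b \<otimes>\<^bsub>S\<^esub> basis_vec y b j)"
    unfolding point_vec_def using \<xi>c basis_vec_closed[OF y]
    by (subst S.finsum_free_module) (auto intro!: SJ.smult_closed simp del: free_module_simps(3), simp)
  also have "\<dots> = (\<Oplus>\<^bsub>S\<^esub>b\<in>Bs. \<Oplus>\<^bsub>S\<^esub>i\<in>I. \<xi> b \<otimes>\<^bsub>S\<^esub> (y i \<otimes>\<^bsub>S\<^esub> f (entry \<theta> I J b i j)))"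
    unfolding basis_vec_def using \<xi>c yc f_closed finI
    by (intro S.add.finprod_cong' refl S.finsum_rdistr) (auto intro!: S.finsum_closed)
  also have "\<dots> = (\<Oplus>\<^bsub>S\<^esub>i\<in>I. \<Oplus>\<^bsub>S\<^esub>b\<in>Bs. \<xi> b \<otimes>\<^bsub>S\<^esub> (y i \<otimes>\<^bsub>S\<^esub> f (entry \<theta> I J b i j)))"
  proof -
    let ?h = "\<lambda>(b, i). \<xi> b \<otimes>\<^bsub>S\<^esub> (y i \<otimes>\<^bsub>S\<^esub> f (entry \<theta> I J b i j))"
    have "finsum S ?h (Bs \<times> I) = finsum S ?h (prod.swap ` (I \<times> Bs))" by (simp add: product_swap)
    also have "\<dots> = (\<Oplus>\<^bsub>S\<^esub>p\<in>I \<times> Bs. ?h (prod.swap p))"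
      by (rule S.add.finprod_reindex) (use cl in \<open>auto\<close>)
    finally show ?thesis
      using S.finsum_Times[OF finB finI, of ?h] S.finsum_Times[OF finI finB, of "\<lambda>p. ?h (prod.swap p)"] cl by simp
  qed
  also have "\<dots> = (\<Oplus>\<^bsub>S\<^esub>i\<in>I. y i \<otimes>\<^bsub>S\<^esub> (\<Oplus>\<^bsub>S\<^esub>b\<in>Bs. \<xi> b \<otimes>\<^bsub>S\<^esub> f (entry \<theta> I J b i j)))"
  proof (rule S.add.finprod_cong'[OF refl])
    show "(\<lambda>i. y i \<otimes>\<^bsub>S\<^esub> (\<Oplus>\<^bsub>S\<^esub>b\<in>Bs. \<xi> b \<otimes>\<^bsub>S\<^esub> f (entry \<theta> I J b i j))) \<in> I \<rightarrow> carrier S"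
      using \<xi>c yc f_closed by (auto intro!: S.finsum_closed S.m_closed)
    fix i assume i: "i \<in> I"
    have yi: "y i \<in> carrier S" using y i by auto
    have "(\<Oplus>\<^bsub>S\<^esub>b\<in>Bs. \<xi> b \<otimes>\<^bsub>S\<^esub> (y i \<otimes>\<^bsub>S\<^esub> f (entry \<theta> I J b i j))) = (\<Oplus>\<^bsub>S\<^esub>b\<in>Bs. y i \<otimes>\<^bsub>S\<^esub> (\<xi> b \<otimes>\<^bsub>S\<^esub> f (entry \<theta> I J b i j)))"
      using \<xi>c yi f_closed by (intro S.add.finprod_cong') (auto simp: S.m_lcomm)
    also have "\<dots> = y i \<otimes>\<^bsub>S\<^esub> (\<Oplus>\<^bsub>S\<^esub>b\<in>Bs. \<xi> b \<otimes>\<^bsub>S\<^esub> f (entry \<theta> I J b i j))"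
      using \<xi>c yi f_closed finB by (intro S.finsum_rdistr[symmetric]) auto
    finally show "(\<Oplus>\<^bsub>S\<^esub>b\<in>Bs. \<xi> b \<otimes>\<^bsub>S\<^esub> (y i \<otimes>\<^bsub>S\<^esub> f (entry \<theta> I J b i j))) =
        y i \<otimes>\<^bsub>S\<^esub> (\<Oplus>\<^bsub>S\<^esub>b\<in>Bs. \<xi> b \<otimes>\<^bsub>S\<^esub> f (entry \<theta> I J b i j))" .
  qed
  finally show ?thesis .
qed

text \<open>An isolated blank cell \<open>(i0, j0)\<close> provides a relation whose value at \<open>y\<close> is, up to multiples of \<open>\<pi>\<close>, a unit
  multiple of the basis vector at \<open>j0\<close> as far as the columns that are left are concerned.\<close>

lemma isolated_blank_vector:
  assumes y: "y \<in> I \<rightarrow> carrier S" and K: "K \<subseteq> J"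
  defines "H \<equiv> {i \<in> I. y i \<in> Units S}"
  assumes b: "b \<in> B H K" and cell: "cell_class \<theta> H K b = {(i0, j0)}" and blank: "local_colour (B H K) \<beta> b = None"
  shows "\<exists>\<xi>\<in>Rel_image. \<exists>u\<in>Units S. \<forall>j\<in>K. \<exists>t\<in>carrier S. point_vec y \<xi> j = (if j = j0 then u else \<zero>\<^bsub>S\<^esub>) \<oplus>\<^bsub>S\<^esub> \<pi> \<otimes>\<^bsub>S\<^esub> t"
proof -
  have HI: "H \<subseteq> I" by (auto simp: H_def)
  have fin: "finite H" "finite K" using HI K finI finJ finite_subset by auto
  have sub: "B H K \<subseteq> Bs" by (rule comb_family_restrictD(1)[OF finI finJ HI K])
  have BsU: "Bs \<subseteq> U" using BU finI finJ by (auto simp: B_infinity_def)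
  have cells: "i0 \<in> H" "j0 \<in> K" "entry \<theta> H K b i0 j0 \<noteq> 0"
    "\<And>i j. i \<in> H \<Longrightarrow> j \<in> K \<Longrightarrow> (i, j) \<noteq> (i0, j0) \<Longrightarrow> entry \<theta> H K b i j = 0"
    using cell by (auto simp: cell_class_def)
  \<comment> \<open>The relation lives over \<open>B I J\<close> but is normalised on
    \<open>B H K\<close> only. Its other coordinates belong to classes that do not meet
    \<open>H \<times> K\<close>.\<close>
  obtain x :: "'u \<Rightarrow> ('u, 'r) laurent" where x: "x \<in> Rel U Bs \<beta>" "x b = 1" "\<forall>b'\<in>B H K. b' \<noteq> b \<longrightarrow> x b' = 0"
    using blank_relation[OF col BsU sub b blank] by auto
  define \<xi> where "\<xi> = (\<lambda>b. \<psi> (x b))"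
  have \<xi>R: "\<xi> \<in> Rel_image" using x(1) by (auto simp: Rel_image_def \<xi>_def)
  then have \<xi>: "\<xi> \<in> carrier (free_module S Bs)" using Rel_image_closed by auto
  note \<xi>c = S.free_module_closed[OF \<xi>]
  have \<xi>v: "\<xi> b = \<one>\<^bsub>S\<^esub>" "\<And>b'. b' \<in> B H K \<Longrightarrow> b' \<noteq> b \<Longrightarrow> \<xi> b' = \<zero>\<^bsub>S\<^esub>"
    using x(2,3) ring_hom_one[OF \<psi>] ring_hom_zero[OF \<psi> cring.axioms(1)[OF cring_laurent_ring] S.ring_axioms]
    by (simp_all add: \<xi>_def)
  define c where "c i j = (\<Oplus>\<^bsub>S\<^esub>b\<in>Bs. \<xi> b \<otimes>\<^bsub>S\<^esub> f (entry \<theta> I J b i j))" for i j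
  have cc: "c i j \<in> carrier S" for i j unfolding c_def using \<xi>c f_closed by (intro S.finsum_closed) auto
  have cH: "c i j = f (entry \<theta> H K b i j)" if "i \<in> H" "j \<in> K" for i j
  proof -
    have "c i j = (\<Oplus>\<^bsub>S\<^esub>b'\<in>Bs. if b = b' then f (entry \<theta> H K b' i j) else \<zero>\<^bsub>S\<^esub>)"
      unfolding c_def
    proof (rule S.add.finprod_cong'[OF refl])
      fix b' assume b': "b' \<in> Bs"
      show "\<xi> b' \<otimes>\<^bsub>S\<^esub> f (entry \<theta> I J b' i j) = (if b = b' then f (entry \<theta> H K b' i j) else \<zero>\<^bsub>S\<^esub>)"
        unfolding entry_restrict[OF finI finJ HI K b' that]
        using \<xi>v \<xi>c f_closed b by (cases "b' \<in> B H K") (auto simp: f_zero)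
    qed (use f_closed in auto)
    also have "\<dots> = f (entry \<theta> H K b i j)"
      using b sub finB f_closed by (subst S.add.finprod_singleton) auto
    finally show ?thesis .
  qed
  define u where "u = y i0 \<otimes>\<^bsub>S\<^esub> f (entry \<theta> H K b i0 j0)"
  have "f (entry \<theta> H K b i0 j0) \<in> Units S"
    by (rule f_unit[OF comb_familyD(3)[OF fin b cells(1,2,3)]])
  then have u: "u \<in> Units S" using cells(1) by (auto simp: u_def H_def)
  have yc: "y i \<in> carrier S" if "i \<in> I" for i using y that by auto
  have "\<exists>t\<in>carrier S. point_vec y \<xi> j = (if j = j0 then u else \<zero>\<^bsub>S\<^esub>) \<oplus>\<^bsub>S\<^esub> \<pi> \<otimes>\<^bsub>S\<^esub> t" if j: "j \<in> K" for j
  proof -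
    \<comment> \<open>Rows outside \<open>H\<close> have non-unit coordinates, so they contribute
      multiples of \<open>\<pi>\<close>, whatever the entries of the relation are in those
      rows.\<close>
    have "\<forall>i. \<exists>t. i \<in> I - H \<longrightarrow> t \<in> carrier S \<and> y i = \<pi> \<otimes>\<^bsub>S\<^esub> t"
      using local_ring yc by (auto simp: H_def)
    then obtain t where t: "\<And>i. i \<in> I - H \<Longrightarrow> t i \<in> carrier S" "\<And>i. i \<in> I - H \<Longrightarrow> y i = \<pi> \<otimes>\<^bsub>S\<^esub> t i" by metis
    have "point_vec y \<xi> j = (\<Oplus>\<^bsub>S\<^esub>i\<in>I. y i \<otimes>\<^bsub>S\<^esub> c i j)" unfolding c_def by (rule point_vec_apply[OF y \<xi>])
    also have "(\<Oplus>\<^bsub>S\<^esub>i\<in>I. y i \<otimes>\<^bsub>S\<^esub> c i j) = (\<Oplus>\<^bsub>S\<^esub>i\<in>H \<union> (I - H). y i \<otimes>\<^bsub>S\<^esub> c i j)"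
      using HI by (simp only: Un_Diff_cancel Un_absorb1)
    also have "(\<Oplus>\<^bsub>S\<^esub>i\<in>H \<union> (I - H). y i \<otimes>\<^bsub>S\<^esub> c i j) = (\<Oplus>\<^bsub>S\<^esub>i\<in>H. y i \<otimes>\<^bsub>S\<^esub> c i j) \<oplus>\<^bsub>S\<^esub> (\<Oplus>\<^bsub>S\<^esub>i\<in>I - H. y i \<otimes>\<^bsub>S\<^esub> c i j)"
      using yc cc fin finI HI by (intro S.add.finprod_Un_disjoint) auto
    also have "(\<Oplus>\<^bsub>S\<^esub>i\<in>H. y i \<otimes>\<^bsub>S\<^esub> c i j) = (\<Oplus>\<^bsub>S\<^esub>i\<in>H. if i0 = i then (if j = j0 then u else \<zero>\<^bsub>S\<^esub>) else \<zero>\<^bsub>S\<^esub>)"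
    proof (rule S.add.finprod_cong'[OF refl])
      fix i assume i: "i \<in> H"
      show "y i \<otimes>\<^bsub>S\<^esub> c i j = (if i0 = i then (if j = j0 then u else \<zero>\<^bsub>S\<^esub>) else \<zero>\<^bsub>S\<^esub>)"
        using cH[OF i j] cells(4)[OF i j] yc[of i] i HI by (auto simp: u_def f_zero)
    qed (use u in auto)
    also have "\<dots> = (if j = j0 then u else \<zero>\<^bsub>S\<^esub>)"
      using cells(1) fin u by (subst S.add.finprod_singleton) auto
    also have "(\<Oplus>\<^bsub>S\<^esub>i\<in>I - H. y i \<otimes>\<^bsub>S\<^esub> c i j) = (\<Oplus>\<^bsub>S\<^esub>i\<in>I - H. \<pi> \<otimes>\<^bsub>S\<^esub> (t i \<otimes>\<^bsub>S\<^esub> c i j))"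
      using t cc \<pi> by (intro S.add.finprod_cong') (auto simp: S.m_assoc)
    also have "\<dots> = \<pi> \<otimes>\<^bsub>S\<^esub> (\<Oplus>\<^bsub>S\<^esub>i\<in>I - H. t i \<otimes>\<^bsub>S\<^esub> c i j)"
      using t cc \<pi> finI by (intro S.finsum_rdistr[symmetric]) auto
    finally show ?thesis
      using t(1) cc by (intro bexI[of _ "\<Oplus>\<^bsub>S\<^esub>i\<in>I - H. t i \<otimes>\<^bsub>S\<^esub> c i j"]) (auto intro!: S.finsum_closed)
  qed
  then show ?thesis using \<xi>R u by blast
qed

section \<open>Approximation by relations modulo powers of the uniformiser\<close>

lemma eventually_spanned:
  assumes y: "y \<in> I \<rightarrow> carrier S" and unit: "\<exists>i\<in>I. y i \<in> Units S"
  shows "\<exists>E\<subseteq>J. card E \<le> l \<and>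
    (\<forall>z\<in>carrier SJ. \<exists>w\<in>rel_span y. \<forall>j\<in>J - E. \<exists>t\<in>carrier S. z j = w j \<oplus>\<^bsub>S\<^esub> \<pi> \<otimes>\<^bsub>S\<^esub> t)"
proof -
  define H where "H = {i \<in> I. y i \<in> Units S}"
  have "H \<noteq> {}" "H \<subseteq> I" using unit by (auto simp: H_def)
  then obtain E where E: "E \<subseteq> J" "card E \<le> l" "(move B \<theta> \<beta> H)\<^sup>*\<^sup>* (J - E) {}"
    using adm unfolding admissible_def by (elim allE[of _ H] impE) auto
  note W0s = rel_span_submodule[OF y]
  note W0c = SJ.submoduleE(1)[OF W0s, THEN subsetD]
  have Sc: "z j \<in> carrier S" if "z \<in> carrier SJ" for z j using that by (rule S.free_module_closed)
  \<comment> \<open>The vectors matched by \<open>rel_span y\<close> modulo \<open>\<pi>\<close> on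
    the columns outside \<open>E\<close>. Being a submodule, it is everything once it contains the
    basis vectors; these are caught in the order in which the moves remove their columns.\<close>
  define V where "V = {z \<in> carrier SJ. \<exists>w\<in>rel_span y. \<forall>j\<in>J - E. \<exists>t\<in>carrier S. z j = w j \<oplus>\<^bsub>S\<^esub> \<pi> \<otimes>\<^bsub>S\<^esub> t}"
  have V: "submodule V S SJ"
  proof (rule SJ.submodule_smultI)
    show "\<zero>\<^bsub>SJ\<^esub> \<in> V"
      unfolding V_def mem_Collect_eq
      using \<pi> by (intro conjI SJ.M.zero_closed bexI[OF _ SJ.submodule_zero[OF W0s]] ballI bexI[of _ "\<zero>\<^bsub>S\<^esub>"]) auto
  next
    fix a b assume "a \<in> V" "b \<in> V"
    then obtain v w where a: "a \<in> carrier SJ" "v \<in> rel_span y" "\<forall>j\<in>J - E. \<exists>t\<in>carrier S. a j = v j \<oplus>\<^bsub>S\<^esub> \<pi> \<otimes>\<^bsub>S\<^esub> t"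
      and b: "b \<in> carrier SJ" "w \<in> rel_span y" "\<forall>j\<in>J - E. \<exists>t\<in>carrier S. b j = w j \<oplus>\<^bsub>S\<^esub> \<pi> \<otimes>\<^bsub>S\<^esub> t"
      by (auto simp: V_def)
    have "\<exists>t\<in>carrier S. (a \<oplus>\<^bsub>SJ\<^esub> b) j = (v \<oplus>\<^bsub>SJ\<^esub> w) j \<oplus>\<^bsub>S\<^esub> \<pi> \<otimes>\<^bsub>S\<^esub> t" if j: "j \<in> J - E" for j
    proof -
      obtain t t' where t: "t \<in> carrier S" "a j = v j \<oplus>\<^bsub>S\<^esub> \<pi> \<otimes>\<^bsub>S\<^esub> t" "t' \<in> carrier S" "b j = w j \<oplus>\<^bsub>S\<^esub> \<pi> \<otimes>\<^bsub>S\<^esub> t'"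
        using bspec[OF a(3) j] bspec[OF b(3) j] by blast
      then show ?thesis
        using Sc[OF W0c[OF a(2)], of j] Sc[OF W0c[OF b(2)], of j] \<pi>
        by (intro bexI[of _ "t \<oplus>\<^bsub>S\<^esub> t'"]) (simp_all add: S.r_distr S.a_ac)
    qed
    then show "a \<oplus>\<^bsub>SJ\<^esub> b \<in> V"
      unfolding V_def using SJ.M.a_closed[OF a(1) b(1)] SJ.submoduleE(5)[OF W0s a(2) b(2)] by blast
  next
    fix s a assume s: "s \<in> carrier S" and "a \<in> V"
    then obtain v where a: "a \<in> carrier SJ" "v \<in> rel_span y" "\<forall>j\<in>J - E. \<exists>t\<in>carrier S. a j = v j \<oplus>\<^bsub>S\<^esub> \<pi> \<otimes>\<^bsub>S\<^esub> t"
      by (auto simp: V_def)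
    have "\<exists>t\<in>carrier S. (s \<odot>\<^bsub>SJ\<^esub> a) j = (s \<odot>\<^bsub>SJ\<^esub> v) j \<oplus>\<^bsub>S\<^esub> \<pi> \<otimes>\<^bsub>S\<^esub> t" if j: "j \<in> J - E" for j
    proof -
      obtain t where t: "t \<in> carrier S" "a j = v j \<oplus>\<^bsub>S\<^esub> \<pi> \<otimes>\<^bsub>S\<^esub> t" using bspec[OF a(3) j] by blast
      then show ?thesis
        using Sc[OF W0c[OF a(2)], of j] \<pi> s
        by (intro bexI[of _ "s \<otimes>\<^bsub>S\<^esub> t"]) (simp_all add: S.r_distr S.m_lcomm)
    qed
    then show "s \<odot>\<^bsub>SJ\<^esub> a \<in> V"
      unfolding V_def using SJ.smult_closed[OF s a(1)] SJ.submoduleE(4)[OF W0s s a(2)] by blast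
  qed (auto simp: V_def)
  have W0V: "w \<in> V" if "w \<in> rel_span y" for w
    unfolding V_def mem_Collect_eq
    using that \<pi> Sc[OF W0c[OF that]] by (intro conjI W0c bexI[OF _ that] ballI bexI[of _ "\<zero>\<^bsub>S\<^esub>"]) auto
  have \<pi>V: "z \<in> V" if z: "z \<in> carrier SJ" "\<forall>j\<in>J. \<exists>t\<in>carrier S. z j = \<pi> \<otimes>\<^bsub>S\<^esub> t" for z
  proof -
    have "\<exists>t\<in>carrier S. z j = \<zero>\<^bsub>SJ\<^esub> j \<oplus>\<^bsub>S\<^esub> \<pi> \<otimes>\<^bsub>S\<^esub> t" if j: "j \<in> J - E" for j
    proof -
      obtain t where "t \<in> carrier S" "z j = \<pi> \<otimes>\<^bsub>S\<^esub> t" using bspec[OF z(2), of j] j by blast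
      then show ?thesis using \<pi> by (intro bexI[of _ t]) auto
    qed
    then show ?thesis unfolding V_def using z(1) SJ.submodule_zero[OF W0s] by blast
  qed
  have "K \<subseteq> J \<and> (\<forall>j\<in>J - K. evec S j \<in> V)" if "(move B \<theta> \<beta> H)\<^sup>*\<^sup>* (J - E) K" for K
    using that
  proof (induction K rule: rtranclp_induct)
    case base
    \<comment> \<open>No comparison is made on the columns of \<open>E\<close>, so their basis
      vectors are matched by zero.\<close>
    have "evec S j \<in> V" if "j \<in> E" for j
    proof -
      have "j \<in> J" using that E(1) by auto
      then have e: "evec S j \<in> carrier SJ" by (rule S.evec_closed)
      have "\<exists>t\<in>carrier S. evec S j j' = \<zero>\<^bsub>SJ\<^esub> j' \<oplus>\<^bsub>S\<^esub> \<pi> \<otimes>\<^bsub>S\<^esub> t" if "j' \<in> J - E" for j'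
        using that \<open>j \<in> E\<close> \<pi> by (intro bexI[of _ "\<zero>\<^bsub>S\<^esub>"]) (auto simp: evec_def)
      then show ?thesis unfolding V_def using e SJ.submodule_zero[OF W0s] by blast
    qed
    then show ?case by auto
  next
    case (step K K')
    then have K: "K \<subseteq> J" "\<And>j. j \<in> J - K \<Longrightarrow> evec S j \<in> V" by auto
    obtain b i0 j0 where b: "b \<in> B H K" "cell_class \<theta> H K b = {(i0, j0)}" "local_colour (B H K) \<beta> b = None" "K' = K - {j0}"
      using step.hyps(2) by (auto simp: move_def)
    have j0: "j0 \<in> K" using b(2) by (auto simp: cell_class_def)
    obtain \<xi> u where \<xi>: "\<xi> \<in> Rel_image" "u \<in> Units S"
      "\<forall>j\<in>K. \<exists>t\<in>carrier S. point_vec y \<xi> j = (if j = j0 then u else \<zero>\<^bsub>S\<^esub>) \<oplus>\<^bsub>S\<^esub> \<pi> \<otimes>\<^bsub>S\<^esub> t"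
      using isolated_blank_vector[OF y K(1) b(1-3)[unfolded H_def]] by blast
    define u' where "u' = inv\<^bsub>S\<^esub> u"
    have u': "u' \<in> carrier S" "u' \<otimes>\<^bsub>S\<^esub> u = \<one>\<^bsub>S\<^esub>" "u \<in> carrier S" using \<xi>(2) by (auto simp: u'_def)
    define z where "z = u' \<odot>\<^bsub>SJ\<^esub> point_vec y \<xi>"
    have zW: "z \<in> rel_span y" unfolding z_def by (rule SJ.submoduleE(4)[OF W0s u'(1) point_vec_rel_span[OF \<xi>(1)]])
    have zc: "z \<in> carrier SJ" by (rule W0c[OF zW])
    have zK: "\<exists>t\<in>carrier S. z j = evec S j0 j \<oplus>\<^bsub>S\<^esub> \<pi> \<otimes>\<^bsub>S\<^esub> t" if j: "j \<in> K" for j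
    proof -
      obtain t where t: "t \<in> carrier S" "point_vec y \<xi> j = (if j = j0 then u else \<zero>\<^bsub>S\<^esub>) \<oplus>\<^bsub>S\<^esub> \<pi> \<otimes>\<^bsub>S\<^esub> t"
        using bspec[OF \<xi>(3) j] by blast
      then show ?thesis using u' \<pi>
        by (intro bexI[of _ "u' \<otimes>\<^bsub>S\<^esub> t"]) (auto simp: z_def evec_def S.r_distr S.m_lcomm)
    qed
    \<comment> \<open>\<open>z\<close> is under control only on the columns of \<open>K\<close>. Its
      part \<open>z'\<close> on the columns removed so far is a combination of basis vectors already
      in \<open>V\<close>.\<close>
    define z' where "z' = (\<lambda>j. if j \<in> J - K then z j else \<zero>\<^bsub>S\<^esub>)"
    have z'c: "z' \<in> carrier SJ" using Sc[OF zc] by (auto simp: carrier_free_module_finite[OF finJ] z'_def)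
    have "(\<Oplus>\<^bsub>SJ\<^esub>j\<in>J - K. z' j \<odot>\<^bsub>SJ\<^esub> evec S j) \<in> V"
      by (rule SJ.submodule_finsum[OF V], rule SJ.submoduleE(4)[OF V Sc[OF z'c] K(2)])
    moreover have "(\<Oplus>\<^bsub>SJ\<^esub>j\<in>J - K. z' j \<odot>\<^bsub>SJ\<^esub> evec S j) = z'"
      by (rule S.free_module_expand[OF z'c]) (use finJ in \<open>auto simp: z'_def\<close>)
    ultimately have z'V: "z' \<in> V" by (simp only:)
    \<comment> \<open>After the new basis vector is subtracted as well, every entry is divisible by
      \<open>\<pi>\<close>, and such vectors are matched by zero.\<close>
    define d where "d = (z \<ominus>\<^bsub>SJ\<^esub> z') \<ominus>\<^bsub>SJ\<^esub> evec S j0"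
    have e0: "evec S j0 \<in> carrier SJ" using j0 K(1) by (intro S.evec_closed) auto
    have zz': "z \<ominus>\<^bsub>SJ\<^esub> z' \<in> carrier SJ" by (rule SJ.M.minus_closed[OF zc z'c])
    have dc: "d \<in> carrier SJ" unfolding d_def by (rule SJ.M.minus_closed[OF zz' e0])
    have "\<exists>t\<in>carrier S. d j = \<pi> \<otimes>\<^bsub>S\<^esub> t" if j: "j \<in> J" for j
    proof -
      have dj: "d j = (z j \<ominus>\<^bsub>S\<^esub> z' j) \<ominus>\<^bsub>S\<^esub> evec S j0 j"
        unfolding d_def by (simp add: S.free_module_minus[OF zz' e0] S.free_module_minus[OF zc z'c])
      show ?thesis
      proof (cases "j \<in> K")
        case True
        obtain t where t: "t \<in> carrier S" "z j = evec S j0 j \<oplus>\<^bsub>S\<^esub> \<pi> \<otimes>\<^bsub>S\<^esub> t" using zK[OF True] by blast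
        have e: "evec S j0 j \<in> carrier S" by (rule Sc[OF e0])
        have "d j = (evec S j0 j \<oplus>\<^bsub>S\<^esub> \<pi> \<otimes>\<^bsub>S\<^esub> t) \<ominus>\<^bsub>S\<^esub> evec S j0 j"
          using dj True t \<pi> e S.minus_equality[of "\<zero>\<^bsub>S\<^esub>" "\<zero>\<^bsub>S\<^esub>"] by (simp add: z'_def S.minus_eq)
        also have "\<dots> = \<pi> \<otimes>\<^bsub>S\<^esub> t" using t(1) \<pi> e by (intro S.add_minus_cancel) auto
        finally show ?thesis using t(1) by auto
      next
        case False
        then have "d j = \<zero>\<^bsub>S\<^esub>"
          using dj j j0 Sc[OF zc, of j] S.minus_equality[of "\<zero>\<^bsub>S\<^esub>" "\<zero>\<^bsub>S\<^esub>"]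
          by (auto simp: z'_def evec_def S.minus_eq S.r_neg)
        then show ?thesis using \<pi> by (intro bexI[of _ "\<zero>\<^bsub>S\<^esub>"]) auto
      qed
    qed
    then have dV: "d \<in> V" using dc by (intro \<pi>V) auto
    have "evec S j0 = (z \<ominus>\<^bsub>SJ\<^esub> z') \<ominus>\<^bsub>SJ\<^esub> d"
      unfolding d_def by (rule SJ.M.minus_minus_cancel[OF zz' e0, symmetric])
    then have "evec S j0 \<in> V"
      using SJ.submodule_diff[OF V SJ.submodule_diff[OF V W0V[OF zW] z'V] dV] by simp
    then show ?case using K b(4) by auto
  qed
  from this[OF E(3)] have "evec S ` J \<subseteq> V" by auto
  then have "gen_submodule S SJ (evec S ` J) \<subseteq> V" by (rule gen_submodule_least[OF V])
  then have "carrier SJ \<subseteq> V" by (simp only: S.free_module_gen)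
  then show ?thesis using E(1,2) by (intro exI[of _ E] conjI ballI) (auto simp: V_def)
qed

text \<open>Nakayama's argument by iteration: approximating the cofactor of \<open>\<pi> ^ k\<close>
  in the error improves the error to a multiple of \<open>\<pi> ^ (k + 1)\<close>, and
  \<open>\<pi> ^ n\<close> is zero.\<close>

lemma spanned:
  assumes y: "y \<in> I \<rightarrow> carrier S" and unit: "\<exists>i\<in>I. y i \<in> Units S"
  shows "\<exists>E\<subseteq>J. card E \<le> l \<and> (\<forall>z\<in>carrier SJ. \<exists>w\<in>rel_span y. \<forall>j\<in>J - E. z j = w j)"
proof -
  obtain E where E: "E \<subseteq> J" "card E \<le> l"
    "\<forall>z\<in>carrier SJ. \<exists>w\<in>rel_span y. \<forall>j\<in>J - E. \<exists>t\<in>carrier S. z j = w j \<oplus>\<^bsub>S\<^esub> \<pi> \<otimes>\<^bsub>S\<^esub> t"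
    using eventually_spanned[OF assms] by (elim exE conjE)
  note W0s = rel_span_submodule[OF y]
  note W0c = SJ.submoduleE(1)[OF W0s, THEN subsetD]
  have Sc: "z j \<in> carrier S" if "z \<in> carrier SJ" for z j using that by (rule S.free_module_closed)
  have nak: "\<forall>z\<in>carrier SJ. \<exists>w\<in>rel_span y. \<forall>j\<in>J - E. \<exists>t\<in>carrier S. z j = w j \<oplus>\<^bsub>S\<^esub> (\<pi> [^]\<^bsub>S\<^esub> k) \<otimes>\<^bsub>S\<^esub> t" for k :: nat
  proof (induction k)
    case 0
    show ?case
    proof
      fix z assume z: "z \<in> carrier SJ"
      show "\<exists>w\<in>rel_span y. \<forall>j\<in>J - E. \<exists>t\<in>carrier S. z j = w j \<oplus>\<^bsub>S\<^esub> (\<pi> [^]\<^bsub>S\<^esub> (0::nat)) \<otimes>\<^bsub>S\<^esub> t"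
        using Sc[OF z] by (intro bexI[OF _ SJ.submodule_zero[OF W0s]] ballI bexI[of _ "z _"]) auto
    qed
  next
    case (Suc k)
    show ?case
    proof
      fix z assume z: "z \<in> carrier SJ"
      obtain w where w: "w \<in> rel_span y" "\<forall>j\<in>J - E. \<exists>t\<in>carrier S. z j = w j \<oplus>\<^bsub>S\<^esub> (\<pi> [^]\<^bsub>S\<^esub> k) \<otimes>\<^bsub>S\<^esub> t"
        using bspec[OF Suc.IH z] by (rule bexE)
      then obtain t where t: "\<And>j. j \<in> J - E \<Longrightarrow> t j \<in> carrier S"
        "\<And>j. j \<in> J - E \<Longrightarrow> z j = w j \<oplus>\<^bsub>S\<^esub> (\<pi> [^]\<^bsub>S\<^esub> k) \<otimes>\<^bsub>S\<^esub> t j" by metis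
      \<comment> \<open>The error terms are given only on \<open>J - E\<close>. Extended by zero
        they form a vector of \<open>S J\<close> that can be approximated in turn.\<close>
      define z' where "z' = (\<lambda>j. if j \<in> J - E then t j else \<zero>\<^bsub>S\<^esub>)"
      have z'c: "z' \<in> carrier SJ" using t(1) by (auto simp: carrier_free_module_finite[OF finJ] z'_def)
      obtain w' where w': "w' \<in> rel_span y" "\<forall>j\<in>J - E. \<exists>t\<in>carrier S. z' j = w' j \<oplus>\<^bsub>S\<^esub> \<pi> \<otimes>\<^bsub>S\<^esub> t"
        using bspec[OF E(3) z'c] by (rule bexE)
      have pk: "\<pi> [^]\<^bsub>S\<^esub> k \<in> carrier S" using \<pi> by simp
      define w'' where "w'' = w \<oplus>\<^bsub>SJ\<^esub> (\<pi> [^]\<^bsub>S\<^esub> k) \<odot>\<^bsub>SJ\<^esub> w'"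
      have w'': "w'' \<in> rel_span y" unfolding w''_def
        by (rule SJ.submoduleE(5)[OF W0s w(1) SJ.submoduleE(4)[OF W0s pk w'(1)]])
      have "\<exists>t\<in>carrier S. z j = w'' j \<oplus>\<^bsub>S\<^esub> (\<pi> [^]\<^bsub>S\<^esub> Suc k) \<otimes>\<^bsub>S\<^esub> t" if j: "j \<in> J - E" for j
      proof -
        obtain t' where t': "t' \<in> carrier S" "z' j = w' j \<oplus>\<^bsub>S\<^esub> \<pi> \<otimes>\<^bsub>S\<^esub> t'"
          using bspec[OF w'(2) j] by (rule bexE)
        have c: "w j \<in> carrier S" "w' j \<in> carrier S" using Sc[OF W0c[OF w(1)]] Sc[OF W0c[OF w'(1)]] by auto
        have "z j = w j \<oplus>\<^bsub>S\<^esub> (\<pi> [^]\<^bsub>S\<^esub> k) \<otimes>\<^bsub>S\<^esub> z' j" using t(2)[OF j] j by (simp add: z'_def)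
        also have "\<dots> = w j \<oplus>\<^bsub>S\<^esub> (\<pi> [^]\<^bsub>S\<^esub> k) \<otimes>\<^bsub>S\<^esub> (w' j \<oplus>\<^bsub>S\<^esub> \<pi> \<otimes>\<^bsub>S\<^esub> t')" by (simp only: t'(2))
        also have "\<dots> = w'' j \<oplus>\<^bsub>S\<^esub> (\<pi> [^]\<^bsub>S\<^esub> Suc k) \<otimes>\<^bsub>S\<^esub> t'"
          using c t'(1) pk \<pi> by (simp add: w''_def S.r_distr S.m_assoc S.a_assoc)
        finally show ?thesis using t'(1) by blast
      qed
      then show "\<exists>w\<in>rel_span y. \<forall>j\<in>J - E. \<exists>t\<in>carrier S. z j = w j \<oplus>\<^bsub>S\<^esub> (\<pi> [^]\<^bsub>S\<^esub> Suc k) \<otimes>\<^bsub>S\<^esub> t"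
        by (intro bexI[OF _ w''] ballI)
    qed
  qed
  have "\<forall>z\<in>carrier SJ. \<exists>w\<in>rel_span y. \<forall>j\<in>J - E. z j = w j"
  proof
    fix z assume z: "z \<in> carrier SJ"
    obtain w where w: "w \<in> rel_span y" "\<forall>j\<in>J - E. \<exists>t\<in>carrier S. z j = w j \<oplus>\<^bsub>S\<^esub> (\<pi> [^]\<^bsub>S\<^esub> n) \<otimes>\<^bsub>S\<^esub> t"
      using bspec[OF nak[of n] z] by (rule bexE)
    have "z j = w j" if j: "j \<in> J - E" for j
    proof -
      obtain t where "t \<in> carrier S" "z j = w j \<oplus>\<^bsub>S\<^esub> (\<pi> [^]\<^bsub>S\<^esub> n) \<otimes>\<^bsub>S\<^esub> t"
        using bspec[OF w(2) j] by (rule bexE)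
      then show ?thesis using Sc[OF W0c[OF w(1)], of j] by (simp add: \<pi>_nil)
    qed
    then show "\<exists>w\<in>rel_span y. \<forall>j\<in>J - E. z j = w j" by (intro bexI[OF _ w(1)] ballI)
  qed
  then show ?thesis using E(1,2) by (intro exI[of _ E] conjI)
qed

section \<open>From the orbit module to the equality of spans\<close>

lemma orbit_row_eval:
  assumes y: "y \<in> I \<rightarrow> carrier S" and ev: "ev \<in> ring_hom (mpoly_ring I) S"
    and evv: "\<And>i. i \<in> I \<Longrightarrow> ev (lvar i) = y i" and evc: "\<And>r. ev (lconst r) = f r" and b: "b \<in> Bs"
  shows "(\<lambda>j. ev (orbit_row I (fam_rep B \<theta> I J) (evec base_ring b) j)) = basis_vec y b"
proof
  fix j
  interpret A: cring "mpoly_ring I :: (nat, 'r) laurent ring" by (rule cring_mpoly_ring)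
  interpret ev: ring_hom_cring "mpoly_ring I :: (nat, 'r) laurent ring" S ev
    by (simp add: ring_hom_cring_def ring_hom_cring_axioms_def A.is_cring S_cring ev)
  let ?g = "\<lambda>i. lvar i * lconst (entry \<theta> I J b i j) :: (nat, 'r) laurent"
  have gc: "?g i \<in> carrier (mpoly_ring I)" if "i \<in> I" for i
    using A.m_closed[OF lvar_closed(2)[OF that] lconst_closed(2)] by simp
  have "orbit_row I (fam_rep B \<theta> I J) (evec base_ring b) j = sum ?g I"
    by (simp add: orbit_row_def fam_rep_def entry_def)
  also have "\<dots> = finsum (mpoly_ring I) ?g I"
    using type_subring.RC_finsum[OF mpoly_subring, of I ?g] gc unfolding mpoly_ring_eq by simp
  finally have "ev (orbit_row I (fam_rep B \<theta> I J) (evec base_ring b) j) = (\<Oplus>\<^bsub>S\<^esub>i\<in>I. ev (?g i))"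
    using ev.hom_finsum[of ?g I] gc by (simp add: comp_def)
  also have "\<dots> = basis_vec y b j"
    unfolding basis_vec_def
  proof (rule S.add.finprod_cong'[OF refl])
    show "(\<lambda>i. y i \<otimes>\<^bsub>S\<^esub> f (entry \<theta> I J b i j)) \<in> I \<rightarrow> carrier S" using y f_closed by auto
    fix i assume i: "i \<in> I"
    show "ev (?g i) = y i \<otimes>\<^bsub>S\<^esub> f (entry \<theta> I J b i j)"
      using ev.hom_mult[OF lvar_closed(2)[OF i] lconst_closed(2)] evv[OF i] evc by simp
  qed
  finally show "ev (orbit_row I (fam_rep B \<theta> I J) (evec base_ring b) j) = basis_vec y b j" .
qed

lemma orbit_row_closed:
  assumes x: "x \<in> carrier (free_module base_ring Bs)"
  shows "orbit_row I (fam_rep B \<theta> I J) x \<in> carrier (free_module (mpoly_ring I) J)"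
proof -
  interpret b: cring "base_ring :: 'r ring" by (rule cring_base_ring)
  interpret A: cring "mpoly_ring I :: (nat, 'r) laurent ring" by (rule cring_mpoly_ring)
  have out: "\<theta> I J x (evec base_ring i) \<in> carrier (free_module base_ring J)" if "i \<in> I" for i
    using lin_mapD(1)[OF lin_map_rep_act2[OF comb_familyD(2)[OF finI finJ]], of x "evec base_ring i"]
      x b.evec_closed[OF that] by (simp add: fam_rep_def)
  show ?thesis
    unfolding carrier_free_module_finite[OF finJ]
  proof (intro conjI ballI allI impI)
    fix j
    let ?g = "\<lambda>i. lvar i * lconst (\<theta> I J x (evec base_ring i) j) :: (nat, 'r) laurent"
    have gc: "?g i \<in> carrier (mpoly_ring I)" if "i \<in> I" for i
      using A.m_closed[OF lvar_closed(2)[OF that] lconst_closed(2)] by simp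
    have "sum ?g I = finsum (mpoly_ring I) ?g I"
      using type_subring.RC_finsum[OF mpoly_subring, of I ?g] gc unfolding mpoly_ring_eq by simp
    also have "\<dots> \<in> carrier (mpoly_ring I)" using gc by (intro A.finsum_closed) auto
    finally show "orbit_row I (fam_rep B \<theta> I J) x j \<in> carrier (mpoly_ring I)"
      by (simp add: orbit_row_def fam_rep_def)
  next
    fix j assume "j \<notin> J"
    then have "\<theta> I J x (evec base_ring i) j = 0" if "i \<in> I" for i
      using free_module_zero_outside[OF out[OF that]] by simp
    then show "orbit_row I (fam_rep B \<theta> I J) x j = \<zero>\<^bsub>mpoly_ring I\<^esub>"
      by (simp add: orbit_row_def fam_rep_def lconst_def)
  qed
qed

lemma point_vec_span_unit:
  assumes y: "y \<in> I \<rightarrow> carrier S" and unit: "\<exists>i\<in>I. y i \<in> Units S"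
    and \<xi>: "\<xi> \<in> carrier (free_module S Bs)"
  shows "point_vec y \<xi> \<in> rel_span y"
proof -
  obtain E where E: "E \<subseteq> J" "card E \<le> l" "\<forall>z\<in>carrier SJ. \<exists>w\<in>rel_span y. \<forall>j\<in>J - E. z j = w j"
    using spanned[OF y unit] by (elim exE conjE)
  have finE: "finite E" using E(1) finJ finite_subset by auto
  note W0s = rel_span_submodule[OF y]
  note W0c = SJ.submoduleE(1)[OF W0s, THEN subsetD]
  have Sc: "z j \<in> carrier S" if "z \<in> carrier SJ" for z j using that by (rule S.free_module_closed)
  have f': "f \<in> ring_hom base_ring S" by (rule f_hom)
  obtain ev where ev: "ev \<in> ring_hom (mpoly_ring I) S" "\<forall>i\<in>I. ev (lvar i) = y i" "\<forall>r. ev (lconst r) = f r"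
    using mpoly_eval[OF S_cring f', of I y] y by auto
  let ?rep = "fam_rep B \<theta> I J"
  \<comment> \<open>The span of these rows contains whatever arbitrary parameters produce, relations
    included. It is this span to which the Fitting ideals of the orbit module apply.\<close>
  define GW where "GW = (\<lambda>b j. ev (orbit_row I ?rep b j)) ` carrier (rep_par ?rep)"
  have GWc: "GW \<subseteq> carrier SJ"
    using semilin_map[OF cring_mpoly_ring S_cring ev(1), of J] orbit_row_closed
    by (auto simp: GW_def semilin_def fam_rep_def)
  have Ws: "submodule (gen_submodule S SJ GW) S SJ" by (rule SJ.gen_submodule_submodule[OF GWc])
  interpret b: cring "base_ring :: 'r ring" by (rule cring_base_ring)
  have bW: "basis_vec y b \<in> gen_submodule S SJ GW" if b: "b \<in> Bs" for b
  proof -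
    have "basis_vec y b \<in> GW"
      unfolding GW_def
    proof (rule image_eqI)
      show "basis_vec y b = (\<lambda>j. ev (orbit_row I ?rep (evec base_ring b) j))"
        using orbit_row_eval[OF y ev(1) _ _ b] ev(2,3) by simp
      show "evec base_ring b \<in> carrier (rep_par ?rep)" using b.evec_closed[OF b] by (simp add: fam_rep_def)
    qed
    then show ?thesis using gen_submodule_incl by (rule rev_subsetD)
  qed
  have yW: "point_vec y \<zeta> \<in> gen_submodule S SJ GW" if "\<zeta> \<in> carrier (free_module S Bs)" for \<zeta>
    unfolding point_vec_def
    by (rule SJ.submodule_finsum[OF Ws], rule SJ.submoduleE(4)[OF Ws S.free_module_closed[OF that] bW])
  have W0W: "w \<in> gen_submodule S SJ GW" if "w \<in> rel_span y" for w
  proof -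
    have "point_vec y ` Rel_image \<subseteq> gen_submodule S SJ GW" using yW Rel_image_closed by auto
    then have "rel_span y \<subseteq> gen_submodule S SJ GW" unfolding rel_span_def by (rule gen_submodule_least[OF Ws])
    then show ?thesis using that by auto
  qed
  have vc: "point_vec y \<xi> \<in> carrier SJ" by (rule lin_mapD(1)[OF point_vec_lin[OF y] \<xi>])
  obtain w0 where w0: "w0 \<in> rel_span y" "\<forall>j\<in>J - E. point_vec y \<xi> j = w0 j"
    using bspec[OF E(3) vc] by (rule bexE)
  define w' where "w' = point_vec y \<xi> \<ominus>\<^bsub>SJ\<^esub> w0"
  have w'W: "w' \<in> gen_submodule S SJ GW" unfolding w'_def by (rule SJ.submodule_diff[OF Ws yW[OF \<xi>] W0W[OF w0(1)]])
  have w'c: "w' \<in> carrier SJ" using SJ.submoduleE(1)[OF Ws] w'W by auto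
  have w'0: "w' j = \<zero>\<^bsub>S\<^esub>" if "j \<in> J - E" for j
    using bspec[OF w0(2) that] Sc[OF W0c[OF w0(1)], of j]
    by (simp add: w'_def S.free_module_minus[OF vc W0c[OF w0(1)]] S.minus_eq S.r_neg)
  have eJ: "evec S j \<in> carrier SJ" if "j \<in> J" for j by (rule S.evec_closed[OF that])
  have "\<forall>j. \<exists>w. j \<in> J \<longrightarrow> w \<in> rel_span y \<and> (\<forall>j'\<in>J - E. evec S j j' = w j')"
  proof
    fix j
    show "\<exists>w. j \<in> J \<longrightarrow> w \<in> rel_span y \<and> (\<forall>j'\<in>J - E. evec S j j' = w j')"
      using bspec[OF E(3) eJ[of j]] by (cases "j \<in> J") (simp_all add: Bex_def)
  qed
  then obtain wj where wj': "\<forall>j. j \<in> J \<longrightarrow> wj j \<in> rel_span y \<and> (\<forall>j'\<in>J - E. evec S j j' = wj j j')"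
    by (rule choice[THEN exE])
  have wj: "\<And>j. j \<in> J \<Longrightarrow> wj j \<in> rel_span y" "\<And>j j'. j \<in> J \<Longrightarrow> j' \<in> J - E \<Longrightarrow> evec S j j' = wj j j'"
    using wj' by simp_all
  have "w' d = \<zero>\<^bsub>S\<^esub>" if d: "d \<in> E" for d
  proof -
    obtain ys where ys: "set ys = E - {d}" "distinct ys" using finite_distinct_list[of "E - {d}"] finE by auto
    obtain xs where xs: "set xs = J - E" "distinct xs" using finite_distinct_list[of "J - E"] finJ by auto
    \<comment> \<open>The columns of \<open>E\<close> other than \<open>d\<close> come first, then
      \<open>d\<close>, then those outside \<open>E\<close>. The entries of \<open>w'\<close> and of
      the vectors \<open>wj\<close> are prescribed only outside \<open>E\<close>, so with this order
      every uncontrolled entry lies on or to the left of the diagonal. The rows for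
      \<open>E - {d}\<close> are plain basis vectors that fill up the square.\<close>
    define zs where "zs = ys @ d # xs"
    have dz: "distinct zs" "set zs = J" using ys xs d E(1) by (auto simp: zs_def)
    have len: "length ys = card E - 1" "card E > 0"
      using ys d finE distinct_card[OF ys(2)] by (auto simp: card_gt_0_iff)
    define m where "m = length zs"
    define k where "k = length ys"
    have km: "k < m" by (simp add: k_def m_def zs_def)
    have h: "bij_betw (nth zs) {..<m} J" using bij_betw_nth[OF dz(1)] dz(2) by (simp add: m_def)
    have z1: "zs ! a \<in> E - {d}" if "a < k" for a using that ys(1) nth_mem[of a ys] by (simp add: zs_def nth_append k_def)
    have z2: "zs ! k = d" by (simp add: zs_def k_def)
    have z3: "zs ! a \<in> J - E" if "k < a" "a < m" for a
      using that xs(1) nth_mem[of "a - Suc k" xs] by (simp add: zs_def nth_append k_def m_def nth_Cons')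
    define T where "T a = (if a < k then evec S (zs ! a) else if a = k then w' else wj (zs ! a))" for a
    have "T k (zs ! k) = \<zero>\<^bsub>S\<^esub>"
    proof (rule orbit_triangular[OF S_cring f' h _ _ ev(1), where \<theta> = ?rep and i = "card E - 1" and T = T and Gd = "{k..<m}"])
      show "orbit_row I ?rep b \<in> carrier (free_module (mpoly_ring I) J)" if "b \<in> carrier (rep_par ?rep)" for b
        using that by (intro orbit_row_closed) (simp add: fam_rep_def)
      \<comment> \<open>The \<open>card E - 1\<close> leading rows are not claimed to be relations;
        the index of the Fitting ideal makes up for exactly these. It is smaller than
        \<open>l\<close> because \<open>E\<close> contains \<open>d\<close> and has at most
        \<open>l\<close> elements.\<close>
      show "fitting_ideal (mpoly_ring I) (Orbit I J ?rep) (card E - 1) = Idl\<^bsub>mpoly_ring I\<^esub> {0}"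
        using const len(2) E(2) unfolding constant_rank_def by auto
      show "T a \<in> carrier SJ" if "a < m" for a
        using that z1[of a] z3[of a] E(1) eJ w'c W0c[OF wj(1)] by (auto simp: T_def)
      show "T a (zs ! b) = \<zero>\<^bsub>S\<^esub>" if ab: "a < b" "b < m" for a b
      proof -
        have ne: "zs ! a \<noteq> zs ! b" using dz(1) ab by (simp add: nth_eq_iff_index_eq m_def)
        show ?thesis
        proof (cases "a < k")
          case True
          then show ?thesis using ne by (simp add: T_def evec_def)
        next
          case False
          then have b: "zs ! b \<in> J - E" using ab by (intro z3) auto
          show ?thesis
          proof (cases "a = k")
            case True
            then show ?thesis using w'0[OF b] by (simp add: T_def)
          next
            case F2: False
            then have "zs ! a \<in> J" using False ab z3[of a] by auto
            then show ?thesis using wj(2)[OF _ b, of "zs ! a"] ne False F2 by (simp add: T_def evec_def)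
          qed
        qed
      qed
      show "{k..<m} \<subseteq> {..<m}" by auto
      show "m \<le> card {k..<m} + (card E - 1)" using len km by (simp add: k_def)
      show "T a \<in> gen_submodule S SJ ((\<lambda>b j. ev (orbit_row I ?rep b j)) ` carrier (rep_par ?rep))" if "a \<in> {k..<m}" for a
        using that z3[of a] w'W W0W[OF wj(1)] by (auto simp: T_def GW_def)
      show "k < m" by (rule km)
      show "T a (zs ! a) = \<one>\<^bsub>S\<^esub>" if "a < m" "a \<noteq> k" for a
      proof (cases "a < k")
        case True
        then show ?thesis by (simp add: T_def evec_def)
      next
        case False
        then have a: "zs ! a \<in> J - E" using that by (intro z3) auto
        then show ?thesis using wj(2)[of "zs ! a" "zs ! a"] False that by (simp add: T_def evec_def)
      qed
    qed
    then show ?thesis by (simp add: T_def z2)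
  qed
  then have "w' j = \<zero>\<^bsub>S\<^esub>" for j
    using w'0[of j] free_module_zero_outside[OF w'c, of j] by (cases "j \<in> E"; cases "j \<in> J") auto
  then have "w' = \<zero>\<^bsub>SJ\<^esub>" by auto
  then have "point_vec y \<xi> = w0" unfolding w'_def by (rule SJ.M.eq_if_minus_zero[OF vc W0c[OF w0(1)]])
  then show ?thesis using w0(1) by simp
qed

text \<open>A power \<open>\<pi> ^ k\<close> is taken out of \<open>y\<close> so that no further
  factor can be; this stops before \<open>n\<close>, as \<open>\<pi> ^ n\<close> is zero and
  \<open>y\<close> is not. Then some coordinate of the quotient \<open>y'\<close> is a unit, for
  otherwise all would be divisible by \<open>\<pi>\<close>, and scaling by \<open>\<pi> ^ k\<close>
  carries the span at \<open>y'\<close> into the span at \<open>y\<close>.\<close>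

theorem point_vec_span:
  assumes y: "y \<in> I \<rightarrow> carrier S" and \<xi>: "\<xi> \<in> carrier (free_module S Bs)"
  shows "point_vec y \<xi> \<in> rel_span y"
proof (cases "\<forall>i\<in>I. y i = \<zero>\<^bsub>S\<^esub>")
  case True
  have "point_vec y \<xi> j = \<zero>\<^bsub>S\<^esub>" for j
  proof -
    have "point_vec y \<xi> j = (\<Oplus>\<^bsub>S\<^esub>i\<in>I. \<zero>\<^bsub>S\<^esub>)"
      unfolding point_vec_apply[OF y \<xi>]
      using True S.free_module_closed[OF \<xi>] f_closed
      by (intro S.add.finprod_cong') (auto intro!: S.l_null S.finsum_closed)
    then show ?thesis by simp
  qed
  then have "point_vec y \<xi> = \<zero>\<^bsub>SJ\<^esub>" by auto
  then show ?thesis using SJ.submodule_zero[OF rel_span_submodule[OF y]] by simp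
next
  case False
  define P where "P k \<longleftrightarrow> (\<exists>y'\<in>I \<rightarrow> carrier S. \<forall>i\<in>I. y i = (\<pi> [^]\<^bsub>S\<^esub> (k::nat)) \<otimes>\<^bsub>S\<^esub> y' i)" for k
  have "P 0" unfolding P_def using y funcset_mem[OF y] by (intro bexI[of _ y]) auto
  moreover have "\<not> P n"
  proof
    assume "P n"
    then obtain y' where y': "y' \<in> I \<rightarrow> carrier S" "\<forall>i\<in>I. y i = (\<pi> [^]\<^bsub>S\<^esub> n) \<otimes>\<^bsub>S\<^esub> y' i"
      unfolding P_def by (rule bexE)
    have "y i = \<zero>\<^bsub>S\<^esub>" if "i \<in> I" for i using bspec[OF y'(2) that] funcset_mem[OF y'(1) that] by (simp add: \<pi>_nil)
    then show False using False by simp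
  qed
  ultimately obtain k where k: "P k" "\<not> P (Suc k)" using nat_induct[of P n] by blast
  obtain y' where y': "y' \<in> I \<rightarrow> carrier S" "\<forall>i\<in>I. y i = (\<pi> [^]\<^bsub>S\<^esub> k) \<otimes>\<^bsub>S\<^esub> y' i" using k(1) by (auto simp: P_def)
  have pk: "\<pi> [^]\<^bsub>S\<^esub> k \<in> carrier S" using \<pi> by simp
  have "\<exists>i\<in>I. y' i \<in> Units S"
  proof (rule ccontr)
    assume no: "\<not> (\<exists>i\<in>I. y' i \<in> Units S)"
    have "\<forall>i. \<exists>t. i \<in> I \<longrightarrow> t \<in> carrier S \<and> y' i = \<pi> \<otimes>\<^bsub>S\<^esub> t"
    proof
      fix i show "\<exists>t. i \<in> I \<longrightarrow> t \<in> carrier S \<and> y' i = \<pi> \<otimes>\<^bsub>S\<^esub> t"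
        using local_ring[of "y' i"] y'(1) no by (cases "i \<in> I") auto
    qed
    then obtain t where t: "\<And>i. i \<in> I \<Longrightarrow> t i \<in> carrier S" "\<And>i. i \<in> I \<Longrightarrow> y' i = \<pi> \<otimes>\<^bsub>S\<^esub> t i" by metis
    have "P (Suc k)" unfolding P_def
      using t y'(2) pk \<pi> by (intro bexI[of _ t]) (auto simp: S.m_assoc)
    then show False using k(2) by simp
  qed
  from point_vec_span_unit[OF y'(1) this]
  have sp: "point_vec y' \<zeta> \<in> rel_span y'" if "\<zeta> \<in> carrier (free_module S Bs)" for \<zeta> using that .
  have scale: "point_vec y \<zeta> = (\<pi> [^]\<^bsub>S\<^esub> k) \<odot>\<^bsub>SJ\<^esub> point_vec y' \<zeta>" if \<zeta>: "\<zeta> \<in> carrier (free_module S Bs)" for \<zeta>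
  proof
    fix j
    define c where "c i = (\<Oplus>\<^bsub>S\<^esub>b\<in>Bs. \<zeta> b \<otimes>\<^bsub>S\<^esub> f (entry \<theta> I J b i j))" for i
    have cc: "c i \<in> carrier S" for i unfolding c_def using S.free_module_closed[OF \<zeta>] f_closed by (intro S.finsum_closed) auto
    have yc: "y' i \<in> carrier S" if "i \<in> I" for i using y'(1) that by auto
    have "point_vec y \<zeta> j = (\<Oplus>\<^bsub>S\<^esub>i\<in>I. y i \<otimes>\<^bsub>S\<^esub> c i)" unfolding c_def by (rule point_vec_apply[OF y \<zeta>])
    also have "\<dots> = (\<Oplus>\<^bsub>S\<^esub>i\<in>I. (\<pi> [^]\<^bsub>S\<^esub> k) \<otimes>\<^bsub>S\<^esub> (y' i \<otimes>\<^bsub>S\<^esub> c i))"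
      using y'(2) yc cc pk by (intro S.add.finprod_cong') (auto simp: S.m_assoc)
    also have "\<dots> = (\<pi> [^]\<^bsub>S\<^esub> k) \<otimes>\<^bsub>S\<^esub> (\<Oplus>\<^bsub>S\<^esub>i\<in>I. y' i \<otimes>\<^bsub>S\<^esub> c i)"
      using yc cc pk finI by (intro S.finsum_rdistr[symmetric]) auto
    also have "(\<Oplus>\<^bsub>S\<^esub>i\<in>I. y' i \<otimes>\<^bsub>S\<^esub> c i) = point_vec y' \<zeta> j" unfolding c_def by (rule point_vec_apply[OF y'(1) \<zeta>, symmetric])
    finally show "point_vec y \<zeta> j = ((\<pi> [^]\<^bsub>S\<^esub> k) \<odot>\<^bsub>SJ\<^esub> point_vec y' \<zeta>) j" by simp
  qed
  have id: "lin_map S SJ SJ (\<lambda>z. z)" by (rule lin_mapI) simp_all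
  show ?thesis
    unfolding scale[OF \<xi>]
  proof (rule lin_map_gen[OF SJ.module_axioms SJ.module_axioms SJ.lin_map_smult[OF id pk] _ rel_span_submodule[OF y] _ sp[OF \<xi>, unfolded rel_span_def]])
    show "point_vec y' ` Rel_image \<subseteq> carrier SJ" using lin_mapD(1)[OF point_vec_lin[OF y'(1)]] Rel_image_closed by auto
    fix z assume "z \<in> point_vec y' ` Rel_image"
    then obtain \<zeta> where \<zeta>: "\<zeta> \<in> Rel_image" "z = point_vec y' \<zeta>" by auto
    have "\<zeta> \<in> carrier (free_module S Bs)" using \<zeta>(1) Rel_image_closed by auto
    from scale[OF this] show "(\<pi> [^]\<^bsub>S\<^esub> k) \<odot>\<^bsub>SJ\<^esub> z \<in> rel_span y" using point_vec_rel_span[OF \<zeta>(1), of y] \<zeta>(2) by simp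
  qed
qed

end

section \<open>Quotients of compact discrete valuation rings\<close>

context cring
begin

lemma ideal_power_0 [simp]: "ideal_power R P 0 = carrier R"
  by (simp add: ideal_power_def ideals_set_def)

lemma ideal_power_Suc: "ideal_power R P (Suc n) = ideal_power R P n \<cdot> P"
proof -
  interpret comm_monoid "ideals_set R" by (rule ideals_set_is_comm_monoid)
  show ?thesis by (simp add: ideal_power_def) (simp add: ideals_set_def)
qed

lemma ideal_power_ideal: "ideal P R \<Longrightarrow> ideal (ideal_power R P n) R"
  by (induction n) (simp_all add: ideal_power_Suc oneideal ideal_prod_is_ideal)

lemma ideal_power_mono:
  assumes P: "ideal P R" and "m \<le> n" shows "ideal_power R P n \<subseteq> ideal_power R P m"
  using \<open>m \<le> n\<close>
proof (induction n rule: dec_induct)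
  case (step n)
  have "ideal_power R P (Suc n) \<subseteq> ideal_power R P n"
    using ideal_prod_inter[OF ideal_power_ideal[OF P] P, of n] by (auto simp: ideal_power_Suc)
  then show ?case using step.IH by simp
qed simp

lemma pow_in_ideal_power: "ideal P R \<Longrightarrow> p \<in> P \<Longrightarrow> p [^] n \<in> ideal_power R P n"
  by (induction n) (auto simp: ideal_power_Suc intro: ideal_prod.prod)

text \<open>The predicate can be recovered from \<open>topology\<close> only after it is known to
  define one. Intersections are handled by the fact that the powers of \<open>P\<close>
  decrease.\<close>

lemma openin_adic_topology:
  assumes P: "ideal P R"
  shows "openin (adic_topology R P) V \<longleftrightarrow>
    V \<subseteq> carrier R \<and> (\<forall>x\<in>V. \<exists>n. ideal_power R P n +> x \<subseteq> V)"
proof -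
  have mono: "ideal_power R P n +> x \<subseteq> ideal_power R P m +> x" if "m \<le> n" for m n x
    using ideal_power_mono[OF P that] by (auto simp: a_r_coset_def')
  have "istopology (\<lambda>V. V \<subseteq> carrier R \<and> (\<forall>x\<in>V. \<exists>n. ideal_power R P n +> x \<subseteq> V))"
    unfolding istopology_def
  proof (intro conjI allI impI ballI)
    fix V W x
    assume V: "V \<subseteq> carrier R \<and> (\<forall>x\<in>V. \<exists>n. ideal_power R P n +> x \<subseteq> V)"
      and W: "W \<subseteq> carrier R \<and> (\<forall>x\<in>W. \<exists>n. ideal_power R P n +> x \<subseteq> W)"
    show "V \<inter> W \<subseteq> carrier R" using V by auto
    assume "x \<in> V \<inter> W"
    then obtain m n where "ideal_power R P m +> x \<subseteq> V" "ideal_power R P n +> x \<subseteq> W" using V W by blast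
    then have "ideal_power R P (max m n) +> x \<subseteq> V \<inter> W"
      using mono[of m "max m n" x] mono[of n "max m n" x] by auto
    then show "\<exists>n. ideal_power R P n +> x \<subseteq> V \<inter> W" by blast
  next
    fix \<K> x
    assume K: "\<forall>V\<in>\<K>. V \<subseteq> carrier R \<and> (\<forall>x\<in>V. \<exists>n. ideal_power R P n +> x \<subseteq> V)"
    show "\<Union>\<K> \<subseteq> carrier R" using K by auto
    assume "x \<in> \<Union>\<K>"
    then obtain V where V: "V \<in> \<K>" "x \<in> V" by auto
    then obtain n where "ideal_power R P n +> x \<subseteq> V" using K by blast
    then have "ideal_power R P n +> x \<subseteq> \<Union>\<K>" using V(1) by auto
    then show "\<exists>n. ideal_power R P n +> x \<subseteq> \<Union>\<K>" by (rule exI)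
  qed
  then show ?thesis unfolding adic_topology_def by (simp only: topology_inverse')
qed

text \<open>The cosets form a cover by disjoint, non-empty open sets. Such a cover has no proper
  subcover, so compactness makes it finite.\<close>

lemma finite_quotient_ideal_power:
  assumes P: "ideal P R" and comp: "compact_space (adic_topology R P)"
  shows "finite (carrier (R Quot (ideal_power R P n)))"
proof -
  let ?Q = "ideal_power R P n"
  let ?C = "a_rcosets ?Q"
  interpret Q: ideal ?Q R by (rule ideal_power_ideal[OF P])
  have sub: "abelian_subgroup ?Q R" by (rule abelian_subgroupI3) unfold_locales
  note part = abelian_subgroup.a_rcosets_part_G[OF sub]
  have coset: "C = ?Q +> x" if "C \<in> ?C" "x \<in> C" for C x
    using that abelian_subgroup.a_repr_independence'[OF sub] by (auto simp: A_RCOSETS_def')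
  have ne: "C \<noteq> {}" if "C \<in> ?C" for C
    using that abelian_subgroup.a_rcos_self[OF sub] by (auto simp: A_RCOSETS_def')
  have "openin (adic_topology R P) C" if C: "C \<in> ?C" for C
    unfolding openin_adic_topology[OF P]
    using part C coset[OF C] by (intro conjI ballI exI[of _ n]) auto
  moreover have top: "topspace (adic_topology R P) = carrier R"
  proof
    show "topspace (adic_topology R P) \<subseteq> carrier R"
      using openin_topspace[of "adic_topology R P"] unfolding openin_adic_topology[OF P] by (rule conjunct1)
    have "ideal_power R P 0 +> x \<subseteq> carrier R" if "x \<in> carrier R" for x
      using a_r_coset_subset_G[of "carrier R" x] that by simp
    then have "openin (adic_topology R P) (carrier R)" unfolding openin_adic_topology[OF P] by blast
    then show "carrier R \<subseteq> topspace (adic_topology R P)" by (rule openin_subset)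
  qed
  ultimately obtain F where F: "finite F" "F \<subseteq> ?C" "carrier R \<subseteq> \<Union>F"
    using comp part unfolding compact_space_def compactin_def top by (metis subset_refl)
  have "?C \<subseteq> F"
  proof
    fix C assume C: "C \<in> ?C"
    then obtain x where x: "x \<in> C" using ne by auto
    then have "x \<in> carrier R" using C part by auto
    then obtain C' where C': "C' \<in> F" "x \<in> C'" using F(3) by auto
    then have "C' = C" using coset[OF C x] coset[of C' x] F(2) by auto
    then show "C \<in> F" using C' by simp
  qed
  then show ?thesis using F(1) by (auto simp: FactRing_def intro: finite_subset)
qed

end

section \<open>Uniformisers and the local structure of the quotients\<close>

lemma dvr_maximalideal: assumes "dvr D" shows "maximalideal (max_ideal D) D"
  unfolding max_ideal_def by (rule theI'[of "\<lambda>P. maximalideal P D"]) (use assms in \<open>simp add: dvr_def\<close>)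

text \<open>In a principal ideal domain irreducible elements generate maximal ideals, and here there
  is only one. So each non-zero non-unit is divisible by a generator of \<open>max_ideal D\<close>,
  hence lies in it, and is a multiple of the generator \<open>p\<close> fixed beforehand.\<close>

lemma dvr_uniformizer:
  fixes D (structure)
  assumes D: "dvr D"
  shows "\<exists>p\<in>max_ideal D. \<forall>x\<in>carrier D. x \<in> Units D \<or> (\<exists>t\<in>carrier D. x = p \<otimes>\<^bsub>D\<^esub> t)"
proof -
  interpret principal_domain D using D by (simp add: dvr_def)
  let ?P = "max_ideal D"
  interpret P: maximalideal ?P D by (rule dvr_maximalideal[OF D])
  have uniq: "Q = ?P" if "maximalideal Q D" for Q
    using D that P.maximalideal_axioms by (auto simp: dvr_def)
  have irr: "\<exists>b\<in>carrier D. PIdl b = ?P \<and> x \<in> PIdl b" if x: "x \<in> carrier D - {\<zero>\<^bsub>D\<^esub>}" "x \<notin> Units D" for x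
  proof -
    obtain b where b: "b \<in> carrier D" "ring_irreducible b" "b divides\<^bsub>D\<^esub> x"
      using exists_irreducible_divisor[OF x] .
    have "x \<in> PIdl b" using b(1,3) by (auto simp: factor_def cgenideal_def m_comm)
    then show ?thesis using b uniq[OF irreducible_imp_maximalideal[OF b(1,2)]] by auto
  qed
  have "\<zero>\<^bsub>D\<^esub> \<in> ?P" by (rule P.zero_closed)
  then obtain a where a: "a \<in> ?P" "a \<noteq> \<zero>\<^bsub>D\<^esub>" using D by (auto simp: dvr_def)
  have "a \<notin> Units D"
  proof
    assume u: "a \<in> Units D"
    have "inv a \<otimes> a \<in> ?P" by (rule P.I_l_closed[OF a(1) Units_inv_closed[OF u]])
    then have "?P = carrier D" using u P.one_imp_carrier by simp
    then show False using P.I_notcarr by simp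
  qed
  then obtain p where p: "p \<in> carrier D" "PIdl p = ?P" using irr[of a] a P.Icarr[OF a(1)] by blast
  have "x \<in> Units D \<or> (\<exists>t\<in>carrier D. x = p \<otimes>\<^bsub>D\<^esub> t)" if x: "x \<in> carrier D" for x
  proof (cases "x = \<zero>\<^bsub>D\<^esub> \<or> x \<in> Units D")
    case True
    then show ?thesis using p(1) by (auto intro!: bexI[of _ "\<zero>\<^bsub>D\<^esub>"])
  next
    case False
    then have "x \<in> PIdl p" using irr[of x] x p(2) by auto
    then show ?thesis using p(1) by (auto simp: cgenideal_def m_comm)
  qed
  moreover have "p \<in> ?P" using cgenideal_self[OF p(1)] p(2) by simp
  ultimately show ?thesis by blast
qed

lemma compact_dvr_quotient:
  fixes n :: nat
  assumes D: "compact_dvr D"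
  defines "Q \<equiv> ideal_power D (max_ideal D) n"
  shows "cring D" "cring (D Quot Q)" "finite (carrier (D Quot Q))" "(\<lambda>a. Q +>\<^bsub>D\<^esub> a) \<in> ring_hom D (D Quot Q)"
    "\<exists>\<pi>\<in>carrier (D Quot Q). \<pi> [^]\<^bsub>D Quot Q\<^esub> n = \<zero>\<^bsub>D Quot Q\<^esub> \<and>
      (\<forall>s\<in>carrier (D Quot Q). s \<in> Units (D Quot Q) \<or> (\<exists>t\<in>carrier (D Quot Q). s = \<pi> \<otimes>\<^bsub>D Quot Q\<^esub> t))"
proof -
  have dvr: "dvr D" and comp: "compact_space (adic_topology D (max_ideal D))" using D by (simp_all add: compact_dvr_def)
  interpret principal_domain D using dvr by (simp add: dvr_def)
  show "cring D" by (rule is_cring)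
  have P: "ideal (max_ideal D) D" using dvr_maximalideal[OF dvr] by (rule maximalideal.axioms(1))
  interpret Q: ideal Q D unfolding Q_def by (rule ideal_power_ideal[OF P])
  show S: "cring (D Quot Q)" by (rule Q.quotient_is_cring[OF is_cring])
  interpret S: cring "D Quot Q" by (rule S)
  show "finite (carrier (D Quot Q))" unfolding Q_def by (rule finite_quotient_ideal_power[OF P comp])
  show h: "(\<lambda>a. Q +>\<^bsub>D\<^esub> a) \<in> ring_hom D (D Quot Q)" by (rule Q.rcos_ring_hom)
  interpret h: ring_hom_cring D "D Quot Q" "\<lambda>a. Q +>\<^bsub>D\<^esub> a"
    by (simp add: ring_hom_cring_def ring_hom_cring_axioms_def is_cring S h)
  have sub: "abelian_subgroup Q D" by (rule abelian_subgroupI3) unfold_locales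
  obtain p where p: "p \<in> max_ideal D" "\<forall>x\<in>carrier D. x \<in> Units D \<or> (\<exists>t\<in>carrier D. x = p \<otimes>\<^bsub>D\<^esub> t)"
    using dvr_uniformizer[OF dvr] by blast
  have pc: "p \<in> carrier D" using ideal.Icarr[OF P p(1)] .
  have carr: "carrier (D Quot Q) = (\<lambda>a. Q +>\<^bsub>D\<^esub> a) ` carrier D"
    unfolding FactRing_def A_RCOSETS_def' by auto
  \<comment> \<open>The element \<open>p ^ n\<close> lies in the \<open>n\<close>-th power of the
    maximal ideal. For \<open>n = 0\<close> the quotient is the zero ring, in which the empty power
    is zero too.\<close>
  have "(Q +>\<^bsub>D\<^esub> p) [^]\<^bsub>D Quot Q\<^esub> n = Q +>\<^bsub>D\<^esub> (p [^]\<^bsub>D\<^esub> n)"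
    by (induction n) (simp_all add: pc)
  also have "\<dots> = \<zero>\<^bsub>D Quot Q\<^esub>"
    unfolding FactRing_def ring.simps monoid.simps
    using pow_in_ideal_power[OF P p(1), of n] abelian_subgroup.a_rcos_const[OF sub] by (simp add: Q_def)
  finally have "(Q +>\<^bsub>D\<^esub> p) [^]\<^bsub>D Quot Q\<^esub> n = \<zero>\<^bsub>D Quot Q\<^esub>" .
  moreover have "s \<in> Units (D Quot Q) \<or> (\<exists>t\<in>carrier (D Quot Q). s = (Q +>\<^bsub>D\<^esub> p) \<otimes>\<^bsub>D Quot Q\<^esub> t)"
    if s: "s \<in> carrier (D Quot Q)" for s
  proof -
    obtain x where x: "x \<in> carrier D" "s = Q +>\<^bsub>D\<^esub> x" using s[unfolded carr] by (rule imageE)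
    from bspec[OF p(2) x(1)] show ?thesis
    proof
      assume u: "x \<in> Units D"
      have "s \<in> Units (D Quot Q)" unfolding x(2)
        using u h.hom_mult[of x "inv\<^bsub>D\<^esub> x"] h.hom_mult[of "inv\<^bsub>D\<^esub> x" x] h.hom_one x(1)
        by (auto simp: Units_def[of "D Quot Q"] intro!: bexI[of _ "Q +>\<^bsub>D\<^esub> (inv\<^bsub>D\<^esub> x)"])
      then show ?thesis ..
    next
      assume "\<exists>t\<in>carrier D. x = p \<otimes>\<^bsub>D\<^esub> t"
      then obtain t where "t \<in> carrier D" "x = p \<otimes>\<^bsub>D\<^esub> t" by (rule bexE)
      then have "s = (Q +>\<^bsub>D\<^esub> p) \<otimes>\<^bsub>D Quot Q\<^esub> (Q +>\<^bsub>D\<^esub> t)" "Q +>\<^bsub>D\<^esub> t \<in> carrier (D Quot Q)"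
        using x(2) pc by simp_all
      then show ?thesis by (intro disjI2 bexI)
    qed
  qed
  ultimately show "\<exists>\<pi>\<in>carrier (D Quot Q). \<pi> [^]\<^bsub>D Quot Q\<^esub> n = \<zero>\<^bsub>D Quot Q\<^esub> \<and>
      (\<forall>s\<in>carrier (D Quot Q). s \<in> Units (D Quot Q) \<or> (\<exists>t\<in>carrier (D Quot Q). s = \<pi> \<otimes>\<^bsub>D Quot Q\<^esub> t))"
    using h.hom_closed[OF pc] by (intro bexI[of _ "Q +>\<^bsub>D\<^esub> p"] conjI ballI)
qed

section \<open>Iterated extension of scalars\<close>

lemma semilin_finsum:
  assumes R: "cring R" and M: "module R M" and P: "module S P" and h: "h \<zero>\<^bsub>R\<^esub> = \<zero>\<^bsub>S\<^esub>"
    and u: "semilin R h M P u" and g: "g \<in> A \<rightarrow> carrier M"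
  shows "u (finsum M g A) = (\<Oplus>\<^bsub>P\<^esub>a\<in>A. u (g a))"
proof -
  interpret M: module R M by (rule M)
  interpret P: module S P by (rule P)
  note u = u[unfolded semilin_def]
  have uc: "u m \<in> carrier P" if "m \<in> carrier M" for m using u that by auto
  have "u \<zero>\<^bsub>M\<^esub> = u (\<zero>\<^bsub>R\<^esub> \<odot>\<^bsub>M\<^esub> \<zero>\<^bsub>M\<^esub>)" by simp
  also have "\<dots> = \<zero>\<^bsub>P\<^esub>" using u h uc[of "\<zero>\<^bsub>M\<^esub>"] by (simp del: M.smult_l_null M.smult_r_null)
  finally have u0: "u \<zero>\<^bsub>M\<^esub> = \<zero>\<^bsub>P\<^esub>" .
  show ?thesis
    using g
  proof (induction A rule: infinite_finite_induct)
    case (insert x A)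
    then have "(\<lambda>a. u (g a)) \<in> A \<rightarrow> carrier P" using uc by auto
    then show ?case using insert u uc by (simp add: Pi_iff)
  qed (auto simp: u0)
qed

text \<open>Scalars are extended to the valuation ring and then to its quotient. The iterated tensor
  product is not rewritten as a single one; its elements are reached through the iterated pure
  tensors \<open>tens2\<close>.\<close>

locale two_step_ext =
  fixes L :: "('l, 'x) ring_scheme" and D :: "('d, 'y) ring_scheme" and S :: "('s, 'z) ring_scheme"
    and \<phi> :: "'l \<Rightarrow> 'd" and \<rho> :: "'d \<Rightarrow> 's"
  assumes L_cring: "cring L" and D_cring: "cring D" and S_cring: "cring S"
    and \<phi>: "\<phi> \<in> ring_hom L D" and \<rho>: "\<rho> \<in> ring_hom D S"
begin

interpretation L: cring L by (rule L_cring)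
interpretation D: cring D by (rule D_cring)
interpretation S: cring S by (rule S_cring)

abbreviation "ext2 M \<equiv> ext_module D S \<rho> (ext_module L D \<phi> M)"
abbreviation "tens2 M m \<equiv> tens D S \<rho> (ext_module L D \<phi> M) (tens L D \<phi> M m)"
abbreviation "rep2 \<omega> \<equiv> ext_rep D S \<rho> (ext_rep L D \<phi> \<omega>)"

lemma comp_closed: "a \<in> carrier L \<Longrightarrow> \<rho> (\<phi> a) \<in> carrier S"
  by (rule ring_hom_closed[OF \<rho> ring_hom_closed[OF \<phi>]])

lemma comp_hom: "(\<lambda>a. \<rho> (\<phi> a)) \<in> ring_hom L S"
  using ring_hom_trans[OF \<phi> \<rho>] by (simp add: comp_def)

context
  fixes M :: "('l, 'm, 'w) module_scheme"
  assumes M: "module L M"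
begin

lemma ext1: "scalar_ext L D \<phi> M" and ext2: "scalar_ext D S \<rho> (ext_module L D \<phi> M)"
proof -
  show 1: "scalar_ext L D \<phi> M" by (simp add: scalar_ext_def M D_cring \<phi>)
  show "scalar_ext D S \<rho> (ext_module L D \<phi> M)"
    using scalar_ext.E_module[OF 1] by (simp add: scalar_ext_def S_cring \<rho>)
qed

lemma ext2_module: "module S (ext2 M)" by (rule scalar_ext.E_module[OF ext2])

lemma tens2_closed: "m \<in> carrier M \<Longrightarrow> tens2 M m \<in> carrier (ext2 M)"
  by (intro scalar_ext.t_closed[OF ext2] scalar_ext.t_closed[OF ext1])

lemma tens2_semilin: "semilin L (\<lambda>a. \<rho> (\<phi> a)) M (ext2 M) (tens2 M)"
  using scalar_ext.t_closed[OF ext1] scalar_ext.t_add[OF ext1] scalar_ext.t_smult[OF ext1]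
    scalar_ext.t_add[OF ext2] scalar_ext.t_smult[OF ext2] tens2_closed ring_hom_closed[OF \<phi>]
  by (simp add: semilin_def)

lemma ext2_gen:
  assumes H: "submodule H S (ext2 M)" and tH: "\<And>m. m \<in> carrier M \<Longrightarrow> tens2 M m \<in> H" and x: "x \<in> carrier (ext2 M)"
  shows "x \<in> H"
proof (rule scalar_ext.E_gen[OF ext2 H _ x])
  let ?E = "ext_module L D \<phi> M"
  fix e assume e: "e \<in> carrier ?E"
  have "e \<in> {e \<in> carrier ?E. tens D S \<rho> ?E e \<in> H}"
    by (rule scalar_ext.E_gen[OF ext1 semilin_preimage[OF D_cring S_cring \<rho> _ _ scalar_ext.t_semilin[OF ext2] H] _ e])
      (use tH scalar_ext.t_closed[OF ext1] scalar_ext.E_module[OF ext1] ext2_module in auto)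
  then show "tens D S \<rho> ?E e \<in> H" by simp
qed

lemma fin_gen_ext2: "fin_gen L M \<Longrightarrow> fin_gen S (ext2 M)"
  by (rule scalar_ext.fin_gen_ext[OF ext2 scalar_ext.fin_gen_ext[OF ext1]])

end

text \<open>The element with coordinates \<open>w\<close> in the doubly extended free module. Images
  are compared inside that module, so coordinates serve only to name its elements.\<close>

definition coord2 where
  "coord2 A w = (\<Oplus>\<^bsub>ext2 (free_module L A)\<^esub>a\<in>A. w a \<odot>\<^bsub>ext2 (free_module L A)\<^esub> tens2 (free_module L A) (evec L a))"

lemma coord2_lin:
  assumes "finite A" shows "lin_map S (free_module S A) (ext2 (free_module L A)) (coord2 A)"
  unfolding coord2_def[abs_def]
  by (rule module.lin_map_lincomb[OF ext2_module[OF L.free_module_module] assms])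
    (simp add: tens2_closed[OF L.free_module_module] L.evec_closed)

lemma tens2_coord2:
  assumes A: "finite A" and z: "z \<in> carrier (free_module L A)"
  shows "tens2 (free_module L A) z = coord2 A (\<lambda>a. \<rho> (\<phi> (z a)))"
proof -
  let ?F = "free_module L A"
  interpret F: module L ?F by (rule L.free_module_module)
  have "z = (\<Oplus>\<^bsub>?F\<^esub>a\<in>A. z a \<odot>\<^bsub>?F\<^esub> evec L a)"
    by (rule L.free_module_expand[OF z A, symmetric]) (use free_module_support[OF z] in auto)
  then have "tens2 ?F z = tens2 ?F (\<Oplus>\<^bsub>?F\<^esub>a\<in>A. z a \<odot>\<^bsub>?F\<^esub> evec L a)" by (rule arg_cong)
  also have "\<dots> = (\<Oplus>\<^bsub>ext2 ?F\<^esub>a\<in>A. tens2 ?F (z a \<odot>\<^bsub>?F\<^esub> evec L a))"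
    by (rule semilin_finsum[OF L_cring F.module_axioms ext2_module[OF F.module_axioms] _ tens2_semilin[OF F.module_axioms]])
      (use ring_hom_zero[OF comp_hom L.ring_axioms S.ring_axioms] in \<open>simp_all del: free_module_simps add:
        F.smult_closed L.free_module_closed[OF z] L.evec_closed\<close>)
  also have "\<dots> = coord2 A (\<lambda>a. \<rho> (\<phi> (z a)))"
    unfolding coord2_def
  proof (rule abelian_monoid.finsum_cong'[OF _ refl])
    interpret E: module S "ext2 ?F" by (rule ext2_module[OF F.module_axioms])
    show "abelian_monoid (ext2 ?F)" by (rule E.M.abelian_monoid_axioms)
    show "(\<lambda>a. \<rho> (\<phi> (z a)) \<odot>\<^bsub>ext2 ?F\<^esub> tens2 ?F (evec L a)) \<in> A \<rightarrow> carrier (ext2 ?F)"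
      by (intro Pi_I E.smult_closed comp_closed L.free_module_closed[OF z] tens2_closed[OF F.module_axioms] L.evec_closed)
    show "tens2 ?F (z a \<odot>\<^bsub>?F\<^esub> evec L a) = \<rho> (\<phi> (z a)) \<odot>\<^bsub>ext2 ?F\<^esub> tens2 ?F (evec L a)" if "a \<in> A" for a
      using tens2_semilin[OF F.module_axioms] L.free_module_closed[OF z] L.evec_closed[OF that]
      unfolding semilin_def by blast
  qed
  finally show ?thesis .
qed

lemma coord2_surj:
  assumes A: "finite A" and y: "y \<in> carrier (ext2 (free_module L A))"
  shows "\<exists>w\<in>carrier (free_module S A). y = coord2 A w"
proof -
  let ?F = "free_module L A"
  interpret F: module L ?F by (rule L.free_module_module)
  interpret SA: module S "free_module S A" by (rule S.free_module_module)
  note lin = coord2_lin[OF A]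
  have "y \<in> coord2 A ` carrier (free_module S A)"
  proof (rule ext2_gen[OF F.module_axioms _ _ y])
    show "submodule (coord2 A ` carrier (free_module S A)) S (ext2 ?F)"
      by (rule lin_map_image[OF SA.module_axioms ext2_module[OF F.module_axioms] lin SA.carrier_is_submodule])
    show "tens2 ?F z \<in> coord2 A ` carrier (free_module S A)" if "z \<in> carrier ?F" for z
      using tens2_coord2[OF A that] semilin_map[OF L_cring S_cring comp_hom, of A] that
      by (auto simp: semilin_def)
  qed
  then show ?thesis by auto
qed

text \<open>The coordinates of the value of the iterated pure tensor of \<open>m\<close> at the
  vector with coordinates \<open>w\<close>, computed from the matrix of \<open>m\<close> over
  \<open>L\<close>.\<close>

definition act_coord where
  "act_coord I' J' \<omega> w m = (\<Oplus>\<^bsub>free_module S J'\<^esub>i\<in>I'. w i \<odot>\<^bsub>free_module S J'\<^esub> (\<lambda>j. \<rho> (\<phi> (rep_act \<omega> m (evec L i) j))))"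

context
  fixes \<omega> :: "('l, 'm, 'i \<Rightarrow> 'l, 'j \<Rightarrow> 'l) mod_rep" and I' J'
  assumes rep: "is_mod_rep L \<omega>" and src: "rep_src \<omega> = free_module L I'" and tgt: "rep_tgt \<omega> = free_module L J'"
    and fin: "finite I'" "finite J'"
begin

lemma rep1: "is_mod_rep D (ext_rep L D \<phi> \<omega>)"
  by (rule bilin_ext.ext_is_mod_rep) (simp add: bilin_ext_def rep D_cring \<phi>)

lemma rep2: "is_mod_rep S (rep2 \<omega>)"
  by (rule bilin_ext.ext_is_mod_rep) (simp add: bilin_ext_def rep1 S_cring \<rho>)

lemma bilin1: "bilin_ext L D \<phi> \<omega>" and bilin2: "bilin_ext D S \<rho> (ext_rep L D \<phi> \<omega>)"
  by (simp_all add: bilin_ext_def rep rep1 D_cring S_cring \<phi> \<rho>)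

lemma rep2_sel:
  "rep_par (rep2 \<omega>) = ext2 (rep_par \<omega>)" "rep_src (rep2 \<omega>) = ext2 (free_module L I')"
  "rep_tgt (rep2 \<omega>) = ext2 (free_module L J')"
  by (simp_all add: bilin_ext.ext_rep_sel[OF bilin1] bilin_ext.ext_rep_sel[OF bilin2] src tgt)

lemma rep_act_evec_closed:
  assumes "m \<in> carrier (rep_par \<omega>)" "i \<in> I'"
  shows "rep_act \<omega> m (evec L i) \<in> carrier (free_module L J')"
  using lin_mapD(1)[OF lin_map_rep_act2[OF rep assms(1)]] L.evec_closed[OF assms(2)] by (simp add: src tgt)

lemma act_coord_closed:
  assumes "w \<in> carrier (free_module S I')" "m \<in> carrier (rep_par \<omega>)"
  shows "(\<lambda>i. w i \<odot>\<^bsub>free_module S J'\<^esub> (\<lambda>j. \<rho> (\<phi> (rep_act \<omega> m (evec L i) j)))) \<in> I' \<rightarrow> carrier (free_module S J')"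
proof
  interpret SJ: module S "free_module S J'" by (rule S.free_module_module)
  fix i assume "i \<in> I'"
  then have "(\<lambda>j. \<rho> (\<phi> (rep_act \<omega> m (evec L i) j))) \<in> carrier (free_module S J')"
    using semilin_map[OF L_cring S_cring comp_hom, of J'] rep_act_evec_closed[OF assms(2)] by (auto simp: semilin_def)
  then show "w i \<odot>\<^bsub>free_module S J'\<^esub> (\<lambda>j. \<rho> (\<phi> (rep_act \<omega> m (evec L i) j))) \<in> carrier (free_module S J')"
    by (rule SJ.smult_closed[OF S.free_module_closed[OF assms(1)]])
qed

lemma act_coord_add:
  assumes w: "w \<in> carrier (free_module S I')" and m: "m \<in> carrier (rep_par \<omega>)" "m' \<in> carrier (rep_par \<omega>)"
  shows "act_coord I' J' \<omega> w (m \<oplus>\<^bsub>rep_par \<omega>\<^esub> m') = act_coord I' J' \<omega> w m \<oplus>\<^bsub>free_module S J'\<^esub> act_coord I' J' \<omega> w m'"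
proof -
  let ?SJ = "free_module S J'"
  interpret SJ: module S ?SJ by (rule S.free_module_module)
  interpret M: module L "rep_par \<omega>" by (rule is_mod_rep_modules(1)[OF rep])
  let ?h = "\<lambda>m i j. \<rho> (\<phi> (rep_act \<omega> m (evec L i) j))"
  note sl = semilin_map[OF L_cring S_cring comp_hom, of J', unfolded semilin_def]
  have hc: "?h m i \<in> carrier ?SJ" if "m \<in> carrier (rep_par \<omega>)" "i \<in> I'" for m i
    using sl rep_act_evec_closed[OF that] by auto
  have "?h (m \<oplus>\<^bsub>rep_par \<omega>\<^esub> m') i = ?h m i \<oplus>\<^bsub>?SJ\<^esub> ?h m' i" if i: "i \<in> I'" for i
  proof -
    have "rep_act \<omega> (m \<oplus>\<^bsub>rep_par \<omega>\<^esub> m') (evec L i) =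
        rep_act \<omega> m (evec L i) \<oplus>\<^bsub>free_module L J'\<^esub> rep_act \<omega> m' (evec L i)"
      using lin_mapD(2)[OF lin_map_rep_act1[OF rep, of "evec L i"] m] L.evec_closed[OF i] by (simp add: src tgt)
    then show ?thesis using sl rep_act_evec_closed[OF m(1) i] rep_act_evec_closed[OF m(2) i] by presburger
  qed
  then have "act_coord I' J' \<omega> w (m \<oplus>\<^bsub>rep_par \<omega>\<^esub> m') =
      (\<Oplus>\<^bsub>?SJ\<^esub>i\<in>I'. w i \<odot>\<^bsub>?SJ\<^esub> ?h m i \<oplus>\<^bsub>?SJ\<^esub> w i \<odot>\<^bsub>?SJ\<^esub> ?h m' i)"
    unfolding act_coord_def
    by (intro SJ.M.finsum_cong' refl Pi_I SJ.M.a_closed SJ.smult_closed)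
      (simp_all del: free_module_simps add: S.free_module_closed[OF w] hc m SJ.smult_r_distr)
  also have "\<dots> = act_coord I' J' \<omega> w m \<oplus>\<^bsub>?SJ\<^esub> act_coord I' J' \<omega> w m'"
    unfolding act_coord_def by (rule SJ.M.finsum_addf[OF act_coord_closed[OF w m(1)] act_coord_closed[OF w m(2)]])
  finally show ?thesis .
qed

lemma act_coord_apply:
  assumes w: "w \<in> carrier (free_module S I')" and m: "m \<in> carrier (rep_par \<omega>)"
  shows "act_coord I' J' \<omega> w m j = (\<Oplus>\<^bsub>S\<^esub>i\<in>I'. w i \<otimes>\<^bsub>S\<^esub> \<rho> (\<phi> (rep_act \<omega> m (evec L i) j)))"
  unfolding act_coord_def S.finsum_free_module[OF act_coord_closed[OF w m]] by simp

lemma rep2_act: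
  assumes m: "m \<in> carrier (rep_par \<omega>)" and w: "w \<in> carrier (free_module S I')"
  shows "rep_act (rep2 \<omega>) (tens2 (rep_par \<omega>) m) (coord2 I' w) = coord2 J' (act_coord I' J' \<omega> w m)"
proof -
  let ?FI = "free_module L I'" and ?FJ = "free_module L J'"
  interpret FI: module L ?FI by (rule L.free_module_module)
  interpret FJ: module L ?FJ by (rule L.free_module_module)
  interpret EI: module S "ext2 ?FI" by (rule ext2_module[OF FI.module_axioms])
  interpret EJ: module S "ext2 ?FJ" by (rule ext2_module[OF FJ.module_axioms])
  interpret SJ: module S "free_module S J'" by (rule S.free_module_module)
  note par = is_mod_rep_modules(1)[OF rep]
  let ?A = "rep_act (rep2 \<omega>) (tens2 (rep_par \<omega>) m)"
  have A: "lin_map S (ext2 ?FI) (ext2 ?FJ) ?A"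
    using lin_map_rep_act2[OF rep2, of "tens2 (rep_par \<omega>) m"] tens2_closed[OF par m] by (simp add: rep2_sel)
  note wc = S.free_module_closed[OF w]
  have te: "tens2 ?FI (evec L i) \<in> carrier (ext2 ?FI)" if "i \<in> I'" for i
    by (rule tens2_closed[OF FI.module_axioms L.evec_closed[OF that]])
  have "?A (coord2 I' w) = (\<Oplus>\<^bsub>ext2 ?FJ\<^esub>i\<in>I'. ?A (w i \<odot>\<^bsub>ext2 ?FI\<^esub> tens2 ?FI (evec L i)))"
    unfolding coord2_def
    by (rule lin_map_finsum[OF EI.module_axioms EJ.module_axioms A]) (use te wc in \<open>auto intro!: EI.smult_closed\<close>)
  also have "\<dots> = (\<Oplus>\<^bsub>ext2 ?FJ\<^esub>i\<in>I'. coord2 J' (w i \<odot>\<^bsub>free_module S J'\<^esub> (\<lambda>j. \<rho> (\<phi> (rep_act \<omega> m (evec L i) j)))))"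
  proof (rule EJ.M.finsum_cong'[OF refl])
    show "(\<lambda>i. coord2 J' (w i \<odot>\<^bsub>free_module S J'\<^esub> (\<lambda>j. \<rho> (\<phi> (rep_act \<omega> m (evec L i) j))))) \<in> I' \<rightarrow> carrier (ext2 ?FJ)"
      using lin_mapD(1)[OF coord2_lin[OF fin(2)]] act_coord_closed[OF w m] by auto
    fix i assume i: "i \<in> I'"
    have z: "rep_act \<omega> m (evec L i) \<in> carrier ?FJ" by (rule rep_act_evec_closed[OF m i])
    then have z': "(\<lambda>j. \<rho> (\<phi> (rep_act \<omega> m (evec L i) j))) \<in> carrier (free_module S J')"
      using semilin_map[OF L_cring S_cring comp_hom, of J'] by (auto simp: semilin_def)
    have "?A (tens2 ?FI (evec L i)) = tens2 ?FJ (rep_act \<omega> m (evec L i))"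
      using bilin_ext.ext_act_tens[OF bilin1 m, of "evec L i"]
        bilin_ext.ext_act_tens[OF bilin2, of "tens L D \<phi> (rep_par \<omega>) m" "tens L D \<phi> ?FI (evec L i)"]
        scalar_ext.t_closed[OF ext1[OF par] m] scalar_ext.t_closed[OF ext1[OF FI.module_axioms] L.evec_closed[OF i]]
        L.evec_closed[OF i]
      by (simp add: bilin_ext.ext_rep_sel[OF bilin1] src tgt)
    then have "?A (w i \<odot>\<^bsub>ext2 ?FI\<^esub> tens2 ?FI (evec L i)) = w i \<odot>\<^bsub>ext2 ?FJ\<^esub> tens2 ?FJ (rep_act \<omega> m (evec L i))"
      using lin_mapD(3)[OF A wc te[OF i]] by simp
    also have "\<dots> = coord2 J' (w i \<odot>\<^bsub>free_module S J'\<^esub> (\<lambda>j. \<rho> (\<phi> (rep_act \<omega> m (evec L i) j))))"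
      using tens2_coord2[OF fin(2) z] lin_mapD(3)[OF coord2_lin[OF fin(2)] wc z'] by simp
    finally show "?A (w i \<odot>\<^bsub>ext2 ?FI\<^esub> tens2 ?FI (evec L i)) =
      coord2 J' (w i \<odot>\<^bsub>free_module S J'\<^esub> (\<lambda>j. \<rho> (\<phi> (rep_act \<omega> m (evec L i) j))))" .
  qed
  also have "\<dots> = coord2 J' (act_coord I' J' \<omega> w m)"
    unfolding act_coord_def
    by (rule lin_map_finsum[OF SJ.module_axioms EJ.module_axioms coord2_lin[OF fin(2)] act_coord_closed[OF w m], symmetric])
  finally show ?thesis .
qed

text \<open>The parameters that send a fixed vector into \<open>H\<close> form a submodule, so it
  suffices to test iterated pure tensors.\<close>

lemma rep2_image_subset:
  assumes w: "w \<in> carrier (free_module S I')" and H: "submodule H S (ext2 (free_module L J'))"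
  shows "(\<lambda>m. rep_act (rep2 \<omega>) m (coord2 I' w)) ` carrier (rep_par (rep2 \<omega>)) \<subseteq> H \<longleftrightarrow>
    (\<forall>m\<in>carrier (rep_par \<omega>). coord2 J' (act_coord I' J' \<omega> w m) \<in> H)"
proof
  note par = is_mod_rep_modules(1)[OF rep]
  have y: "coord2 I' w \<in> carrier (rep_src (rep2 \<omega>))" using lin_mapD(1)[OF coord2_lin[OF fin(1)] w] by (simp add: rep2_sel)
  note lin = lin_map_rep_act1[OF rep2 y, unfolded rep2_sel]
  show "\<forall>m\<in>carrier (rep_par \<omega>). coord2 J' (act_coord I' J' \<omega> w m) \<in> H"
    if "(\<lambda>m. rep_act (rep2 \<omega>) m (coord2 I' w)) ` carrier (rep_par (rep2 \<omega>)) \<subseteq> H"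
  proof
    fix m assume m: "m \<in> carrier (rep_par \<omega>)"
    show "coord2 J' (act_coord I' J' \<omega> w m) \<in> H"
      unfolding rep2_act[OF m w, symmetric]
      by (rule subsetD[OF that]) (use tens2_closed[OF par m] in \<open>simp add: rep2_sel\<close>)
  qed
  show "(\<lambda>m. rep_act (rep2 \<omega>) m (coord2 I' w)) ` carrier (rep_par (rep2 \<omega>)) \<subseteq> H"
    if all: "\<forall>m\<in>carrier (rep_par \<omega>). coord2 J' (act_coord I' J' \<omega> w m) \<in> H"
  proof
    fix z assume "z \<in> (\<lambda>m. rep_act (rep2 \<omega>) m (coord2 I' w)) ` carrier (rep_par (rep2 \<omega>))"
    then obtain m where m: "m \<in> carrier (ext2 (rep_par \<omega>))" "z = rep_act (rep2 \<omega>) m (coord2 I' w)"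
      unfolding rep2_sel by (elim imageE)
    have sub: "submodule {m \<in> carrier (ext2 (rep_par \<omega>)). rep_act (rep2 \<omega>) m (coord2 I' w) \<in> H} S (ext2 (rep_par \<omega>))"
      by (rule lin_map_preimage[OF ext2_module[OF par] ext2_module[OF L.free_module_module] lin H])
    have "m \<in> {m \<in> carrier (ext2 (rep_par \<omega>)). rep_act (rep2 \<omega>) m (coord2 I' w) \<in> H}"
      by (rule ext2_gen[OF par sub _ m(1)]) (use all tens2_closed[OF par] rep2_act[OF _ w] in auto)
    then show "z \<in> H" using m(2) by simp
  qed
qed

end

text \<open>By the counting formula only the images at each vector \<open>y\<close> matter. Both are
  submodules, and two submodules that are contained in the same submodules are equal. Containment is
  tested on coordinates, with \<open>K\<close> the preimage of \<open>H\<close> under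
  \<open>coord2\<close>.\<close>

lemma ask_rep2_eq:
  fixes \<omega> :: "('l, 'm, 'i \<Rightarrow> 'l, 'j \<Rightarrow> 'l) mod_rep" and \<omega>' :: "('l, 'k, 'i \<Rightarrow> 'l, 'j \<Rightarrow> 'l) mod_rep"
  assumes rep: "is_mod_rep L \<omega>" "rep_src \<omega> = free_module L I'" "rep_tgt \<omega> = free_module L J'" "fin_gen L (rep_par \<omega>)"
    and rep': "is_mod_rep L \<omega>'" "rep_src \<omega>' = free_module L I'" "rep_tgt \<omega>' = free_module L J'" "fin_gen L (rep_par \<omega>')"
    and fin: "finite I'" "finite J'" "finite (carrier S)"
    and span: "\<And>w K. w \<in> carrier (free_module S I') \<Longrightarrow> submodule K S (free_module S J') \<Longrightarrow>
      (\<forall>m\<in>carrier (rep_par \<omega>). act_coord I' J' \<omega> w m \<in> K) \<longleftrightarrow> (\<forall>m\<in>carrier (rep_par \<omega>'). act_coord I' J' \<omega>' w m \<in> K)"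
  shows "ask (rep2 \<omega>) = ask (rep2 \<omega>')"
proof -
  interpret SJ: module S "free_module S J'" by (rule S.free_module_module)
  note EJ = ext2_module[OF L.free_module_module, of J']
  have finpar: "finite (carrier (ext2 (rep_par \<omega>)))" "finite (carrier (ext2 (rep_par \<omega>')))"
    "finite (carrier (ext2 (free_module L I')))"
    using rep(4) rep'(4) is_mod_rep_modules(1)[OF rep(1)] is_mod_rep_modules(1)[OF rep'(1)]
      L.fin_gen_free[OF fin(1)] L.free_module_module
    by (auto intro!: finite_fin_gen[OF ext2_module fin(3) fin_gen_ext2])
  note sel = rep2_sel[OF rep(1-3) fin(1,2)] rep2_sel[OF rep'(1-3) fin(1,2)]
  define IM where "IM y = (\<lambda>m. rep_act (rep2 \<omega>) m y) ` carrier (rep_par (rep2 \<omega>))" for y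
  define IM' where "IM' y = (\<lambda>m. rep_act (rep2 \<omega>') m y) ` carrier (rep_par (rep2 \<omega>'))" for y
  have "IM y = IM' y" if y: "y \<in> carrier (ext2 (free_module L I'))" for y
  proof -
    obtain w where w: "w \<in> carrier (free_module S I')" "y = coord2 I' w" using coord2_surj[OF fin(1) y] by auto
    have iff: "IM y \<subseteq> H \<longleftrightarrow> IM' y \<subseteq> H" if H: "submodule H S (ext2 (free_module L J'))" for H
    proof -
      have K: "submodule {v \<in> carrier (free_module S J'). coord2 J' v \<in> H} S (free_module S J')"
        by (rule lin_map_preimage[OF SJ.module_axioms EJ coord2_lin[OF fin(2)] H])
      have c: "act_coord I' J' \<omega> w m \<in> carrier (free_module S J')" if "m \<in> carrier (rep_par \<omega>)" for m
        unfolding act_coord_def by (rule SJ.M.finsum_closed[OF act_coord_closed[OF rep(1-3) fin(1,2) w(1) that]])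
      have c': "act_coord I' J' \<omega>' w m \<in> carrier (free_module S J')" if "m \<in> carrier (rep_par \<omega>')" for m
        unfolding act_coord_def by (rule SJ.M.finsum_closed[OF act_coord_closed[OF rep'(1-3) fin(1,2) w(1) that]])
      show ?thesis
        unfolding IM_def IM'_def w(2) rep2_image_subset[OF rep(1-3) fin(1,2) w(1) H]
          rep2_image_subset[OF rep'(1-3) fin(1,2) w(1) H]
        using span[OF w(1) K] c c' by simp
    qed
    have sub: "submodule (IM y) S (ext2 (free_module L J'))" "submodule (IM' y) S (ext2 (free_module L J'))"
    proof -
      note r = rep2[OF rep(1-3) fin(1,2)] and r' = rep2[OF rep'(1-3) fin(1,2)]
      note lin = lin_map_rep_act1[OF r, unfolded sel, OF y] and lin' = lin_map_rep_act1[OF r', unfolded sel, OF y]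
      note par = ext2_module[OF is_mod_rep_modules(1)[OF rep(1)]] and par' = ext2_module[OF is_mod_rep_modules(1)[OF rep'(1)]]
      show "submodule (IM y) S (ext2 (free_module L J'))" unfolding IM_def sel
        by (rule lin_map_image[OF par EJ lin module.carrier_is_submodule[OF par]])
      show "submodule (IM' y) S (ext2 (free_module L J'))" unfolding IM'_def sel
        by (rule lin_map_image[OF par' EJ lin' module.carrier_is_submodule[OF par']])
    qed
    show ?thesis using iff[OF sub(1)] iff[OF sub(2)] by simp
  qed
  then show ?thesis
    using ask_images[OF rep2[OF rep(1-3) fin(1,2)]] ask_images[OF rep2[OF rep'(1-3) fin(1,2)]] finpar
    unfolding IM_def IM'_def by (simp add: sel)
qed

end

section \<open>Modules of relations\<close>

lemma laurent_diff_closed: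
  assumes "x \<in> carrier (laurent_ring V)" "y \<in> carrier (laurent_ring V)" shows "x - y \<in> carrier (laurent_ring V)"
  using type_subring.add[OF laurent_subring, of x V "- y"] type_subring.uminus[OF laurent_subring, of y V] assms
  by (simp add: laurent_ring_eq)

lemma laurent_sum_closed:
  assumes "\<And>a. a \<in> A \<Longrightarrow> g a \<in> carrier (laurent_ring V)" shows "sum g A \<in> carrier (laurent_ring V)"
proof -
  interpret cring "laurent_ring V" by (rule cring_laurent_ring)
  show ?thesis
    using assms
  proof (induction A rule: infinite_finite_induct)
    case (insert a A)
    then show ?case using a_closed[of "g a" "sum g A"] by simp
  qed (use zero_closed in simp_all)
qed

lemma Rel_submodule:
  "submodule (Rel U A \<beta>) (laurent_ring U) (free_module (laurent_ring U :: ('u, 'r::comm_ring_1) laurent ring) A)"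
proof -
  let ?L = "laurent_ring U :: ('u, 'r) laurent ring"
  let ?F = "free_module ?L A"
  interpret L: cring ?L by (rule cring_laurent_ring)
  interpret F: module ?L ?F by (rule L.free_module_module)
  show ?thesis
  proof (rule F.submodule_smultI)
    show "(Rel U A \<beta> :: ('u \<Rightarrow> ('u, 'r) laurent) set) \<subseteq> carrier ?F" by (auto simp: Rel_def)
    show "\<zero>\<^bsub>?F\<^esub> \<in> Rel U A \<beta>"
      using F.M.zero_closed by (simp add: Rel_def)
    fix x y :: "'u \<Rightarrow> ('u, 'r) laurent" assume "x \<in> Rel U A \<beta>" "y \<in> Rel U A \<beta>"
    then show "x \<oplus>\<^bsub>?F\<^esub> y \<in> Rel U A \<beta>"
      using F.M.a_closed[of x y] by (simp add: Rel_def distrib_left sum.distrib)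
  next
    fix s and x :: "'u \<Rightarrow> ('u, 'r) laurent" assume "s \<in> carrier ?L" "x \<in> Rel U A \<beta>"
    then show "s \<odot>\<^bsub>?F\<^esub> x \<in> Rel U A \<beta>"
      using F.smult_closed[of s x] by (simp add: Rel_def mult.left_commute[of _ s] flip: sum_distrib_left)
  qed
qed

text \<open>One chosen element \<open>r\<close> of each colour is solved for: this gives a projection of the free module onto
  the module of relations.\<close>

lemma Rel_fin_gen:
  assumes A: "finite A" "A \<subseteq> U" and col: "\<And>c. finite (\<beta> -` {Some c})"
  shows "fin_gen (laurent_ring U) ((free_module (laurent_ring U :: ('u, 'r::comm_ring_1) laurent ring) A)\<lparr>carrier := Rel U A \<beta>\<rparr>)"
proof -
  let ?L = "laurent_ring U :: ('u, 'r) laurent ring"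
  let ?F = "free_module ?L A"
  interpret L: cring ?L by (rule cring_laurent_ring)
  interpret F: module ?L ?F by (rule L.free_module_module)
  \<comment> \<open>For a colour that does not occur, \<open>r c\<close> is an arbitrary element;
    \<open>Z\<close> also asks that the element carry the colour, so such colours select
    nothing.\<close>
  define r where "r c = (SOME b. \<beta> b = Some c)" for c
  define Z where "Z a \<longleftrightarrow> (\<exists>c\<in>colours_in \<beta> A. \<beta> a = Some c \<and> a = r c)" for a
  define s where "s x a = (\<Sum>b\<in>\<beta> -` {\<beta> a}. lvar b * x b)" for x :: "'u \<Rightarrow> ('u, 'r) laurent" and a
  \<comment> \<open>Only the coordinate at the chosen element changes: it is lowered by the weighted
    sum of its colour class divided by its own variable, which makes the new weighted sum
    zero.\<close>
  define p where "p x = (\<lambda>a. x a - (if Z a then lvar_inv a * s x a else 0))" for x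
  have ZA: "a \<in> A" "\<beta> -` {\<beta> a} \<subseteq> A" if "Z a" for a using that by (auto simp: Z_def colours_in_def)
  have pF: "p x \<in> carrier ?F" if x: "x \<in> carrier ?F" for x
    unfolding carrier_free_module_finite[OF A(1)]
  proof (intro conjI ballI allI impI)
    note xc = L.free_module_closed[OF x]
    fix a
    have "lvar_inv a * s x a \<in> carrier ?L" if Z: "Z a"
    proof -
      have "s x a \<in> carrier ?L" unfolding s_def
      proof (rule laurent_sum_closed)
        fix b assume "b \<in> \<beta> -` {\<beta> a}"
        then have "b \<in> U" using ZA(2)[OF Z] A(2) by blast
        then show "lvar b * x b \<in> carrier ?L" using L.m_closed[OF lvar_closed(1) xc] by simp
      qed
      then show ?thesis using L.m_closed[OF lvar_inv_closed, of a "s x a"] ZA(1)[OF Z] A(2) by auto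
    qed
    then show "p x a \<in> carrier ?L" using xc L.zero_closed by (auto simp: p_def intro: laurent_diff_closed)
    assume "a \<notin> A"
    then show "p x a = \<zero>\<^bsub>?L\<^esub>" using ZA(1) free_module_zero_outside[OF x] by (auto simp: p_def)
  qed
  have pR: "p x \<in> Rel U A \<beta>" if x: "x \<in> carrier ?F" for x
  proof -
    have "(\<Sum>b\<in>\<beta> -` {Some c}. lvar b * p x b) = 0" if c: "c \<in> colours_in \<beta> A" for c
    proof (cases "\<beta> -` {Some c} = {}")
      case False
      then have r: "r c \<in> \<beta> -` {Some c}" unfolding r_def by (auto intro: someI)
      have Zr: "Z b \<longleftrightarrow> b = r c" if "b \<in> \<beta> -` {Some c}" for b using that c by (auto simp: Z_def)
      let ?s = "\<Sum>b\<in>\<beta> -` {Some c}. lvar b * x b"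
      have "(\<Sum>b\<in>\<beta> -` {Some c}. lvar b * p x b) = (\<Sum>b\<in>\<beta> -` {Some c}. lvar b * x b - (if b = r c then ?s else 0))"
      proof (rule sum.cong[OF refl])
        fix b assume b: "b \<in> \<beta> -` {Some c}"
        have "lvar b * (lvar_inv b * ?s) = ?s" by (simp add: lvar_inv flip: mult.assoc)
        then show "lvar b * p x b = lvar b * x b - (if b = r c then ?s else 0)"
          using Zr[OF b] b by (auto simp: p_def s_def right_diff_distrib)
      qed
      also have "\<dots> = 0" using r col by (simp add: sum_subtractf sum.delta)
      finally show ?thesis .
    qed simp
    then show ?thesis using pF[OF x] by (simp add: Rel_def)
  qed
  show ?thesis
  proof (rule fin_gen_image[OF F.module_axioms _ _ _ L.fin_gen_free[OF A(1)]])
    show "module ?L (?F\<lparr>carrier := Rel U A \<beta>\<rparr>)"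
      by (rule submodule.submodule_is_module[OF Rel_submodule F.module_axioms])
    show "lin_map ?L ?F (?F\<lparr>carrier := Rel U A \<beta>\<rparr>) p"
    proof (rule lin_mapI)
      fix x assume "x \<in> carrier ?F"
      then show "p x \<in> carrier (?F\<lparr>carrier := Rel U A \<beta>\<rparr>)" using pR by simp
      show "p (x \<oplus>\<^bsub>?F\<^esub> y) = p x \<oplus>\<^bsub>?F\<lparr>carrier := Rel U A \<beta>\<rparr>\<^esub> p y" for y
        by (auto simp: p_def s_def distrib_left sum.distrib)
      show "p (t \<odot>\<^bsub>?F\<^esub> x) = t \<odot>\<^bsub>?F\<lparr>carrier := Rel U A \<beta>\<rparr>\<^esub> p x" for t
        by (auto simp: p_def s_def right_diff_distrib mult.left_commute[of _ t] simp flip: sum_distrib_left)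
    qed
    \<comment> \<open>For a relation the weighted sums are already zero. Hence \<open>p\<close>
      fixes relations and is onto.\<close>
    have "p x = x" if "x \<in> Rel U A \<beta>" for x
    proof
      fix a
      have "s x a = 0" if "Z a" using that \<open>x \<in> Rel U A \<beta>\<close> by (auto simp: Z_def s_def Rel_def)
      then show "p x a = x a" by (simp add: p_def)
    qed
    then show "carrier (?F\<lparr>carrier := Rel U A \<beta>\<rparr>) \<subseteq> p ` carrier ?F"
      by (auto simp: Rel_def intro!: image_eqI[of _ p])
  qed
qed

section \<open>Specialised matrices of the family\<close>

lemma acute_fam_rep:
  assumes "is_mod_rep base_ring (fam_rep B \<theta> I J)"
  shows "is_mod_rep (laurent_ring U) (acute_fam U B \<theta> I J)"
  unfolding acute_fam_def
  by (rule ext_rep_free3_is_mod_rep[OF cring_base_ring cring_laurent_ring lconst_hom assms]) (simp_all add: fam_rep_def)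

lemma acute_fam_sel:
  "rep_par (acute_fam U B \<theta> I J) = free_module (laurent_ring U) (B I J)"
  "rep_src (acute_fam U B \<theta> I J) = free_module (laurent_ring U) I"
  "rep_tgt (acute_fam U B \<theta> I J) = free_module (laurent_ring U) J"
  by (simp_all add: acute_fam_def ext_rep_free3_sel)

context family_point
begin

text \<open>The matrix of \<open>x\<close> is the combination of the matrices of the basis elements
  with coefficients \<open>x b\<close>. Specialisation turns its entries into the coefficients of
  \<open>y i\<close> in \<open>point_vec_apply\<close>.\<close>

lemma \<psi>_acute_fam:
  assumes x: "x \<in> carrier (free_module (laurent_ring U) (B I J))" and i: "i \<in> I"
  shows "\<psi> (rep_act (acute_fam U B \<theta> I J) x (evec (laurent_ring U) i) j) =
    (\<Oplus>\<^bsub>S\<^esub>b\<in>B I J. \<psi> (x b) \<otimes>\<^bsub>S\<^esub> f (entry \<theta> I J b i j))"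
proof -
  let ?L = "laurent_ring U :: ('u, 'r) laurent ring"
  let ?A = "acute_fam U B \<theta> I J :: (('u, 'r) laurent, _, _, _) mod_rep"
  let ?F = "free_module ?L (B I J)" and ?FJ = "free_module ?L J"
  interpret L: cring ?L by (rule cring_laurent_ring)
  interpret S: cring S by (rule S_cring)
  interpret F: module ?L ?F by (rule L.free_module_module)
  interpret FJ: module ?L ?FJ by (rule L.free_module_module)
  interpret \<psi>: ring_hom_cring ?L S \<psi>
    by (simp add: ring_hom_cring_def ring_hom_cring_axioms_def L.is_cring S_cring \<psi>)
  note rep = comb_familyD(2)[OF finI finJ]
  let ?g = "\<lambda>b. \<lambda>j. lconst (entry \<theta> I J b i j) :: ('u, 'r) laurent"
  have lin: "lin_map ?L ?F ?FJ (\<lambda>x. rep_act ?A x (evec ?L i))"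
    using lin_map_rep_act1[OF acute_fam_rep[OF rep], of "evec ?L i" U] L.evec_closed[OF i] by (simp add: acute_fam_sel)
  have g: "rep_act ?A (evec ?L b) (evec ?L i) = ?g b" if "b \<in> B I J" for b
    unfolding acute_fam_def
    by (subst ext_rep_free3_act[OF cring_base_ring cring_laurent_ring lconst_hom rep])
      (simp_all add: fam_rep_def entry_def that i)
  have gc: "?g b \<in> carrier ?FJ" if "b \<in> B I J" for b
    using lin_mapD(1)[OF lin L.evec_closed[OF that]] g[OF that] by simp
  note xc = L.free_module_closed[OF x]
  have "rep_act ?A x (evec ?L i) = rep_act ?A (\<Oplus>\<^bsub>?F\<^esub>b\<in>B I J. x b \<odot>\<^bsub>?F\<^esub> evec ?L b) (evec ?L i)"
    using L.free_module_expand[OF x finB order.refl free_module_support[OF x]] by simp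
  also have "\<dots> = (\<Oplus>\<^bsub>?FJ\<^esub>b\<in>B I J. rep_act ?A (x b \<odot>\<^bsub>?F\<^esub> evec ?L b) (evec ?L i))"
    by (rule lin_map_finsum[OF F.module_axioms FJ.module_axioms lin])
      (intro Pi_I F.smult_closed xc L.evec_closed)
  also have "\<dots> = (\<Oplus>\<^bsub>?FJ\<^esub>b\<in>B I J. x b \<odot>\<^bsub>?FJ\<^esub> ?g b)"
  proof (rule FJ.M.finsum_cong'[OF refl])
    show "(\<lambda>b. x b \<odot>\<^bsub>?FJ\<^esub> ?g b) \<in> B I J \<rightarrow> carrier ?FJ" by (intro Pi_I FJ.smult_closed xc gc)
    show "rep_act ?A (x b \<odot>\<^bsub>?F\<^esub> evec ?L b) (evec ?L i) = x b \<odot>\<^bsub>?FJ\<^esub> ?g b" if "b \<in> B I J" for b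
      using lin_mapD(3)[OF lin xc L.evec_closed[OF that]] g[OF that] by simp
  qed
  finally have "rep_act ?A x (evec ?L i) j = (\<Oplus>\<^bsub>?FJ\<^esub>b\<in>B I J. x b \<odot>\<^bsub>?FJ\<^esub> ?g b) j" by (rule fun_cong)
  also have "\<dots> = (\<Oplus>\<^bsub>?L\<^esub>b\<in>B I J. x b \<otimes>\<^bsub>?L\<^esub> ?g b j)"
  proof -
    have "(\<lambda>b. x b \<odot>\<^bsub>?FJ\<^esub> ?g b) \<in> B I J \<rightarrow> carrier ?FJ" by (intro Pi_I FJ.smult_closed xc gc)
    from L.finsum_free_module[OF this] show ?thesis by simp
  qed
  finally have "\<psi> (rep_act ?A x (evec ?L i) j) = \<psi> (\<Oplus>\<^bsub>?L\<^esub>b\<in>B I J. x b \<otimes>\<^bsub>?L\<^esub> ?g b j)" by (rule arg_cong)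
  also have "\<dots> = (\<Oplus>\<^bsub>S\<^esub>b\<in>B I J. \<psi> (x b \<otimes>\<^bsub>?L\<^esub> ?g b j))"
    using \<psi>.hom_finsum[of "\<lambda>b. x b \<otimes>\<^bsub>?L\<^esub> ?g b j" "B I J"] L.m_closed[OF xc lconst_closed(1)] by (simp add: comp_def)
  also have "\<dots> = (\<Oplus>\<^bsub>S\<^esub>b\<in>B I J. \<psi> (x b) \<otimes>\<^bsub>S\<^esub> f (entry \<theta> I J b i j))"
    using \<psi>.hom_mult[OF xc lconst_closed(1)] by (simp add: f_def)
  finally show ?thesis .
qed

end

section \<open>Comparison of the two zeta functions\<close>

theorem theorem7p26:
  fixes U :: "'u set"
    and B :: "'u fam_sets"
    and \<theta> :: "('u, 'r::comm_ring_1) fam_maps"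
    and \<beta> :: "'u \<Rightarrow> 'c option"
    and I J I' J' :: "nat set"
    and l :: nat
    and N :: "('r, 'n) module"
    and \<eta> :: "'n \<Rightarrow> (nat \<Rightarrow> 'r) \<Rightarrow> (nat \<Rightarrow> 'r)"
    and D :: "'o ring"
    and \<phi> :: "('u, 'r) laurent \<Rightarrow> 'o"
  defines "eta \<equiv> \<lparr> rep_par = N, rep_src = free_module base_ring I', rep_tgt = free_module base_ring J',
                   rep_act = \<eta> \<rparr>"
  defines "eta_acute \<equiv> ext_rep_free base_ring (laurent_ring U) lconst I' J' eta"
  defines "\<sigma> \<equiv> sum_rep (inflation (laurent_ring U) I' J' I (rel_fam U B \<theta> I J \<beta>)) eta_acute"
  defines "\<sigma>' \<equiv> sum_rep (inflation (laurent_ring U) I' J' I (acute_fam U B \<theta> I J)) eta_acute"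
  assumes "infinite U" and "infinite (UNIV :: 'c set)"
    and "comb_family B \<theta>" and "B_infinity B \<subseteq> U"
    and "finite I" and "finite J" and "constant_rank B \<theta> I J l"
    and "partial_colouring (B_infinity B) \<beta>" and "admissible B \<theta> \<beta> I J l"
    and "finite I'" and "finite J'" and "I \<subseteq> I'" and "J \<subseteq> J'"
    and "Module.module base_ring N" and "fin_gen base_ring N" and "is_mod_rep base_ring eta"
    and "compact_dvr D" and "\<phi> \<in> ring_hom (laurent_ring U) D"
  shows "Zask D (ext_rep (laurent_ring U) D \<phi> \<sigma>) = Zask D (ext_rep (laurent_ring U) D \<phi> \<sigma>')"
proof -
  let ?L = "laurent_ring U :: ('u, 'r) laurent ring"
  let ?Bs = "B I J"
  let ?A = "acute_fam U B \<theta> I J"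
  let ?SJ = "\<lambda>S :: 'o set ring. free_module S J"
  note finI = \<open>finite I\<close> and finJ = \<open>finite J\<close> and finI' = \<open>finite I'\<close> and finJ' = \<open>finite J'\<close>
  interpret b: cring "base_ring :: 'r ring" by (rule cring_base_ring)
  interpret L: cring ?L by (rule cring_laurent_ring)
  have combIJ: "finite ?Bs" "is_mod_rep base_ring (fam_rep B \<theta> I J)"
    using \<open>comb_family B \<theta>\<close> finI finJ by (simp_all add: comb_family_def)
  have BsU: "?Bs \<subseteq> U" using \<open>B_infinity B \<subseteq> U\<close> finI finJ by (auto simp: B_infinity_def)
  have fin_col: "finite (\<beta> -` {Some c})" for c
    using \<open>partial_colouring (B_infinity B) \<beta>\<close> by (simp add: partial_colouring_def)
  have repA: "is_mod_rep ?L ?A" by (rule acute_fam_rep[OF combIJ(2)])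
  have repR: "is_mod_rep ?L (rel_fam U B \<theta> I J \<beta>)"
    unfolding rel_fam_def by (rule restrict_par_is_mod_rep[OF repA]) (simp add: acute_fam_sel Rel_submodule)
  have infA: "is_mod_rep ?L (inflation ?L I' J' I ?A)"
    by (rule inflation_is_mod_rep[OF L.is_cring repA _ _ \<open>I \<subseteq> I'\<close> \<open>J \<subseteq> J'\<close>]) (simp_all add: acute_fam_sel)
  have infR: "is_mod_rep ?L (inflation ?L I' J' I (rel_fam U B \<theta> I J \<beta>))"
    by (rule inflation_is_mod_rep[OF L.is_cring repR _ _ \<open>I \<subseteq> I'\<close> \<open>J \<subseteq> J'\<close>])
      (simp_all add: rel_fam_def restrict_par_def acute_fam_sel)
  have eta_sel: "rep_src eta = free_module base_ring I'" "rep_tgt eta = free_module base_ring J'" "rep_par eta = N"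
    by (simp_all add: eta_def)
  note ext_eta = cring_base_ring cring_laurent_ring lconst_hom \<open>is_mod_rep base_ring eta\<close> eta_sel(1,2)
  have repE: "is_mod_rep ?L eta_acute" unfolding eta_acute_def by (rule ext_rep_free_is_mod_rep[OF ext_eta])
  have eta_acute_sel: "rep_src eta_acute = free_module ?L I'" "rep_tgt eta_acute = free_module ?L J'"
    "rep_par eta_acute = ext_module base_ring ?L lconst N"
    unfolding eta_acute_def by (simp_all add: ext_rep_free_sel[OF ext_eta] eta_sel(3))
  have finE: "fin_gen ?L (rep_par eta_acute)"
    unfolding eta_acute_sel(3) using \<open>Module.module base_ring N\<close> \<open>fin_gen base_ring N\<close>
    by (intro scalar_ext.fin_gen_ext) (simp_all add: scalar_ext_def cring_laurent_ring lconst_hom)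
  have par: "rep_par \<sigma> = dsum_module ((free_module ?L ?Bs)\<lparr>carrier := Rel U ?Bs \<beta>\<rparr>) (rep_par eta_acute)"
    "rep_par \<sigma>' = dsum_module (free_module ?L ?Bs) (rep_par eta_acute)"
    by (simp_all add: \<sigma>_def \<sigma>'_def sum_rep_def inflation_def rel_fam_def restrict_par_def acute_fam_sel)
  have rep: "is_mod_rep ?L \<sigma>" "rep_src \<sigma> = free_module ?L I'" "rep_tgt \<sigma> = free_module ?L J'"
    and rep': "is_mod_rep ?L \<sigma>'" "rep_src \<sigma>' = free_module ?L I'" "rep_tgt \<sigma>' = free_module ?L J'"
    unfolding \<sigma>_def \<sigma>'_def
    using sum_rep_is_mod_rep[OF infR repE] sum_rep_is_mod_rep[OF infA repE]
    by (simp_all add: eta_acute_sel inflation_def sum_rep_def)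
  have gen: "fin_gen ?L (rep_par \<sigma>)" "fin_gen ?L (rep_par \<sigma>')"
    unfolding par
    by (intro fin_gen_dsum finE Rel_fin_gen L.fin_gen_free L.free_module_module is_mod_rep_modules(1)[OF repE]
        submodule.submodule_is_module[OF Rel_submodule] combIJ(1) BsU fin_col)+
  \<comment> \<open>The two representations differ only in their parameter modules, so one inclusion
    between the images at a vector is automatic.\<close>
  have act_eq: "rep_act \<sigma> = rep_act \<sigma>'"
    by (simp add: \<sigma>_def \<sigma>'_def sum_rep_def inflation_def rel_fam_def restrict_par_def)
  interpret E: module ?L "rep_par eta_acute" by (rule is_mod_rep_modules(1)[OF repE])
  interpret F: module ?L "free_module ?L ?Bs" by (rule L.free_module_module)
  interpret FJ': module ?L "free_module ?L J'" by (rule L.free_module_module)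
  interpret FI: module ?L "free_module ?L I" by (rule L.free_module_module)
  interpret FJ: module ?L "free_module ?L J" by (rule L.free_module_module)
  note RelF = F.submoduleE(1)[OF Rel_submodule]
  \<comment> \<open>\<open>ret\<close> kills the basis vectors outside \<open>I\<close>, and the
    summand coming from \<open>N\<close> vanishes at zero. So the matrix of \<open>(x, 0)\<close> is
    that of \<open>x\<close> over \<open>(I, J)\<close>, bordered by zeros.\<close>
  have act0: "rep_act \<sigma>' (x, \<zero>\<^bsub>rep_par eta_acute\<^esub>) (evec ?L i) j =
      (if i \<in> I then rep_act ?A x (evec ?L i) j else 0)"
    if x: "x \<in> carrier (free_module ?L ?Bs)" and i: "i \<in> I'" for x i j
  proof -
    have "lin_map ?L (rep_par eta_acute) (free_module ?L J') (\<lambda>m. rep_act eta_acute m (evec ?L i))"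
      using lin_map_rep_act1[OF repE, of "evec ?L i"] L.evec_closed[OF i] by (simp add: eta_acute_sel)
    then have e0: "rep_act eta_acute \<zero>\<^bsub>rep_par eta_acute\<^esub> (evec ?L i) = \<zero>\<^bsub>free_module ?L J'\<^esub>"
      by (rule lin_map_zero[OF E.module_axioms FJ'.module_axioms])
    have "lin_map ?L (free_module ?L I) (free_module ?L J) (rep_act ?A x)"
      using lin_map_rep_act2[OF repA, of x] x by (simp add: acute_fam_sel)
    then have a0: "rep_act ?A x \<zero>\<^bsub>free_module ?L I\<^esub> = \<zero>\<^bsub>free_module ?L J\<^esub>"
      by (rule lin_map_zero[OF FI.module_axioms FJ.module_axioms])
    have "ret ?L I (evec ?L i) = (if i \<in> I then evec ?L i else \<zero>\<^bsub>free_module ?L I\<^esub>)"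
      by (auto simp: ret_def evec_def)
    then show ?thesis using e0 a0 by (simp add: \<sigma>'_def sum_rep_def inflation_def)
  qed
  have "ask (ext_rep D (D Quot Q) (\<lambda>a. Q +>\<^bsub>D\<^esub> a) (ext_rep ?L D \<phi> \<sigma>)) =
      ask (ext_rep D (D Quot Q) (\<lambda>a. Q +>\<^bsub>D\<^esub> a) (ext_rep ?L D \<phi> \<sigma>'))"
    if Q: "Q = ideal_power D (max_ideal D) n" for Q n
  proof -
    define S where "S = D Quot Q"
    define \<rho> where "\<rho> = (\<lambda>a. Q +>\<^bsub>D\<^esub> a)"
    note D_cring = compact_dvr_quotient(1)[OF \<open>compact_dvr D\<close>]
    note dvr = compact_dvr_quotient(2-5)[OF \<open>compact_dvr D\<close>, of n, folded Q, folded S_def \<rho>_def]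
    interpret S: cring S by (rule dvr(1))
    obtain \<pi> where \<pi>: "\<pi> \<in> carrier S" "\<pi> [^]\<^bsub>S\<^esub> n = \<zero>\<^bsub>S\<^esub>"
      "\<forall>s\<in>carrier S. s \<in> Units S \<or> (\<exists>t\<in>carrier S. s = \<pi> \<otimes>\<^bsub>S\<^esub> t)"
      using dvr(4) by (elim bexE conjE)
    interpret two: two_step_ext ?L D S \<phi> \<rho>
      by (rule two_step_ext.intro[OF L.is_cring D_cring dvr(1) \<open>\<phi> \<in> ring_hom ?L D\<close> dvr(3)])
    \<comment> \<open>The point ring is the quotient by the \<open>n\<close>-th power of the maximal
      ideal, so the local analysis is applied separately for every coefficient of the zeta
      function.\<close>
    interpret fp: family_point S \<pi> n U B \<theta> \<beta> I J l "\<lambda>a. \<rho> (\<phi> a)"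
      using \<pi>(3) by (intro family_point.intro dvr(1) \<pi>(1,2) assms two.comp_hom) auto
    interpret SJ: module S "free_module S J" by (rule S.free_module_module)
    interpret SJ': module S "free_module S J'" by (rule S.free_module_module)
    have coord_eq: "two.act_coord I' J' \<sigma> w m = two.act_coord I' J' \<sigma>' w m" for w m
      by (simp add: two.act_coord_def act_eq)
    have coord0: "two.act_coord I' J' \<sigma>' w (x, \<zero>\<^bsub>rep_par eta_acute\<^esub>) = fp.point_vec w (\<lambda>b. \<rho> (\<phi> (x b)))"
      if w: "w \<in> carrier (free_module S I')" and x: "x \<in> carrier (free_module ?L ?Bs)" for w x
    proof
      fix j
      note wc = S.free_module_closed[OF w]
      have wI: "w \<in> I \<rightarrow> carrier S" using wc by auto
      have \<xi>: "(\<lambda>b. \<rho> (\<phi> (x b))) \<in> carrier (free_module S ?Bs)"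
        using semilin_map[OF L.is_cring S.is_cring two.comp_hom, of ?Bs] x by (auto simp: semilin_def)
      have m: "(x, \<zero>\<^bsub>rep_par eta_acute\<^esub>) \<in> carrier (rep_par \<sigma>')" using x by (simp add: par)
      let ?h = "\<lambda>i. w i \<otimes>\<^bsub>S\<^esub> (\<Oplus>\<^bsub>S\<^esub>b\<in>?Bs. \<rho> (\<phi> (x b)) \<otimes>\<^bsub>S\<^esub> fp.f (entry \<theta> I J b i j))"
      have hc: "?h i \<in> carrier S" for i
        by (intro S.m_closed wc S.finsum_closed Pi_I fp.f_closed S.free_module_closed[OF \<xi>])
      have \<psi>0: "\<rho> (\<phi> 0) = \<zero>\<^bsub>S\<^esub>" using ring_hom_zero[OF two.comp_hom L.ring_axioms S.ring_axioms] by simp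
      have "two.act_coord I' J' \<sigma>' w (x, \<zero>\<^bsub>rep_par eta_acute\<^esub>) j =
          (\<Oplus>\<^bsub>S\<^esub>i\<in>I'. w i \<otimes>\<^bsub>S\<^esub> \<rho> (\<phi> (rep_act \<sigma>' (x, \<zero>\<^bsub>rep_par eta_acute\<^esub>) (evec ?L i) j)))"
        by (rule two.act_coord_apply[OF rep' finI' finJ' w m])
      also have "\<dots> = (\<Oplus>\<^bsub>S\<^esub>i\<in>I'. if i \<in> I then ?h i else \<zero>\<^bsub>S\<^esub>)"
        by (rule S.finsum_cong'[OF refl])
          (use hc wc in \<open>auto simp: act0[OF x] fp.\<psi>_acute_fam[OF x] \<psi>0\<close>)
      also have "\<dots> = (\<Oplus>\<^bsub>S\<^esub>i\<in>I. ?h i)"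
        by (rule S.add.finprod_mono_neutral_cong_left[OF finI' \<open>I \<subseteq> I'\<close>, symmetric]) (use hc in auto)
      also have "\<dots> = fp.point_vec w (\<lambda>b. \<rho> (\<phi> (x b))) j" by (rule fp.point_vec_apply[OF wI \<xi>, symmetric])
      finally show "two.act_coord I' J' \<sigma>' w (x, \<zero>\<^bsub>rep_par eta_acute\<^esub>) j = fp.point_vec w (\<lambda>b. \<rho> (\<phi> (x b))) j" .
    qed
    have span: "(\<forall>m\<in>carrier (rep_par \<sigma>). two.act_coord I' J' \<sigma> w m \<in> K) \<longleftrightarrow>
        (\<forall>m\<in>carrier (rep_par \<sigma>'). two.act_coord I' J' \<sigma>' w m \<in> K)" (is "?l \<longleftrightarrow> ?r")
      if w: "w \<in> carrier (free_module S I')" and K: "submodule K S (free_module S J')" for w K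
    proof
      show ?l if ?r
        using that RelF by (auto simp: coord_eq par)
      \<comment> \<open>A parameter splits as \<open>(x, 0) + (0, n)\<close>. The second part
        belongs to both parameter modules, and the value of the first is a combination of values of
        relations, which lie in \<open>K\<close> by assumption.\<close>
      show ?r if l: ?l
      proof
        fix m assume "m \<in> carrier (rep_par \<sigma>')"
        then obtain x n where m: "m = (x, n)" "x \<in> carrier (free_module ?L ?Bs)" "n \<in> carrier (rep_par eta_acute)"
          by (auto simp: par)
        let ?x = "(x, \<zero>\<^bsub>rep_par eta_acute\<^esub>)" and ?n = "(\<zero>\<^bsub>free_module ?L ?Bs\<^esub>, n)"
        have wI: "w \<in> I \<rightarrow> carrier S" using S.free_module_closed[OF w] by auto
        have \<xi>: "(\<lambda>b. \<rho> (\<phi> (x b))) \<in> carrier (free_module S ?Bs)"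
          using semilin_map[OF L.is_cring S.is_cring two.comp_hom, of ?Bs] m(2) by (auto simp: semilin_def)
        \<comment> \<open>The span of the relation vectors is formed in \<open>S J\<close>, while
          \<open>K\<close> lies in \<open>S J'\<close>. The inclusion is linear and the identity on
          functions, so it is enough that the spanning vectors land in \<open>K\<close>.\<close>
        have "fp.point_vec w (\<lambda>b. \<rho> (\<phi> (x b))) \<in> K"
        proof (rule lin_map_gen[OF SJ.module_axioms SJ'.module_axioms S.inc_lin[OF \<open>J \<subseteq> J'\<close>] _ K _
              fp.point_vec_span[OF wI \<xi>, unfolded fp.rel_span_def]])
          show "fp.point_vec w ` fp.Rel_image \<subseteq> carrier (free_module S J)"
            using lin_mapD(1)[OF fp.point_vec_lin[OF wI]] fp.Rel_image_closed by auto
          fix z assume "z \<in> fp.point_vec w ` fp.Rel_image"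
          then obtain x' where x': "x' \<in> Rel U ?Bs \<beta>" "z = fp.point_vec w (\<lambda>b. \<rho> (\<phi> (x' b)))"
            by (auto simp: fp.Rel_image_def)
          have "(x', \<zero>\<^bsub>rep_par eta_acute\<^esub>) \<in> carrier (rep_par \<sigma>)" using x'(1) by (simp add: par)
          from bspec[OF l this] show "z \<in> K"
            unfolding x'(2) coord_eq coord0[OF w subsetD[OF RelF x'(1)]] .
        qed
        then have "two.act_coord I' J' \<sigma>' w ?x \<in> K" by (simp only: coord0[OF w m(2)])
        moreover have "two.act_coord I' J' \<sigma>' w ?n \<in> K"
        proof -
          have "?n \<in> carrier (rep_par \<sigma>)" using m(3) F.submodule_zero[OF Rel_submodule] by (simp add: par)
          from bspec[OF l this] show ?thesis by (simp only: coord_eq)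
        qed
        moreover have "m = ?x \<oplus>\<^bsub>rep_par \<sigma>'\<^esub> ?n" using m F.M.r_zero[OF m(2)] by (simp add: par)
        moreover have "?x \<in> carrier (rep_par \<sigma>')" "?n \<in> carrier (rep_par \<sigma>')"
          using m F.M.zero_closed by (simp_all add: par)
        ultimately show "two.act_coord I' J' \<sigma>' w m \<in> K"
          using two.act_coord_add[OF rep' finI' finJ' w, of ?x ?n] SJ'.submoduleE(5)[OF K] by (simp only:)
      qed
    qed
    show ?thesis
      using two.ask_rep2_eq[OF rep gen(1) rep' gen(2) finI' finJ' dvr(2) span] by (simp only: S_def \<rho>_def)
  qed
  then show ?thesis by (simp add: Zask_def Let_def)
qed

end
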